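(* Let $\mathscr{J}$ be a system of arities in a symmetric monoidal closed category $\mathscr{V}$ such that $\mathscr{V}_0$ has pullbacks, and let $\mathscr{C}$ be a $\mathscr{J}$-admissible $\mathscr{V}$-category. The adjunction $\mathsf{Com}\dashv\mathsf{Com}^{\mathrm{op}}:\mathrm{Alg}^{\mathrm{s}}(\mathscr{C})^{\mathrm{op}}\to\mathrm{Alg}^{\mathrm{s}}(\mathscr{C})$ is idempotent, as is the adjunction $\mathsf{Com}_C\dashv\mathsf{Com}_C^{\mathrm{op}}:\mathrm{Alg}(C)^{\mathrm{op}}\to\mathrm{Alg}(C)$ for each object $C$ of $\mathscr{C}$. Consequently, the monad $(-)^{\perp\perp}=\mathsf{Com}^{\mathrm{op}}\mathsf{Com}$ on $\mathrm{Alg}^{\mathrm{s}}(\mathscr{C})$ is idempotent, as is the monad $(-)^{\perp\perp}=\mathsf{Com}_C^{\mathrm{op}}\mathsf{Com}_C$ on $\mathrm{Alg}(C)$.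
   Context: Base setting. $\mathscr{V}$ is a symmetric monoidal closed category with unit object $I$ and underlying ordinary category $\mathscr{V}_0$. By universe enlargement, $\mathscr{V}$ is a full subcategory of a symmetric monoidal closed category $\mathscr{V}'$ that is complete and cocomplete relative to a universe in which everything considered is small, with $\mathscr{V}\hookrightarrow\mathscr{V}'$ preserving all limits that exist in $\mathscr{V}$; $\mathscr{V}$-functor categories exist as $\mathscr{V}'$-categories. A system of arities is a fully faithful symmetric strong monoidal $\mathscr{V}$-functor $\mathscr{J}\to\mathscr{V}$, written as the inclusion of a full sub-$\mathscr{V}$-category containing $I$ and closed under $\otimes$ ($\mathscr{J}$ need not be small). A $\mathscr{J}$-cotensor in a $\mathscr{V}$-category is a cotensor $[J,C]$ with $J\in\mathrm{ob}\,\mathscr{J}$; $\mathscr{V}$-categories with $\mathscr{J}$-cotensors are equipped with designated ones, with $[I,C]=C$ (and identity counit). A $\mathscr{J}$-theory is a $\mathscr{V}$-category $\mathscr{T}$ equipped with an identity-on-objects $\mathscr{V}$-functor $\tau:\mathscr{J}^{\mathrm{op}}\to\mathscr{T}$ that preserves $\mathscr{J}$-cotensors; equivalently, $\mathrm{ob}\,\mathscr{T}=\mathrm{ob}\,\mathscr{J}$ and each object $J$ is equipped with a morphism $J\to\mathscr{T}(J,I)$ exhibiting $J$ as a cotensor $[J,I]$ in $\mathscr{T}$, which for $J=I$ is the identity on $I$. A morphism of $\mathscr{J}$-theories is a $\mathscr{V}$-functor commuting with the structure $\mathscr{V}$-functors $\tau$. For a $\mathscr{V}$-category $\mathscr{C}$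 with $\mathscr{J}$-cotensors, a $\mathscr{T}$-algebra in $\mathscr{C}$ is a $\mathscr{V}$-functor $A:\mathscr{T}\to\mathscr{C}$ preserving $\mathscr{J}$-cotensors; its carrier is $|A|=A(I)$. $\mathscr{T}\text{-}\mathrm{Alg}(\mathscr{C})$ is the full sub-$\mathscr{V}'$-category of $[\mathscr{T},\mathscr{C}]$ on the $\mathscr{T}$-algebras; for a morphism $f$ in it, $|f|=f_I$. $\mathscr{C}$ is $\mathscr{J}$-admissible if it has $\mathscr{J}$-cotensors and for every $\mathscr{J}$-theory $\mathscr{T}$ the ends defining the hom-objects of $\mathscr{T}\text{-}\mathrm{Alg}(\mathscr{C})$ exist in $\mathscr{V}$ (so it is a $\mathscr{V}$-category). $\mathscr{J}$-cotensors in $\mathscr{T}\text{-}\mathrm{Alg}(\mathscr{C})$ are pointwise, with designated ones chosen so that evaluation at $I$ sends them to the designated ones in $\mathscr{C}$. Strong morphisms. An algebra in $\mathscr{C}$ is a pair $(\mathscr{T},A)$ (also written $A$) with $\mathscr{T}$ a $\mathscr{J}$-theory and $A$ a $\mathscr{T}$-algebra in $\mathscr{C}$. $\mathrm{Alg}^{\mathrm{s}}(\mathscr{C})$ is the category of algebras, where a (strong) morphism $(M,f):(\mathscr{T},A)\to(\mathscr{U},B)$ consists of a morphism of $\mathscr{J}$-theories $M:\mathscr{T}\to\mathscr{U}$ and an isomorphism $f:A\to BM$ of $\mathscr{T}$-algebras; $(N,g)(M,f)=(NM,(gM)\cdot f)$. The underlying isomorphism of $(M,f)$ is $|f|:|A|\to|B|$.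 For an object $C$ of $\mathscr{C}$, $\mathrm{Alg}(C)$ is the (non-full) subcategory of algebras with carrier $C$ and morphisms $(M,f)$ with $|f|=1_C$. Commutants. The commutant of $(\mathscr{T},A)$ is the algebra $(\mathscr{T},A)^\perp=(\mathscr{T}^\perp_A,A^\perp)$ (written $A^\perp$), where $\mathscr{T}^\perp_A$ is the $\mathscr{J}$-theory with $\mathscr{T}^\perp_A(J,K)=\mathscr{T}\text{-}\mathrm{Alg}(\mathscr{C})([J,A],[K,A])$ for $J,K\in\mathrm{ob}\,\mathscr{J}$, with composition and identities as in $\mathscr{T}\text{-}\mathrm{Alg}(\mathscr{C})$ and structure morphisms $J\to\mathscr{T}\text{-}\mathrm{Alg}(\mathscr{C})([J,A],A)$ the cotensor counits, and $A^\perp:\mathscr{T}^\perp_A\to\mathscr{C}$ is the algebra on $|A|$ given on objects by $J\mapsto[J,|A|]$ and on homs by evaluation at $I$. The commutant adjunction. There is a functor $\mathsf{Com}=(-)^\perp:\mathrm{Alg}^{\mathrm{s}}(\mathscr{C})\to\mathrm{Alg}^{\mathrm{s}}(\mathscr{C})^{\mathrm{op}}$ sending each algebra to its commutant and each strong morphism $f:A\to B$ to the unique strong morphism $f^\perp:B^\perp\to A^\perp$ whose underlying isomorphism is $|f|^{-1}$. It is left adjoint to its opposite; the unit consists of the unique morphisms $u_A:A\to A^{\perp\perp}$ in $\mathrm{Alg}(C)$ ($C=|A|$), and the counit is $u^{\mathrm{op}}$. For each object $C$ of $\mathscr{C}$ this adjunction restricts to an adjunction $\mathsf{Com}_C\dashv\mathsf{Com}_C^{\mathrm{op}}:\mathrm{Alg}(C)^{\mathrm{op}}\to\mathrm{Alg}(C)$.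 An adjunction $F\dashv G$ with unit $\eta$ and counit $\varepsilon$ is idempotent if $F\eta$ is an isomorphism (equivalently, any of $\varepsilon F$, $\eta G$, $G\varepsilon$ is); a monad is idempotent if its multiplication is an isomorphism. *)

theory Defs
  imports Main "HOL-Library.FuncSet"
begin

section \<open>Ordinary categories, adjunctions, monads\<close>

record ('o, 'a) category =
  Obj :: "'o set"
  Arr :: "'a set"
  Dom :: "'a \<Rightarrow> 'o"
  Cod :: "'a \<Rightarrow> 'o"
  Ident :: "'o \<Rightarrow> 'a"
  Comp :: "'a \<Rightarrow> 'a \<Rightarrow> 'a"  (infixr "\<cdot>\<index>" 70)

definition Hom :: "('o, 'a, 'm) category_scheme \<Rightarrow> 'o \<Rightarrow> 'o \<Rightarrow> 'a set"
  where "Hom C a b = {f \<in> Arr C. Dom C f = a \<and> Cod C f = b}"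

locale category =
  fixes C :: "('o, 'a, 'm) category_scheme" (structure)
  assumes dom_obj: "f \<in> Arr C \<Longrightarrow> Dom C f \<in> Obj C"
    and cod_obj: "f \<in> Arr C \<Longrightarrow> Cod C f \<in> Obj C"
    and ident_hom: "a \<in> Obj C \<Longrightarrow> Ident C a \<in> Hom C a a"
    and comp_hom: "\<lbrakk>f \<in> Hom C a b; g \<in> Hom C b c\<rbrakk> \<Longrightarrow> g \<cdot> f \<in> Hom C a c"
    and comp_ident_right: "f \<in> Hom C a b \<Longrightarrow> f \<cdot> Ident C a = f"
    and comp_ident_left: "f \<in> Hom C a b \<Longrightarrow> Ident C b \<cdot> f = f"
    and comp_assoc: "\<lbrakk>f \<in> Hom C a b; g \<in> Hom C b c; h \<in> Hom C c d\<rbrakk>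
      \<Longrightarrow> (h \<cdot> g) \<cdot> f = h \<cdot> (g \<cdot> f)"

definition inverse_arrows :: "('o, 'a, 'm) category_scheme \<Rightarrow> 'a \<Rightarrow> 'a \<Rightarrow> bool"
  where "inverse_arrows C f g \<longleftrightarrow>
    f \<in> Arr C \<and> g \<in> Hom C (Cod C f) (Dom C f) \<and>
    Comp C g f = Ident C (Dom C f) \<and> Comp C f g = Ident C (Cod C f)"

definition is_iso :: "('o, 'a, 'm) category_scheme \<Rightarrow> 'a \<Rightarrow> bool"
  where "is_iso C f \<longleftrightarrow> (\<exists>g. inverse_arrows C f g)"

definition inverse_arrow :: "('o, 'a, 'm) category_scheme \<Rightarrow> 'a \<Rightarrow> 'a"
  where "inverse_arrow C f = (THE g. inverse_arrows C f g)"

definition is_pullback :: "('o, 'a, 'm) category_scheme \<Rightarrow> 'a \<Rightarrow> 'a \<Rightarrow> 'a \<Rightarrow> 'a \<Rightarrow> bool"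
  where "is_pullback C f g p q \<longleftrightarrow>
    p \<in> Arr C \<and> q \<in> Arr C \<and> Dom C p = Dom C q \<and>
    Cod C p = Dom C f \<and> Cod C q = Dom C g \<and> Comp C f p = Comp C g q \<and>
    (\<forall>w. \<forall>x\<in>Hom C w (Dom C f). \<forall>y\<in>Hom C w (Dom C g). Comp C f x = Comp C g y \<longrightarrow>
      (\<exists>!h. h \<in> Hom C w (Dom C p) \<and> Comp C p h = x \<and> Comp C q h = y))"

definition has_pullbacks :: "('o, 'a, 'm) category_scheme \<Rightarrow> bool"
  where "has_pullbacks C \<longleftrightarrow>
    (\<forall>f\<in>Arr C. \<forall>g\<in>Arr C. Cod C f = Cod C g \<longrightarrow> (\<exists>p q. is_pullback C f g p q))"

definition dual :: "('o, 'a) category \<Rightarrow> ('o, 'a) category"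
  where "dual C = \<lparr>Obj = Obj C, Arr = Arr C, Dom = Cod C, Cod = Dom C,
    Ident = Ident C, Comp = (\<lambda>g f. Comp C f g)\<rparr>"

record ('o, 'a, 'p, 'b) func =
  OMap :: "'o \<Rightarrow> 'p"
  AMap :: "'a \<Rightarrow> 'b"

definition is_functor ::
    "('o, 'a) category \<Rightarrow> ('p, 'b) category \<Rightarrow> ('o, 'a, 'p, 'b) func \<Rightarrow> bool"
  where "is_functor C D F \<longleftrightarrow> category C \<and> category D \<and>
    (\<forall>a\<in>Obj C. OMap F a \<in> Obj D) \<and>
    (\<forall>f\<in>Arr C. AMap F f \<in> Hom D (OMap F (Dom C f)) (OMap F (Cod C f))) \<and>
    (\<forall>a\<in>Obj C. AMap F (Ident C a) = Ident D (OMap F a)) \<and>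
    (\<forall>f\<in>Arr C. \<forall>g\<in>Arr C. Dom C g = Cod C f \<longrightarrow>
      AMap F (Comp C g f) = Comp D (AMap F g) (AMap F f))"

definition id_func :: "('o, 'a, 'o, 'a) func"
  where "id_func = \<lparr>OMap = (\<lambda>x. x), AMap = (\<lambda>f. f)\<rparr>"

definition comp_func ::
    "('p, 'b, 'q, 'c) func \<Rightarrow> ('o, 'a, 'p, 'b) func \<Rightarrow> ('o, 'a, 'q, 'c) func"
  where "comp_func G F = \<lparr>OMap = (\<lambda>x. OMap G (OMap F x)), AMap = (\<lambda>f. AMap G (AMap F f))\<rparr>"

text \<open>The opposite of a functor from \<open>C\<close> to \<open>D\<close> is a functor from \<open>dual C\<close> to \<open>dual D\<close>
  with the same object and arrow maps.\<close>

definition dual_func :: "('o, 'a, 'p, 'b) func \<Rightarrow> ('o, 'a, 'p, 'b) func"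
  where "dual_func F = \<lparr>OMap = OMap F, AMap = AMap F\<rparr>"

definition is_nat_trans ::
    "('o, 'a) category \<Rightarrow> ('p, 'b) category \<Rightarrow> ('o, 'a, 'p, 'b) func \<Rightarrow> ('o, 'a, 'p, 'b) func
      \<Rightarrow> ('o \<Rightarrow> 'b) \<Rightarrow> bool"
  where "is_nat_trans C D F G \<alpha> \<longleftrightarrow> is_functor C D F \<and> is_functor C D G \<and>
    (\<forall>a\<in>Obj C. \<alpha> a \<in> Hom D (OMap F a) (OMap G a)) \<and>
    (\<forall>f\<in>Arr C. Comp D (AMap G f) (\<alpha> (Dom C f)) = Comp D (\<alpha> (Cod C f)) (AMap F f))"

definition is_adjunction ::
    "('o, 'a) category \<Rightarrow> ('p, 'b) category \<Rightarrow> ('o, 'a, 'p, 'b) func \<Rightarrow> ('p, 'b, 'o, 'a) func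
      \<Rightarrow> ('o \<Rightarrow> 'a) \<Rightarrow> ('p \<Rightarrow> 'b) \<Rightarrow> bool"
  where "is_adjunction C D F G \<eta> \<epsilon> \<longleftrightarrow>
    is_functor C D F \<and> is_functor D C G \<and>
    is_nat_trans C C id_func (comp_func G F) \<eta> \<and>
    is_nat_trans D D (comp_func F G) id_func \<epsilon> \<and>
    (\<forall>x\<in>Obj C. Comp D (\<epsilon> (OMap F x)) (AMap F (\<eta> x)) = Ident D (OMap F x)) \<and>
    (\<forall>y\<in>Obj D. Comp C (AMap G (\<epsilon> y)) (\<eta> (OMap G y)) = Ident C (OMap G y))"

definition is_idempotent_adjunction ::
    "('o, 'a) category \<Rightarrow> ('p, 'b) category \<Rightarrow> ('o, 'a, 'p, 'b) func \<Rightarrow> ('p, 'b, 'o, 'a) func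
      \<Rightarrow> ('o \<Rightarrow> 'a) \<Rightarrow> ('p \<Rightarrow> 'b) \<Rightarrow> bool"
  where "is_idempotent_adjunction C D F G \<eta> \<epsilon> \<longleftrightarrow>
    is_adjunction C D F G \<eta> \<epsilon> \<and> (\<forall>x\<in>Obj C. is_iso D (AMap F (\<eta> x)))"

definition is_monad ::
    "('o, 'a) category \<Rightarrow> ('o, 'a, 'o, 'a) func \<Rightarrow> ('o \<Rightarrow> 'a) \<Rightarrow> ('o \<Rightarrow> 'a) \<Rightarrow> bool"
  where "is_monad C T \<eta> \<mu> \<longleftrightarrow>
    is_nat_trans C C id_func T \<eta> \<and>
    is_nat_trans C C (comp_func T T) T \<mu> \<and>
    (\<forall>x\<in>Obj C. Comp C (\<mu> x) (AMap T (\<mu> x)) = Comp C (\<mu> x) (\<mu> (OMap T x))) \<and>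
    (\<forall>x\<in>Obj C. Comp C (\<mu> x) (AMap T (\<eta> x)) = Ident C (OMap T x)) \<and>
    (\<forall>x\<in>Obj C. Comp C (\<mu> x) (\<eta> (OMap T x)) = Ident C (OMap T x))"

definition is_idempotent_monad ::
    "('o, 'a) category \<Rightarrow> ('o, 'a, 'o, 'a) func \<Rightarrow> ('o \<Rightarrow> 'a) \<Rightarrow> ('o \<Rightarrow> 'a) \<Rightarrow> bool"
  where "is_idempotent_monad C T \<eta> \<mu> \<longleftrightarrow>
    is_monad C T \<eta> \<mu> \<and> (\<forall>x\<in>Obj C. is_iso C (\<mu> x))"

definition adjunction_mult ::
    "('o, 'a, 'p, 'b) func \<Rightarrow> ('p, 'b, 'o, 'a) func \<Rightarrow> ('p \<Rightarrow> 'b) \<Rightarrow> 'o \<Rightarrow> 'a"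
  where "adjunction_mult F G \<epsilon> = (\<lambda>x. AMap G (\<epsilon> (OMap F x)))"


section \<open>Symmetric monoidal closed categories\<close>

text \<open>\<open>Assoc a b c\<close> goes from \<open>(a \<otimes> b) \<otimes> c\<close> to \<open>a \<otimes> (b \<otimes> c)\<close>, and \<open>Ev a b\<close> from
  \<open>IHom a b \<otimes> a\<close> to \<open>b\<close>.\<close>

record ('o, 'a) smc_category = "('o, 'a) category" +
  Unit :: "'o"  ("\<one>\<index>")
  Ten :: "'o \<Rightarrow> 'o \<Rightarrow> 'o"  (infixr "\<otimes>\<index>" 75)
  TenA :: "'a \<Rightarrow> 'a \<Rightarrow> 'a"  (infixr "\<boxtimes>\<index>" 75)
  Assoc :: "'o \<Rightarrow> 'o \<Rightarrow> 'o \<Rightarrow> 'a"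
  LUnit :: "'o \<Rightarrow> 'a"
  RUnit :: "'o \<Rightarrow> 'a"
  Sym :: "'o \<Rightarrow> 'o \<Rightarrow> 'a"
  IHom :: "'o \<Rightarrow> 'o \<Rightarrow> 'o"
  Ev :: "'o \<Rightarrow> 'o \<Rightarrow> 'a"

locale symmetric_monoidal_closed_category =
  category V for V :: "('o, 'a) smc_category" (structure) +
  assumes unit_obj: "\<one> \<in> Obj V"
    and ten_obj: "\<lbrakk>a \<in> Obj V; b \<in> Obj V\<rbrakk> \<Longrightarrow> a \<otimes> b \<in> Obj V"
    and ten_hom: "\<lbrakk>f \<in> Hom V a b; g \<in> Hom V c d\<rbrakk> \<Longrightarrow> f \<boxtimes> g \<in> Hom V (a \<otimes> c) (b \<otimes> d)"
    and ten_ident: "\<lbrakk>a \<in> Obj V; b \<in> Obj V\<rbrakk> \<Longrightarrow> Ident V a \<boxtimes> Ident V b = Ident V (a \<otimes> b)"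
    and ten_comp: "\<lbrakk>f \<in> Hom V a b; g \<in> Hom V b c; h \<in> Hom V a' b'; k \<in> Hom V b' c'\<rbrakk>
      \<Longrightarrow> (g \<cdot> f) \<boxtimes> (k \<cdot> h) = (g \<boxtimes> k) \<cdot> (f \<boxtimes> h)"
    and assoc_hom: "\<lbrakk>a \<in> Obj V; b \<in> Obj V; c \<in> Obj V\<rbrakk>
      \<Longrightarrow> Assoc V a b c \<in> Hom V ((a \<otimes> b) \<otimes> c) (a \<otimes> (b \<otimes> c))"
    and assoc_iso: "\<lbrakk>a \<in> Obj V; b \<in> Obj V; c \<in> Obj V\<rbrakk> \<Longrightarrow> is_iso V (Assoc V a b c)"
    and assoc_natural: "\<lbrakk>f \<in> Hom V a a'; g \<in> Hom V b b'; h \<in> Hom V c c'\<rbrakk>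
      \<Longrightarrow> Assoc V a' b' c' \<cdot> ((f \<boxtimes> g) \<boxtimes> h) = (f \<boxtimes> (g \<boxtimes> h)) \<cdot> Assoc V a b c"
    and lunit_hom: "a \<in> Obj V \<Longrightarrow> LUnit V a \<in> Hom V (\<one> \<otimes> a) a"
    and lunit_iso: "a \<in> Obj V \<Longrightarrow> is_iso V (LUnit V a)"
    and lunit_natural: "f \<in> Hom V a b \<Longrightarrow> LUnit V b \<cdot> (Ident V \<one> \<boxtimes> f) = f \<cdot> LUnit V a"
    and runit_hom: "a \<in> Obj V \<Longrightarrow> RUnit V a \<in> Hom V (a \<otimes> \<one>) a"
    and runit_iso: "a \<in> Obj V \<Longrightarrow> is_iso V (RUnit V a)"
    and runit_natural: "f \<in> Hom V a b \<Longrightarrow> RUnit V b \<cdot> (f \<boxtimes> Ident V \<one>) = f \<cdot> RUnit V a"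
    and pentagon: "\<lbrakk>a \<in> Obj V; b \<in> Obj V; c \<in> Obj V; d \<in> Obj V\<rbrakk>
      \<Longrightarrow> Assoc V a b (c \<otimes> d) \<cdot> Assoc V (a \<otimes> b) c d =
        (Ident V a \<boxtimes> Assoc V b c d) \<cdot> Assoc V a (b \<otimes> c) d \<cdot> (Assoc V a b c \<boxtimes> Ident V d)"
    and triangle: "\<lbrakk>a \<in> Obj V; b \<in> Obj V\<rbrakk>
      \<Longrightarrow> (Ident V a \<boxtimes> LUnit V b) \<cdot> Assoc V a \<one> b = RUnit V a \<boxtimes> Ident V b"
    and sym_hom: "\<lbrakk>a \<in> Obj V; b \<in> Obj V\<rbrakk> \<Longrightarrow> Sym V a b \<in> Hom V (a \<otimes> b) (b \<otimes> a)"
    and sym_natural: "\<lbrakk>f \<in> Hom V a a'; g \<in> Hom V b b'\<rbrakk>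
      \<Longrightarrow> Sym V a' b' \<cdot> (f \<boxtimes> g) = (g \<boxtimes> f) \<cdot> Sym V a b"
    and sym_sym: "\<lbrakk>a \<in> Obj V; b \<in> Obj V\<rbrakk> \<Longrightarrow> Sym V b a \<cdot> Sym V a b = Ident V (a \<otimes> b)"
    and hexagon: "\<lbrakk>a \<in> Obj V; b \<in> Obj V; c \<in> Obj V\<rbrakk>
      \<Longrightarrow> Assoc V b c a \<cdot> Sym V a (b \<otimes> c) \<cdot> Assoc V a b c =
        (Ident V b \<boxtimes> Sym V a c) \<cdot> Assoc V b a c \<cdot> (Sym V a b \<boxtimes> Ident V c)"
    and ihom_obj: "\<lbrakk>a \<in> Obj V; b \<in> Obj V\<rbrakk> \<Longrightarrow> IHom V a b \<in> Obj V"
    and ev_hom: "\<lbrakk>a \<in> Obj V; b \<in> Obj V\<rbrakk> \<Longrightarrow> Ev V a b \<in> Hom V (IHom V a b \<otimes> a) b"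
    and ev_universal: "\<lbrakk>x \<in> Obj V; a \<in> Obj V; b \<in> Obj V; f \<in> Hom V (x \<otimes> a) b\<rbrakk>
      \<Longrightarrow> \<exists>!g. g \<in> Hom V x (IHom V a b) \<and> Ev V a b \<cdot> (g \<boxtimes> Ident V a) = f"


section \<open>Enriched categories\<close>

text \<open>\<open>VComp a b c\<close> is the composition arrow from \<open>VHom b c \<otimes> VHom a b\<close> to \<open>VHom a c\<close>.\<close>

record ('o, 'a, 'c) vcat =
  VObj :: "'c set"
  VHom :: "'c \<Rightarrow> 'c \<Rightarrow> 'o"
  VComp :: "'c \<Rightarrow> 'c \<Rightarrow> 'c \<Rightarrow> 'a"
  VId :: "'c \<Rightarrow> 'a"

text \<open>A \<open>\<V>\<close>-category with designated cotensors \<open>Cot v c\<close> and counits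
  \<open>Cou v c\<close> from \<open>v\<close> to \<open>VHom (Cot v c) c\<close>.\<close>

record ('o, 'a, 'c) cvcat = "('o, 'a, 'c) vcat" +
  Cot :: "'o \<Rightarrow> 'c \<Rightarrow> 'c"
  Cou :: "'o \<Rightarrow> 'c \<Rightarrow> 'a"

record ('c, 'd, 'a) vfun =
  FO :: "'c \<Rightarrow> 'd"
  FH :: "'c \<Rightarrow> 'c \<Rightarrow> 'a"

context
  fixes V :: "('o, 'a) smc_category" (structure)
begin

definition transposed :: "'o \<Rightarrow> 'o \<Rightarrow> 'o \<Rightarrow> 'a \<Rightarrow> 'a"
  where "transposed x a b f =
    (THE g. g \<in> Hom V x (IHom V a b) \<and> Ev V a b \<cdot> (g \<boxtimes> Ident V a) = f)"

definition vcategory :: "('o, 'a, 'c, 'm) vcat_scheme \<Rightarrow> bool"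
  where "vcategory C \<longleftrightarrow>
    (\<forall>a\<in>VObj C. \<forall>b\<in>VObj C. VHom C a b \<in> Obj V) \<and>
    (\<forall>a\<in>VObj C. \<forall>b\<in>VObj C. \<forall>c\<in>VObj C.
      VComp C a b c \<in> Hom V (VHom C b c \<otimes> VHom C a b) (VHom C a c)) \<and>
    (\<forall>a\<in>VObj C. VId C a \<in> Hom V \<one> (VHom C a a)) \<and>
    (\<forall>a\<in>VObj C. \<forall>b\<in>VObj C. \<forall>c\<in>VObj C. \<forall>d\<in>VObj C.
      VComp C a b d \<cdot> (VComp C b c d \<boxtimes> Ident V (VHom C a b)) =
      VComp C a c d \<cdot> (Ident V (VHom C c d) \<boxtimes> VComp C a b c) \<cdot>
        Assoc V (VHom C c d) (VHom C b c) (VHom C a b)) \<and>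
    (\<forall>a\<in>VObj C. \<forall>b\<in>VObj C.
      VComp C a b b \<cdot> (VId C b \<boxtimes> Ident V (VHom C a b)) = LUnit V (VHom C a b)) \<and>
    (\<forall>a\<in>VObj C. \<forall>b\<in>VObj C.
      VComp C a a b \<cdot> (Ident V (VHom C a b) \<boxtimes> VId C a) = RUnit V (VHom C a b))"

definition vself :: "('o, 'a, 'o) vcat"
  where "vself = \<lparr>VObj = Obj V, VHom = IHom V,
    VComp = (\<lambda>a b c. transposed (IHom V b c \<otimes> IHom V a b) a c
      (Ev V b c \<cdot> (Ident V (IHom V b c) \<boxtimes> Ev V a b) \<cdot> Assoc V (IHom V b c) (IHom V a b) a)),
    VId = (\<lambda>a. transposed \<one> a a (LUnit V a))\<rparr>"

definition vfull :: "('o, 'a, 'c) vcat \<Rightarrow> 'c set \<Rightarrow> ('o, 'a, 'c) vcat"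
  where "vfull C S = C\<lparr>VObj := S\<rparr>"

definition vop :: "('o, 'a, 'c) vcat \<Rightarrow> ('o, 'a, 'c) vcat"
  where "vop C = \<lparr>VObj = VObj C, VHom = (\<lambda>a b. VHom C b a),
    VComp = (\<lambda>a b c. VComp C c b a \<cdot> Sym V (VHom C c b) (VHom C b a)),
    VId = VId C\<rparr>"

text \<open>The data of \<open>\<V>\<close>-functors and of \<open>\<V>\<close>-natural transformations are
  extensional functions on the objects of the domain, so that equality is equality on objects
  and hom-objects.\<close>

definition vfunctor ::
    "('o, 'a, 'c, 'm) vcat_scheme \<Rightarrow> ('o, 'a, 'd, 'n) vcat_scheme \<Rightarrow> ('c, 'd, 'a) vfun \<Rightarrow> bool"
  where "vfunctor C D F \<longleftrightarrow> vcategory C \<and> vcategory D \<and>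
    FO F \<in> VObj C \<rightarrow>\<^sub>E VObj D \<and>
    FH F \<in> VObj C \<rightarrow>\<^sub>E VObj C \<rightarrow>\<^sub>E Arr V \<and>
    (\<forall>a\<in>VObj C. \<forall>b\<in>VObj C. FH F a b \<in> Hom V (VHom C a b) (VHom D (FO F a) (FO F b))) \<and>
    (\<forall>a\<in>VObj C. FH F a a \<cdot> VId C a = VId D (FO F a)) \<and>
    (\<forall>a\<in>VObj C. \<forall>b\<in>VObj C. \<forall>c\<in>VObj C.
      FH F a c \<cdot> VComp C a b c =
      VComp D (FO F a) (FO F b) (FO F c) \<cdot> (FH F b c \<boxtimes> FH F a b))"

definition vfun_id :: "('o, 'a, 'c, 'm) vcat_scheme \<Rightarrow> ('c, 'c, 'a) vfun"
  where "vfun_id C = \<lparr>FO = (\<lambda>a\<in>VObj C. a),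
    FH = (\<lambda>a\<in>VObj C. \<lambda>b\<in>VObj C. Ident V (VHom C a b))\<rparr>"

text \<open>\<open>vfun_comp S G F\<close> is \<open>G\<close> after \<open>F\<close>, where \<open>S\<close> is the set of
  objects of the domain of \<open>F\<close>.\<close>

definition vfun_comp :: "'c set \<Rightarrow> ('d, 'e, 'a) vfun \<Rightarrow> ('c, 'd, 'a) vfun \<Rightarrow> ('c, 'e, 'a) vfun"
  where "vfun_comp S G F = \<lparr>FO = (\<lambda>a\<in>S. FO G (FO F a)),
    FH = (\<lambda>a\<in>S. \<lambda>b\<in>S. FH G (FO F a) (FO F b) \<cdot> FH F a b)\<rparr>"

text \<open>Arrows of the underlying ordinary category \<open>C\<^sub>0\<close> are arrows from the unit to hom-objects.
  Composition and inverses in \<open>C\<^sub>0\<close>:\<close>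

definition vcomp0 :: "('o, 'a, 'c, 'm) vcat_scheme \<Rightarrow> 'c \<Rightarrow> 'c \<Rightarrow> 'c \<Rightarrow> 'a \<Rightarrow> 'a \<Rightarrow> 'a"
  where "vcomp0 C a b c g f = VComp C a b c \<cdot> (g \<boxtimes> f) \<cdot> inverse_arrow V (LUnit V \<one>)"

definition vinverse0 :: "('o, 'a, 'c, 'm) vcat_scheme \<Rightarrow> 'c \<Rightarrow> 'c \<Rightarrow> 'a \<Rightarrow> 'a \<Rightarrow> bool"
  where "vinverse0 C a b f g \<longleftrightarrow>
    f \<in> Hom V \<one> (VHom C a b) \<and> g \<in> Hom V \<one> (VHom C b a) \<and>
    vcomp0 C a b a g f = VId C a \<and> vcomp0 C b a b f g = VId C b"

definition vnatural ::
    "('o, 'a, 'c, 'm) vcat_scheme \<Rightarrow> ('o, 'a, 'd, 'n) vcat_scheme \<Rightarrow>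
      ('c, 'd, 'a) vfun \<Rightarrow> ('c, 'd, 'a) vfun \<Rightarrow> ('c \<Rightarrow> 'a) \<Rightarrow> bool"
  where "vnatural C D F G \<alpha> \<longleftrightarrow> vfunctor C D F \<and> vfunctor C D G \<and>
    \<alpha> \<in> VObj C \<rightarrow>\<^sub>E Arr V \<and>
    (\<forall>a\<in>VObj C. \<alpha> a \<in> Hom V \<one> (VHom D (FO F a) (FO G a))) \<and>
    (\<forall>a\<in>VObj C. \<forall>b\<in>VObj C.
      VComp D (FO F a) (FO F b) (FO G b) \<cdot> (\<alpha> b \<boxtimes> FH F a b) \<cdot>
        inverse_arrow V (LUnit V (VHom C a b)) =
      VComp D (FO F a) (FO G a) (FO G b) \<cdot> (FH G a b \<boxtimes> \<alpha> a) \<cdot>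
        inverse_arrow V (RUnit V (VHom C a b)))"

definition vnatural_iso ::
    "('o, 'a, 'c, 'm) vcat_scheme \<Rightarrow> ('o, 'a, 'd, 'n) vcat_scheme \<Rightarrow>
      ('c, 'd, 'a) vfun \<Rightarrow> ('c, 'd, 'a) vfun \<Rightarrow> ('c \<Rightarrow> 'a) \<Rightarrow> bool"
  where "vnatural_iso C D F G \<alpha> \<longleftrightarrow> vnatural C D F G \<alpha> \<and>
    (\<exists>\<beta>. vnatural C D G F \<beta> \<and>
      (\<forall>a\<in>VObj C. vinverse0 D (FO F a) (FO G a) (\<alpha> a) (\<beta> a)))"

subsection \<open>Cotensors\<close>

text \<open>The arrow from \<open>C(d, p)\<close> to \<open>[v, C(d, c)]\<close> induced by \<open>\<gamma>\<close> from \<open>v\<close> to \<open>C(p, c)\<close>.\<close>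

definition cot_map :: "('o, 'a, 'c, 'm) vcat_scheme \<Rightarrow> 'o \<Rightarrow> 'c \<Rightarrow> 'c \<Rightarrow> 'a \<Rightarrow> 'c \<Rightarrow> 'a"
  where "cot_map C v c p \<gamma> d = transposed (VHom C d p) v (VHom C d c)
    (VComp C d p c \<cdot> Sym V (VHom C d p) (VHom C p c) \<cdot> (Ident V (VHom C d p) \<boxtimes> \<gamma>))"

definition is_cotensor :: "('o, 'a, 'c, 'm) vcat_scheme \<Rightarrow> 'o \<Rightarrow> 'c \<Rightarrow> 'c \<Rightarrow> 'a \<Rightarrow> bool"
  where "is_cotensor C v c p \<gamma> \<longleftrightarrow>
    v \<in> Obj V \<and> c \<in> VObj C \<and> p \<in> VObj C \<and> \<gamma> \<in> Hom V v (VHom C p c) \<and>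
    (\<forall>d\<in>VObj C. is_iso V (cot_map C v c p \<gamma> d))"

text \<open>The arrow from \<open>x\<close> to \<open>C(d, [v, c])\<close> that corresponds to \<open>f\<close> from \<open>x \<otimes> v\<close> to \<open>C(d, c)\<close>.\<close>

definition cot_lift :: "('o, 'a, 'c) cvcat \<Rightarrow> 'o \<Rightarrow> 'c \<Rightarrow> 'c \<Rightarrow> 'o \<Rightarrow> 'a \<Rightarrow> 'a"
  where "cot_lift C v c d x f =
    inverse_arrow V (cot_map C v c (Cot C v c) (Cou C v c) d) \<cdot> transposed x v (VHom C d c) f"

text \<open>The hom-arrow from \<open>C(x, y)\<close> to \<open>C([v, x], [v, y])\<close> of the \<open>\<V>\<close>-functor \<open>[v, -]\<close>.\<close>

definition cot_hom :: "('o, 'a, 'c) cvcat \<Rightarrow> 'o \<Rightarrow> 'c \<Rightarrow> 'c \<Rightarrow> 'a"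
  where "cot_hom C v x y = cot_lift C v y (Cot C v x) (VHom C x y)
    (VComp C (Cot C v x) x y \<cdot> (Ident V (VHom C x y) \<boxtimes> Cou C v x))"

subsection \<open>Arities, theories and algebras\<close>

definition system_of_arities :: "'o set \<Rightarrow> bool"
  where "system_of_arities J \<longleftrightarrow>
    J \<subseteq> Obj V \<and> \<one> \<in> J \<and> (\<forall>j\<in>J. \<forall>k\<in>J. j \<otimes> k \<in> J)"

context
  fixes J :: "'o set"
begin

definition preserves_cotensors ::
    "('o, 'a, 'c, 'm) vcat_scheme \<Rightarrow> ('o, 'a, 'd, 'n) vcat_scheme \<Rightarrow> ('c, 'd, 'a) vfun \<Rightarrow> bool"
  where "preserves_cotensors C D F \<longleftrightarrow>
    (\<forall>j\<in>J. \<forall>c p \<gamma>. is_cotensor C j c p \<gamma> \<longrightarrow>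
      is_cotensor D j (FO F c) (FO F p) (FH F p c \<cdot> \<gamma>))"

definition designated_cotensors :: "('o, 'a, 'c) cvcat \<Rightarrow> bool"
  where "designated_cotensors C \<longleftrightarrow>
    (\<forall>j\<in>J. \<forall>c\<in>VObj C. is_cotensor C j c (Cot C j c) (Cou C j c)) \<and>
    (\<forall>c\<in>VObj C. Cot C \<one> c = c \<and> Cou C \<one> c = VId C c)"

definition arity_op :: "('o, 'a, 'o) vcat"
  where "arity_op = vop (vfull vself J)"

end

end

record ('o, 'a) jtheory = "('o, 'a, 'o) vcat" +
  Tau :: "'o \<Rightarrow> 'o \<Rightarrow> 'a"

type_synonym ('o, 'a, 'c) algebra = "('o, 'a) jtheory \<times> ('o, 'c, 'a) vfun"

text \<open>A strong morphism, recorded together with its domain and codomain.\<close>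

record ('o, 'a, 'c) strong_morphism =
  Src :: "('o, 'a, 'c) algebra"
  Tgt :: "('o, 'a, 'c) algebra"
  TMor :: "('o, 'o, 'a) vfun"
  AIso :: "'o \<Rightarrow> 'a"

context
  fixes V :: "('o, 'a) smc_category" (structure)
    and J :: "'o set"
begin

definition tau_vfun :: "('o, 'a) jtheory \<Rightarrow> ('o, 'o, 'a) vfun"
  where "tau_vfun T = \<lparr>FO = (\<lambda>j\<in>J. j), FH = Tau T\<rparr>"

text \<open>As for \<open>\<V>\<close>-functors, the data of a theory are extensional on \<open>J\<close>, so that equality of
  theories is equality of their homs, composition, identities and structure arrows.\<close>

definition is_theory :: "('o, 'a) jtheory \<Rightarrow> bool"
  where "is_theory T \<longleftrightarrow> vcategory V T \<and> VObj T = J \<and>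
    VHom T \<in> J \<rightarrow>\<^sub>E J \<rightarrow>\<^sub>E Obj V \<and>
    VComp T \<in> J \<rightarrow>\<^sub>E J \<rightarrow>\<^sub>E J \<rightarrow>\<^sub>E Arr V \<and>
    VId T \<in> J \<rightarrow>\<^sub>E Arr V \<and>
    vfunctor V (arity_op V J) T (tau_vfun T) \<and>
    preserves_cotensors V J (arity_op V J) T (tau_vfun T)"

definition is_theory_morphism ::
    "('o, 'a) jtheory \<Rightarrow> ('o, 'a) jtheory \<Rightarrow> ('o, 'o, 'a) vfun \<Rightarrow> bool"
  where "is_theory_morphism T U M \<longleftrightarrow>
    is_theory T \<and> is_theory U \<and> vfunctor V T U M \<and> vfun_comp V J M (tau_vfun T) = tau_vfun U"

context
  fixes C :: "('o, 'a, 'c) cvcat"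
begin

definition is_algebra :: "('o, 'a) jtheory \<Rightarrow> ('o, 'c, 'a) vfun \<Rightarrow> bool"
  where "is_algebra T A \<longleftrightarrow> vfunctor V T C A \<and> preserves_cotensors V J T C A"

text \<open>\<open>\<V>\<close>-natural families with components \<open>l j\<close> from \<open>x\<close> to \<open>C(A j, B j)\<close>, and the end of
  \<open>C(A-, B-)\<close>, which is the universal such family.\<close>

definition is_wedge ::
    "('o, 'a) jtheory \<Rightarrow> ('o, 'c, 'a) vfun \<Rightarrow> ('o, 'c, 'a) vfun \<Rightarrow> 'o \<Rightarrow> ('o \<Rightarrow> 'a) \<Rightarrow> bool"
  where "is_wedge T A B x l \<longleftrightarrow> x \<in> Obj V \<and>
    (\<forall>j\<in>VObj T. l j \<in> Hom V x (VHom C (FO A j) (FO B j))) \<and>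
    (\<forall>j\<in>VObj T. \<forall>k\<in>VObj T.
      VComp C (FO A j) (FO A k) (FO B k) \<cdot> (l k \<boxtimes> FH A j k) =
      VComp C (FO A j) (FO B j) (FO B k) \<cdot> (FH B j k \<boxtimes> l j) \<cdot> Sym V x (VHom T j k))"

definition is_end ::
    "('o, 'a) jtheory \<Rightarrow> ('o, 'c, 'a) vfun \<Rightarrow> ('o, 'c, 'a) vfun \<Rightarrow> 'o \<Rightarrow> ('o \<Rightarrow> 'a) \<Rightarrow> bool"
  where "is_end T A B e l \<longleftrightarrow> is_wedge T A B e l \<and>
    (\<forall>x m. is_wedge T A B x m \<longrightarrow>
      (\<exists>!h. h \<in> Hom V x e \<and> (\<forall>j\<in>VObj T. l j \<cdot> h = m j)))"

definition admissible :: bool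
  where "admissible \<longleftrightarrow> vcategory V C \<and> designated_cotensors V J C \<and>
    (\<forall>T A B. is_theory T \<and> is_algebra T A \<and> is_algebra T B \<longrightarrow> (\<exists>e l. is_end T A B e l))"

definition chosen_end ::
    "('o, 'a) jtheory \<Rightarrow> ('o, 'c, 'a) vfun \<Rightarrow> ('o, 'c, 'a) vfun \<Rightarrow> 'o \<times> ('o \<Rightarrow> 'a)"
  where "chosen_end T A B = (SOME (e, l). is_end T A B e l)"

definition alg_hom :: "('o, 'a) jtheory \<Rightarrow> ('o, 'c, 'a) vfun \<Rightarrow> ('o, 'c, 'a) vfun \<Rightarrow> 'o"
  where "alg_hom T A B = fst (chosen_end T A B)"

definition alg_ev :: "('o, 'a) jtheory \<Rightarrow> ('o, 'c, 'a) vfun \<Rightarrow> ('o, 'c, 'a) vfun \<Rightarrow> 'o \<Rightarrow> 'a"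
  where "alg_ev T A B = snd (chosen_end T A B)"

text \<open>The arrow from \<open>x\<close> to the hom-object of \<open>T\<close>-algebra morphisms induced by a family.\<close>

definition into_alg_hom ::
    "('o, 'a) jtheory \<Rightarrow> ('o, 'c, 'a) vfun \<Rightarrow> ('o, 'c, 'a) vfun \<Rightarrow> 'o \<Rightarrow> ('o \<Rightarrow> 'a) \<Rightarrow> 'a"
  where "into_alg_hom T A B x m =
    (THE h. h \<in> Hom V x (alg_hom T A B) \<and> (\<forall>j\<in>VObj T. alg_ev T A B j \<cdot> h = m j))"

definition pointwise_cot :: "('o, 'a) jtheory \<Rightarrow> 'o \<Rightarrow> ('o, 'c, 'a) vfun \<Rightarrow> ('o, 'c, 'a) vfun"
  where "pointwise_cot T v A = \<lparr>FO = (\<lambda>j\<in>VObj T. Cot C v (FO A j)),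
    FH = (\<lambda>j\<in>VObj T. \<lambda>k\<in>VObj T. cot_hom V C v (FO A j) (FO A k) \<cdot> FH A j k)\<rparr>"

text \<open>The \<open>\<V>\<close>-category of \<open>T\<close>-algebras in \<open>C\<close>. Its designated cotensors \<open>[v, A]\<close> are the
  composites of \<open>A\<close> with the designated \<open>[v, -]\<close> of \<open>C\<close>, so every evaluation \<open>\<V>\<close>-functor
  (in particular the one at the unit) sends them to the designated ones in \<open>C\<close>.\<close>

definition alg_vcat :: "('o, 'a) jtheory \<Rightarrow> ('o, 'a, ('o, 'c, 'a) vfun) cvcat"
  where "alg_vcat T = \<lparr>VObj = {A. is_algebra T A},
    VHom = alg_hom T,
    VComp = (\<lambda>A B D. into_alg_hom T A D (alg_hom T B D \<otimes> alg_hom T A B)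
      (\<lambda>j. VComp C (FO A j) (FO B j) (FO D j) \<cdot> (alg_ev T B D j \<boxtimes> alg_ev T A B j))),
    VId = (\<lambda>A. into_alg_hom T A A \<one> (\<lambda>j. VId C (FO A j))),
    Cot = pointwise_cot T,
    Cou = (\<lambda>v A. into_alg_hom T (pointwise_cot T v A) A v (\<lambda>j. Cou C v (FO A j)))\<rparr>"

subsection \<open>Strong morphisms\<close>

definition carrier :: "('o, 'a, 'c) algebra \<Rightarrow> 'c"
  where "carrier X = FO (snd X) \<one>"

definition underlying :: "('o, 'a, 'c) strong_morphism \<Rightarrow> 'a"
  where "underlying h = AIso h \<one>"

definition Alg\<^sub>s :: "(('o, 'a, 'c) algebra, ('o, 'a, 'c) strong_morphism) category"
  where "Alg\<^sub>s = \<lparr>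
    Obj = {(T, A). is_theory T \<and> is_algebra T A},
    Arr = {h. is_algebra (fst (Src h)) (snd (Src h)) \<and>
              is_algebra (fst (Tgt h)) (snd (Tgt h)) \<and>
              is_theory_morphism (fst (Src h)) (fst (Tgt h)) (TMor h) \<and>
              vnatural_iso V (fst (Src h)) C
                (snd (Src h)) (vfun_comp V J (snd (Tgt h)) (TMor h)) (AIso h)},
    Dom = Src,
    Cod = Tgt,
    Ident = (\<lambda>X. \<lparr>Src = X, Tgt = X, TMor = vfun_id V (fst X),
                    AIso = (\<lambda>j\<in>J. VId C (FO (snd X) j))\<rparr>),
    Comp = (\<lambda>k h. \<lparr>Src = Src h, Tgt = Tgt k, TMor = vfun_comp V J (TMor k) (TMor h),
      AIso = (\<lambda>j\<in>J. vcomp0 V C (FO (snd (Src h)) j)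
        (FO (snd (Tgt h)) (FO (TMor h) j))
        (FO (snd (Tgt k)) (FO (TMor k) (FO (TMor h) j)))
        (AIso k (FO (TMor h) j)) (AIso h j))\<rparr>)\<rparr>"

definition Alg_on :: "'c \<Rightarrow> (('o, 'a, 'c) algebra, ('o, 'a, 'c) strong_morphism) category"
  where "Alg_on c = Alg\<^sub>s\<lparr>Obj := {X \<in> Obj Alg\<^sub>s. carrier X = c},
    Arr := {h \<in> Arr Alg\<^sub>s. carrier (Src h) = c \<and> carrier (Tgt h) = c \<and> underlying h = VId C c}\<rparr>"

subsection \<open>Commutants\<close>

text \<open>The theory with homs \<open>E([j, X], [k, X])\<close>, for an object \<open>X\<close> of a \<open>\<V>\<close>-category \<open>E\<close> with
  designated cotensors. The structure arrows are the hom-arrows \<open>J(k, j) \<rightarrow> E([j, X], [k, X])\<close>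
  of the \<open>\<V>\<close>-functor \<open>[-, X]\<close>; equivalently, they are determined by the counits
  \<open>j \<rightarrow> E([j, X], X)\<close>.\<close>

definition cotensor_theory :: "('o, 'a, 'e) cvcat \<Rightarrow> 'e \<Rightarrow> ('o, 'a) jtheory"
  where "cotensor_theory E X = \<lparr>VObj = J,
    VHom = (\<lambda>j\<in>J. \<lambda>k\<in>J. VHom E (Cot E j X) (Cot E k X)),
    VComp = (\<lambda>j\<in>J. \<lambda>k\<in>J. \<lambda>l\<in>J. VComp E (Cot E j X) (Cot E k X) (Cot E l X)),
    VId = (\<lambda>j\<in>J. VId E (Cot E j X)),
    Tau = (\<lambda>j\<in>J. \<lambda>k\<in>J. cot_lift V E k X (Cot E j X) (IHom V k j) (Cou E j X \<cdot> Ev V k j))\<rparr>"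

definition commutant :: "('o, 'a, 'c) algebra \<Rightarrow> ('o, 'a, 'c) algebra"
  where "commutant X = (case X of (T, A) \<Rightarrow>
    (cotensor_theory (alg_vcat T) A,
     \<lparr>FO = (\<lambda>j\<in>J. Cot C j (carrier (T, A))),
      FH = (\<lambda>j\<in>J. \<lambda>k\<in>J.
        alg_ev T (pointwise_cot T j A) (pointwise_cot T k A) \<one>)\<rparr>))"

definition commutant_arrow :: "('o, 'a, 'c) strong_morphism \<Rightarrow> ('o, 'a, 'c) strong_morphism"
  where "commutant_arrow f =
    (THE g. g \<in> Hom Alg\<^sub>s (commutant (Tgt f)) (commutant (Src f)) \<and>
      vinverse0 V C (carrier (Src f)) (carrier (Tgt f)) (underlying f) (underlying g))"

text \<open>This is a functor from \<open>Alg\<^sub>s\<close> to \<open>dual Alg\<^sub>s\<close> and, by restriction, from \<open>Alg_on c\<close> to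
  \<open>dual (Alg_on c)\<close>.\<close>

definition Com :: "(('o, 'a, 'c) algebra, ('o, 'a, 'c) strong_morphism,
    ('o, 'a, 'c) algebra, ('o, 'a, 'c) strong_morphism) func"
  where "Com = \<lparr>OMap = commutant, AMap = commutant_arrow\<rparr>"

definition com_unit :: "('o, 'a, 'c) algebra \<Rightarrow> ('o, 'a, 'c) strong_morphism"
  where "com_unit X = (THE u. u \<in> Hom (Alg_on (carrier X)) X (commutant (commutant X)))"

text \<open>The counit has the same components as the unit, read as arrows of \<open>dual Alg\<^sub>s\<close>.\<close>

definition com_counit :: "('o, 'a, 'c) algebra \<Rightarrow> ('o, 'a, 'c) strong_morphism"
  where "com_counit = com_unit"

end

end

end

theory Submission
  imports Defs
begin

text \<open>An arrow into a commutant is determined by its underlying isomorphism: by naturality at the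
  structure arrows \<open>j \<rightarrow> T(j, I)\<close> its component at \<open>I\<close> determines all components, and evaluation
  at \<open>I\<close> is monic on the hom-objects of a category of algebras. Hence, once \<open>f\<^sup>\<bottom>\<close> and
  \<open>u\<^sub>A : A \<rightarrow> A\<^sup>\<bottom>\<^sup>\<bottom>\<close> exist, all equations between composites of them hold; in particular
  \<open>u\<close> at \<open>A\<^sup>\<bottom>\<close> is inverse to \<open>u\<^sub>A\<^sup>\<bottom>\<close>, as both have identity underlying isomorphisms.
  The arrow \<open>f\<^sup>\<bottom>\<close> is conjugation of wedges with \<open>f\<close>. For the unit, a
  generalized element \<open>t\<close> of \<open>T(j, k)\<close> acts on \<open>[l, A j] \<cong> [j, [l, A I]]\<close>, and this commutes with
  the elements of the commutant because these are natural in the objects of \<open>T\<close>.\<close>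

section \<open>Monoidal coherence\<close>

text \<open>Diagrams in enriched categories are dominated by associators and symmetries. The
  calculation is therefore done with generalized elements: an element over y composed with one over
  x is an element over y \<otimes> x, and every reordering becomes an explicit change of domain,
  settled by the unit coherences, the hexagons or the Yang-Baxter relation. Functors, natural
  transformations, cotensors and wedges are each restated for such elements, so that Yoneda
  arguments replace the diagrams.

  Two kinds of strictness turn statements about underlying isomorphisms into literal equations in
  \<open>C\<close>: designated cotensors by I leave objects unchanged, and morphisms of theories are
  the identity on objects. The first has to be carried through the construction of the V-category of
  algebras, whose cotensors by I must again be strict.

  The direction of f^\<bottom> comes from restriction: a family that is natural over the target
  theory restricts along the theory morphism to one that is natural over the source theory.\<close>

context category
begin

lemma comp_typing [simp]:
  assumes "f \<in> Arr C" "g \<in> Arr C" "Dom C g = Cod C f"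
  shows "g \<cdot> f \<in> Arr C" "Dom C (g \<cdot> f) = Dom C f" "Cod C (g \<cdot> f) = Cod C g"
  using comp_hom[of f "Dom C f" "Cod C f" g "Cod C g"] assms by (auto simp: Hom_def)

lemma ident_typing [simp]:
  assumes "a \<in> Obj C"
  shows "Ident C a \<in> Arr C" "Dom C (Ident C a) = a" "Cod C (Ident C a) = a"
  using ident_hom[OF assms] by (auto simp: Hom_def)

lemma dom_cod_obj [simp]:
  assumes "f \<in> Arr C"
  shows "Dom C f \<in> Obj C" "Cod C f \<in> Obj C"
  using assms dom_obj cod_obj by auto

lemma comp_ident [simp]:
  assumes "f \<in> Arr C"
  shows "Dom C f = a \<Longrightarrow> f \<cdot> Ident C a = f" "Cod C f = b \<Longrightarrow> Ident C b \<cdot> f = f"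
  using assms comp_ident_left comp_ident_right by (auto simp: Hom_def)

lemma assoc [simp]:
  assumes "f \<in> Arr C" "g \<in> Arr C" "h \<in> Arr C" "Dom C g = Cod C f" "Dom C h = Cod C g"
  shows "(h \<cdot> g) \<cdot> f = h \<cdot> (g \<cdot> f)"
  using assms comp_assoc by (auto simp: Hom_def)

lemma inverse_arrows_unique:
  assumes "inverse_arrows C f g" "inverse_arrows C f h"
  shows "g = h"
proof -
  have t: "f \<in> Arr C" "g \<in> Arr C" "h \<in> Arr C" "Dom C g = Cod C f" "Dom C h = Cod C f"
      "Cod C g = Dom C f" "Cod C h = Dom C f"
    using assms by (auto simp: inverse_arrows_def Hom_def)
  have "g = g \<cdot> (f \<cdot> h)" using assms t by (simp add: inverse_arrows_def)
  also have "\<dots> = (g \<cdot> f) \<cdot> h" using t by simp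
  also have "\<dots> = h" using assms t by (simp add: inverse_arrows_def del: assoc)
  finally show ?thesis .
qed

lemma inverse_arrowI: "inverse_arrows C f g \<Longrightarrow> inverse_arrow C f = g"
  unfolding inverse_arrow_def using inverse_arrows_unique by blast

lemma inverse_arrow [simp]:
  assumes "is_iso C f"
  shows "inverse_arrow C f \<in> Arr C" "Dom C (inverse_arrow C f) = Cod C f"
    "Cod C (inverse_arrow C f) = Dom C f"
    "Cod C f = b \<Longrightarrow> f \<cdot> inverse_arrow C f = Ident C b"
    "Dom C f = a \<Longrightarrow> inverse_arrow C f \<cdot> f = Ident C a"
    "\<lbrakk>h \<in> Arr C; Cod C h = Cod C f\<rbrakk> \<Longrightarrow> f \<cdot> (inverse_arrow C f \<cdot> h) = h"
    "\<lbrakk>k \<in> Arr C; Cod C k = Dom C f\<rbrakk> \<Longrightarrow> inverse_arrow C f \<cdot> (f \<cdot> k) = k"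
proof -
  obtain g where g: "inverse_arrows C f g" using assms by (auto simp: is_iso_def)
  have e: "inverse_arrow C f = g" by (rule inverse_arrowI[OF g])
  have t: "f \<in> Arr C" "g \<in> Arr C" "Dom C g = Cod C f" "Cod C g = Dom C f"
      "g \<cdot> f = Ident C (Dom C f)" "f \<cdot> g = Ident C (Cod C f)"
    using g by (auto simp: inverse_arrows_def Hom_def)
  show "inverse_arrow C f \<in> Arr C" "Dom C (inverse_arrow C f) = Cod C f"
    "Cod C (inverse_arrow C f) = Dom C f"
    "Cod C f = b \<Longrightarrow> f \<cdot> inverse_arrow C f = Ident C b"
    "Dom C f = a \<Longrightarrow> inverse_arrow C f \<cdot> f = Ident C a"
    using t e by auto
  show "\<lbrakk>h \<in> Arr C; Cod C h = Cod C f\<rbrakk> \<Longrightarrow> f \<cdot> (inverse_arrow C f \<cdot> h) = h"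
    using assoc[of h g f] t e by simp
  show "\<lbrakk>k \<in> Arr C; Cod C k = Dom C f\<rbrakk> \<Longrightarrow> inverse_arrow C f \<cdot> (f \<cdot> k) = k"
    using assoc[of k f g] t e by simp
qed

lemma iso_arr: "is_iso C f \<Longrightarrow> f \<in> Arr C"
  by (auto simp: is_iso_def inverse_arrows_def)

lemma isoI:
  assumes "f \<in> Arr C" "g \<in> Arr C" "Dom C g = Cod C f" "Cod C g = Dom C f"
    "g \<cdot> f = Ident C (Dom C f)" "f \<cdot> g = Ident C (Cod C f)"
  shows "is_iso C f"
  using assms by (auto simp: is_iso_def inverse_arrows_def Hom_def)

lemma iso_ident [simp]: "a \<in> Obj C \<Longrightarrow> is_iso C (Ident C a)"
  by (rule isoI[of _ "Ident C a"]) auto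

lemma iso_inverse [simp]: "is_iso C f \<Longrightarrow> is_iso C (inverse_arrow C f)"
  by (rule isoI[of _ f]) (auto simp: iso_arr)

lemma iso_comp [simp]:
  assumes "is_iso C f" "is_iso C g" "Dom C g = Cod C f"
  shows "is_iso C (g \<cdot> f)"
  by (rule isoI[of _ "inverse_arrow C f \<cdot> inverse_arrow C g"]) (use assms in \<open>auto simp: iso_arr\<close>)

lemma iso_cancel_left:
  assumes "f \<cdot> g = f \<cdot> h" "is_iso C f" "g \<in> Arr C" "h \<in> Arr C" "Cod C g = Dom C f" "Cod C h = Dom C f"
  shows "g = h"
proof -
  have "inverse_arrow C f \<cdot> (f \<cdot> g) = inverse_arrow C f \<cdot> (f \<cdot> h)" by (simp only: assms(1))
  then show ?thesis using assms(2-) by (simp add: iso_arr)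
qed

lemma iso_cancel_right:
  assumes "g \<cdot> f = h \<cdot> f" "is_iso C f" "g \<in> Arr C" "h \<in> Arr C" "Dom C g = Cod C f" "Dom C h = Cod C f"
  shows "g = h"
proof -
  have "g = (g \<cdot> f) \<cdot> inverse_arrow C f" using assms(2-) by (simp add: iso_arr)
  also have "\<dots> = h" unfolding assms(1) using assms(2-) by (simp add: iso_arr)
  finally show ?thesis .
qed

end

context symmetric_monoidal_closed_category
begin

lemma obj_simps [simp]: "\<one> \<in> Obj V"
  "\<lbrakk>a \<in> Obj V; b \<in> Obj V\<rbrakk> \<Longrightarrow> a \<otimes> b \<in> Obj V"
  "\<lbrakk>a \<in> Obj V; b \<in> Obj V\<rbrakk> \<Longrightarrow> IHom V a b \<in> Obj V"
  by (simp_all add: unit_obj ten_obj ihom_obj)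

lemma ten_typing [simp]:
  assumes "f \<in> Arr V" "g \<in> Arr V"
  shows "f \<boxtimes> g \<in> Arr V" "Dom V (f \<boxtimes> g) = Dom V f \<otimes> Dom V g" "Cod V (f \<boxtimes> g) = Cod V f \<otimes> Cod V g"
  using ten_hom[of f "Dom V f" "Cod V f" g "Dom V g" "Cod V g"] assms by (auto simp: Hom_def)

lemma structure_typing [simp]:
  "\<lbrakk>a \<in> Obj V; b \<in> Obj V; c \<in> Obj V\<rbrakk> \<Longrightarrow> Assoc V a b c \<in> Arr V"
  "\<lbrakk>a \<in> Obj V; b \<in> Obj V; c \<in> Obj V\<rbrakk> \<Longrightarrow> Dom V (Assoc V a b c) = (a \<otimes> b) \<otimes> c"
  "\<lbrakk>a \<in> Obj V; b \<in> Obj V; c \<in> Obj V\<rbrakk> \<Longrightarrow> Cod V (Assoc V a b c) = a \<otimes> (b \<otimes> c)"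
  "a \<in> Obj V \<Longrightarrow> LUnit V a \<in> Arr V" "a \<in> Obj V \<Longrightarrow> Dom V (LUnit V a) = \<one> \<otimes> a"
  "a \<in> Obj V \<Longrightarrow> Cod V (LUnit V a) = a"
  "a \<in> Obj V \<Longrightarrow> RUnit V a \<in> Arr V" "a \<in> Obj V \<Longrightarrow> Dom V (RUnit V a) = a \<otimes> \<one>"
  "a \<in> Obj V \<Longrightarrow> Cod V (RUnit V a) = a"
  "\<lbrakk>a \<in> Obj V; b \<in> Obj V\<rbrakk> \<Longrightarrow> Sym V a b \<in> Arr V"
  "\<lbrakk>a \<in> Obj V; b \<in> Obj V\<rbrakk> \<Longrightarrow> Dom V (Sym V a b) = a \<otimes> b"
  "\<lbrakk>a \<in> Obj V; b \<in> Obj V\<rbrakk> \<Longrightarrow> Cod V (Sym V a b) = b \<otimes> a"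
  "\<lbrakk>a \<in> Obj V; b \<in> Obj V\<rbrakk> \<Longrightarrow> Ev V a b \<in> Arr V"
  "\<lbrakk>a \<in> Obj V; b \<in> Obj V\<rbrakk> \<Longrightarrow> Dom V (Ev V a b) = IHom V a b \<otimes> a"
  "\<lbrakk>a \<in> Obj V; b \<in> Obj V\<rbrakk> \<Longrightarrow> Cod V (Ev V a b) = b"
  using assoc_hom[of a b c] lunit_hom[of a] runit_hom[of a] sym_hom[of a b] ev_hom[of a b]
  by (auto simp: Hom_def)

lemma structure_iso [simp]:
  "\<lbrakk>a \<in> Obj V; b \<in> Obj V; c \<in> Obj V\<rbrakk> \<Longrightarrow> is_iso V (Assoc V a b c)"
  "a \<in> Obj V \<Longrightarrow> is_iso V (LUnit V a)" "a \<in> Obj V \<Longrightarrow> is_iso V (RUnit V a)"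
  "\<lbrakk>a \<in> Obj V; b \<in> Obj V\<rbrakk> \<Longrightarrow> is_iso V (Sym V a b)"
  by (auto simp: assoc_iso lunit_iso runit_iso sym_sym intro!: isoI[of "Sym V a b" "Sym V b a"])

lemma ten_ident' [simp]: "\<lbrakk>a \<in> Obj V; b \<in> Obj V\<rbrakk> \<Longrightarrow> Ident V a \<boxtimes> Ident V b = Ident V (a \<otimes> b)"
  by (rule ten_ident)

lemma interchange:
  assumes "f \<in> Arr V" "g \<in> Arr V" "h \<in> Arr V" "k \<in> Arr V" "Dom V g = Cod V f" "Dom V k = Cod V h"
  shows "(g \<boxtimes> k) \<cdot> (f \<boxtimes> h) = (g \<cdot> f) \<boxtimes> (k \<cdot> h)"
  using ten_comp[of f _ _ g _ h _ _ k] assms by (simp add: Hom_def)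

lemma interchange':
  assumes "f \<in> Arr V" "g \<in> Arr V" "h \<in> Arr V" "k \<in> Arr V" "Dom V g = Cod V f" "Dom V k = Cod V h"
    "r \<in> Arr V" "Cod V r = Dom V f \<otimes> Dom V h"
  shows "(g \<boxtimes> k) \<cdot> ((f \<boxtimes> h) \<cdot> r) = ((g \<cdot> f) \<boxtimes> (k \<cdot> h)) \<cdot> r"
  using assms by (simp add: interchange[symmetric])

lemmas interchange_simps = interchange interchange'

lemma iso_ten [simp]: "is_iso V f \<Longrightarrow> is_iso V g \<Longrightarrow> is_iso V (f \<boxtimes> g)"
  by (rule isoI[of _ "inverse_arrow V f \<boxtimes> inverse_arrow V g"]) (auto simp: iso_arr interchange_simps)

lemma lunit_nat: "f \<in> Arr V \<Longrightarrow> Cod V f = b \<Longrightarrow> LUnit V b \<cdot> (Ident V \<one> \<boxtimes> f) = f \<cdot> LUnit V (Dom V f)"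
  by (rule lunit_natural) (simp add: Hom_def)

lemma runit_nat: "f \<in> Arr V \<Longrightarrow> Cod V f = b \<Longrightarrow> RUnit V b \<cdot> (f \<boxtimes> Ident V \<one>) = f \<cdot> RUnit V (Dom V f)"
  by (rule runit_natural) (simp add: Hom_def)

lemma sym_nat:
  "\<lbrakk>f \<in> Arr V; g \<in> Arr V; Cod V f = a; Cod V g = b\<rbrakk>
    \<Longrightarrow> Sym V a b \<cdot> (f \<boxtimes> g) = (g \<boxtimes> f) \<cdot> Sym V (Dom V f) (Dom V g)"
  by (rule sym_natural) (simp_all add: Hom_def)

lemma assoc_nat:
  "\<lbrakk>f \<in> Arr V; g \<in> Arr V; h \<in> Arr V; Cod V f = a; Cod V g = b; Cod V h = c\<rbrakk>
    \<Longrightarrow> Assoc V a b c \<cdot> ((f \<boxtimes> g) \<boxtimes> h) = (f \<boxtimes> (g \<boxtimes> h)) \<cdot> Assoc V (Dom V f) (Dom V g) (Dom V h)"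
  by (rule assoc_natural) (simp_all add: Hom_def)

lemma sym_nat':
  "\<lbrakk>f \<in> Arr V; g \<in> Arr V; Cod V f = a; Cod V g = b; r \<in> Arr V; Cod V r = Dom V f \<otimes> Dom V g\<rbrakk>
    \<Longrightarrow> Sym V a b \<cdot> ((f \<boxtimes> g) \<cdot> r) = (g \<boxtimes> f) \<cdot> (Sym V (Dom V f) (Dom V g) \<cdot> r)"
  using assoc[of r "f \<boxtimes> g" "Sym V a b"] assoc[of r "Sym V (Dom V f) (Dom V g)" "g \<boxtimes> f"]
    sym_nat[of f g] by (auto simp del: assoc)

lemma assoc_nat':
  "\<lbrakk>f \<in> Arr V; g \<in> Arr V; h \<in> Arr V; Cod V f = a; Cod V g = b; Cod V h = c;
    r \<in> Arr V; Cod V r = (Dom V f \<otimes> Dom V g) \<otimes> Dom V h\<rbrakk>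
    \<Longrightarrow> Assoc V a b c \<cdot> (((f \<boxtimes> g) \<boxtimes> h) \<cdot> r) = (f \<boxtimes> (g \<boxtimes> h)) \<cdot> (Assoc V (Dom V f) (Dom V g) (Dom V h) \<cdot> r)"
  using assoc[of r "(f \<boxtimes> g) \<boxtimes> h" "Assoc V a b c"]
    assoc[of r "Assoc V (Dom V f) (Dom V g) (Dom V h)" "f \<boxtimes> (g \<boxtimes> h)"]
    assoc_nat[of f g h] by (auto simp del: assoc)

lemma sym_inv [simp]: "\<lbrakk>a \<in> Obj V; b \<in> Obj V\<rbrakk> \<Longrightarrow> Sym V b a \<cdot> Sym V a b = Ident V (a \<otimes> b)"
  by (rule sym_sym)

lemma sym_inv' [simp]:
  "\<lbrakk>a \<in> Obj V; b \<in> Obj V; r \<in> Arr V; Cod V r = a \<otimes> b\<rbrakk> \<Longrightarrow> Sym V b a \<cdot> (Sym V a b \<cdot> r) = r"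
  using assoc[of r "Sym V a b" "Sym V b a"] by (simp del: assoc)

text \<open>The left unitor is natural and invertible, so it conjugates
  \<open>Ident V \<one> \<boxtimes> f\<close> to \<open>f\<close>. Equations between unit coherences
  can thus be tested after tensoring with \<one>, where the pentagon and the triangle apply.\<close>

lemma unit_ten_faithful:
  assumes "Ident V \<one> \<boxtimes> f = Ident V \<one> \<boxtimes> g" "f \<in> Arr V" "g \<in> Arr V" "Dom V f = Dom V g" "Cod V f = Cod V g"
  shows "f = g"
proof (rule iso_cancel_right)
  show "f \<cdot> LUnit V (Dom V f) = g \<cdot> LUnit V (Dom V f)"
    using lunit_nat[of f] lunit_nat[of g] assms by metis
qed (use assms in auto)

lemma ten_unit_faithful:
  assumes "f \<boxtimes> Ident V \<one> = g \<boxtimes> Ident V \<one>" "f \<in> Arr V" "g \<in> Arr V" "Dom V f = Dom V g" "Cod V f = Cod V g"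
  shows "f = g"
proof (rule iso_cancel_right)
  show "f \<cdot> RUnit V (Dom V f) = g \<cdot> RUnit V (Dom V f)"
    using runit_nat[of f] runit_nat[of g] assms by metis
qed (use assms in auto)

lemma triangle':
  "\<lbrakk>a \<in> Obj V; b \<in> Obj V; r \<in> Arr V; Cod V r = (a \<otimes> \<one>) \<otimes> b\<rbrakk> \<Longrightarrow>
    (Ident V a \<boxtimes> LUnit V b) \<cdot> (Assoc V a \<one> b \<cdot> r) = (RUnit V a \<boxtimes> Ident V b) \<cdot> r"
  using assoc[of r "Assoc V a \<one> b" "Ident V a \<boxtimes> LUnit V b"] triangle[of a b] by (simp del: assoc)

text \<open>Kelly's argument: tensored with \<one> on the left and composed with the isomorphism
  \<open>?s\<close>, the claim follows from the pentagon at (\<one>, \<one>, x, y) and two uses of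
  the triangle.\<close>

lemma lunit_ten:
  assumes x [simp]: "x \<in> Obj V" and y [simp]: "y \<in> Obj V"
  shows "LUnit V (x \<otimes> y) \<cdot> Assoc V \<one> x y = LUnit V x \<boxtimes> Ident V y"
proof (rule unit_ten_faithful)
  let ?i = "Ident V \<one>"
  let ?L = "?i \<boxtimes> (LUnit V (x \<otimes> y) \<cdot> Assoc V \<one> x y)"
  let ?s = "Assoc V \<one> (\<one> \<otimes> x) y \<cdot> (Assoc V \<one> \<one> x \<boxtimes> Ident V y)"
  have "?L \<cdot> ?s = (?i \<boxtimes> LUnit V (x \<otimes> y)) \<cdot> ((?i \<boxtimes> Assoc V \<one> x y) \<cdot> ?s)"
    by (simp add: interchange_simps)
  also have "\<dots> = (?i \<boxtimes> LUnit V (x \<otimes> y)) \<cdot> (Assoc V \<one> \<one> (x \<otimes> y) \<cdot> Assoc V (\<one> \<otimes> \<one>) x y)"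
    using pentagon[of \<one> \<one> x y] by simp
  also have "\<dots> = (RUnit V \<one> \<boxtimes> Ident V (x \<otimes> y)) \<cdot> Assoc V (\<one> \<otimes> \<one>) x y"
    by (simp add: triangle')
  also have "\<dots> = Assoc V \<one> x y \<cdot> ((RUnit V \<one> \<boxtimes> Ident V x) \<boxtimes> Ident V y)"
    by (simp add: assoc_nat)
  also have "\<dots> = Assoc V \<one> x y \<cdot> (((?i \<boxtimes> LUnit V x) \<boxtimes> Ident V y) \<cdot> (Assoc V \<one> \<one> x \<boxtimes> Ident V y))"
    by (simp add: interchange_simps triangle)
  also have "\<dots> = (?i \<boxtimes> (LUnit V x \<boxtimes> Ident V y)) \<cdot> ?s"
    by (simp add: assoc_nat')
  finally show "?L = ?i \<boxtimes> (LUnit V x \<boxtimes> Ident V y)"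
    by (rule iso_cancel_right) auto
qed auto

text \<open>Mirror image of \<open>lunit_ten\<close>, from the pentagon at (x, y, \<one>,
  \<one>).\<close>

lemma runit_ten:
  assumes x [simp]: "x \<in> Obj V" and y [simp]: "y \<in> Obj V"
  shows "(Ident V x \<boxtimes> RUnit V y) \<cdot> Assoc V x y \<one> = RUnit V (x \<otimes> y)"
proof (rule ten_unit_faithful)
  let ?i = "Ident V \<one>"
  have "Assoc V x y \<one> \<cdot> (((Ident V x \<boxtimes> RUnit V y) \<cdot> Assoc V x y \<one>) \<boxtimes> ?i)
      = Assoc V x y \<one> \<cdot> (((Ident V x \<boxtimes> RUnit V y) \<boxtimes> ?i) \<cdot> (Assoc V x y \<one> \<boxtimes> ?i))"
    by (simp add: interchange_simps)
  also have "\<dots> = (Ident V x \<boxtimes> (RUnit V y \<boxtimes> ?i)) \<cdot> (Assoc V x (y \<otimes> \<one>) \<one> \<cdot> (Assoc V x y \<one> \<boxtimes> ?i))"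
    by (simp add: assoc_nat')
  also have "\<dots> = (Ident V x \<boxtimes> (Ident V y \<boxtimes> LUnit V \<one>)) \<cdot> ((Ident V x \<boxtimes> Assoc V y \<one> \<one>) \<cdot> (Assoc V x (y \<otimes> \<one>) \<one> \<cdot> (Assoc V x y \<one> \<boxtimes> ?i)))"
    by (simp add: interchange_simps triangle)
  also have "\<dots> = (Ident V x \<boxtimes> (Ident V y \<boxtimes> LUnit V \<one>)) \<cdot> (Assoc V x y (\<one> \<otimes> \<one>) \<cdot> Assoc V (x \<otimes> y) \<one> \<one>)"
    using pentagon[of x y \<one> \<one>] by simp
  also have "\<dots> = Assoc V x y \<one> \<cdot> ((Ident V (x \<otimes> y) \<boxtimes> LUnit V \<one>) \<cdot> Assoc V (x \<otimes> y) \<one> \<one>)"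
    using assoc_nat'[of "Ident V x" "Ident V y" "LUnit V \<one>" x y \<one> "Assoc V (x \<otimes> y) \<one> \<one>"] by simp
  also have "\<dots> = Assoc V x y \<one> \<cdot> (RUnit V (x \<otimes> y) \<boxtimes> ?i)"
    by (simp add: triangle)
  finally show "((Ident V x \<boxtimes> RUnit V y) \<cdot> Assoc V x y \<one>) \<boxtimes> ?i = RUnit V (x \<otimes> y) \<boxtimes> ?i"
    by (rule iso_cancel_left) auto
qed auto

text \<open>Naturality of the left unitor at \<open>LUnit V \<one>\<close>, with that isomorphism
  cancelled, gives \<open>e\<close>; then \<open>lunit_ten\<close> and the triangle compare the two
  unitors.\<close>

lemma lunit_unit: "LUnit V \<one> = RUnit V \<one>"
proof (rule ten_unit_faithful)
  let ?i = "Ident V \<one>"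
  have e: "LUnit V (\<one> \<otimes> \<one>) = ?i \<boxtimes> LUnit V \<one>"
    by (rule iso_cancel_left[of "LUnit V \<one>"]) (simp_all add: lunit_nat)
  have "LUnit V \<one> \<boxtimes> ?i = (?i \<boxtimes> LUnit V \<one>) \<cdot> Assoc V \<one> \<one> \<one>"
    using lunit_ten[of \<one> \<one>] e by simp
  then show "LUnit V \<one> \<boxtimes> ?i = RUnit V \<one> \<boxtimes> ?i"
    by (simp add: triangle)
qed auto

text \<open>The hexagon at (a, \<one>, \<one>), with the associators removed by
  \<open>lunit_ten\<close> and the triangle.\<close>

lemma lunit_sym:
  assumes a [simp]: "a \<in> Obj V"
  shows "LUnit V a \<cdot> Sym V a \<one> = RUnit V a"
proof (rule ten_unit_faithful)
  let ?i = "Ident V \<one>"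
  have "Sym V a \<one> \<cdot> ((LUnit V a \<cdot> Sym V a \<one>) \<boxtimes> ?i)
    = Sym V a \<one> \<cdot> (LUnit V (a \<otimes> \<one>) \<cdot> (Assoc V \<one> a \<one> \<cdot> (Sym V a \<one> \<boxtimes> ?i)))"
    using assoc[of "Sym V a \<one> \<boxtimes> ?i" "Assoc V \<one> a \<one>" "LUnit V (a \<otimes> \<one>)"]
    by (simp add: lunit_ten interchange_simps del: assoc)
  also have "\<dots> = LUnit V (\<one> \<otimes> a) \<cdot> ((?i \<boxtimes> Sym V a \<one>) \<cdot> (Assoc V \<one> a \<one> \<cdot> (Sym V a \<one> \<boxtimes> ?i)))"
    using assoc[of "Assoc V \<one> a \<one> \<cdot> (Sym V a \<one> \<boxtimes> ?i)" "?i \<boxtimes> Sym V a \<one>" "LUnit V (\<one> \<otimes> a)"]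
    by (simp add: lunit_nat del: assoc) simp
  also have "\<dots> = LUnit V (\<one> \<otimes> a) \<cdot> (Assoc V \<one> \<one> a \<cdot> (Sym V a (\<one> \<otimes> \<one>) \<cdot> Assoc V a \<one> \<one>))"
    using hexagon[of a \<one> \<one>] by simp
  also have "\<dots> = (LUnit V \<one> \<boxtimes> Ident V a) \<cdot> (Sym V a (\<one> \<otimes> \<one>) \<cdot> Assoc V a \<one> \<one>)"
    using assoc[of "Sym V a (\<one> \<otimes> \<one>) \<cdot> Assoc V a \<one> \<one>" "Assoc V \<one> \<one> a" "LUnit V (\<one> \<otimes> a)"]
    by (simp add: lunit_ten del: assoc)
  also have "\<dots> = Sym V a \<one> \<cdot> (RUnit V a \<boxtimes> ?i)"
    using sym_nat'[of "Ident V a" "LUnit V \<one>" a \<one> "Assoc V a \<one> \<one>"] by (simp add: triangle)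
  finally show "(LUnit V a \<cdot> Sym V a \<one>) \<boxtimes> ?i = RUnit V a \<boxtimes> ?i"
    by (rule iso_cancel_left) auto
qed auto

lemma runit_sym: "a \<in> Obj V \<Longrightarrow> RUnit V a \<cdot> Sym V \<one> a = LUnit V a"
  by (simp add: lunit_sym[symmetric])

end

section \<open>Generalized elements\<close>

text \<open>A generalized element of the hom-object \<open>C(a, b)\<close>: an arrow \<open>x \<rightarrow> C(a, b)\<close> together with \<open>a\<close>
  and \<open>b\<close>, which cannot be recovered from the object \<open>C(a, b)\<close> of \<open>V\<close>.\<close>

datatype ('c, 'a) gel = Gel (gsrc: 'c) (gtgt: 'c) (garr: 'a)

lemma gel_eqI: "\<lbrakk>gsrc f = gsrc g; gtgt f = gtgt g; garr f = garr g\<rbrakk> \<Longrightarrow> f = g"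
  by (cases f; cases g) simp

definition gmap :: "('c, 'd, 'a) vfun \<Rightarrow> ('o, 'a) smc_category \<Rightarrow> ('c, 'a) gel \<Rightarrow> ('d, 'a) gel"
  where "gmap F V f = Gel (FO F (gsrc f)) (FO F (gtgt f)) (Comp V (FH F (gsrc f) (gtgt f)) (garr f))"

context symmetric_monoidal_closed_category
begin

definition is_gel :: "('o, 'a, 'c, 'm) vcat_scheme \<Rightarrow> ('c, 'a) gel \<Rightarrow> bool"
  where "is_gel C f \<longleftrightarrow> gsrc f \<in> VObj C \<and> gtgt f \<in> VObj C \<and> garr f \<in> Arr V \<and>
    Cod V (garr f) = VHom C (gsrc f) (gtgt f)"

definition gdom :: "('c, 'a) gel \<Rightarrow> 'o"
  where "gdom f = Dom V (garr f)"

definition reindex :: "('c, 'a) gel \<Rightarrow> 'a \<Rightarrow> ('c, 'a) gel" (infixl "\<lhd>" 69)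
  where "f \<lhd> u = Gel (gsrc f) (gtgt f) (garr f \<cdot> u)"

text \<open>The two factors vary over independent domains, so the composite varies over
  \<open>gdom g \<otimes> gdom f\<close>, in the order of composition. Reorderings of factors then
  appear as \<open>reindex\<close> along associators and symmetries.\<close>

definition gcomp :: "('c, 'a) gel \<Rightarrow> ('o, 'a, 'c, 'm) vcat_scheme \<Rightarrow> ('c, 'a) gel \<Rightarrow> ('c, 'a) gel"
    ("(_ \<odot>[_]/ _)" [76, 0, 75] 75)
  where "g \<odot>[C] f = Gel (gsrc f) (gtgt g) (VComp C (gsrc f) (gsrc g) (gtgt g) \<cdot> (garr g \<boxtimes> garr f))"

definition gid :: "('o, 'a, 'c, 'm) vcat_scheme \<Rightarrow> 'c \<Rightarrow> ('c, 'a) gel"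
  where "gid C a = Gel a a (VId C a)"

text \<open>Composition with an arrow of the underlying ordinary category. It is meaningful only if one of
  the two domains is the unit; if both are, the two cases agree by \<open>LUnit V \<one> = RUnit V \<one>\<close>.\<close>

definition star :: "('c, 'a) gel \<Rightarrow> ('o, 'a, 'c, 'm) vcat_scheme \<Rightarrow> ('c, 'a) gel \<Rightarrow> ('c, 'a) gel"
    ("(_ \<star>[_]/ _)" [76, 0, 75] 75)
  where "g \<star>[C] f = g \<odot>[C] f \<lhd>
    (if gdom g = \<one> then inverse_arrow V (LUnit V (gdom f)) else inverse_arrow V (RUnit V (gdom g)))"

abbreviation fapp :: "('c, 'd, 'a) vfun \<Rightarrow> ('c, 'a) gel \<Rightarrow> ('d, 'a) gel" (infixr "\<rhd>" 80)
  where "F \<rhd> f \<equiv> gmap F V f"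

definition ginverse :: "('o, 'a, 'c, 'm) vcat_scheme \<Rightarrow> ('c, 'a) gel \<Rightarrow> ('c, 'a) gel \<Rightarrow> bool"
  where "ginverse C f g \<longleftrightarrow> is_gel C f \<and> is_gel C g \<and> gdom f = \<one> \<and> gdom g = \<one> \<and>
    gsrc g = gtgt f \<and> gtgt g = gsrc f \<and>
    g \<star>[C] f = gid C (gsrc f) \<and> f \<star>[C] g = gid C (gtgt f)"

lemma gsrc_gtgt [simp]:
  "gsrc (f \<lhd> u) = gsrc f" "gtgt (f \<lhd> u) = gtgt f"
  "gsrc (g \<odot>[C] f) = gsrc f" "gtgt (g \<odot>[C] f) = gtgt g"
  "gsrc (g \<star>[C] f) = gsrc f" "gtgt (g \<star>[C] f) = gtgt g"
  "gsrc (gid C a) = a" "gtgt (gid C a) = a"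
  "gsrc (F \<rhd> f) = FO F (gsrc f)" "gtgt (F \<rhd> f) = FO F (gtgt f)"
  by (simp_all add: reindex_def gcomp_def star_def gid_def gmap_def)

lemma gel_simps [simp]:
  assumes "is_gel C f"
  shows "gsrc f \<in> VObj C" "gtgt f \<in> VObj C" "garr f \<in> Arr V" "gdom f \<in> Obj V"
    "Cod V (garr f) = VHom C (gsrc f) (gtgt f)"
  using assms by (simp_all add: is_gel_def gdom_def)

lemma is_gel_Gel: "is_gel C (Gel a b f) \<longleftrightarrow> a \<in> VObj C \<and> b \<in> VObj C \<and> f \<in> Arr V \<and> Cod V f = VHom C a b"
  by (simp add: is_gel_def)

lemma gdom_Gel [simp]: "gdom (Gel a b f) = Dom V f"
  by (simp add: gdom_def)

lemma gel_reindex [simp]: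
  "\<lbrakk>garr f \<in> Arr V; u \<in> Arr V; Cod V u = gdom f\<rbrakk> \<Longrightarrow> gdom (f \<lhd> u) = Dom V u"
  "\<lbrakk>garr f \<in> Arr V; u \<in> Arr V; Cod V u = gdom f\<rbrakk> \<Longrightarrow> garr (f \<lhd> u) \<in> Arr V"
  "\<lbrakk>is_gel C f; u \<in> Arr V; Cod V u = gdom f\<rbrakk> \<Longrightarrow> is_gel C (f \<lhd> u)"
  by (simp_all add: is_gel_def gdom_def reindex_def del: gel_simps)

lemma reindex_reindex [simp]:
  "\<lbrakk>garr f \<in> Arr V; u \<in> Arr V; v \<in> Arr V; Cod V u = gdom f; Dom V u = Cod V v\<rbrakk>
    \<Longrightarrow> f \<lhd> u \<lhd> v = f \<lhd> u \<cdot> v"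
  by (simp add: reindex_def gdom_def)

lemma reindex_ident [simp]: "\<lbrakk>garr f \<in> Arr V; gdom f = x\<rbrakk> \<Longrightarrow> f \<lhd> Ident V x = f"
  by (cases f) (simp add: reindex_def gdom_def)

context
  fixes C :: "('o, 'a, 'c, 'm) vcat_scheme"
  assumes C [simp]: "vcategory V C"
begin

lemma vcat_typing [simp]:
  assumes [simp]: "a \<in> VObj C"
  shows "b \<in> VObj C \<Longrightarrow> VHom C a b \<in> Obj V" "VId C a \<in> Arr V" "Dom V (VId C a) = \<one>" "Cod V (VId C a) = VHom C a a"
    "\<lbrakk>b \<in> VObj C; c \<in> VObj C\<rbrakk> \<Longrightarrow> VComp C a b c \<in> Arr V"
    "\<lbrakk>b \<in> VObj C; c \<in> VObj C\<rbrakk> \<Longrightarrow> Dom V (VComp C a b c) = VHom C b c \<otimes> VHom C a b"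
    "\<lbrakk>b \<in> VObj C; c \<in> VObj C\<rbrakk> \<Longrightarrow> Cod V (VComp C a b c) = VHom C a c"
  using C unfolding vcategory_def Hom_def by auto

lemma gel_gid [simp]:
  assumes "a \<in> VObj C"
  shows "is_gel C (gid C a)" "gdom (gid C a) = \<one>" "garr (gid C a) \<in> Arr V"
  using assms by (simp_all add: is_gel_def gdom_def gid_def del: gel_simps)

lemma gel_gcomp [simp]:
  assumes "is_gel C f" "is_gel C g" "gsrc g = gtgt f"
  shows "is_gel C (g \<odot>[C] f)" "gdom (g \<odot>[C] f) = gdom g \<otimes> gdom f" "garr (g \<odot>[C] f) \<in> Arr V"
  using assms by (simp_all add: is_gel_def gdom_def gcomp_def del: gel_simps)

lemma gel_star [simp]:
  assumes "is_gel C f" "is_gel C g" "gsrc g = gtgt f"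
  shows "gdom g = \<one> \<Longrightarrow> is_gel C (g \<star>[C] f)" "gdom g = \<one> \<Longrightarrow> gdom (g \<star>[C] f) = gdom f"
    "gdom f = \<one> \<Longrightarrow> is_gel C (g \<star>[C] f)" "gdom f = \<one> \<Longrightarrow> gdom (g \<star>[C] f) = gdom g"
    "gdom f = \<one> \<or> gdom g = \<one> \<Longrightarrow> garr (g \<star>[C] f) \<in> Arr V"
  using assms by (auto simp: star_def)

lemma reindex_cancel:
  assumes "f \<lhd> u = g \<lhd> u" "is_iso V u" "is_gel C f" "is_gel C g" "Cod V u = gdom f" "Cod V u = gdom g"
  shows "f = g"
  by (rule gel_eqI) (use assms in \<open>auto simp: reindex_def gdom_def intro: iso_cancel_right\<close>)

lemma gcomp_reindex_left [simp]:
  assumes "is_gel C f" "is_gel C g" "gsrc g = gtgt f" "u \<in> Arr V" "Cod V u = gdom g"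
  shows "(g \<lhd> u) \<odot>[C] f = g \<odot>[C] f \<lhd> u \<boxtimes> Ident V (gdom f)"
  using assms by (simp add: reindex_def gdom_def gcomp_def interchange_simps)

lemma gcomp_reindex_right [simp]:
  assumes "is_gel C f" "is_gel C g" "gsrc g = gtgt f" "u \<in> Arr V" "Cod V u = gdom f"
  shows "g \<odot>[C] (f \<lhd> u) = g \<odot>[C] f \<lhd> Ident V (gdom g) \<boxtimes> u"
  using assms by (simp add: reindex_def gdom_def gcomp_def interchange_simps)

lemma gcomp_assoc:
  assumes "is_gel C f" "is_gel C g" "is_gel C h" "gsrc g = gtgt f" "gsrc h = gtgt g"
  shows "(h \<odot>[C] g) \<odot>[C] f = h \<odot>[C] (g \<odot>[C] f) \<lhd> Assoc V (gdom h) (gdom g) (gdom f)"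
proof -
  let ?a = "gsrc f" and ?b = "gtgt f" and ?c = "gtgt g" and ?d = "gtgt h"
  have o: "?a \<in> VObj C" "?b \<in> VObj C" "?c \<in> VObj C" "?d \<in> VObj C" using assms by auto
  have A: "VComp C ?a ?b ?d \<cdot> (VComp C ?b ?c ?d \<boxtimes> Ident V (VHom C ?a ?b)) =
      VComp C ?a ?c ?d \<cdot> (Ident V (VHom C ?c ?d) \<boxtimes> VComp C ?a ?b ?c) \<cdot>
        Assoc V (VHom C ?c ?d) (VHom C ?b ?c) (VHom C ?a ?b)"
    using C o unfolding vcategory_def by blast
  have "VComp C ?a ?b ?d \<cdot> ((VComp C ?b ?c ?d \<cdot> (garr h \<boxtimes> garr g)) \<boxtimes> garr f) =
     (VComp C ?a ?b ?d \<cdot> (VComp C ?b ?c ?d \<boxtimes> Ident V (VHom C ?a ?b))) \<cdot> ((garr h \<boxtimes> garr g) \<boxtimes> garr f)"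
    using assms by (simp add: interchange_simps)
  also have "\<dots> = VComp C ?a ?c ?d \<cdot> (Ident V (VHom C ?c ?d) \<boxtimes> VComp C ?a ?b ?c) \<cdot>
        (garr h \<boxtimes> garr g \<boxtimes> garr f) \<cdot> Assoc V (gdom h) (gdom g) (gdom f)"
    unfolding A using assms by (simp add: assoc_nat gdom_def)
  also have "\<dots> = VComp C ?a ?c ?d \<cdot> (garr h \<boxtimes> (VComp C ?a ?b ?c \<cdot> (garr g \<boxtimes> garr f))) \<cdot>
        Assoc V (gdom h) (gdom g) (gdom f)"
    using assms by (simp add: interchange_simps gdom_def)
  finally show ?thesis using assms by (simp add: gcomp_def reindex_def gdom_def)
qed

lemma gcomp_gid [simp]:
  assumes "is_gel C f"
  shows "gtgt f = b \<Longrightarrow> gid C b \<odot>[C] f = f \<lhd> LUnit V (gdom f)"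
    "gsrc f = a \<Longrightarrow> f \<odot>[C] gid C a = f \<lhd> RUnit V (gdom f)"
proof -
  let ?a = "gsrc f" and ?b = "gtgt f"
  have o: "?a \<in> VObj C" "?b \<in> VObj C" using assms by auto
  have L: "VComp C ?a ?b ?b \<cdot> (VId C ?b \<boxtimes> Ident V (VHom C ?a ?b)) = LUnit V (VHom C ?a ?b)"
    and R: "VComp C ?a ?a ?b \<cdot> (Ident V (VHom C ?a ?b) \<boxtimes> VId C ?a) = RUnit V (VHom C ?a ?b)"
    using C o unfolding vcategory_def by blast+
  have "VComp C ?a ?b ?b \<cdot> (VId C ?b \<boxtimes> garr f) =
      (VComp C ?a ?b ?b \<cdot> (VId C ?b \<boxtimes> Ident V (VHom C ?a ?b))) \<cdot> (Ident V \<one> \<boxtimes> garr f)"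
    using assms by (simp add: interchange_simps)
  also have "\<dots> = garr f \<cdot> LUnit V (gdom f)" unfolding L using assms by (simp add: lunit_nat gdom_def)
  finally show "gtgt f = b \<Longrightarrow> gid C b \<odot>[C] f = f \<lhd> LUnit V (gdom f)"
    by (simp add: gcomp_def reindex_def gid_def)
  have "VComp C ?a ?a ?b \<cdot> (garr f \<boxtimes> VId C ?a) =
      (VComp C ?a ?a ?b \<cdot> (Ident V (VHom C ?a ?b) \<boxtimes> VId C ?a)) \<cdot> (garr f \<boxtimes> Ident V \<one>)"
    using assms by (simp add: interchange_simps)
  also have "\<dots> = garr f \<cdot> RUnit V (gdom f)" unfolding R using assms by (simp add: runit_nat gdom_def)
  finally show "gsrc f = a \<Longrightarrow> f \<odot>[C] gid C a = f \<lhd> RUnit V (gdom f)"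
    by (auto simp add: gcomp_def reindex_def gid_def)
qed

lemma star_left: "gdom g = \<one> \<Longrightarrow> g \<star>[C] f = g \<odot>[C] f \<lhd> inverse_arrow V (LUnit V (gdom f))"
  by (simp add: star_def)

lemma star_right: "gdom f = \<one> \<Longrightarrow> g \<star>[C] f = g \<odot>[C] f \<lhd> inverse_arrow V (RUnit V (gdom g))"
  by (simp add: star_def lunit_unit)

lemma star_gid [simp]:
  assumes "is_gel C f"
  shows "gtgt f = b \<Longrightarrow> gid C b \<star>[C] f = f" "gsrc f = a \<Longrightarrow> f \<star>[C] gid C a = f"
  using assms by (auto simp: star_left star_right)

text \<open>This lemma and the next two place the arrow with domain \<one> on the right, on the left
  and in the middle of a triple composite. Each time one unit coherence cancels the associator of
  \<open>gcomp_assoc\<close>: here \<open>runit_ten\<close>, then \<open>lunit_ten\<close>, then the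
  triangle.\<close>

lemma gcomp_star:
  assumes "is_gel C f" "is_gel C g" "is_gel C h" "gsrc g = gtgt f" "gsrc h = gtgt g" "gdom f = \<one>"
  shows "(h \<odot>[C] g) \<star>[C] f = h \<odot>[C] (g \<star>[C] f)"
proof -
  let ?z = "gdom h" and ?y = "gdom g"
  have e: "Assoc V ?z ?y \<one> \<cdot> inverse_arrow V (RUnit V (?z \<otimes> ?y)) = Ident V ?z \<boxtimes> inverse_arrow V (RUnit V ?y)"
    by (rule iso_cancel_left[of "Ident V ?z \<boxtimes> RUnit V ?y"])
      (use assms assoc[of "inverse_arrow V (RUnit V (?z \<otimes> ?y))" "Assoc V ?z ?y \<one>" "Ident V ?z \<boxtimes> RUnit V ?y"]
        in \<open>simp_all add: runit_ten interchange_simps del: assoc\<close>)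
  show ?thesis using assms by (simp add: star_right gcomp_assoc e)
qed

lemma star_gcomp:
  assumes "is_gel C f" "is_gel C g" "is_gel C h" "gsrc g = gtgt f" "gsrc h = gtgt g" "gdom h = \<one>"
  shows "(h \<star>[C] g) \<odot>[C] f = h \<star>[C] (g \<odot>[C] f)"
proof -
  let ?x = "gdom f" and ?y = "gdom g"
  have "Assoc V \<one> ?y ?x = inverse_arrow V (LUnit V (?y \<otimes> ?x)) \<cdot> (LUnit V ?y \<boxtimes> Ident V ?x)"
    by (rule iso_cancel_left[of "LUnit V (?y \<otimes> ?x)"]) (use assms in \<open>simp_all add: lunit_ten\<close>)
  then have e: "Assoc V \<one> ?y ?x \<cdot> (inverse_arrow V (LUnit V ?y) \<boxtimes> Ident V ?x) = inverse_arrow V (LUnit V (?y \<otimes> ?x))"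
    using assms by (simp add: interchange_simps)
  show ?thesis using assms by (simp add: star_left gcomp_assoc e)
qed

lemma star_gcomp_middle:
  assumes "is_gel C f" "is_gel C g" "is_gel C h" "gsrc g = gtgt f" "gsrc h = gtgt g" "gdom g = \<one>"
  shows "(h \<star>[C] g) \<odot>[C] f = h \<odot>[C] (g \<star>[C] f)"
proof -
  let ?x = "gdom f" and ?z = "gdom h"
  have "Assoc V ?z \<one> ?x = (Ident V ?z \<boxtimes> inverse_arrow V (LUnit V ?x)) \<cdot> (RUnit V ?z \<boxtimes> Ident V ?x)"
    by (rule iso_cancel_left[of "Ident V ?z \<boxtimes> LUnit V ?x"]) (use assms in \<open>simp_all add: triangle interchange_simps\<close>)
  then have e: "Assoc V ?z \<one> ?x \<cdot> (inverse_arrow V (RUnit V ?z) \<boxtimes> Ident V ?x) = Ident V ?z \<boxtimes> inverse_arrow V (LUnit V ?x)"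
    using assms by (simp add: interchange_simps)
  show ?thesis using assms by (simp add: star_left star_right gcomp_assoc e)
qed

lemma star_reindex_left:
  assumes "is_gel C f" "is_gel C g" "gsrc g = gtgt f" "gdom f = \<one>" "u \<in> Arr V" "Cod V u = gdom g"
  shows "(g \<lhd> u) \<star>[C] f = g \<star>[C] f \<lhd> u"
proof -
  have e: "(u \<boxtimes> Ident V \<one>) \<cdot> inverse_arrow V (RUnit V (Dom V u)) = inverse_arrow V (RUnit V (gdom g)) \<cdot> u"
    by (rule iso_cancel_left[of "RUnit V (gdom g)"])
      (use assms assoc[of "inverse_arrow V (RUnit V (Dom V u))" "u \<boxtimes> Ident V \<one>" "RUnit V (gdom g)"]
        in \<open>simp_all add: runit_nat del: assoc\<close>, simp)
  show ?thesis using assms by (simp add: star_right e)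
qed

lemma star_reindex_right:
  assumes "is_gel C f" "is_gel C g" "gsrc g = gtgt f" "gdom g = \<one>" "u \<in> Arr V" "Cod V u = gdom f"
  shows "g \<star>[C] (f \<lhd> u) = g \<star>[C] f \<lhd> u"
proof -
  have e: "(Ident V \<one> \<boxtimes> u) \<cdot> inverse_arrow V (LUnit V (Dom V u)) = inverse_arrow V (LUnit V (gdom f)) \<cdot> u"
    by (rule iso_cancel_left[of "LUnit V (gdom f)"])
      (use assms assoc[of "inverse_arrow V (LUnit V (Dom V u))" "Ident V \<one> \<boxtimes> u" "LUnit V (gdom f)"]
        in \<open>simp_all add: lunit_nat del: assoc\<close>, simp)
  show ?thesis using assms by (simp add: star_left e)
qed

lemma star_assoc:
  assumes "is_gel C f" "is_gel C g" "is_gel C h" "gsrc g = gtgt f" "gsrc h = gtgt g"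
  shows "gdom h = \<one> \<Longrightarrow> gdom g = \<one> \<Longrightarrow> (h \<star>[C] g) \<star>[C] f = h \<star>[C] (g \<star>[C] f)"
    "gdom h = \<one> \<Longrightarrow> gdom f = \<one> \<Longrightarrow> (h \<star>[C] g) \<star>[C] f = h \<star>[C] (g \<star>[C] f)"
    "gdom g = \<one> \<Longrightarrow> gdom f = \<one> \<Longrightarrow> (h \<star>[C] g) \<star>[C] f = h \<star>[C] (g \<star>[C] f)"
proof -
  show "gdom h = \<one> \<Longrightarrow> gdom g = \<one> \<Longrightarrow> (h \<star>[C] g) \<star>[C] f = h \<star>[C] (g \<star>[C] f)"
    using assms star_gcomp_middle[of f g h] by (simp add: star_left[of "h \<star>[C] g"] star_left[of h "g \<star>[C] f"])
  show "gdom h = \<one> \<Longrightarrow> gdom f = \<one> \<Longrightarrow> (h \<star>[C] g) \<star>[C] f = h \<star>[C] (g \<star>[C] f)"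
    using assms star_gcomp[of f g h]
    by (simp add: star_right[of f "h \<star>[C] g"] star_right[of f g] star_reindex_right)
  show "gdom g = \<one> \<Longrightarrow> gdom f = \<one> \<Longrightarrow> (h \<star>[C] g) \<star>[C] f = h \<star>[C] (g \<star>[C] f)"
    using assms star_gcomp_middle[of f g h]
    by (simp add: star_right[of f "h \<star>[C] g"] star_right[of "g \<star>[C] f"])
qed

end

end

section \<open>Functors and natural transformations\<close>

context symmetric_monoidal_closed_category
begin

lemma vfunctor_typing:
  assumes "vfunctor V C D F"
  shows "a \<in> VObj C \<Longrightarrow> FO F a \<in> VObj D"
    "\<lbrakk>a \<in> VObj C; b \<in> VObj C\<rbrakk> \<Longrightarrow> FH F a b \<in> Arr V"
    "\<lbrakk>a \<in> VObj C; b \<in> VObj C\<rbrakk> \<Longrightarrow> Dom V (FH F a b) = VHom C a b"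
    "\<lbrakk>a \<in> VObj C; b \<in> VObj C\<rbrakk> \<Longrightarrow> Cod V (FH F a b) = VHom D (FO F a) (FO F b)"
  using assms unfolding vfunctor_def Hom_def by auto

context
  fixes C :: "('o, 'a, 'c, 'm) vcat_scheme" and D :: "('o, 'a, 'd, 'n) vcat_scheme" and F :: "('c, 'd, 'a) vfun"
  assumes F: "vfunctor V C D F"
begin

lemma C_vcategory: "vcategory V C" and D_vcategory: "vcategory V D"
  using F by (simp_all add: vfunctor_def)

lemma gmap_typing:
  assumes "is_gel C f"
  shows "is_gel D (F \<rhd> f)" "gdom (F \<rhd> f) = gdom f" "garr (F \<rhd> f) \<in> Arr V"
  using assms C_vcategory by (simp_all add: is_gel_def gmap_def gdom_def vfunctor_typing[OF F] del: gel_simps)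

lemma gmap_reindex:
  assumes "is_gel C f" "u \<in> Arr V" "Cod V u = gdom f"
  shows "F \<rhd> (f \<lhd> u) = F \<rhd> f \<lhd> u"
  using assms by (simp add: gmap_def reindex_def vfunctor_typing[OF F] gdom_def)

lemma gmap_gid: "a \<in> VObj C \<Longrightarrow> F \<rhd> gid C a = gid D (FO F a)"
  using F by (simp add: vfunctor_def gmap_def gid_def)

lemma gmap_gcomp:
  assumes "is_gel C f" "is_gel C g" "gsrc g = gtgt f"
  shows "F \<rhd> (g \<odot>[C] f) = (F \<rhd> g) \<odot>[D] (F \<rhd> f)"
proof -
  let ?a = "gsrc f" and ?b = "gtgt f" and ?c = "gtgt g"
  have o: "?a \<in> VObj C" "?b \<in> VObj C" "?c \<in> VObj C" using assms by auto
  have e: "FH F ?a ?c \<cdot> VComp C ?a ?b ?c =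
      VComp D (FO F ?a) (FO F ?b) (FO F ?c) \<cdot> (FH F ?b ?c \<boxtimes> FH F ?a ?b)"
    using F o unfolding vfunctor_def by blast
  have "FH F ?a ?c \<cdot> (VComp C ?a ?b ?c \<cdot> (garr g \<boxtimes> garr f)) = (FH F ?a ?c \<cdot> VComp C ?a ?b ?c) \<cdot> (garr g \<boxtimes> garr f)"
    using assms o by (simp add: vfunctor_typing[OF F] C_vcategory)
  then show ?thesis using assms o unfolding e
    by (simp add: vfunctor_typing[OF F] C_vcategory D_vcategory interchange_simps gmap_def gcomp_def)
qed

lemma gmap_star:
  assumes "is_gel C f" "is_gel C g" "gsrc g = gtgt f" "gdom f = \<one> \<or> gdom g = \<one>"
  shows "F \<rhd> (g \<star>[C] f) = (F \<rhd> g) \<star>[D] (F \<rhd> f)"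
  using assms C_vcategory by (auto simp add: star_def gmap_gcomp gmap_reindex gmap_typing)

lemma gmap_ginverse:
  assumes "ginverse C f g"
  shows "ginverse D (F \<rhd> f) (F \<rhd> g)"
proof -
  have t: "is_gel C f" "is_gel C g" "gdom f = \<one>" "gdom g = \<one>" "gsrc g = gtgt f" "gtgt g = gsrc f"
    "g \<star>[C] f = gid C (gsrc f)" "f \<star>[C] g = gid C (gtgt f)"
    using assms by (simp_all add: ginverse_def)
  have "gsrc f \<in> VObj C" "gtgt f \<in> VObj C" using t(1) by auto
  then show ?thesis using t gmap_star[of f g] gmap_star[of g f]
    by (simp add: ginverse_def gmap_typing gmap_gid)
qed

end

lemmas gmap_simps = gmap_typing gmap_reindex gmap_gid gmap_gcomp gmap_star

lemma ginverse_sym: "ginverse C f g \<Longrightarrow> ginverse C g f"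
  by (simp add: ginverse_def)

lemma ginverse_cancel:
  assumes C: "vcategory V C" and i: "ginverse C f g"
  shows "\<lbrakk>is_gel C h; gtgt h = gsrc f\<rbrakk> \<Longrightarrow> g \<star>[C] (f \<star>[C] h) = h"
    "\<lbrakk>is_gel C h; gtgt h = gtgt f\<rbrakk> \<Longrightarrow> f \<star>[C] (g \<star>[C] h) = h"
    "\<lbrakk>is_gel C h; gsrc h = gsrc f\<rbrakk> \<Longrightarrow> (h \<star>[C] g) \<star>[C] f = h"
    "\<lbrakk>is_gel C h; gsrc h = gtgt f\<rbrakk> \<Longrightarrow> (h \<star>[C] f) \<star>[C] g = h"
proof -
  have t: "is_gel C f" "is_gel C g" "gdom f = \<one>" "gdom g = \<one>" "gsrc g = gtgt f" "gtgt g = gsrc f"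
    "g \<star>[C] f = gid C (gsrc f)" "f \<star>[C] g = gid C (gtgt f)"
    using i by (simp_all add: ginverse_def)
  show "g \<star>[C] (f \<star>[C] h) = h" if "is_gel C h" "gtgt h = gsrc f"
    using that t star_assoc(1)[OF C that(1) t(1,2)] C by simp
  show "f \<star>[C] (g \<star>[C] h) = h" if "is_gel C h" "gtgt h = gtgt f"
    using that t star_assoc(1)[OF C that(1) t(2,1)] C by simp
  show "(h \<star>[C] g) \<star>[C] f = h" if "is_gel C h" "gsrc h = gsrc f"
    using that t star_assoc(3)[OF C t(1,2) that(1)] C by simp
  show "(h \<star>[C] f) \<star>[C] g = h" if "is_gel C h" "gsrc h = gtgt f"
    using that t star_assoc(3)[OF C t(2,1) that(1)] C by simp
qed

lemma ginverse_unique: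
  assumes C: "vcategory V C" and i: "ginverse C f g" "ginverse C f h"
  shows "g = h"
proof -
  have t: "is_gel C g" "is_gel C h" "gsrc h = gtgt f" "gtgt h = gsrc f" "gsrc g = gtgt f" using i by (simp_all add: ginverse_def)
  have "g = g \<star>[C] (f \<star>[C] h)" using i t C by (simp add: ginverse_def)
  also have "\<dots> = h" using ginverse_cancel(1)[OF C i(1) t(2)] t by simp
  finally show ?thesis .
qed

lemma ginverse_gid [simp]: "vcategory V C \<Longrightarrow> a \<in> VObj C \<Longrightarrow> ginverse C (gid C a) (gid C a)"
  by (simp add: ginverse_def)

lemma ginverse_star:
  assumes C: "vcategory V C" and i: "ginverse C f f'" "ginverse C g g'" and e: "gsrc g = gtgt f"
  shows "ginverse C (g \<star>[C] f) (f' \<star>[C] g')"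
proof -
  have t: "is_gel C f" "is_gel C f'" "is_gel C g" "is_gel C g'" "gdom f = \<one>" "gdom f' = \<one>" "gdom g = \<one>" "gdom g' = \<one>"
    "gsrc f' = gtgt f" "gtgt f' = gsrc f" "gsrc g' = gtgt g" "gtgt g' = gsrc g"
    using i by (simp_all add: ginverse_def)
  have "(f' \<star>[C] g') \<star>[C] (g \<star>[C] f) = f' \<star>[C] (g' \<star>[C] (g \<star>[C] f))"
    using t e C by (simp add: star_assoc)
  also have "\<dots> = gid C (gsrc f)" using ginverse_cancel(1)[OF C i(2) t(1)] i e by (simp add: ginverse_def)
  finally have 1: "(f' \<star>[C] g') \<star>[C] (g \<star>[C] f) = gid C (gsrc f)" .
  have "(g \<star>[C] f) \<star>[C] (f' \<star>[C] g') = g \<star>[C] (f \<star>[C] (f' \<star>[C] g'))"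
    using t e C by (simp add: star_assoc)
  also have "\<dots> = gid C (gtgt g)" using ginverse_cancel(2)[OF C i(1) t(4)] i e t by (simp add: ginverse_def)
  finally show ?thesis using 1 t e C by (simp add: ginverse_def)
qed

lemma garr_star:
  assumes "vcategory V C" "is_gel C f" "is_gel C g" "gsrc g = gtgt f" "gdom f = \<one>" "gdom g = \<one>"
  shows "garr (g \<star>[C] f) = vcomp0 V C (gsrc f) (gtgt f) (gtgt g) (garr g) (garr f)"
  using assms by (simp add: vcomp0_def star_def reindex_def gcomp_def gdom_def)

lemma gid_garr: "garr (gid C a) = VId C a"
  by (simp add: gid_def)

lemma ginverse_iff_vinverse0:
  fixes C :: "('o, 'a, 'c, 'm) vcat_scheme"
  assumes C: "vcategory V C" and [simp]: "a \<in> VObj C" "b \<in> VObj C"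
  shows "ginverse C (Gel a b f) (Gel b a g) \<longleftrightarrow> vinverse0 V C a b f g"
proof -
  have e: "x = y \<longleftrightarrow> garr x = garr y" if "gsrc x = gsrc y" "gtgt x = gtgt y" for x y :: "('c, 'a) gel"
    using that gel_eqI by blast
  have "ginverse C (Gel a b f) (Gel b a g) \<longleftrightarrow> is_gel C (Gel a b f) \<and> is_gel C (Gel b a g) \<and> Dom V f = \<one> \<and> Dom V g = \<one> \<and>
     garr (Gel b a g \<star>[C] Gel a b f) = VId C a \<and> garr (Gel a b f \<star>[C] Gel b a g) = VId C b"
    unfolding ginverse_def
    using e[of "Gel b a g \<star>[C] Gel a b f" "gid C a"] e[of "Gel a b f \<star>[C] Gel b a g" "gid C b"]
    by (auto simp: gid_garr)
  also have "\<dots> \<longleftrightarrow> vinverse0 V C a b f g"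
    using C by (auto simp: vinverse0_def Hom_def is_gel_Gel garr_star)
  finally show ?thesis .
qed

text \<open>Yoneda principle: every element is a reindexing of the identity of its hom-object.
  Statements stable under reindexing hold for all elements once they hold for these generic ones;
  this matches the diagrammatic definitions with the elementwise ones.\<close>

lemma gel_generic: "is_gel C f \<Longrightarrow> f = Gel (gsrc f) (gtgt f) (Ident V (VHom C (gsrc f) (gtgt f))) \<lhd> garr f"
  by (cases f) (simp add: reindex_def is_gel_Gel)

text \<open>Preservation of composites is assumed for elements over arbitrary domains; at the two
  generic elements it is the functoriality square.\<close>

lemma vfunctorI:
  fixes C :: "('o, 'a, 'c, 'm) vcat_scheme" and D :: "('o, 'a, 'd, 'n) vcat_scheme"
  assumes C: "vcategory V C" and D: "vcategory V D"
    and O: "FO F \<in> VObj C \<rightarrow>\<^sub>E VObj D" and H: "FH F \<in> VObj C \<rightarrow>\<^sub>E VObj C \<rightarrow>\<^sub>E Arr V"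
    and T: "\<And>a b. \<lbrakk>a \<in> VObj C; b \<in> VObj C\<rbrakk> \<Longrightarrow> Dom V (FH F a b) = VHom C a b"
      "\<And>a b. \<lbrakk>a \<in> VObj C; b \<in> VObj C\<rbrakk> \<Longrightarrow> Cod V (FH F a b) = VHom D (FO F a) (FO F b)"
    and I: "\<And>a. a \<in> VObj C \<Longrightarrow> F \<rhd> gid C a = gid D (FO F a)"
    and G: "\<And>f g. \<lbrakk>is_gel C f; is_gel C g; gsrc g = gtgt f\<rbrakk> \<Longrightarrow> F \<rhd> (g \<odot>[C] f) = (F \<rhd> g) \<odot>[D] (F \<rhd> f)"
  shows "vfunctor V C D F"
proof -
  have A: "FH F a b \<in> Arr V" if "a \<in> VObj C" "b \<in> VObj C" for a b
    using that H by (auto simp: PiE_iff)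
  have "FH F a c \<cdot> VComp C a b c = VComp D (FO F a) (FO F b) (FO F c) \<cdot> (FH F b c \<boxtimes> FH F a b)"
    if o: "a \<in> VObj C" "b \<in> VObj C" "c \<in> VObj C" for a b c
    using G[of "Gel a b (Ident V (VHom C a b))" "Gel b c (Ident V (VHom C b c))"] o C T
    by (simp add: is_gel_Gel gmap_def gcomp_def A)
  moreover have "FH F a a \<cdot> VId C a = VId D (FO F a)" if "a \<in> VObj C" for a
    using I[OF that] by (simp add: gmap_def gid_def)
  ultimately show ?thesis
    unfolding vfunctor_def using C D O H T A by (simp add: Hom_def)
qed

text \<open>Generic elements recover the hom-arrows, and extensionality of the data leaves nothing
  else to compare.\<close>

lemma vfun_eqI:
  assumes F: "vfunctor V C D F" and G: "vfunctor V C D' G"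
    and O: "\<And>a. a \<in> VObj C \<Longrightarrow> FO F a = FO G a"
    and H: "\<And>f. is_gel C f \<Longrightarrow> garr (F \<rhd> f) = garr (G \<rhd> f)"
  shows "F = G"
proof (rule vfun.equality)
  have C: "vcategory V C" using F by (simp add: vfunctor_def)
  have E: "FO F \<in> extensional (VObj C)" "FO G \<in> extensional (VObj C)"
    "FH F \<in> VObj C \<rightarrow>\<^sub>E VObj C \<rightarrow>\<^sub>E Arr V" "FH G \<in> VObj C \<rightarrow>\<^sub>E VObj C \<rightarrow>\<^sub>E Arr V"
    using F G by (auto simp: vfunctor_def PiE_iff)
  show "FO F = FO G" using E O by (auto intro: extensionalityI)
  show "FH F = FH G"
  proof (rule PiE_ext[OF E(3,4)], rule PiE_ext)
    fix a b assume o: "a \<in> VObj C" "b \<in> VObj C"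
    show "FH F a \<in> VObj C \<rightarrow>\<^sub>E Arr V" "FH G a \<in> VObj C \<rightarrow>\<^sub>E Arr V" using E(3,4) o(1) by (auto simp: PiE_iff)
    show "FH F a b = FH G a b"
      using H[of "Gel a b (Ident V (VHom C a b))"] o C
      by (simp add: is_gel_Gel gmap_def vfunctor_typing[OF F] vfunctor_typing[OF G])
  qed
qed simp

lemma vfunctor_comp:
  assumes F: "vfunctor V C D F" and G: "vfunctor V D E G" and S: "VObj C = S"
  shows "vfunctor V C E (vfun_comp V S G F)"
    "is_gel C f \<Longrightarrow> vfun_comp V S G F \<rhd> f = G \<rhd> F \<rhd> f"
proof -
  have C: "vcategory V C" and E: "vcategory V E" using F G by (simp_all add: vfunctor_def)
  show e: "vfun_comp V S G F \<rhd> f = G \<rhd> F \<rhd> f" if "is_gel C f" for f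
    using that C by (simp add: S[symmetric] gmap_def vfun_comp_def vfunctor_typing[OF F] vfunctor_typing[OF G])
  show "vfunctor V C E (vfun_comp V S G F)"
    by (rule vfunctorI) (use C E in \<open>simp_all add: e gmap_simps[OF F] gmap_simps[OF G] vfunctor_typing[OF F]\<close>,
      auto simp: vfun_comp_def S[symmetric] vfunctor_typing[OF F] vfunctor_typing[OF G])
qed

lemma vfunctor_id:
  assumes C: "vcategory V C"
  shows "vfunctor V C C (vfun_id V C)" "is_gel C f \<Longrightarrow> vfun_id V C \<rhd> f = f"
proof -
  show e: "vfun_id V C \<rhd> f = f" if "is_gel C f" for f
    using that by (intro gel_eqI) (simp_all add: gmap_def vfun_id_def)
  show "vfunctor V C C (vfun_id V C)"
    by (rule vfunctorI) (use C in \<open>simp_all add: e\<close>, auto simp: vfun_id_def)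
qed

text \<open>The naturality equation of \<open>vnatural\<close> is \<open>?N\<close> at the generic
  element; it extends to all elements because both of its sides commute with reindexing.\<close>

lemma vnatural_iff:
  "vnatural V C D F G \<alpha> \<longleftrightarrow> vfunctor V C D F \<and> vfunctor V C D G \<and> \<alpha> \<in> extensional (VObj C) \<and>
    (\<forall>a\<in>VObj C. is_gel D (Gel (FO F a) (FO G a) (\<alpha> a)) \<and> Dom V (\<alpha> a) = \<one>) \<and>
    (\<forall>f. is_gel C f \<longrightarrow> Gel (FO F (gtgt f)) (FO G (gtgt f)) (\<alpha> (gtgt f)) \<star>[D] (F \<rhd> f) =
      (G \<rhd> f) \<star>[D] Gel (FO F (gsrc f)) (FO G (gsrc f)) (\<alpha> (gsrc f)))"
  (is "_ \<longleftrightarrow> ?FF \<and> ?GG \<and> ?E \<and> ?T \<and> (\<forall>f. _ \<longrightarrow> ?N f)")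
proof (cases "?FF \<and> ?GG \<and> ?E \<and> ?T")
  case True
  then have F: ?FF and G: ?GG and E: ?E and T: ?T by auto
  have C: "vcategory V C" and D: "vcategory V D" using F by (simp_all add: vfunctor_def)
  let ?g = "\<lambda>a b. Gel a b (Ident V (VHom C a b))"
  let ?\<alpha> = "\<lambda>a. Gel (FO F a) (FO G a) (\<alpha> a)"
  have P: "\<alpha> \<in> VObj C \<rightarrow>\<^sub>E Arr V" "\<And>a. a \<in> VObj C \<Longrightarrow> \<alpha> a \<in> Hom V \<one> (VHom D (FO F a) (FO G a))"
    using E T by (auto simp: PiE_iff is_gel_Gel Hom_def)
  have e: "?N (?g a b) \<longleftrightarrow>
      VComp D (FO F a) (FO F b) (FO G b) \<cdot> (\<alpha> b \<boxtimes> FH F a b) \<cdot> inverse_arrow V (LUnit V (VHom C a b)) =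
      VComp D (FO F a) (FO G a) (FO G b) \<cdot> (FH G a b \<boxtimes> \<alpha> a) \<cdot> inverse_arrow V (RUnit V (VHom C a b))"
    if o: "a \<in> VObj C" "b \<in> VObj C" for a b
  proof -
    have "\<alpha> a \<in> Arr V" "\<alpha> b \<in> Arr V" "Dom V (\<alpha> a) = \<one>" "Dom V (\<alpha> b) = \<one>"
      "Cod V (\<alpha> a) = VHom D (FO F a) (FO G a)" "Cod V (\<alpha> b) = VHom D (FO F b) (FO G b)"
      using o P by (auto simp: Hom_def)
    then show ?thesis using o C D
      by (simp add: star_left star_right gmap_def gcomp_def reindex_def is_gel_Gel
        vfunctor_typing[OF F] vfunctor_typing[OF G])
  qed
  have "?N f" if f: "is_gel C f" and n: "?N (?g (gsrc f) (gtgt f))" for f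
  proof -
    let ?h = "?g (gsrc f) (gtgt f)"
    have h: "is_gel C ?h" "f = ?h \<lhd> garr f" "gdom ?h = VHom C (gsrc f) (gtgt f)" using f C gel_generic[OF f] by (auto simp: is_gel_Gel)
    have a: "is_gel D (?\<alpha> (gtgt f))" "is_gel D (?\<alpha> (gsrc f))" "Dom V (\<alpha> (gtgt f)) = \<one>" "Dom V (\<alpha> (gsrc f)) = \<one>"
      using T f by simp_all
    have "?\<alpha> (gtgt f) \<star>[D] (F \<rhd> (?h \<lhd> garr f)) = ?\<alpha> (gtgt f) \<star>[D] (F \<rhd> ?h) \<lhd> garr f"
      using f h(1,3) a D by (simp add: gmap_simps[OF F] star_reindex_right)
    also have "\<dots> = (G \<rhd> ?h) \<star>[D] ?\<alpha> (gsrc f) \<lhd> garr f" using n h(1) by simp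
    also have "\<dots> = (G \<rhd> (?h \<lhd> garr f)) \<star>[D] ?\<alpha> (gsrc f)"
      using f h(1,3) a D by (simp add: gmap_simps[OF G] star_reindex_left)
    finally show ?thesis unfolding h(2)[symmetric] by simp
  qed
  moreover have "is_gel C (?g a b)" if "a \<in> VObj C" "b \<in> VObj C" for a b
    using that C by (simp add: is_gel_Gel)
  ultimately have "(\<forall>f. is_gel C f \<longrightarrow> ?N f) \<longleftrightarrow> (\<forall>a\<in>VObj C. \<forall>b\<in>VObj C. ?N (?g a b))"
    using gel_simps(1,2) by blast
  with F G E T P C e show ?thesis unfolding vnatural_def by simp
next
  case False
  then show ?thesis by (auto simp: vnatural_def PiE_iff is_gel_Gel Hom_def vfunctor_def Pi_iff)
qed

end

section \<open>Cotensors\<close>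

context symmetric_monoidal_closed_category
begin

lemma transposed:
  assumes "x \<in> Obj V" "a \<in> Obj V" "f \<in> Arr V" "Dom V f = x \<otimes> a" "Cod V f = b"
  shows "transposed V x a b f \<in> Arr V" "Dom V (transposed V x a b f) = x"
    "Cod V (transposed V x a b f) = IHom V a b"
    "Ev V a b \<cdot> (transposed V x a b f \<boxtimes> Ident V a) = f"
proof -
  have b: "b \<in> Obj V" using assms by auto
  have "\<exists>!g. g \<in> Hom V x (IHom V a b) \<and> Ev V a b \<cdot> (g \<boxtimes> Ident V a) = f"
    by (rule ev_universal) (use assms b in \<open>auto simp: Hom_def\<close>)
  from theI'[OF this] show "transposed V x a b f \<in> Arr V" "Dom V (transposed V x a b f) = x"
    "Cod V (transposed V x a b f) = IHom V a b"
    "Ev V a b \<cdot> (transposed V x a b f \<boxtimes> Ident V a) = f"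
    by (auto simp: transposed_def Hom_def)
qed

lemma transposed_unique:
  assumes "Ev V a b \<cdot> (g \<boxtimes> Ident V a) = Ev V a b \<cdot> (h \<boxtimes> Ident V a)"
    "g \<in> Arr V" "h \<in> Arr V" "Dom V g = Dom V h" "Cod V g = IHom V a b" "Cod V h = IHom V a b"
    "a \<in> Obj V" "b \<in> Obj V"
  shows "g = h"
proof -
  have "\<exists>!k. k \<in> Hom V (Dom V h) (IHom V a b) \<and> Ev V a b \<cdot> (k \<boxtimes> Ident V a) = Ev V a b \<cdot> (h \<boxtimes> Ident V a)"
    by (rule ev_universal) (use assms in \<open>auto simp: Hom_def\<close>)
  then show ?thesis using assms by (auto simp: Hom_def)
qed

text \<open>The counit, as a generalized element, carries all the data: its domain is the weight,
  its target the cotensored object and its source the cotensor.\<close>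

definition is_cot :: "('o, 'a, 'c, 'm) vcat_scheme \<Rightarrow> ('c, 'a) gel \<Rightarrow> bool"
  where "is_cot C \<kappa> \<longleftrightarrow> is_cotensor V C (gdom \<kappa>) (gtgt \<kappa>) (gsrc \<kappa>) (garr \<kappa>)"

lemma is_cot_gel: "is_cot C \<kappa> \<Longrightarrow> is_gel C \<kappa>"
  by (cases \<kappa>) (simp add: is_cot_def is_cotensor_def is_gel_Gel Hom_def)

lemma is_cotensor_iff: "is_cotensor V C v c p \<gamma> \<longleftrightarrow> is_cot C (Gel p c \<gamma>) \<and> Dom V \<gamma> = v"
  by (auto simp: is_cot_def is_cotensor_def Hom_def)

context
  fixes C :: "('o, 'a, 'c, 'm) vcat_scheme"
  assumes C: "vcategory V C"
begin

text \<open>Untransposed, the comparison arrow sends \<open>h\<close> to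
  \<open>\<kappa> \<odot>[C] h\<close>, up to the symmetry that comes from the order of factors in
  \<open>cot_map\<close>. This turns invertibility of the comparison into unique factorization
  through \<open>\<kappa>\<close>.\<close>

lemma cot_map_eval:
  assumes k: "is_gel C \<kappa>" and h: "is_gel C h" "gtgt h = gsrc \<kappa>"
  defines "m \<equiv> cot_map V C (gdom \<kappa>) (gtgt \<kappa>) (gsrc \<kappa>) (garr \<kappa>) (gsrc h)"
  shows "m \<in> Arr V" "Dom V m = VHom C (gsrc h) (gsrc \<kappa>)" "Cod V m = IHom V (gdom \<kappa>) (VHom C (gsrc h) (gtgt \<kappa>))"
    "Ev V (gdom \<kappa>) (VHom C (gsrc h) (gtgt \<kappa>)) \<cdot> ((m \<cdot> garr h) \<boxtimes> Ident V (gdom \<kappa>)) =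
      garr (\<kappa> \<odot>[C] h \<lhd> Sym V (gdom h) (gdom \<kappa>))"
proof -
  let ?v = "gdom \<kappa>" and ?c = "gtgt \<kappa>" and ?p = "gsrc \<kappa>" and ?d = "gsrc h"
  have o: "?c \<in> VObj C" "?p \<in> VObj C" "?d \<in> VObj C" "?v \<in> Obj V" using k h by auto
  let ?f = "VComp C ?d ?p ?c \<cdot> Sym V (VHom C ?d ?p) (VHom C ?p ?c) \<cdot> (Ident V (VHom C ?d ?p) \<boxtimes> garr \<kappa>)"
  have m: "m = transposed V (VHom C ?d ?p) ?v (VHom C ?d ?c) ?f"
    by (simp add: m_def cot_map_def)
  have f: "?f \<in> Arr V" "Dom V ?f = VHom C ?d ?p \<otimes> ?v" "Cod V ?f = VHom C ?d ?c"
    using o k C by (simp_all add: gdom_def)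
  have M: "m \<in> Arr V" "Dom V m = VHom C ?d ?p" "Cod V m = IHom V ?v (VHom C ?d ?c)"
    "Ev V ?v (VHom C ?d ?c) \<cdot> (m \<boxtimes> Ident V ?v) = ?f"
    unfolding m by (rule transposed; use o f C in simp)+
  then show "m \<in> Arr V" "Dom V m = VHom C ?d ?p" "Cod V m = IHom V ?v (VHom C ?d ?c)" by auto
  have "Ev V ?v (VHom C ?d ?c) \<cdot> ((m \<cdot> garr h) \<boxtimes> Ident V ?v) =
    (Ev V ?v (VHom C ?d ?c) \<cdot> (m \<boxtimes> Ident V ?v)) \<cdot> (garr h \<boxtimes> Ident V ?v)"
    using o M(1-3) C h by (simp add: interchange_simps)
  also have "\<dots> = VComp C ?d ?p ?c \<cdot> Sym V (VHom C ?d ?p) (VHom C ?p ?c) \<cdot> (garr h \<boxtimes> garr \<kappa>)"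
    unfolding M(4) using o k C h by (simp add: gdom_def interchange_simps)
  also have "\<dots> = garr (\<kappa> \<odot>[C] h \<lhd> Sym V (gdom h) ?v)"
    using o k C h by (simp add: gdom_def gcomp_def reindex_def sym_nat)
  finally show "Ev V ?v (VHom C ?d ?c) \<cdot> ((m \<cdot> garr h) \<boxtimes> Ident V ?v) = garr (\<kappa> \<odot>[C] h \<lhd> Sym V (gdom h) ?v)" .
qed

lemma cot_lift_general:
  assumes k: "is_cot C \<kappa>" and o: "d \<in> VObj C" "x \<in> Obj V"
    and f: "f \<in> Arr V" "Dom V f = x \<otimes> gdom \<kappa>" "Cod V f = VHom C d (gtgt \<kappa>)"
  defines "h \<equiv> Gel d (gsrc \<kappa>) (inverse_arrow V (cot_map V C (gdom \<kappa>) (gtgt \<kappa>) (gsrc \<kappa>) (garr \<kappa>) d) \<cdot>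
    transposed V x (gdom \<kappa>) (VHom C d (gtgt \<kappa>)) f)"
  shows "is_gel C h" "gdom h = x" "\<kappa> \<odot>[C] h = Gel d (gtgt \<kappa>) f \<lhd> Sym V (gdom \<kappa>) x"
proof -
  let ?v = "gdom \<kappa>" and ?c = "gtgt \<kappa>" and ?p = "gsrc \<kappa>"
  let ?m = "cot_map V C ?v ?c ?p (garr \<kappa>) d"
  let ?t = "transposed V x ?v (VHom C d ?c) f"
  have kg: "is_gel C \<kappa>" by (rule is_cot_gel[OF k])
  have o': "?c \<in> VObj C" "?p \<in> VObj C" "?v \<in> Obj V" using kg by auto
  let ?g = "Gel d ?p (Ident V (VHom C d ?p))"
  have g: "is_gel C ?g" using o o' C by (simp add: is_gel_Gel)
  have m: "?m \<in> Arr V" "Dom V ?m = VHom C d ?p" "Cod V ?m = IHom V ?v (VHom C d ?c)"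
    using cot_map_eval[OF kg g] by simp_all
  have i: "is_iso V ?m" using k o unfolding is_cot_def is_cotensor_def by blast
  have t: "?t \<in> Arr V" "Dom V ?t = x" "Cod V ?t = IHom V ?v (VHom C d ?c)" "Ev V ?v (VHom C d ?c) \<cdot> (?t \<boxtimes> Ident V ?v) = f"
    by (rule transposed; use o o' f in simp)+
  show H: "is_gel C h" "gdom h = x" using o o' i m t by (simp_all add: h_def is_gel_Gel)
  have "garr (\<kappa> \<odot>[C] h \<lhd> Sym V x ?v) = f"
    using cot_map_eval(4)[OF kg H(1)] H(2) i m t by (simp add: h_def)
  then have "\<kappa> \<odot>[C] h \<lhd> Sym V x ?v = Gel d ?c f"
    by (intro gel_eqI) (simp_all add: h_def)
  then have "\<kappa> \<odot>[C] h \<lhd> Sym V x ?v \<lhd> Sym V ?v x = Gel d ?c f \<lhd> Sym V ?v x" by simp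
  then show "\<kappa> \<odot>[C] h = Gel d ?c f \<lhd> Sym V ?v x"
    using H kg o o' C by (simp add: h_def)
qed

lemma cot_ex:
  assumes k: "is_cot C \<kappa>" and x: "x \<in> Obj V" and f: "is_gel C f" "gtgt f = gtgt \<kappa>" "gdom f = gdom \<kappa> \<otimes> x"
  obtains h where "is_gel C h" "gsrc h = gsrc f" "gtgt h = gsrc \<kappa>" "gdom h = x" "\<kappa> \<odot>[C] h = f"
proof -
  have kg: "is_gel C \<kappa>" by (rule is_cot_gel[OF k])
  let ?f = "garr f \<cdot> Sym V x (gdom \<kappa>)"
  have t: "?f \<in> Arr V" "Dom V ?f = x \<otimes> gdom \<kappa>" "Cod V ?f = VHom C (gsrc f) (gtgt \<kappa>)"
    using f kg x by (simp_all add: gdom_def)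
  note L = cot_lift_general[OF k _ x t]
  show thesis
    by (rule that[OF L(1) _ _ L(2)]) (use f kg x L(3) C in \<open>simp_all add: reindex_def gel.expand gdom_def\<close>)
qed

lemma cot_cancel:
  assumes e: "\<kappa> \<odot>[C] h = \<kappa> \<odot>[C] h'" and k: "is_cot C \<kappa>" 
    and h: "is_gel C h" "is_gel C h'" "gtgt h = gsrc \<kappa>" "gtgt h' = gsrc \<kappa>" "gdom h = gdom h'"
  shows "h = h'"
proof -
  let ?v = "gdom \<kappa>" and ?c = "gtgt \<kappa>" and ?p = "gsrc \<kappa>" and ?d = "gsrc h"
  have kg: "is_gel C \<kappa>" by (rule is_cot_gel[OF k])
  have s: "gsrc h = gsrc h'" using arg_cong[OF e, of gsrc] by simp
  let ?m = "cot_map V C ?v ?c ?p (garr \<kappa>) ?d"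
  note M = cot_map_eval[OF kg h(1,3)]
  have i: "is_iso V ?m" using k h unfolding is_cot_def is_cotensor_def by auto
  have "?m \<cdot> garr h = ?m \<cdot> garr h'"
  proof (rule transposed_unique)
    show "Ev V ?v (VHom C ?d ?c) \<cdot> ((?m \<cdot> garr h) \<boxtimes> Ident V ?v) =
      Ev V ?v (VHom C ?d ?c) \<cdot> ((?m \<cdot> garr h') \<boxtimes> Ident V ?v)"
      using M(4) cot_map_eval(4)[OF kg h(2,4)] e s h(5) by simp
  qed (use M(1-3) kg h s C in \<open>auto simp: gdom_def[symmetric]\<close>)
  then have "garr h = garr h'"
    by (rule iso_cancel_left) (use i M(1-3) kg h s in auto)
  then show ?thesis using s h by (intro gel_eqI) auto
qed

text \<open>Converse of \<open>cot_ex\<close> and \<open>cot_cancel\<close>: unique factorization of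
  elements over all domains makes the comparison arrow invertible, by the usual representability
  argument.\<close>

lemma is_cotI:
  assumes k: "is_gel C \<kappa>"
    and ex: "\<And>f x. \<lbrakk>is_gel C f; gtgt f = gtgt \<kappa>; x \<in> Obj V; gdom f = gdom \<kappa> \<otimes> x\<rbrakk> \<Longrightarrow>
      \<exists>h. is_gel C h \<and> gsrc h = gsrc f \<and> gtgt h = gsrc \<kappa> \<and> gdom h = x \<and> \<kappa> \<odot>[C] h = f"
    and un: "\<And>h h'. \<lbrakk>is_gel C h; is_gel C h'; gsrc h = gsrc h'; gtgt h = gsrc \<kappa>; gtgt h' = gsrc \<kappa>; gdom h = gdom h';
      \<kappa> \<odot>[C] h = \<kappa> \<odot>[C] h'\<rbrakk> \<Longrightarrow> h = h'"
  shows "is_cot C \<kappa>"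
proof -
  let ?v = "gdom \<kappa>" and ?c = "gtgt \<kappa>" and ?p = "gsrc \<kappa>"
  have o: "?v \<in> Obj V" "?c \<in> VObj C" "?p \<in> VObj C" using k by auto
  have "is_iso V (cot_map V C ?v ?c ?p (garr \<kappa>) d)" if d: "d \<in> VObj C" for d
  proof -
    let ?m = "cot_map V C ?v ?c ?p (garr \<kappa>) d"
    let ?z = "IHom V ?v (VHom C d ?c)"
    \<comment> \<open>The universal element to be factored: evaluation on the internal hom
      \<open>?z\<close>. Its factorization \<open>h\<close> is the inverse of
      \<open>?m\<close>.\<close>
    let ?f = "Gel d ?c (Ev V ?v (VHom C d ?c) \<cdot> Sym V ?v ?z)"
    have f: "is_gel C ?f" using d o C by (simp add: is_gel_Gel)
    obtain h where h: "is_gel C h" "gsrc h = d" "gtgt h = ?p" "gdom h = ?z" "\<kappa> \<odot>[C] h = ?f"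
      using ex[OF f, of ?z] d o C by auto
    note M = cot_map_eval[OF k h(1,3), unfolded h(2)]
    have gh: "garr h \<in> Arr V" "Dom V (garr h) = ?z" "Cod V (garr h) = VHom C d ?p"
      using h by (auto simp: gdom_def)
    have 1: "?m \<cdot> garr h = Ident V ?z"
      by (rule transposed_unique[of ?v "VHom C d ?c"])
        (use M h gh d o C in \<open>simp_all add: reindex_def\<close>)
    \<comment> \<open>For the other composite, \<open>?h\<close> and the generic element
      \<open>?i\<close> become equal after \<open>\<kappa>\<close>, so the uniqueness hypothesis
      identifies them.\<close>
    let ?i = "Gel d ?p (Ident V (VHom C d ?p))" and ?h = "Gel d ?p (garr h \<cdot> ?m)"
    have g: "is_gel C ?i" "is_gel C ?h" using d o C M(1-3) gh by (simp_all add: is_gel_Gel)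
    have "?m \<cdot> (garr h \<cdot> ?m) = (?m \<cdot> garr h) \<cdot> ?m" using M(1-3) gh by simp
    then have e: "?m \<cdot> garr ?h = ?m \<cdot> garr ?i" unfolding 1 using M(1-3) by simp
    have "\<kappa> \<odot>[C] ?h \<lhd> Sym V (VHom C d ?p) ?v = \<kappa> \<odot>[C] ?i \<lhd> Sym V (VHom C d ?p) ?v"
      using cot_map_eval(4)[OF k g(1)] cot_map_eval(4)[OF k g(2)] e M(1-3) gh d o C
      by (intro gel_eqI) (simp_all)
    then have "\<kappa> \<odot>[C] ?h = \<kappa> \<odot>[C] ?i"
      by (rule reindex_cancel[OF C]) (use k g d o C M(1-3) gh in simp_all)
    then have "?h = ?i" using un[OF g(2) g(1)] d o C M(1-3) gh by simp
    then have 2: "garr h \<cdot> ?m = Ident V (VHom C d ?p)" by simp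
    show ?thesis by (rule isoI[of _ "garr h"]) (use 1 2 M(1-3) gh in simp_all)
  qed
  then show ?thesis using k o by (simp add: is_cot_def is_cotensor_def Hom_def gdom_def)
qed

text \<open>The case x = \<one> of \<open>cot_ex\<close>, with the right unitor absorbed: the
  factorization is an arrow of the underlying category.\<close>

lemma cot_star_ex:
  assumes k: "is_cot C \<kappa>" and f: "is_gel C f" "gtgt f = gtgt \<kappa>" "gdom f = gdom \<kappa>"
  obtains h where "is_gel C h" "gsrc h = gsrc f" "gtgt h = gsrc \<kappa>" "gdom h = \<one>" "\<kappa> \<star>[C] h = f"
proof -
  have kg: "is_gel C \<kappa>" by (rule is_cot_gel[OF k])
  have r: "gdom \<kappa> \<in> Obj V" using kg by simp
  obtain h where h: "is_gel C h" "gsrc h = gsrc f" "gtgt h = gsrc \<kappa>" "gdom h = \<one>" "\<kappa> \<odot>[C] h = f \<lhd> RUnit V (gdom \<kappa>)"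
    by (rule cot_ex[OF k, of \<one> "f \<lhd> RUnit V (gdom \<kappa>)"]) (use f r C in auto)
  then have "\<kappa> \<star>[C] h = f" using f r C by (simp add: star_right)
  with h show thesis using that by blast
qed

lemma cot_star_cancel:
  assumes e: "\<kappa> \<star>[C] h = \<kappa> \<star>[C] h'" and k: "is_cot C \<kappa>" 
    and h: "is_gel C h" "is_gel C h'" "gtgt h = gsrc \<kappa>" "gtgt h' = gsrc \<kappa>" "gdom h = \<one>" "gdom h' = \<one>"
  shows "h = h'"
proof (rule cot_cancel[OF _ k h(1-4)])
  have kg: "is_gel C \<kappa>" by (rule is_cot_gel[OF k])
  then have r: "gdom \<kappa> \<in> Obj V" by simp
  show "\<kappa> \<odot>[C] h = \<kappa> \<odot>[C] h'"
    by (rule reindex_cancel[OF C, of _ "inverse_arrow V (RUnit V (gdom \<kappa>))"])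
      (use e h kg r C in \<open>simp_all add: star_right\<close>)
qed (use h in simp)

text \<open>Each counit factors through the other, and the two composites agree with identities
  after the counits. The factorization equations stay in the conclusion because they determine
  \<open>\<theta>\<close> and \<open>\<theta>'\<close>.\<close>

lemma cot_comparison:
  assumes k: "is_cot C \<kappa>" "is_cot C \<kappa>'" "gtgt \<kappa> = gtgt \<kappa>'" "gdom \<kappa> = gdom \<kappa>'"
  obtains \<theta> \<theta>' where "ginverse C \<theta> \<theta>'" "gsrc \<theta> = gsrc \<kappa>'" "gtgt \<theta> = gsrc \<kappa>"
    "\<kappa> \<star>[C] \<theta> = \<kappa>'" "\<kappa>' \<star>[C] \<theta>' = \<kappa>"
proof -
  have kg: "is_gel C \<kappa>" "is_gel C \<kappa>'" using is_cot_gel k by auto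
  then have o: "gsrc \<kappa> \<in> VObj C" "gsrc \<kappa>' \<in> VObj C" by auto
  obtain h where h: "is_gel C h" "gsrc h = gsrc \<kappa>'" "gtgt h = gsrc \<kappa>" "gdom h = \<one>" "\<kappa> \<star>[C] h = \<kappa>'"
    by (rule cot_star_ex[OF k(1) kg(2)]) (use k in auto)
  obtain g where g: "is_gel C g" "gsrc g = gsrc \<kappa>" "gtgt g = gsrc \<kappa>'" "gdom g = \<one>" "\<kappa>' \<star>[C] g = \<kappa>"
    by (rule cot_star_ex[OF k(2) kg(1)]) (use k in auto)
  have 1: "g \<star>[C] h = gid C (gsrc \<kappa>')"
  proof (rule cot_star_cancel[OF _ k(2)])
    have "\<kappa>' \<star>[C] (g \<star>[C] h) = (\<kappa>' \<star>[C] g) \<star>[C] h" using h(1-4) g(1-4) kg C by (simp add: star_assoc)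
    then show "\<kappa>' \<star>[C] (g \<star>[C] h) = \<kappa>' \<star>[C] gid C (gsrc \<kappa>')" using g(5) h(5) kg C by simp
  qed (use g h o C in simp_all)
  have 2: "h \<star>[C] g = gid C (gsrc \<kappa>)"
  proof (rule cot_star_cancel[OF _ k(1)])
    have "\<kappa> \<star>[C] (h \<star>[C] g) = (\<kappa> \<star>[C] h) \<star>[C] g" using h(1-4) g(1-4) kg C by (simp add: star_assoc)
    then show "\<kappa> \<star>[C] (h \<star>[C] g) = \<kappa> \<star>[C] gid C (gsrc \<kappa>)" using g(5) h(5) kg C by simp
  qed (use g h o C in simp_all)
  show thesis by (rule that[of h g]) (use 1 2 g h in \<open>simp_all add: ginverse_def\<close>)
qed

lemma cot_star_iso:
  assumes k: "is_cot C \<kappa>" and i: "ginverse C \<theta> \<theta>'" "gtgt \<theta> = gsrc \<kappa>"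
  shows "is_cot C (\<kappa> \<star>[C] \<theta>)"
proof (rule is_cotI)
  have kg: "is_gel C \<kappa>" by (rule is_cot_gel[OF k])
  have t: "is_gel C \<theta>" "is_gel C \<theta>'" "gdom \<theta> = \<one>" "gdom \<theta>' = \<one>" "gsrc \<theta>' = gsrc \<kappa>" "gtgt \<theta>' = gsrc \<theta>"
    using i by (simp_all add: ginverse_def)
  show "is_gel C (\<kappa> \<star>[C] \<theta>)" using kg t i C by simp
  have e: "(\<kappa> \<star>[C] \<theta>) \<odot>[C] h = \<kappa> \<odot>[C] (\<theta> \<star>[C] h)" if "is_gel C h" "gtgt h = gsrc \<theta>" for h
    using that kg t i C by (simp add: star_gcomp_middle)
  show "\<exists>h. is_gel C h \<and> gsrc h = gsrc f \<and> gtgt h = gsrc (\<kappa> \<star>[C] \<theta>) \<and> gdom h = x \<and> (\<kappa> \<star>[C] \<theta>) \<odot>[C] h = f"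
    if f: "is_gel C f" "gtgt f = gtgt (\<kappa> \<star>[C] \<theta>)" "x \<in> Obj V" "gdom f = gdom (\<kappa> \<star>[C] \<theta>) \<otimes> x" for f x
  proof -
    obtain h where h: "is_gel C h" "gsrc h = gsrc f" "gtgt h = gsrc \<kappa>" "gdom h = x" "\<kappa> \<odot>[C] h = f"
      by (rule cot_ex[OF k f(3,1)]) (use f kg t i C in auto)
    show ?thesis
      by (rule exI[of _ "\<theta>' \<star>[C] h"])
        (use h t kg i C e[of "\<theta>' \<star>[C] h"] ginverse_cancel(2)[OF C i(1) h(1)] in simp)
  qed
  show "h = h'" if h: "is_gel C h" "is_gel C h'" "gsrc h = gsrc h'" "gtgt h = gsrc (\<kappa> \<star>[C] \<theta>)"
    "gtgt h' = gsrc (\<kappa> \<star>[C] \<theta>)" "gdom h = gdom h'"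
    "(\<kappa> \<star>[C] \<theta>) \<odot>[C] h = (\<kappa> \<star>[C] \<theta>) \<odot>[C] h'" for h h'
  proof -
    have s: "gtgt h = gsrc \<theta>" "gtgt h' = gsrc \<theta>" using h(4,5) by simp_all
    have "\<kappa> \<odot>[C] (\<theta> \<star>[C] h) = \<kappa> \<odot>[C] (\<theta> \<star>[C] h')"
      using h(7) unfolding e[OF h(1) s(1)] e[OF h(2) s(2)] .
    then have "\<theta> \<star>[C] h = \<theta> \<star>[C] h'"
      by (rule cot_cancel[OF _ k]) (use h(1,2,6) s t i(2) C in simp_all)
    then show ?thesis
      using ginverse_cancel(1)[OF C i(1) h(1) s(1)] ginverse_cancel(1)[OF C i(1) h(2) s(2)] by metis
  qed
qed

end

text \<open>Two cotensors with the same weight and object differ by an invertible arrow, which any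
  V-functor preserves. So preservation need be checked on one convenient cotensor only.\<close>

lemma cot_transport:
  assumes F: "vfunctor V C D F" and k: "is_cot C \<kappa>" "is_cot C \<kappa>'" "gtgt \<kappa> = gtgt \<kappa>'" "gdom \<kappa> = gdom \<kappa>'"
    and p: "is_cot D (F \<rhd> \<kappa>)"
  shows "is_cot D (F \<rhd> \<kappa>')"
proof -
  have CD: "vcategory V C" "vcategory V D" using F by (simp_all add: vfunctor_def)
  have kg: "is_gel C \<kappa>" using is_cot_gel k by auto
  obtain \<theta> \<theta>' where t: "ginverse C \<theta> \<theta>'" "gtgt \<theta> = gsrc \<kappa>" "\<kappa> \<star>[C] \<theta> = \<kappa>'"
    by (rule cot_comparison[OF CD(1) k]) blast
  have "is_cot D ((F \<rhd> \<kappa>) \<star>[D] (F \<rhd> \<theta>))"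
    by (rule cot_star_iso[OF CD(2) p gmap_ginverse[OF F t(1)]]) (simp add: t)
  also have "(F \<rhd> \<kappa>) \<star>[D] (F \<rhd> \<theta>) = F \<rhd> \<kappa>'"
    using t kg by (simp add: gmap_star[OF F, symmetric] ginverse_def)
  finally show ?thesis .
qed

end

section \<open>The V-functor [v, -] of cotensors by a fixed object v\<close>

definition cou :: "('o, 'a, 'c) cvcat \<Rightarrow> 'o \<Rightarrow> 'c \<Rightarrow> ('c, 'a) gel"
  where "cou C v c = Gel (Cot C v c) c (Cou C v c)"

definition cotensor_fun :: "('o, 'a) smc_category \<Rightarrow> ('o, 'a, 'c) cvcat \<Rightarrow> 'o \<Rightarrow> ('c, 'c, 'a) vfun"
  where "cotensor_fun V C v = \<lparr>FO = (\<lambda>a\<in>VObj C. Cot C v a), FH = (\<lambda>a\<in>VObj C. \<lambda>b\<in>VObj C. cot_hom V C v a b)\<rparr>"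

context symmetric_monoidal_closed_category
begin

lemma hexagon_left:
  assumes "v \<in> Obj V" "y \<in> Obj V" "x \<in> Obj V"
  shows "(Ident V y \<boxtimes> Sym V v x) \<cdot> Assoc V y v x \<cdot> (Sym V v y \<boxtimes> Ident V x) =
    Assoc V y x v \<cdot> Sym V v (y \<otimes> x) \<cdot> Assoc V v y x"
  using hexagon[OF assms] by simp

context
  fixes C :: "('o, 'a, 'c) cvcat" and v :: 'o
  assumes C: "vcategory V C" and D: "\<forall>c\<in>VObj C. is_cotensor V C v c (Cot C v c) (Cou C v c)"
begin

lemma cou_cot: "c \<in> VObj C \<Longrightarrow> is_cot C (cou C v c)"
  and cou_typing: "c \<in> VObj C \<Longrightarrow> is_gel C (cou C v c)" "c \<in> VObj C \<Longrightarrow> gdom (cou C v c) = v"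
    "gsrc (cou C v c) = Cot C v c" "gtgt (cou C v c) = c" "c \<in> VObj C \<Longrightarrow> Cot C v c \<in> VObj C"
    "c \<in> VObj C \<Longrightarrow> v \<in> Obj V" "c \<in> VObj C \<Longrightarrow> garr (cou C v c) \<in> Arr V"
proof -
  show k: "is_cot C (cou C v c)" if "c \<in> VObj C"
    using bspec[OF D that] by (simp add: cou_def is_cotensor_iff)
  show "is_gel C (cou C v c)" "gdom (cou C v c) = v" "Cot C v c \<in> VObj C" "v \<in> Obj V" "garr (cou C v c) \<in> Arr V" if "c \<in> VObj C"
    using is_cot_gel[OF k[OF that]] bspec[OF D that] by (auto simp add: cou_def is_cotensor_def Hom_def)
qed (simp_all add: cou_def)

lemma cou_garr: "garr (cou C v c) = Cou C v c"
  by (simp add: cou_def)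

lemma cot_lift:
  assumes o: "c \<in> VObj C" "d \<in> VObj C" "x \<in> Obj V"
    and f: "f \<in> Arr V" "Dom V f = x \<otimes> v" "Cod V f = VHom C d c"
  shows "is_gel C (Gel d (Cot C v c) (cot_lift V C v c d x f))" "gdom (Gel d (Cot C v c) (cot_lift V C v c d x f)) = x"
    "cou C v c \<odot>[C] Gel d (Cot C v c) (cot_lift V C v c d x f) = Gel d c f \<lhd> Sym V v x"
  using cot_lift_general[OF C cou_cot[OF o(1)] o(2,3), of f] f o(1)
  by (simp_all add: cot_lift_def cou_typing cou_garr)

lemma cotensor_fun_cou_generic:
  assumes o: "a \<in> VObj C" "b \<in> VObj C"
  shows "is_gel C (Gel (Cot C v a) (Cot C v b) (cot_hom V C v a b))" "Dom V (cot_hom V C v a b) = VHom C a b"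
    "cou C v b \<odot>[C] Gel (Cot C v a) (Cot C v b) (cot_hom V C v a b) =
      Gel a b (Ident V (VHom C a b)) \<odot>[C] cou C v a \<lhd> Sym V v (VHom C a b)"
proof -
  let ?f = "VComp C (Cot C v a) a b \<cdot> (Ident V (VHom C a b) \<boxtimes> Cou C v a)"
  have k: "Cou C v a \<in> Arr V" "Dom V (Cou C v a) = v" "Cod V (Cou C v a) = VHom C (Cot C v a) a"
    using cou_typing(1,2)[OF o(1)] by (auto simp: cou_def is_gel_Gel)
  have f: "?f \<in> Arr V" "Dom V ?f = VHom C a b \<otimes> v" "Cod V ?f = VHom C (Cot C v a) b"
    using k o C by (simp_all add: cou_typing)
  note L = cot_lift[OF o(2) cou_typing(5)[OF o(1)] _ f]
  show "is_gel C (Gel (Cot C v a) (Cot C v b) (cot_hom V C v a b))" "Dom V (cot_hom V C v a b) = VHom C a b"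
    using L o C by (simp_all add: cot_hom_def)
  show "cou C v b \<odot>[C] Gel (Cot C v a) (Cot C v b) (cot_hom V C v a b) =
      Gel a b (Ident V (VHom C a b)) \<odot>[C] cou C v a \<lhd> Sym V v (VHom C a b)"
    using L(3) o C by (simp add: cot_hom_def gcomp_def cou_def)
qed

text \<open>The last equation is naturality of the counit, where the symmetry exchanges
  \<open>v\<close> with the domain of \<open>f\<close>. By \<open>cot_cancel\<close> it
  characterizes the action on homs, and the facts about [v, -] below are derived from it.\<close>

lemma cotensor_fun_gel:
  assumes f: "is_gel C f"
  shows "is_gel C (cotensor_fun V C v \<rhd> f)" "gdom (cotensor_fun V C v \<rhd> f) = gdom f"
    "cou C v (gtgt f) \<odot>[C] (cotensor_fun V C v \<rhd> f) = f \<odot>[C] cou C v (gsrc f) \<lhd> Sym V v (gdom f)"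
proof -
  let ?a = "gsrc f" and ?b = "gtgt f"
  let ?g = "Gel ?a ?b (Ident V (VHom C ?a ?b))"
  let ?h = "Gel (Cot C v ?a) (Cot C v ?b) (cot_hom V C v ?a ?b)"
  have o: "?a \<in> VObj C" "?b \<in> VObj C" using f by auto
  note G = cotensor_fun_cou_generic[OF o]
  have e: "cotensor_fun V C v \<rhd> f = ?h \<lhd> garr f" using o by (simp add: gmap_def cotensor_fun_def reindex_def)
  have v: "v \<in> Obj V" by (rule cou_typing(6)[OF o(1)])
  have d: "Cod V (garr f) = gdom ?h" using f o G by simp
  show "is_gel C (cotensor_fun V C v \<rhd> f)" "gdom (cotensor_fun V C v \<rhd> f) = gdom f"
    unfolding e using G(1,2) d f C gdom_def[of f] by (simp_all add: is_gel_Gel)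
  have g: "is_gel C ?g" "?g \<lhd> garr f = f" using o C f gel_generic[OF f] by (simp_all add: is_gel_Gel)
  have "cou C v ?b \<odot>[C] (?h \<lhd> garr f) = cou C v ?b \<odot>[C] ?h \<lhd> Ident V v \<boxtimes> garr f"
    using G(1) d f o C by (simp add: cou_typing)
  also have "\<dots> = ?g \<odot>[C] cou C v ?a \<lhd> (garr f \<boxtimes> Ident V v) \<cdot> Sym V v (gdom f)"
    unfolding G(3) using g(1) d f o C v G(2) by (simp add: cou_typing sym_nat gdom_def[of f, symmetric])
  also have "\<dots> = (?g \<lhd> garr f) \<odot>[C] cou C v ?a \<lhd> Sym V v (gdom f)"
    using g(1) d f o C v G(2) by (simp add: cou_typing gdom_def[of f, symmetric])
  finally show "cou C v ?b \<odot>[C] (cotensor_fun V C v \<rhd> f) = f \<odot>[C] cou C v ?a \<lhd> Sym V v (gdom f)"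
    unfolding e g(2) .
qed

lemma cotensor_fun_FO: "a \<in> VObj C \<Longrightarrow> FO (cotensor_fun V C v) a = Cot C v a"
  by (simp add: cotensor_fun_def)

lemma cotensor_fun_functor: "vfunctor V C C (cotensor_fun V C v)"
proof (rule vfunctorI[OF C C])
  show "FO (cotensor_fun V C v) \<in> VObj C \<rightarrow>\<^sub>E VObj C"
    using cou_typing(5) by (auto simp: cotensor_fun_def)
  show "FH (cotensor_fun V C v) \<in> VObj C \<rightarrow>\<^sub>E VObj C \<rightarrow>\<^sub>E Arr V"
    using cotensor_fun_cou_generic(1) by (auto simp: cotensor_fun_def is_gel_Gel)
  show "Dom V (FH (cotensor_fun V C v) a b) = VHom C a b"
    "Cod V (FH (cotensor_fun V C v) a b) = VHom C (FO (cotensor_fun V C v) a) (FO (cotensor_fun V C v) b)"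
    if "a \<in> VObj C" "b \<in> VObj C" for a b
    using cotensor_fun_cou_generic(1,2)[OF that] that by (auto simp: cotensor_fun_def is_gel_Gel)
  show "cotensor_fun V C v \<rhd> gid C a = gid C (FO (cotensor_fun V C v) a)" if a: "a \<in> VObj C" for a
  proof (rule cot_cancel[OF C _ cou_cot[OF a]])
    have "v \<in> Obj V" by (rule cou_typing(6)[OF a])
    then show "cou C v a \<odot>[C] (cotensor_fun V C v \<rhd> gid C a) = cou C v a \<odot>[C] gid C (FO (cotensor_fun V C v) a)"
      using cotensor_fun_gel(3)[of "gid C a"] C a by (simp add: cou_typing cotensor_fun_FO lunit_sym)
  qed (use cotensor_fun_gel[of "gid C a"] C a in \<open>simp_all add: cou_typing cotensor_fun_FO\<close>)
  show "cotensor_fun V C v \<rhd> (g \<odot>[C] f) = (cotensor_fun V C v \<rhd> g) \<odot>[C] (cotensor_fun V C v \<rhd> f)"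
    if g: "is_gel C f" "is_gel C g" "gsrc g = gtgt f" for f g
  proof (rule cot_cancel[OF C _ cou_cot])
    let ?F = "cotensor_fun V C v"
    let ?a = "gsrc f" and ?b = "gtgt f" and ?c = "gtgt g" and ?x = "gdom f" and ?y = "gdom g"
    have o: "?a \<in> VObj C" "?b \<in> VObj C" "?c \<in> VObj C" "?x \<in> Obj V" "?y \<in> Obj V" using g by auto
    have v: "v \<in> Obj V" by (rule cou_typing(6)[OF o(1)])
    \<comment> \<open>The counit is moved past \<open>g\<close> and then past \<open>f\<close>, each
      time exchanging \<open>v\<close> with one domain; the hexagon merges the two exchanges into a
      single one with \<open>?y \<otimes> ?x\<close>.\<close>
    have "cou C v ?c \<odot>[C] ((?F \<rhd> g) \<odot>[C] (?F \<rhd> f)) \<lhd> Assoc V v ?y ?x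
       = (cou C v ?c \<odot>[C] (?F \<rhd> g)) \<odot>[C] (?F \<rhd> f)"
      using g o C v by (simp add: gcomp_assoc cotensor_fun_gel(1,2) cou_typing cotensor_fun_FO)
    also have "\<dots> = (g \<odot>[C] cou C v ?b) \<odot>[C] (?F \<rhd> f) \<lhd> Sym V v ?y \<boxtimes> Ident V ?x"
      unfolding cotensor_fun_gel(3)[OF g(2)] using g o C v by (simp add: cotensor_fun_gel(1,2) cou_typing cotensor_fun_FO)
    also have "\<dots> = g \<odot>[C] (cou C v ?b \<odot>[C] (?F \<rhd> f)) \<lhd> Assoc V ?y v ?x \<cdot> (Sym V v ?y \<boxtimes> Ident V ?x)"
      using g o C v by (simp add: gcomp_assoc cotensor_fun_gel(1,2) cou_typing cotensor_fun_FO)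
    also have "\<dots> = g \<odot>[C] (f \<odot>[C] cou C v ?a) \<lhd> (Ident V ?y \<boxtimes> Sym V v ?x) \<cdot> Assoc V ?y v ?x \<cdot> (Sym V v ?y \<boxtimes> Ident V ?x)"
      unfolding cotensor_fun_gel(3)[OF g(1)] using g o C v by (simp add: cotensor_fun_gel(1,2) cou_typing cotensor_fun_FO)
    also have "\<dots> = (g \<odot>[C] f) \<odot>[C] cou C v ?a \<lhd> Sym V v (?y \<otimes> ?x) \<cdot> Assoc V v ?y ?x"
      using g o C v by (simp add: hexagon_left gcomp_assoc cou_typing)
    also have "\<dots> = cou C v ?c \<odot>[C] (?F \<rhd> (g \<odot>[C] f)) \<lhd> Assoc V v ?y ?x"
      using cotensor_fun_gel(3)[of "g \<odot>[C] f"] g o C v by (simp add: cou_typing)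
    finally show "cou C v ?c \<odot>[C] (?F \<rhd> (g \<odot>[C] f)) = cou C v ?c \<odot>[C] ((?F \<rhd> g) \<odot>[C] (?F \<rhd> f))"
      using reindex_cancel[OF C, of "cou C v ?c \<odot>[C] (?F \<rhd> (g \<odot>[C] f))" "Assoc V v ?y ?x"
          "cou C v ?c \<odot>[C] ((?F \<rhd> g) \<odot>[C] (?F \<rhd> f))"]
        g o C v cotensor_fun_gel[of "g \<odot>[C] f"] by (simp add: cotensor_fun_gel(1,2) cou_typing cotensor_fun_FO)
  qed (use g C cotensor_fun_gel[of f] cotensor_fun_gel[of g] cotensor_fun_gel[of "g \<odot>[C] f"] in \<open>simp_all add: cou_typing cotensor_fun_FO\<close>)
qed

text \<open>For arrows of the underlying category the symmetry in \<open>cotensor_fun_gel\<close> is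
  absorbed by the unitors.\<close>

lemma cotensor_fun_star:
  assumes f: "is_gel C f" "gdom f = \<one>"
  shows "cou C v (gtgt f) \<star>[C] (cotensor_fun V C v \<rhd> f) = f \<star>[C] cou C v (gsrc f)"
proof -
  have o: "gsrc f \<in> VObj C" "gtgt f \<in> VObj C" using f by auto
  have v: "v \<in> Obj V" by (rule cou_typing(6)[OF o(1)])
  have e: "Sym V v \<one> \<cdot> inverse_arrow V (RUnit V v) = inverse_arrow V (LUnit V v)"
    by (rule iso_cancel_left[of "LUnit V v"]) (use v assoc[of "inverse_arrow V (RUnit V v)" "Sym V v \<one>" "LUnit V v"]
      in \<open>simp_all add: lunit_sym del: assoc\<close>)
  show ?thesis
    using f o C v cotensor_fun_gel[OF f(1)] by (simp add: star_right[where f="cotensor_fun V C v \<rhd> f"] star_left e cou_typing)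
qed

text \<open>Cotensors commute with one another: composed with the counits of [v, -], factoring an
  element over x through [v, \<kappa>] amounts to factoring one over v \<otimes> x through
  \<open>\<kappa>\<close>.\<close>

lemma cotensor_fun_preserves_cot:
  assumes k: "is_cot C \<kappa>"
  shows "is_cot C (cotensor_fun V C v \<rhd> \<kappa>)"
proof (rule is_cotI[OF C])
  let ?F = "cotensor_fun V C v"
  have kg: "is_gel C \<kappa>" by (rule is_cot_gel[OF k])
  let ?c = "gtgt \<kappa>" and ?p = "gsrc \<kappa>" and ?j = "gdom \<kappa>"
  have o: "?c \<in> VObj C" "?p \<in> VObj C" "?j \<in> Obj V" using kg by auto
  have v: "v \<in> Obj V" by (rule cou_typing(6)[OF o(1)])
  show Fk: "is_gel C (?F \<rhd> \<kappa>)" by (rule cotensor_fun_gel(1)[OF kg])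
  have Fd: "gdom (?F \<rhd> \<kappa>) = ?j" by (rule cotensor_fun_gel(2)[OF kg])
  \<comment> \<open>Exchange of the two weights, from \<open>?j \<otimes> v \<otimes> x\<close> to
    \<open>v \<otimes> ?j \<otimes> x\<close>.\<close>
  let ?s = "\<lambda>x. Assoc V v ?j x \<cdot> (Sym V ?j v \<boxtimes> Ident V x) \<cdot> inverse_arrow V (Assoc V ?j v x)"
  have s: "?s x \<in> Arr V" "Dom V (?s x) = ?j \<otimes> v \<otimes> x" "Cod V (?s x) = v \<otimes> ?j \<otimes> x" "is_iso V (?s x)"
    if "x \<in> Obj V" for x
    using that o v by simp_all
  have key: "cou C v ?c \<odot>[C] ((?F \<rhd> \<kappa>) \<odot>[C] h) \<lhd> ?s (gdom h) = \<kappa> \<odot>[C] (cou C v ?p \<odot>[C] h)"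
    if h: "is_gel C h" "gtgt h = Cot C v ?p" for h
  proof -
    let ?x = "gdom h"
    have x: "?x \<in> Obj V" using h by simp
    have "cou C v ?c \<odot>[C] ((?F \<rhd> \<kappa>) \<odot>[C] h) \<lhd> Assoc V v ?j ?x = (cou C v ?c \<odot>[C] (?F \<rhd> \<kappa>)) \<odot>[C] h"
      using h x o v Fk Fd C by (simp add: gcomp_assoc cou_typing cotensor_fun_FO)
    also have "\<dots> = \<kappa> \<odot>[C] (cou C v ?p \<odot>[C] h) \<lhd> Assoc V ?j v ?x \<cdot> (Sym V v ?j \<boxtimes> Ident V ?x)"
      unfolding cotensor_fun_gel(3)[OF kg] using h x o v kg C by (simp add: gcomp_assoc cou_typing)
    finally have "cou C v ?c \<odot>[C] ((?F \<rhd> \<kappa>) \<odot>[C] h) \<lhd> Assoc V v ?j ?x \<lhd> (Sym V ?j v \<boxtimes> Ident V ?x) \<cdot> inverse_arrow V (Assoc V ?j v ?x)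
      = \<kappa> \<odot>[C] (cou C v ?p \<odot>[C] h) \<lhd> Assoc V ?j v ?x \<cdot> (Sym V v ?j \<boxtimes> Ident V ?x) \<lhd> (Sym V ?j v \<boxtimes> Ident V ?x) \<cdot> inverse_arrow V (Assoc V ?j v ?x)"
      by simp
    then show ?thesis using h x o v kg Fk Fd C by (simp add: cou_typing cotensor_fun_FO interchange_simps)
  qed
  have inj: "a = b" if "cou C v ?c \<odot>[C] a \<lhd> ?s x = cou C v ?c \<odot>[C] b \<lhd> ?s x"
      "is_gel C a" "is_gel C b" "gtgt a = Cot C v ?c" "gtgt b = Cot C v ?c" "gdom a = ?j \<otimes> x" "gdom b = ?j \<otimes> x" "x \<in> Obj V" for a b x
  proof -
    have "cou C v ?c \<odot>[C] a = cou C v ?c \<odot>[C] b"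
      by (rule reindex_cancel[OF C that(1) s(4)[OF that(8)]]) (use that o v C in \<open>simp_all add: cou_typing\<close>)
    then show ?thesis by (rule cot_cancel[OF C _ cou_cot[OF o(1)]]) (use that o in \<open>simp_all add: cou_typing\<close>)
  qed
  show "\<exists>h. is_gel C h \<and> gsrc h = gsrc f \<and> gtgt h = gsrc (?F \<rhd> \<kappa>) \<and> gdom h = x \<and> (?F \<rhd> \<kappa>) \<odot>[C] h = f"
    if f: "is_gel C f" "gtgt f = gtgt (?F \<rhd> \<kappa>)" "x \<in> Obj V" "gdom f = gdom (?F \<rhd> \<kappa>) \<otimes> x" for f x
  proof -
    let ?f = "cou C v ?c \<odot>[C] f \<lhd> ?s x"
    have ft: "gtgt f = Cot C v ?c" "gdom f = ?j \<otimes> x" using f o Fd by (simp_all add: cotensor_fun_FO)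
    \<comment> \<open>Factor through \<open>\<kappa>\<close> over \<open>v \<otimes> x\<close>
      first, then absorb \<open>v\<close> by the counit at \<open>?p\<close>.\<close>
    obtain h' where h': "is_gel C h'" "gsrc h' = gsrc f" "gtgt h' = ?p" "gdom h' = v \<otimes> x" "\<kappa> \<odot>[C] h' = ?f"
      by (rule cot_ex[OF C k, of "v \<otimes> x" ?f]) (use f ft o v s[OF f(3)] C in \<open>auto simp: cou_typing\<close>)
    obtain h where h: "is_gel C h" "gsrc h = gsrc f" "gtgt h = Cot C v ?p" "gdom h = x" "cou C v ?p \<odot>[C] h = h'"
      by (rule cot_ex[OF C cou_cot[OF o(2)] f(3) h'(1)]) (use h' o in \<open>auto simp: cou_typing\<close>)
    have "(?F \<rhd> \<kappa>) \<odot>[C] h = f"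
      by (rule inj[of _ x]) (use key[OF h(1,3)] h h'(5) f ft o Fk Fd C in \<open>simp_all add: cotensor_fun_FO\<close>)
    then show ?thesis using h o by (auto simp: cotensor_fun_FO)
  qed
  show "h = h'" if h: "is_gel C h" "is_gel C h'" "gsrc h = gsrc h'" "gtgt h = gsrc (?F \<rhd> \<kappa>)"
    "gtgt h' = gsrc (?F \<rhd> \<kappa>)" "gdom h = gdom h'" "(?F \<rhd> \<kappa>) \<odot>[C] h = (?F \<rhd> \<kappa>) \<odot>[C] h'" for h h'
  proof -
    have t: "gtgt h = Cot C v ?p" "gtgt h' = Cot C v ?p" using h o by (simp_all add: cotensor_fun_FO)
    have "\<kappa> \<odot>[C] (cou C v ?p \<odot>[C] h) = \<kappa> \<odot>[C] (cou C v ?p \<odot>[C] h')"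
      using key[OF h(1) t(1)] key[OF h(2) t(2)] h(6,7) by metis
    then have "cou C v ?p \<odot>[C] h = cou C v ?p \<odot>[C] h'"
      by (rule cot_cancel[OF C _ k]) (use h(1,2,6) t o C in \<open>simp_all add: cou_typing\<close>)
    then show ?thesis
      by (rule cot_cancel[OF C _ cou_cot[OF o(2)]]) (use h(1,2,6) t in \<open>simp_all add: cou_typing\<close>)
  qed
qed

end

end

section \<open>The opposite of the full subcategory J\<close>

text \<open>The contravariant V-functor [-, X], as a V-functor from \<open>arity_op V J\<close> to
  \<open>E\<close>. Its hom-arrows are the \<open>Tau\<close> of
  \<open>cotensor_theory\<close>.\<close>

definition tau_fun :: "('o, 'a) smc_category \<Rightarrow> 'o set \<Rightarrow> ('o, 'a, 'e) cvcat \<Rightarrow> 'e \<Rightarrow> ('o, 'e, 'a) vfun"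
  where "tau_fun V J E X = \<lparr>FO = (\<lambda>j\<in>J. Cot E j X),
    FH = (\<lambda>j\<in>J. \<lambda>k\<in>J. cot_lift V E k X (Cot E j X) (IHom V k j) (Comp V (Cou E j X) (Ev V k j)))\<rparr>"

text \<open>The fully faithful V-functor from \<open>cotensor_theory V J E X\<close> to
  \<open>E\<close> that sends j to [j, X]; it is the identity on homs because the theory borrows the
  hom-objects of \<open>E\<close>.\<close>

definition incl :: "('o, 'a) smc_category \<Rightarrow> 'o set \<Rightarrow> ('o, 'a, 'e) cvcat \<Rightarrow> 'e \<Rightarrow> ('o, 'e, 'a) vfun"
  where "incl V J E X = \<lparr>FO = (\<lambda>j\<in>J. Cot E j X), FH = (\<lambda>j\<in>J. \<lambda>k\<in>J. Ident V (VHom E (Cot E j X) (Cot E k X)))\<rparr>"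

context symmetric_monoidal_closed_category
begin

text \<open>The second hexagon, obtained from the first by inverting the symmetries in it.\<close>

lemma hexagon_right:
  assumes [simp]: "c \<in> Obj V" "j \<in> Obj V" "x \<in> Obj V"
  shows "Sym V (c \<otimes> j) x = Assoc V x c j \<cdot> (Sym V c x \<boxtimes> Ident V j) \<cdot> inverse_arrow V (Assoc V c x j) \<cdot>
    (Ident V c \<boxtimes> Sym V j x) \<cdot> Assoc V c j x"
    (is "_ = ?r")
proof (rule iso_cancel_right)
  have "?r \<cdot> Sym V x (c \<otimes> j) \<cdot> Assoc V x c j = Assoc V x c j \<cdot> (Sym V c x \<boxtimes> Ident V j) \<cdot> inverse_arrow V (Assoc V c x j) \<cdot>
    (Ident V c \<boxtimes> Sym V j x) \<cdot> ((Ident V c \<boxtimes> Sym V x j) \<cdot> Assoc V c x j \<cdot> (Sym V x c \<boxtimes> Ident V j))"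
    by (simp add: hexagon_left)
  also have "\<dots> = Assoc V x c j" by (simp add: interchange_simps)
  finally show "Sym V (c \<otimes> j) x \<cdot> (Sym V x (c \<otimes> j) \<cdot> Assoc V x c j) = ?r \<cdot> (Sym V x (c \<otimes> j) \<cdot> Assoc V x c j)"
    by simp
qed simp_all

text \<open>Two ways of reversing the order of c, j and x. Functoriality of [-, X] needs it:
  composition in the opposite category and the passage past the counits both contribute
  symmetries.\<close>

lemma yang_baxter:
  assumes [simp]: "c \<in> Obj V" "j \<in> Obj V" "x \<in> Obj V"
  shows "Assoc V x j c \<cdot> (Sym V j x \<boxtimes> Ident V c) \<cdot> Sym V c (j \<otimes> x) \<cdot> Assoc V c j x =
    (Ident V x \<boxtimes> Sym V c j) \<cdot> Sym V (c \<otimes> j) x"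
proof -
  have "Assoc V x j c \<cdot> (Sym V j x \<boxtimes> Ident V c) \<cdot> Sym V c (j \<otimes> x) \<cdot> Assoc V c j x =
      Assoc V x j c \<cdot> Sym V c (x \<otimes> j) \<cdot> (Ident V c \<boxtimes> Sym V j x) \<cdot> Assoc V c j x"
    by (simp add: sym_nat')
  also have "\<dots> = (Assoc V x j c \<cdot> Sym V c (x \<otimes> j) \<cdot> Assoc V c x j) \<cdot> inverse_arrow V (Assoc V c x j) \<cdot> (Ident V c \<boxtimes> Sym V j x) \<cdot> Assoc V c j x"
    by simp
  also have "\<dots> = ((Ident V x \<boxtimes> Sym V c j) \<cdot> Assoc V x c j \<cdot> (Sym V c x \<boxtimes> Ident V j)) \<cdot> inverse_arrow V (Assoc V c x j) \<cdot> (Ident V c \<boxtimes> Sym V j x) \<cdot> Assoc V c j x"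
    by (simp only: hexagon_left assms)
  finally show ?thesis by (simp add: hexagon_right[of c j x])
qed

end

text \<open>The second assumption follows from the existence of a theory; if there is none, there are no
  algebras at all.\<close>

locale arity_system = symmetric_monoidal_closed_category V for V :: "('o, 'a) smc_category" (structure) +
  fixes J :: "'o set"
  assumes system: "system_of_arities V J"
    and op_vcategory: "vcategory V (arity_op V J)"
begin

lemma J_simps [simp]: "j \<in> J \<Longrightarrow> j \<in> Obj V" "\<one> \<in> J" "\<lbrakk>j \<in> J; k \<in> J\<rbrakk> \<Longrightarrow> j \<otimes> k \<in> J"
  using system by (auto simp: system_of_arities_def)

abbreviation Jop where "Jop \<equiv> arity_op V J"

lemma Jop_simps [simp]: "VObj Jop = J" "VHom Jop a b = IHom V b a" "vcategory V Jop"
  using op_vcategory by (simp_all add: arity_op_def vop_def vfull_def vself_def)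

text \<open>Since \<open>J\<^sup>o\<^sup>p(p, c) = [c, p]\<close>, an element \<open>f : x \<rightarrow> J\<^sup>o\<^sup>p(p, c)\<close> amounts to \<open>hat f : x \<otimes> c \<rightarrow> p\<close>.\<close>

definition hat :: "('o, 'a) gel \<Rightarrow> 'a"
  where "hat f = Ev V (gtgt f) (gsrc f) \<cdot> (garr f \<boxtimes> Ident V (gtgt f))"

definition unhat :: "'o \<Rightarrow> 'o \<Rightarrow> 'o \<Rightarrow> 'a \<Rightarrow> ('o, 'a) gel"
  where "unhat x c p k = Gel p c (transposed V x c p k)"

lemma Jop_gel: "is_gel Jop f \<Longrightarrow> gsrc f \<in> J" "is_gel Jop f \<Longrightarrow> gtgt f \<in> J"
  using gel_simps(1,2)[of Jop f] by simp_all

lemma hat_typing [simp]: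
  assumes "is_gel Jop f"
  shows "hat f \<in> Arr V" "Dom V (hat f) = gdom f \<otimes> gtgt f" "Cod V (hat f) = gsrc f"
  using assms Jop_gel[OF assms] gel_simps[OF assms] by (simp_all add: hat_def gdom_def)

lemma unhat:
  assumes "k \<in> Arr V" "Dom V k = x \<otimes> c" "Cod V k = p" "x \<in> Obj V" "c \<in> J" "p \<in> J"
  shows "is_gel Jop (unhat x c p k)" "gdom (unhat x c p k) = x" "hat (unhat x c p k) = k"
    "gsrc (unhat x c p k) = p" "gtgt (unhat x c p k) = c"
  using transposed[of x c k p] assms by (simp_all add: unhat_def is_gel_Gel hat_def)

lemma hat_inj:
  assumes "hat f = hat g" "is_gel Jop f" "is_gel Jop g" "gsrc f = gsrc g" "gtgt f = gtgt g" "gdom f = gdom g"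
  shows "f = g"
proof (rule gel_eqI)
  show "garr f = garr g"
    by (rule transposed_unique[of "gtgt f" "gsrc f"])
      (use assms Jop_gel[OF assms(2)] in \<open>auto simp: hat_def gdom_def\<close>)
qed (use assms in auto)

lemma hat_reindex:
  assumes "is_gel Jop f" "u \<in> Arr V" "Cod V u = gdom f"
  shows "hat (f \<lhd> u) = hat f \<cdot> (u \<boxtimes> Ident V (gtgt f))"
  using assms Jop_gel[OF assms(1)] by (simp add: hat_def reindex_def interchange_simps gdom_def)

lemma hat_gid: "a \<in> J \<Longrightarrow> hat (gid Jop a) = LUnit V a"
  by (simp add: hat_def gid_def arity_op_def vop_def vfull_def vself_def transposed)

text \<open>Composition in the opposite category applies \<open>hat g\<close> first and
  \<open>hat h\<close> second, against the order in which the domains are tensored; hence the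
  symmetry.\<close>

lemma hat_gcomp:
  assumes h: "is_gel Jop h" and g: "is_gel Jop g" and e: "gsrc g = gtgt h"
  shows "hat (g \<odot>[Jop] h) = hat h \<cdot> (Ident V (gdom h) \<boxtimes> hat g) \<cdot> Assoc V (gdom h) (gdom g) (gtgt g) \<cdot>
    (Sym V (gdom g) (gdom h) \<boxtimes> Ident V (gtgt g))"
proof -
  let ?d = "gsrc h" and ?p = "gtgt h" and ?c = "gtgt g" and ?x = "gdom h" and ?j = "gdom g"
  have o: "?d \<in> J" "?p \<in> J" "?c \<in> J" "?x \<in> Obj V" "?j \<in> Obj V" using h g Jop_gel by auto
  have t: "garr h \<in> Arr V" "Cod V (garr h) = IHom V ?p ?d" "Dom V (garr h) = ?x"
      "garr g \<in> Arr V" "Cod V (garr g) = IHom V ?c ?p" "Dom V (garr g) = ?j"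
    using h g gel_simps[OF h] gel_simps[OF g] e by (simp_all add: gdom_def)
  let ?k = "Ev V ?p ?d \<cdot> (Ident V (IHom V ?p ?d) \<boxtimes> Ev V ?c ?p) \<cdot> Assoc V (IHom V ?p ?d) (IHom V ?c ?p) ?c"
  let ?m = "transposed V (IHom V ?p ?d \<otimes> IHom V ?c ?p) ?c ?d ?k"
  have m: "?m \<in> Arr V" "Dom V ?m = IHom V ?p ?d \<otimes> IHom V ?c ?p" "Cod V ?m = IHom V ?c ?d"
      "Ev V ?c ?d \<cdot> (?m \<boxtimes> Ident V ?c) = ?k"
    by (rule transposed; use o in simp)+
  have "garr (g \<odot>[Jop] h) = ?m \<cdot> (garr h \<boxtimes> garr g) \<cdot> Sym V ?j ?x"
    using o t m(1-3) e by (simp add: gcomp_def arity_op_def vop_def vfull_def vself_def sym_nat)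
  then have "hat (g \<odot>[Jop] h) = Ev V ?c ?d \<cdot> ((?m \<cdot> (garr h \<boxtimes> garr g) \<cdot> Sym V ?j ?x) \<boxtimes> Ident V ?c)"
    by (simp add: hat_def)
  also have "\<dots> = (Ev V ?c ?d \<cdot> (?m \<boxtimes> Ident V ?c)) \<cdot> (((garr h \<boxtimes> garr g) \<cdot> Sym V ?j ?x) \<boxtimes> Ident V ?c)"
    using o t m(1-3) by (simp add: interchange_simps)
  also have "\<dots> = ?k \<cdot> (((garr h \<boxtimes> garr g) \<boxtimes> Ident V ?c) \<cdot> (Sym V ?j ?x \<boxtimes> Ident V ?c))"
    unfolding m(4) using o t by (simp add: interchange_simps)
  also have "\<dots> = Ev V ?p ?d \<cdot> (Ident V (IHom V ?p ?d) \<boxtimes> Ev V ?c ?p) \<cdot> (garr h \<boxtimes> (garr g \<boxtimes> Ident V ?c)) \<cdot> Assoc V ?x ?j ?c \<cdot> (Sym V ?j ?x \<boxtimes> Ident V ?c)"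
    using o t by (simp add: assoc_nat')
  also have "\<dots> = hat h \<cdot> (Ident V ?x \<boxtimes> hat g) \<cdot> Assoc V ?x ?j ?c \<cdot> (Sym V ?j ?x \<boxtimes> Ident V ?c)"
    using o t e by (simp add: hat_def interchange_simps)
  finally show ?thesis .
qed

text \<open>In the opposite of J a cotensor of c by j is an object isomorphic to j \<otimes> c:
  \<open>hat\<close> turns factoring through \<open>\<kappa>\<close> into factoring through the
  isomorphism \<open>?s x\<close> built from \<open>hat \<kappa>\<close>.\<close>

lemma Jop_cotI:
  assumes k: "is_gel Jop \<kappa>" and i: "is_iso V (hat \<kappa>)"
  shows "is_cot Jop \<kappa>"
proof (rule is_cotI)
  let ?c = "gtgt \<kappa>" and ?p = "gsrc \<kappa>" and ?j = "gdom \<kappa>"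
  have o: "?c \<in> J" "?p \<in> J" "?j \<in> Obj V" using Jop_gel k by auto
  let ?s = "\<lambda>x. (Ident V x \<boxtimes> hat \<kappa>) \<cdot> Assoc V x ?j ?c \<cdot> (Sym V ?j x \<boxtimes> Ident V ?c)"
  have s: "is_iso V (?s x)" "?s x \<in> Arr V" "Dom V (?s x) = (?j \<otimes> x) \<otimes> ?c" "Cod V (?s x) = x \<otimes> ?p" if "x \<in> Obj V" for x
    using that o i k by simp_all
  show "\<exists>h. is_gel Jop h \<and> gsrc h = gsrc f \<and> gtgt h = ?p \<and> gdom h = x \<and> \<kappa> \<odot>[Jop] h = f"
    if f: "is_gel Jop f" "gtgt f = ?c" "x \<in> Obj V" "gdom f = ?j \<otimes> x" for f x
  proof -
    let ?k = "hat f \<cdot> inverse_arrow V (?s x)"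
    let ?h = "unhat x ?p (gsrc f) ?k"
    have K: "?k \<in> Arr V" "Dom V ?k = x \<otimes> ?p" "Cod V ?k = gsrc f" using f s[OF f(3)] by (simp_all del: assoc)
    have K2: "?k \<cdot> ?s x = hat f" using f s[OF f(3)] by (simp del: comp_typing)
    note h = unhat[OF K f(3) o(2) Jop_gel(1)[OF f(1)]]
    have "\<kappa> \<odot>[Jop] ?h = f"
      by (rule hat_inj) (use hat_gcomp[OF h(1) k] h f k K2 in simp_all)
    then show ?thesis using h by blast
  qed
  show "h = h'" if h: "is_gel Jop h" "is_gel Jop h'" "gsrc h = gsrc h'" "gtgt h = ?p" "gtgt h' = ?p" "gdom h = gdom h'"
    "\<kappa> \<odot>[Jop] h = \<kappa> \<odot>[Jop] h'" for h h'
  proof (rule hat_inj)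
    have "hat h \<cdot> ?s (gdom h) = hat h' \<cdot> ?s (gdom h)"
      using hat_gcomp[OF h(1) k] hat_gcomp[OF h(2) k] h(4-7) by simp
    then show "hat h = hat h'"
      by (rule iso_cancel_right) (use h s[OF gel_simps(4)[OF h(1)]] in \<open>simp_all\<close>)
  qed (use h in auto)
qed (use k in simp_all)

text \<open>Converse of \<open>Jop_cotI\<close>, by Yoneda in the ordinary category: elements over
  \<one> already show that precomposition with \<open>hat \<kappa>\<close> is bijective on arrows
  into objects of J. The weight has to lie in J for \<open>?j \<otimes> ?c\<close> to be such an
  object.\<close>

lemma hat_cot_iso:
  assumes k: "is_cot Jop \<kappa>" and j: "gdom \<kappa> \<in> J"
  shows "is_iso V (hat \<kappa>)"
proof -
  have kg: "is_gel Jop \<kappa>" by (rule is_cot_gel[OF k])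
  let ?c = "gtgt \<kappa>" and ?p = "gsrc \<kappa>" and ?j = "gdom \<kappa>"
  have o: "?c \<in> J" "?p \<in> J" using Jop_gel kg by auto
  \<comment> \<open>An arrow \<open>k\<close> of \<open>V\<close> out of \<open>?p\<close>, seen as
    an element over \<one>.\<close>
  let ?u = "\<lambda>k. unhat \<one> ?p (Cod V k) (k \<cdot> LUnit V ?p)"
  have u: "is_gel Jop (?u k)" "gdom (?u k) = \<one>" "gsrc (?u k) = Cod V k" "gtgt (?u k) = ?p" "hat (?u k) = k \<cdot> LUnit V ?p"
    if "k \<in> Arr V" "Dom V k = ?p" "Cod V k \<in> J" for k
    using unhat[of "k \<cdot> LUnit V ?p" \<one> ?p "Cod V k"] that o by simp_all
  have hu: "hat (\<kappa> \<odot>[Jop] h) = k \<cdot> hat \<kappa> \<cdot> (RUnit V ?j \<boxtimes> Ident V ?c)"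
    if h: "is_gel Jop h" "gdom h = \<one>" "gtgt h = ?p" "hat h = k \<cdot> LUnit V ?p" and kt: "k \<in> Arr V" "Dom V k = ?p" for h k
  proof -
    have "hat (\<kappa> \<odot>[Jop] h) = k \<cdot> (LUnit V ?p \<cdot> (Ident V \<one> \<boxtimes> hat \<kappa>)) \<cdot> Assoc V \<one> ?j ?c \<cdot> (Sym V ?j \<one> \<boxtimes> Ident V ?c)"
      using hat_gcomp[OF h(1) kg] h kt kg o j by simp
    also have "\<dots> = k \<cdot> hat \<kappa> \<cdot> (LUnit V (?j \<otimes> ?c) \<cdot> Assoc V \<one> ?j ?c) \<cdot> (Sym V ?j \<one> \<boxtimes> Ident V ?c)"
      using kt kg o j by (simp add: lunit_nat)
    also have "\<dots> = k \<cdot> hat \<kappa> \<cdot> (RUnit V ?j \<boxtimes> Ident V ?c)"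
      unfolding lunit_ten[OF J_simps(1)[OF j] J_simps(1)[OF o(1)]] using kt kg o j by (simp add: interchange_simps lunit_sym)
    finally show ?thesis .
  qed
  have ex: "\<exists>k. k \<in> Arr V \<and> Dom V k = ?p \<and> Cod V k = d \<and> k \<cdot> hat \<kappa> = q"
    if q: "q \<in> Arr V" "Dom V q = ?j \<otimes> ?c" "Cod V q = d" "d \<in> J" for q d
  proof -
    let ?f = "unhat (?j \<otimes> \<one>) ?c d (q \<cdot> (RUnit V ?j \<boxtimes> Ident V ?c))"
    have f: "is_gel Jop ?f" "gdom ?f = ?j \<otimes> \<one>" "hat ?f = q \<cdot> (RUnit V ?j \<boxtimes> Ident V ?c)" "gsrc ?f = d" "gtgt ?f = ?c"
      using unhat[of "q \<cdot> (RUnit V ?j \<boxtimes> Ident V ?c)" "?j \<otimes> \<one>" ?c d] q o j by simp_all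
    obtain h where h: "is_gel Jop h" "gsrc h = d" "gtgt h = ?p" "gdom h = \<one>" "\<kappa> \<odot>[Jop] h = ?f"
      by (rule cot_ex[OF _ k _ f(1)]) (use f in auto)
    let ?k = "hat h \<cdot> inverse_arrow V (LUnit V ?p)"
    have kt: "?k \<in> Arr V" "Dom V ?k = ?p" "Cod V ?k = d" using h o by simp_all
    have "hat h = ?k \<cdot> LUnit V ?p" using h o by simp
    then have "?k \<cdot> hat \<kappa> \<cdot> (RUnit V ?j \<boxtimes> Ident V ?c) = q \<cdot> (RUnit V ?j \<boxtimes> Ident V ?c)"
      using hu[OF h(1,4,3) _ kt(1,2)] h(5) f(3) by simp
    then have "(?k \<cdot> hat \<kappa>) \<cdot> (RUnit V ?j \<boxtimes> Ident V ?c) = q \<cdot> (RUnit V ?j \<boxtimes> Ident V ?c)"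
      using h o j kg by simp
    then have "?k \<cdot> hat \<kappa> = q"
      by (rule iso_cancel_right) (use h q o j kg in simp_all)
    then show ?thesis using kt by blast
  qed
  have un: "k = k'" if kk: "k \<in> Arr V" "Dom V k = ?p" "Cod V k \<in> J" "k' \<in> Arr V" "Dom V k' = ?p" "Cod V k' = Cod V k"
    "k \<cdot> hat \<kappa> = k' \<cdot> hat \<kappa>" for k k'
  proof -
    have c': "Cod V k' \<in> J" using kk by simp
    note uk = u[OF kk(1,2,3)] and uk' = u[OF kk(4,5) c']
    have "?u k = ?u k'"
    proof (rule cot_cancel[OF _ _ k])
      show "\<kappa> \<odot>[Jop] ?u k = \<kappa> \<odot>[Jop] ?u k'"
      proof (rule hat_inj)
        have "k \<cdot> hat \<kappa> \<cdot> (RUnit V ?j \<boxtimes> Ident V ?c) = k' \<cdot> hat \<kappa> \<cdot> (RUnit V ?j \<boxtimes> Ident V ?c)"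
          using arg_cong[OF kk(7), of "\<lambda>z. z \<cdot> (RUnit V ?j \<boxtimes> Ident V ?c)"] kk(1-6) o j kg by simp
        then show "hat (\<kappa> \<odot>[Jop] ?u k) = hat (\<kappa> \<odot>[Jop] ?u k')"
          using hu[OF uk(1,2,4,5) kk(1,2)] hu[OF uk'(1,2,4,5) kk(4,5)] by simp
      qed (use uk uk' kg kk in simp_all)
    qed (use uk uk' kk in simp_all)
    then have "k \<cdot> LUnit V ?p = k' \<cdot> LUnit V ?p" using uk(5) uk'(5) by simp
    then show ?thesis by (rule iso_cancel_right) (use kk o in simp_all)
  qed
  \<comment> \<open>A left inverse of \<open>hat \<kappa>\<close>, from the identity of
    \<open>?j \<otimes> ?c\<close>; it is two-sided because precomposition with
    \<open>hat \<kappa>\<close> is injective.\<close>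
  obtain k where K: "k \<in> Arr V" "Dom V k = ?p" "Cod V k = ?j \<otimes> ?c" "k \<cdot> hat \<kappa> = Ident V (?j \<otimes> ?c)"
    using ex[of "Ident V (?j \<otimes> ?c)" "?j \<otimes> ?c"] o j by auto
  have "hat \<kappa> \<cdot> k = Ident V ?p"
    by (rule un) (use K kg o in simp_all)
  then show ?thesis
    by (intro isoI[of _ k]) (use K kg in simp_all)
qed

end

section \<open>The theory of cotensors of an object\<close>

context arity_system
begin

definition cotensored :: "('o, 'a, 'c) cvcat \<Rightarrow> bool"
  where "cotensored E \<longleftrightarrow> vcategory V E \<and> designated_cotensors V J E"

lemma cotensored_cot: "\<lbrakk>cotensored E; v \<in> J\<rbrakk> \<Longrightarrow> \<forall>c\<in>VObj E. is_cotensor V E v c (Cot E v c) (Cou E v c)"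
  by (simp add: cotensored_def designated_cotensors_def)

lemma cotensored_vcat: "cotensored E \<Longrightarrow> vcategory V E"
  by (simp add: cotensored_def)

context
  fixes E :: "('o, 'a, 'c) cvcat" and v :: 'o
  assumes E: "cotensored E" and v: "v \<in> J"
begin

lemmas cotensored_cotf = cotensor_fun_gel[OF cotensored_vcat[OF E] cotensored_cot[OF E v]] cotensor_fun_star[OF cotensored_vcat[OF E] cotensored_cot[OF E v]]
lemmas cotensored_cotf_functor = cotensor_fun_functor[OF cotensored_vcat[OF E] cotensored_cot[OF E v]]
lemmas cotensored_cotf_preserves = cotensor_fun_preserves_cot[OF cotensored_vcat[OF E] cotensored_cot[OF E v]]

lemma cotensored_cou:
  assumes "c \<in> VObj E"
  shows "is_cot E (cou E v c)" "is_gel E (cou E v c)" "gdom (cou E v c) = v" "Cot E v c \<in> VObj E"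
    "garr (cou E v c) \<in> Arr V"
  using cou_cot[OF cotensored_vcat[OF E] cotensored_cot[OF E v]] cou_typing[OF cotensored_vcat[OF E] cotensored_cot[OF E v]] assms
  by auto

end

lemma cou_simps [simp]: "gsrc (cou E v c) = Cot E v c" "gtgt (cou E v c) = c"
  by (simp_all add: cou_def)

lemma cotensored_unit: "\<lbrakk>cotensored E; c \<in> VObj E\<rbrakk> \<Longrightarrow> Cot E \<one> c = c" "\<lbrakk>cotensored E; c \<in> VObj E\<rbrakk> \<Longrightarrow> cou E \<one> c = gid E c"
  by (simp_all add: cotensored_def designated_cotensors_def cou_def gid_def)

text \<open>The designated cotensors by \<one> have identity counits, so the equation that
  characterizes the image of \<open>f\<close> reduces to \<open>f\<close> itself. This strictness
  lets components at \<one> be read off without comparison isomorphisms.\<close>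

lemma cotensor_fun_unit:
  assumes E: "cotensored E" and f: "is_gel E f"
  shows "cotensor_fun V E \<one> \<rhd> f = f"
proof (rule cot_cancel[OF cotensored_vcat[OF E] _ cotensored_cou(1)[OF E J_simps(2)]])
  note v = cotensored_vcat[OF E]
  have o: "gsrc f \<in> VObj E" "gtgt f \<in> VObj E" "gdom f \<in> Obj V" using f by auto
  show "gtgt f \<in> VObj E" by fact
  note F = cotensored_cotf(1-3)[OF E J_simps(2) f]
  show "cou E \<one> (gtgt f) \<odot>[E] (cotensor_fun V E \<one> \<rhd> f) = cou E \<one> (gtgt f) \<odot>[E] f"
    using F(3) f o v by (simp add: cotensored_unit[OF E] runit_sym)
qed (use f cotensored_cotf(1,2)[OF E J_simps(2) f] in \<open>auto simp: cotensor_fun_def cotensored_unit[OF E]\<close>)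

context
  fixes E :: "('o, 'a, 'e) cvcat" and X :: 'e
  assumes E: "cotensored E" and X: "X \<in> VObj E"
begin

lemma couX [simp]:
  assumes "j \<in> J"
  shows "is_gel E (cou E j X)" "gdom (cou E j X) = j" "Cot E j X \<in> VObj E" "garr (cou E j X) \<in> Arr V"
  using cotensored_cou[OF E assms X] by auto

text \<open>The last equation characterizes [-, X]: followed by the counit at the target of
  \<open>f\<close>, the image of \<open>f\<close> is the counit at the source, reindexed along
  \<open>hat f\<close>.\<close>

lemma tau_fun_gel:
  assumes f: "is_gel Jop f"
  shows "is_gel E (tau_fun V J E X \<rhd> f)" "gdom (tau_fun V J E X \<rhd> f) = gdom f"
    "cou E (gtgt f) X \<odot>[E] (tau_fun V J E X \<rhd> f) = cou E (gsrc f) X \<lhd> hat f \<cdot> Sym V (gtgt f) (gdom f)"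
proof -
  let ?j = "gsrc f" and ?k = "gtgt f"
  note v = cotensored_vcat[OF E]
  have o: "?j \<in> J" "?k \<in> J" using f Jop_gel by auto
  have c: "Cou E ?j X \<in> Arr V" "Dom V (Cou E ?j X) = ?j" "Cod V (Cou E ?j X) = VHom E (Cot E ?j X) X"
    using gel_simps[OF couX(1)[OF o(1)]] couX(2)[OF o(1)] gdom_def[of "cou E ?j X"] by (simp_all add: cou_def)
  have t: "garr f \<in> Arr V" "Cod V (garr f) = IHom V ?k ?j" "Dom V (garr f) = gdom f"
    using gel_simps[OF f] by (simp_all add: gdom_def)
  let ?f = "Cou E ?j X \<cdot> Ev V ?k ?j"
  let ?h = "Gel (Cot E ?j X) (Cot E ?k X) (cot_lift V E ?k X (Cot E ?j X) (IHom V ?k ?j) ?f)"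
  have F: "?f \<in> Arr V" "Dom V ?f = IHom V ?k ?j \<otimes> ?k" "Cod V ?f = VHom E (Cot E ?j X) X"
    using c o by simp_all
  have x: "IHom V ?k ?j \<in> Obj V" using o by simp
  note L = cot_lift[OF v cotensored_cot[OF E o(2)] X couX(3)[OF o(1)] x F]
  have e: "tau_fun V J E X \<rhd> f = ?h \<lhd> garr f" using o by (simp add: gmap_def tau_fun_def reindex_def)
  show "is_gel E (tau_fun V J E X \<rhd> f)" "gdom (tau_fun V J E X \<rhd> f) = gdom f"
    unfolding e using L(1,2) t v by (simp_all add: is_gel_Gel)
  have "cou E ?k X \<odot>[E] (?h \<lhd> garr f) = (cou E ?k X \<odot>[E] ?h) \<lhd> Ident V ?k \<boxtimes> garr f"
    using L(1,2) t v o by simp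
  also have "\<dots> = cou E ?j X \<lhd> hat f \<cdot> Sym V ?k (gdom f)"
    unfolding L(3) using c t o gel_simps(4)[OF f] by (simp add: reindex_def cou_def hat_def sym_nat)
  finally show "cou E ?k X \<odot>[E] (tau_fun V J E X \<rhd> f) = cou E ?j X \<lhd> hat f \<cdot> Sym V ?k (gdom f)"
    unfolding e .
qed

lemma tau_fun_FO [simp]: "j \<in> J \<Longrightarrow> FO (tau_fun V J E X) j = Cot E j X"
  by (simp add: tau_fun_def)

lemma tau_fun_eqI:
  assumes "cou E j X \<odot>[E] f = cou E j X \<odot>[E] g" "j \<in> J" "is_gel E f" "is_gel E g"
    "gtgt f = Cot E j X" "gtgt g = Cot E j X" "gdom f = gdom g"
  shows "f = g"
  by (rule cot_cancel[OF cotensored_vcat[OF E] assms(1) cotensored_cou(1)[OF E assms(2) X]]) (use assms in simp_all)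

lemma tau_fun_functor: "vfunctor V Jop E (tau_fun V J E X)"
proof (rule vfunctorI)
  note v = cotensored_vcat[OF E]
  let ?F = "tau_fun V J E X"
  have g: "is_gel Jop (Gel j k (Ident V (IHom V k j)))" if "j \<in> J" "k \<in> J" for j k
    using that by (simp add: is_gel_Gel)
  have h: "is_gel E (Gel (Cot E j X) (Cot E k X) (FH ?F j k))" "Dom V (FH ?F j k) = IHom V k j" if o: "j \<in> J" "k \<in> J" for j k
  proof -
    have t: "cot_lift V E k X (Cot E j X) (IHom V k j) (Cou E j X \<cdot> Ev V k j) \<in> Arr V \<and>
      Dom V (cot_lift V E k X (Cot E j X) (IHom V k j) (Cou E j X \<cdot> Ev V k j)) = IHom V k j"
    proof -
      have c: "Cou E j X \<in> Arr V" "Dom V (Cou E j X) = j" "Cod V (Cou E j X) = VHom E (Cot E j X) X"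
        using gel_simps[OF couX(1)[OF o(1)]] couX(2)[OF o(1)] gdom_def[of "cou E j X"] by (simp_all add: cou_def)
      have x: "IHom V k j \<in> Obj V" using o by simp
      show ?thesis
        using cot_lift(1,2)[OF v cotensored_cot[OF E o(2)] X couX(3)[OF o(1)] x, of "Cou E j X \<cdot> Ev V k j"] c o
        by (simp add: is_gel_Gel)
    qed
    then show "is_gel E (Gel (Cot E j X) (Cot E k X) (FH ?F j k))" "Dom V (FH ?F j k) = IHom V k j"
      using tau_fun_gel(1)[OF g[OF o]] o by (simp_all add: gmap_def tau_fun_def)
  qed
  show "FO ?F \<in> VObj Jop \<rightarrow>\<^sub>E VObj E" by (auto simp: tau_fun_def)
  show "FH ?F \<in> VObj Jop \<rightarrow>\<^sub>E VObj Jop \<rightarrow>\<^sub>E Arr V"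
    using h(1) by (auto simp: is_gel_Gel PiE_iff extensional_def tau_fun_def)
  show "Dom V (FH ?F a b) = VHom Jop a b" "Cod V (FH ?F a b) = VHom E (FO ?F a) (FO ?F b)"
    if "a \<in> VObj Jop" "b \<in> VObj Jop" for a b
    using h[of a b] that by (simp_all add: is_gel_Gel)
  show "?F \<rhd> gid Jop a = gid E (FO ?F a)" if a: "a \<in> VObj Jop" for a
  proof -
    have a': "a \<in> J" using a by simp
    note T = tau_fun_gel[of "gid Jop a"]
    show ?thesis
      by (rule tau_fun_eqI[of a]) (use T a' v in \<open>simp_all add: hat_gid lunit_sym\<close>)
  qed
  show "?F \<rhd> (g \<odot>[Jop] f) = (?F \<rhd> g) \<odot>[E] (?F \<rhd> f)"
    if a: "is_gel Jop f" "is_gel Jop g" "gsrc g = gtgt f" for f g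
  proof (rule tau_fun_eqI[of "gtgt g"])
    let ?d = "gsrc f" and ?p = "gtgt f" and ?c = "gtgt g" and ?x = "gdom f" and ?j = "gdom g"
    have o: "?d \<in> J" "?p \<in> J" "?c \<in> J" "?x \<in> Obj V" "?j \<in> Obj V" using a Jop_gel by auto
    have gf: "is_gel Jop (g \<odot>[Jop] f)" using a by simp
    note Tf = tau_fun_gel[OF a(1)] and Tg = tau_fun_gel[OF a(2)] and Tgf = tau_fun_gel[OF gf]
    \<comment> \<open>Both sides become the counit at \<open>?d\<close> reindexed along
      \<open>hat g\<close> and \<open>hat f\<close> after a permutation of the three domains;
      \<open>yang_baxter\<close> equates the permutations.\<close>
    have "cou E ?c X \<odot>[E] ((?F \<rhd> g) \<odot>[E] (?F \<rhd> f)) \<lhd> Assoc V ?c ?j ?x = (cou E ?c X \<odot>[E] (?F \<rhd> g)) \<odot>[E] (?F \<rhd> f)"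
      using Tf(1,2) Tg(1,2) a o v by (simp add: gcomp_assoc)
    also have "\<dots> = (cou E ?p X \<odot>[E] (?F \<rhd> f)) \<lhd> (hat g \<cdot> Sym V ?c ?j) \<boxtimes> Ident V ?x"
      unfolding Tg(3) using Tf(1,2) a o v by simp
    also have "\<dots> = cou E ?d X \<lhd> hat f \<cdot> (Sym V ?p ?x \<cdot> ((hat g \<cdot> Sym V ?c ?j) \<boxtimes> Ident V ?x))"
      unfolding Tf(3) using a o v by simp
    also have "\<dots> = cou E ?d X \<lhd> hat f \<cdot> (Ident V ?x \<boxtimes> hat g) \<cdot> ((Ident V ?x \<boxtimes> Sym V ?c ?j) \<cdot> Sym V (?c \<otimes> ?j) ?x)"
      using a o by (simp add: sym_nat interchange_simps)
    also have "\<dots> = cou E ?c X \<odot>[E] (?F \<rhd> (g \<odot>[Jop] f)) \<lhd> Assoc V ?c ?j ?x"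
      using Tgf(3) a o v by (simp add: yang_baxter[symmetric] hat_gcomp)
    finally have "cou E ?c X \<odot>[E] ((?F \<rhd> g) \<odot>[E] (?F \<rhd> f)) \<lhd> Assoc V ?c ?j ?x
      = cou E ?c X \<odot>[E] (?F \<rhd> (g \<odot>[Jop] f)) \<lhd> Assoc V ?c ?j ?x" .
    then have "cou E ?c X \<odot>[E] ((?F \<rhd> g) \<odot>[E] (?F \<rhd> f)) = cou E ?c X \<odot>[E] (?F \<rhd> (g \<odot>[Jop] f))"
      by (rule reindex_cancel[OF v]) (use Tf(1,2) Tg(1,2) Tgf(1,2) a o v in simp_all)
    then show "cou E ?c X \<odot>[E] (?F \<rhd> (g \<odot>[Jop] f)) = cou E ?c X \<odot>[E] ((?F \<rhd> g) \<odot>[E] (?F \<rhd> f))" by simp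
  qed (use a tau_fun_gel[of f] tau_fun_gel[of g] tau_fun_gel[of "g \<odot>[Jop] f"] v Jop_gel in simp_all)
qed (use cotensored_vcat[OF E] in simp_all)

text \<open>An isomorphism j \<otimes> c \<cong> p is turned by [-, X] into [p, X] \<cong> [j,
  [c, X]].\<close>

lemma tau_fun_cot:
  assumes k: "is_gel Jop \<kappa>" and i: "is_iso V (hat \<kappa>)"
  shows "is_cot E (tau_fun V J E X \<rhd> \<kappa>)"
proof (rule is_cotI[OF cotensored_vcat[OF E]])
  note v = cotensored_vcat[OF E]
  let ?F = "tau_fun V J E X"
  let ?c = "gtgt \<kappa>" and ?p = "gsrc \<kappa>" and ?j = "gdom \<kappa>"
  have o: "?c \<in> J" "?p \<in> J" "?j \<in> Obj V" using Jop_gel k by auto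
  note T = tau_fun_gel[OF k]
  show "is_gel E (?F \<rhd> \<kappa>)" by fact
  let ?s = "\<lambda>x. ((hat \<kappa> \<cdot> Sym V ?c ?j) \<boxtimes> Ident V x) \<cdot> inverse_arrow V (Assoc V ?c ?j x)"
  have s: "?s x \<in> Arr V" "Dom V (?s x) = ?c \<otimes> ?j \<otimes> x" "Cod V (?s x) = ?p \<otimes> x" "is_iso V (?s x)" if "x \<in> Obj V" for x
    using that o i k by simp_all
  have key: "cou E ?c X \<odot>[E] ((?F \<rhd> \<kappa>) \<odot>[E] h) = (cou E ?p X \<odot>[E] h) \<lhd> ?s (gdom h)"
    if h: "is_gel E h" "gtgt h = Cot E ?p X" for h
  proof -
    let ?x = "gdom h"
    have x: "?x \<in> Obj V" using h by simp
    have "cou E ?c X \<odot>[E] ((?F \<rhd> \<kappa>) \<odot>[E] h) \<lhd> Assoc V ?c ?j ?x = (cou E ?c X \<odot>[E] (?F \<rhd> \<kappa>)) \<odot>[E] h"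
      using T(1,2) h x o v by (simp add: gcomp_assoc)
    also have "\<dots> = (cou E ?p X \<odot>[E] h) \<lhd> (hat \<kappa> \<cdot> Sym V ?c ?j) \<boxtimes> Ident V ?x"
      unfolding T(3) using h x o v k by simp
    finally have "cou E ?c X \<odot>[E] ((?F \<rhd> \<kappa>) \<odot>[E] h) \<lhd> Assoc V ?c ?j ?x \<lhd> inverse_arrow V (Assoc V ?c ?j ?x)
      = (cou E ?p X \<odot>[E] h) \<lhd> (hat \<kappa> \<cdot> Sym V ?c ?j) \<boxtimes> Ident V ?x \<lhd> inverse_arrow V (Assoc V ?c ?j ?x)" by simp
    then show ?thesis using T(1,2) h x o v k by simp
  qed
  show "\<exists>h. is_gel E h \<and> gsrc h = gsrc f \<and> gtgt h = gsrc (?F \<rhd> \<kappa>) \<and> gdom h = x \<and> (?F \<rhd> \<kappa>) \<odot>[E] h = f"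
    if f: "is_gel E f" "gtgt f = gtgt (?F \<rhd> \<kappa>)" "x \<in> Obj V" "gdom f = gdom (?F \<rhd> \<kappa>) \<otimes> x" for f x
  proof -
    have ft: "gtgt f = Cot E ?c X" "gdom f = ?j \<otimes> x" using f o T(2) by simp_all
    let ?f = "cou E ?c X \<odot>[E] f \<lhd> inverse_arrow V (?s x)"
    obtain h where h: "is_gel E h" "gsrc h = gsrc f" "gtgt h = Cot E ?p X" "gdom h = x" "cou E ?p X \<odot>[E] h = ?f"
      by (rule cot_ex[OF v cotensored_cou(1)[OF E o(2) X] f(3), of ?f]) (use f(1) ft o v s[OF f(3)] in \<open>auto simp del: assoc\<close>)
    have "(?F \<rhd> \<kappa>) \<odot>[E] h = f"
    proof (rule tau_fun_eqI[of ?c])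
      have "cou E ?c X \<odot>[E] f \<lhd> inverse_arrow V (?s x) \<lhd> ?s x = cou E ?c X \<odot>[E] f"
        using f(1) ft o v s[OF f(3)] by (simp del: comp_typing assoc)
      then show "cou E ?c X \<odot>[E] ((?F \<rhd> \<kappa>) \<odot>[E] h) = cou E ?c X \<odot>[E] f"
        unfolding key[OF h(1,3)] h(4,5) .
    qed (use h(1-4) f(1) ft o T(1,2) v in simp_all)
    then show ?thesis using h o by auto
  qed
  show "h = h'" if h: "is_gel E h" "is_gel E h'" "gsrc h = gsrc h'" "gtgt h = gsrc (?F \<rhd> \<kappa>)"
    "gtgt h' = gsrc (?F \<rhd> \<kappa>)" "gdom h = gdom h'" "(?F \<rhd> \<kappa>) \<odot>[E] h = (?F \<rhd> \<kappa>) \<odot>[E] h'" for h h'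
  proof (rule tau_fun_eqI[of ?p])
    have t: "gtgt h = Cot E ?p X" "gtgt h' = Cot E ?p X" using h o by simp_all
    have "cou E ?p X \<odot>[E] h \<lhd> ?s (gdom h) = cou E ?p X \<odot>[E] h' \<lhd> ?s (gdom h)"
      using key[OF h(1) t(1)] key[OF h(2) t(2)] h(6,7) by metis
    then show "cou E ?p X \<odot>[E] h = cou E ?p X \<odot>[E] h'"
      by (rule reindex_cancel[OF v]) (use h(1,2,6) t o v s[OF gel_simps(4)[OF h(1)]] in simp_all)
  qed (use h o in simp_all)
qed


lemma cotensor_theory_simps: "VObj (cotensor_theory V J E X) = J"
  "\<lbrakk>j \<in> J; k \<in> J\<rbrakk> \<Longrightarrow> VHom (cotensor_theory V J E X) j k = VHom E (Cot E j X) (Cot E k X)"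
  "j \<in> J \<Longrightarrow> VId (cotensor_theory V J E X) j = VId E (Cot E j X)"
  "\<lbrakk>j \<in> J; k \<in> J; l \<in> J\<rbrakk> \<Longrightarrow> VComp (cotensor_theory V J E X) j k l = VComp E (Cot E j X) (Cot E k X) (Cot E l X)"
  "\<lbrakk>j \<in> J; k \<in> J\<rbrakk> \<Longrightarrow> Tau (cotensor_theory V J E X) j k = FH (tau_fun V J E X) j k"
  by (simp_all add: cotensor_theory_def tau_fun_def)

lemma cotensor_theory_vcategory: "vcategory V (cotensor_theory V J E X)"
proof -
  have v: "vcategory V E" by (rule cotensored_vcat[OF E])
  show ?thesis
    unfolding vcategory_def cotensor_theory_simps(1)
    using v[unfolded vcategory_def] couX(3) by (simp add: cotensor_theory_simps)
qed

lemma incl_gel: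
  assumes "is_gel (cotensor_theory V J E X) f"
  shows "incl V J E X \<rhd> f = Gel (Cot E (gsrc f) X) (Cot E (gtgt f) X) (garr f)" "is_gel E (incl V J E X \<rhd> f)"
    "gdom (incl V J E X \<rhd> f) = gdom f" "gsrc f \<in> J" "gtgt f \<in> J"
proof -
  have o: "gsrc f \<in> J" "gtgt f \<in> J" using gel_simps(1,2)[OF assms] by (simp_all add: cotensor_theory_simps)
  then show "gsrc f \<in> J" "gtgt f \<in> J" by auto
  show e: "incl V J E X \<rhd> f = Gel (Cot E (gsrc f) X) (Cot E (gtgt f) X) (garr f)"
    using o gel_simps(3,5)[OF assms] by (simp add: gmap_def incl_def cotensor_theory_simps)
  show "is_gel E (incl V J E X \<rhd> f)" "gdom (incl V J E X \<rhd> f) = gdom f"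
    unfolding e using o gel_simps(3,5)[OF assms] by (simp_all add: is_gel_Gel cotensor_theory_simps gdom_def)
qed

lemma incl_functor: "vfunctor V (cotensor_theory V J E X) E (incl V J E X)"
proof (rule vfunctorI[OF cotensor_theory_vcategory cotensored_vcat[OF E]])
  note v = cotensored_vcat[OF E]
  let ?F = "incl V J E X"
  show "FO ?F \<in> VObj (cotensor_theory V J E X) \<rightarrow>\<^sub>E VObj E" "FH ?F \<in> VObj (cotensor_theory V J E X) \<rightarrow>\<^sub>E VObj (cotensor_theory V J E X) \<rightarrow>\<^sub>E Arr V"
    using v by (auto simp: incl_def cotensor_theory_simps)
  show "Dom V (FH ?F a b) = VHom (cotensor_theory V J E X) a b" "Cod V (FH ?F a b) = VHom E (FO ?F a) (FO ?F b)"
    if "a \<in> VObj (cotensor_theory V J E X)" "b \<in> VObj (cotensor_theory V J E X)" for a b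
    using that v by (simp_all add: incl_def cotensor_theory_simps)
  show "?F \<rhd> gid (cotensor_theory V J E X) a = gid E (FO ?F a)" if "a \<in> VObj (cotensor_theory V J E X)" for a
    using that v by (simp add: gmap_def gid_def incl_def cotensor_theory_simps)
  show "?F \<rhd> (g \<odot>[cotensor_theory V J E X] f) = (?F \<rhd> g) \<odot>[E] (?F \<rhd> f)"
    if a: "is_gel (cotensor_theory V J E X) f" "is_gel (cotensor_theory V J E X) g" "gsrc g = gtgt f" for f g
  proof -
    have "is_gel (cotensor_theory V J E X) (g \<odot>[cotensor_theory V J E X] f)" using a cotensor_theory_vcategory by simp
    from incl_gel(1)[OF this] incl_gel(1)[OF a(1)] incl_gel(1)[OF a(2)] incl_gel(4,5)[OF a(1)] incl_gel(5)[OF a(2)] a(3)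
    show ?thesis by (simp add: gcomp_def cotensor_theory_simps)
  qed
qed

lemma incl_inj:
  assumes "incl V J E X \<rhd> f = incl V J E X \<rhd> g" "is_gel (cotensor_theory V J E X) f" "is_gel (cotensor_theory V J E X) g" "gsrc f = gsrc g" "gtgt f = gtgt g"
  shows "f = g"
  using assms incl_gel(1)[OF assms(2)] incl_gel(1)[OF assms(3)] by (intro gel_eqI) auto

lemma incl_full:
  assumes "is_gel E f" "gsrc f = Cot E j X" "gtgt f = Cot E k X" "j \<in> J" "k \<in> J"
  shows "is_gel (cotensor_theory V J E X) (Gel j k (garr f))" "incl V J E X \<rhd> Gel j k (garr f) = f" "Dom V (garr f) = gdom f"
proof -
  show "is_gel (cotensor_theory V J E X) (Gel j k (garr f))" using gel_simps[OF assms(1)] assms(2-) by (simp add: is_gel_Gel cotensor_theory_simps)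
  from incl_gel(1)[OF this] show "incl V J E X \<rhd> Gel j k (garr f) = f" using assms by (simp add: gel.expand)
qed (simp add: gdom_def)

text \<open>\<open>incl\<close> is fully faithful, so the factorizations found in \<open>E\<close>
  come from unique elements of the theory.\<close>

lemma incl_reflects_cot:
  assumes k: "is_cot E (incl V J E X \<rhd> \<kappa>)" and g: "is_gel (cotensor_theory V J E X) \<kappa>"
  shows "is_cot (cotensor_theory V J E X) \<kappa>"
proof (rule is_cotI[OF cotensor_theory_vcategory g])
  note v = cotensored_vcat[OF E] and u = cotensor_theory_vcategory
  let ?I = "incl V J E X"
  note K = incl_gel[OF g]
  note F = gmap_gcomp[OF incl_functor]
  have I: "FO ?I j = Cot E j X" if "j \<in> J" for j using that by (simp add: incl_def)
  show "\<exists>h. is_gel (cotensor_theory V J E X) h \<and> gsrc h = gsrc f \<and> gtgt h = gsrc \<kappa> \<and> gdom h = x \<and> \<kappa> \<odot>[cotensor_theory V J E X] h = f"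
    if f: "is_gel (cotensor_theory V J E X) f" "gtgt f = gtgt \<kappa>" "x \<in> Obj V" "gdom f = gdom \<kappa> \<otimes> x" for f x
  proof -
    note If = incl_gel[OF f(1)]
    obtain h where h: "is_gel E h" "gsrc h = gsrc (?I \<rhd> f)" "gtgt h = gsrc (?I \<rhd> \<kappa>)" "gdom h = x"
        "(?I \<rhd> \<kappa>) \<odot>[E] h = ?I \<rhd> f"
      by (rule cot_ex[OF v k f(3) If(2)]) (use f K If in simp_all)
    have s: "gsrc h = Cot E (gsrc f) X" "gtgt h = Cot E (gsrc \<kappa>) X" using h(2,3) K If I by simp_all
    note H = incl_full[OF h(1) s If(4) K(4)]
    let ?h = "Gel (gsrc f) (gsrc \<kappa>) (garr h)"
    have "\<kappa> \<odot>[cotensor_theory V J E X] ?h = f"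
      by (rule incl_inj) (use F[OF H(1) g] H(1,2) h(5) f g u in simp_all)
    then show ?thesis using H h(4) by (intro exI[of _ ?h]) simp
  qed
  show "h = h'" if h: "is_gel (cotensor_theory V J E X) h" "is_gel (cotensor_theory V J E X) h'" "gsrc h = gsrc h'" "gtgt h = gsrc \<kappa>" "gtgt h' = gsrc \<kappa>"
    "gdom h = gdom h'" "\<kappa> \<odot>[cotensor_theory V J E X] h = \<kappa> \<odot>[cotensor_theory V J E X] h'" for h h'
  proof (rule incl_inj[OF _ h(1,2)])
    have "(?I \<rhd> \<kappa>) \<odot>[E] (?I \<rhd> h) = (?I \<rhd> \<kappa>) \<odot>[E] (?I \<rhd> h')"
      using F[OF h(1) g] F[OF h(2) g] h(4,5,7) by simp
    then show "?I \<rhd> h = ?I \<rhd> h'"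
      by (rule cot_cancel[OF v _ k]) (use h incl_gel[OF h(1)] incl_gel[OF h(2)] I[OF K(4)] in simp_all)
  qed (use h in simp_all)
qed

lemma incl_tau:
  assumes "is_gel Jop f"
  shows "incl V J E X \<rhd> (tau_vfun J (cotensor_theory V J E X) \<rhd> f) = tau_fun V J E X \<rhd> f" "is_gel (cotensor_theory V J E X) (tau_vfun J (cotensor_theory V J E X) \<rhd> f)"
    "gdom (tau_vfun J (cotensor_theory V J E X) \<rhd> f) = gdom f" "gsrc (tau_vfun J (cotensor_theory V J E X) \<rhd> f) = gsrc f" "gtgt (tau_vfun J (cotensor_theory V J E X) \<rhd> f) = gtgt f"
proof -
  have o: "gsrc f \<in> J" "gtgt f \<in> J" using Jop_gel assms by auto
  let ?h = "Gel (gsrc f) (gtgt f) (garr (tau_fun V J E X \<rhd> f))"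
  have e: "tau_vfun J (cotensor_theory V J E X) \<rhd> f = ?h" using o by (simp add: gmap_def tau_vfun_def cotensor_theory_simps)
  note T = tau_fun_gel(1,2)[OF assms]
  note H = incl_full[OF T(1), of "gsrc f" "gtgt f"]
  show "incl V J E X \<rhd> (tau_vfun J (cotensor_theory V J E X) \<rhd> f) = tau_fun V J E X \<rhd> f" "is_gel (cotensor_theory V J E X) (tau_vfun J (cotensor_theory V J E X) \<rhd> f)"
    "gdom (tau_vfun J (cotensor_theory V J E X) \<rhd> f) = gdom f" "gsrc (tau_vfun J (cotensor_theory V J E X) \<rhd> f) = gsrc f" "gtgt (tau_vfun J (cotensor_theory V J E X) \<rhd> f) = gtgt f"
    using H T o unfolding e by simp_all
qed

text \<open>Checked after the faithful \<open>incl\<close>, where it is the functoriality of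
  [-, X].\<close>

lemma tau_vfun_functor: "vfunctor V Jop (cotensor_theory V J E X) (tau_vfun J (cotensor_theory V J E X))"
proof (rule vfunctorI[OF Jop_simps(3) cotensor_theory_vcategory])
  let ?F = "tau_vfun J (cotensor_theory V J E X)"
  have TT: "vfunctor V Jop E (tau_fun V J E X)" by (rule tau_fun_functor)
  have I: "FO (incl V J E X) j = Cot E j X" if "j \<in> J" for j using that by (simp add: incl_def)
  show "FO ?F \<in> VObj Jop \<rightarrow>\<^sub>E VObj (cotensor_theory V J E X)" by (auto simp: tau_vfun_def cotensor_theory_simps)
  show "FH ?F \<in> VObj Jop \<rightarrow>\<^sub>E VObj Jop \<rightarrow>\<^sub>E Arr V"
    using vfunctor_typing(2)[OF TT] by (auto simp: tau_vfun_def cotensor_theory_simps PiE_iff extensional_def cotensor_theory_def tau_fun_def)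
  show "Dom V (FH ?F a b) = VHom Jop a b" "Cod V (FH ?F a b) = VHom (cotensor_theory V J E X) (FO ?F a) (FO ?F b)"
    if "a \<in> VObj Jop" "b \<in> VObj Jop" for a b
    using that vfunctor_typing(3,4)[OF TT, of a b] by (simp_all add: tau_vfun_def cotensor_theory_simps)
  show "?F \<rhd> gid Jop a = gid (cotensor_theory V J E X) (FO ?F a)" if "a \<in> VObj Jop" for a
  proof (rule incl_inj)
    have a: "a \<in> J" using that by simp
    have g: "is_gel Jop (gid Jop a)" using a by simp
    have f: "FO ?F a = a" using a by (simp add: tau_vfun_def)
    show "incl V J E X \<rhd> ?F \<rhd> gid Jop a = incl V J E X \<rhd> gid (cotensor_theory V J E X) (FO ?F a)"
      using incl_tau(1)[OF g] gmap_gid[OF incl_functor, of a] gmap_gid[OF TT, of a] a f I by (simp add: cotensor_theory_simps)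
    show "is_gel (cotensor_theory V J E X) (?F \<rhd> gid Jop a)" "gsrc (?F \<rhd> gid Jop a) = gsrc (gid (cotensor_theory V J E X) (FO ?F a))"
      "gtgt (?F \<rhd> gid Jop a) = gtgt (gid (cotensor_theory V J E X) (FO ?F a))" "is_gel (cotensor_theory V J E X) (gid (cotensor_theory V J E X) (FO ?F a))"
      using incl_tau[OF g] f cotensor_theory_vcategory a by (simp_all add: cotensor_theory_simps)
  qed
  show "?F \<rhd> (g \<odot>[Jop] f) = (?F \<rhd> g) \<odot>[cotensor_theory V J E X] (?F \<rhd> f)"
    if a: "is_gel Jop f" "is_gel Jop g" "gsrc g = gtgt f" for f g
  proof (rule incl_inj)
    have gf: "is_gel Jop (g \<odot>[Jop] f)" using a by simp
    note G = incl_tau[OF a(1)] incl_tau[OF a(2)] incl_tau[OF gf]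
    show "incl V J E X \<rhd> ?F \<rhd> (g \<odot>[Jop] f) = incl V J E X \<rhd> ((?F \<rhd> g) \<odot>[cotensor_theory V J E X] (?F \<rhd> f))"
      using G a gmap_gcomp[OF incl_functor G(2,7)] gmap_gcomp[OF TT a] by simp
  qed (use a incl_tau[OF a(1)] incl_tau[OF a(2)] incl_tau[of "g \<odot>[Jop] f"] cotensor_theory_vcategory in simp_all)
qed

text \<open>Cotensors in the opposite of J are isomorphisms j \<otimes> c \<cong> p by
  \<open>hat_cot_iso\<close>; [-, X] makes them into iterated cotensors in \<open>E\<close>, and
  \<open>incl\<close> reflects these.\<close>

lemma cotensor_theory_is_theory: "is_theory V J (cotensor_theory V J E X)"
  unfolding is_theory_def
proof (intro conjI cotensor_theory_vcategory tau_vfun_functor cotensor_theory_simps(1))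
  have v: "vcategory V E" by (rule cotensored_vcat[OF E])
  show "VHom (cotensor_theory V J E X) \<in> J \<rightarrow>\<^sub>E J \<rightarrow>\<^sub>E Obj V" "VComp (cotensor_theory V J E X) \<in> J \<rightarrow>\<^sub>E J \<rightarrow>\<^sub>E J \<rightarrow>\<^sub>E Arr V" "VId (cotensor_theory V J E X) \<in> J \<rightarrow>\<^sub>E Arr V"
    using v by (auto simp: cotensor_theory_def)
  show "preserves_cotensors V J (arity_op V J) (cotensor_theory V J E X) (tau_vfun J (cotensor_theory V J E X))"
    unfolding preserves_cotensors_def
  proof (intro ballI allI impI)
    fix j c p \<gamma> assume j: "j \<in> J" and "is_cotensor V (arity_op V J) j c p \<gamma>"
    then have k: "is_cot Jop (Gel p c \<gamma>)" and d: "Dom V \<gamma> = j" by (simp_all add: is_cotensor_iff)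
    have g: "is_gel Jop (Gel p c \<gamma>)" by (rule is_cot_gel[OF k])
    have "is_iso V (hat (Gel p c \<gamma>))" by (rule hat_cot_iso[OF k]) (simp add: d j)
    then have "is_cot E (tau_fun V J E X \<rhd> Gel p c \<gamma>)" by (rule tau_fun_cot[OF g])
    then have "is_cot (cotensor_theory V J E X) (tau_vfun J (cotensor_theory V J E X) \<rhd> Gel p c \<gamma>)"
      using incl_tau(1,2)[OF g] by (intro incl_reflects_cot) simp_all
    then show "is_cotensor V (cotensor_theory V J E X) j (FO (tau_vfun J (cotensor_theory V J E X)) c) (FO (tau_vfun J (cotensor_theory V J E X)) p) (FH (tau_vfun J (cotensor_theory V J E X)) p c \<cdot> \<gamma>)"
      using incl_tau(3)[OF g] d by (simp add: is_cotensor_iff gmap_def)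
  qed
qed

end

end

section \<open>Algebras and ends\<close>

context arity_system
begin

lemma theory_facts:
  assumes "is_theory V J T"
  shows "vcategory V T" "VObj T = J" "vfunctor V Jop T (tau_vfun J T)"
    "preserves_cotensors V J Jop T (tau_vfun J T)"
  using assms by (simp_all add: is_theory_def)

lemma preserves_cot:
  assumes "preserves_cotensors V J C D F" "is_cot C \<kappa>" "gdom \<kappa> \<in> J"
  shows "is_cot D (F \<rhd> \<kappa>)"
proof -
  have "is_cotensor V D (gdom \<kappa>) (FO F (gtgt \<kappa>)) (FO F (gsrc \<kappa>)) (FH F (gsrc \<kappa>) (gtgt \<kappa>) \<cdot> garr \<kappa>)"
    using assms unfolding preserves_cotensors_def is_cot_def by blast
  then show ?thesis by (simp add: is_cotensor_iff gmap_def)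
qed

lemma preserves_cotI:
  assumes F: "vfunctor V C D F" and p: "\<And>\<kappa>. is_cot C \<kappa> \<Longrightarrow> gdom \<kappa> \<in> J \<Longrightarrow> is_cot D (F \<rhd> \<kappa>)"
  shows "preserves_cotensors V J C D F"
  unfolding preserves_cotensors_def
proof (intro ballI allI impI)
  fix j c p' \<gamma> assume j: "j \<in> J" and "is_cotensor V C j c p' \<gamma>"
  then have k: "is_cot C (Gel p' c \<gamma>)" "Dom V \<gamma> = j" by (simp_all add: is_cotensor_iff)
  show "is_cotensor V D j (FO F c) (FO F p') (FH F p' c \<cdot> \<gamma>)"
    using p[OF k(1)] k j gmap_typing(2)[OF F is_cot_gel[OF k(1)]]
    by (simp add: is_cotensor_iff gmap_def)
qed

text \<open>In the opposite of J every j is the cotensor [j, \<one>]; its counit corresponds to the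
  right unitor j \<otimes> \<one> \<rightarrow> j.\<close>

definition arity_cou :: "'o \<Rightarrow> ('o, 'a) gel"
  where "arity_cou j = unhat j \<one> j (RUnit V j)"

lemma arity_cou:
  assumes "j \<in> J"
  shows "is_gel Jop (arity_cou j)" "gdom (arity_cou j) = j" "hat (arity_cou j) = RUnit V j"
    "gsrc (arity_cou j) = j" "gtgt (arity_cou j) = \<one>" "is_cot Jop (arity_cou j)"
proof -
  show 1: "is_gel Jop (arity_cou j)" "gdom (arity_cou j) = j" "hat (arity_cou j) = RUnit V j"
    "gsrc (arity_cou j) = j" "gtgt (arity_cou j) = \<one>"
    unfolding arity_cou_def by (rule unhat; use assms in simp)+
  show "is_cot Jop (arity_cou j)" by (rule Jop_cotI) (use 1 assms in simp_all)
qed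

lemma arity_cou_unit: "arity_cou \<one> = gid Jop \<one>"
  by (rule hat_inj) (use arity_cou[of \<one>] in \<open>simp_all add: hat_gid lunit_unit\<close>)

text \<open>The analogue of \<open>tau_fun_gel\<close> inside \<open>Jop\<close>, where
  \<open>runit_ten\<close> removes the associator. Its image in a theory gives the compatibility of
  the unit with the structure functors.\<close>

lemma arity_cou_gcomp:
  assumes f: "is_gel Jop f"
  shows "arity_cou (gtgt f) \<odot>[Jop] f = arity_cou (gsrc f) \<lhd> hat f \<cdot> Sym V (gtgt f) (gdom f)"
proof (rule hat_inj)
  let ?j = "gsrc f" and ?k = "gtgt f" and ?y = "gdom f"
  have o: "?j \<in> J" "?k \<in> J" "?y \<in> Obj V" using Jop_gel f by auto
  note K = arity_cou[OF o(2)] and L = arity_cou[OF o(1)]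
  have "hat (arity_cou ?k \<odot>[Jop] f) = hat f \<cdot> (((Ident V ?y \<boxtimes> RUnit V ?k) \<cdot> Assoc V ?y ?k \<one>) \<cdot> (Sym V ?k ?y \<boxtimes> Ident V \<one>))"
    using hat_gcomp[OF f K(1)] K o f by simp
  also have "\<dots> = hat f \<cdot> (RUnit V (?y \<otimes> ?k) \<cdot> (Sym V ?k ?y \<boxtimes> Ident V \<one>))"
    unfolding runit_ten[OF o(3) J_simps(1)[OF o(2)]] ..
  also have "\<dots> = hat (arity_cou ?j \<lhd> hat f \<cdot> Sym V ?k ?y)"
    using o L f by (simp add: runit_nat hat_reindex)
  finally show "hat (arity_cou ?k \<odot>[Jop] f) = hat (arity_cou ?j \<lhd> hat f \<cdot> Sym V ?k ?y)" .
  show "is_gel Jop (arity_cou ?k \<odot>[Jop] f)" "is_gel Jop (arity_cou ?j \<lhd> hat f \<cdot> Sym V ?k ?y)"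
    "gsrc (arity_cou ?k \<odot>[Jop] f) = gsrc (arity_cou ?j \<lhd> hat f \<cdot> Sym V ?k ?y)"
    "gtgt (arity_cou ?k \<odot>[Jop] f) = gtgt (arity_cou ?j \<lhd> hat f \<cdot> Sym V ?k ?y)"
    "gdom (arity_cou ?k \<odot>[Jop] f) = gdom (arity_cou ?j \<lhd> hat f \<cdot> Sym V ?k ?y)"
    using f K L o by simp_all
qed

text \<open>The structure arrow \<open>j \<rightarrow> T(j, I)\<close> by which the paper presents a theory.\<close>

definition theory_cou :: "('o, 'a) jtheory \<Rightarrow> 'o \<Rightarrow> ('o, 'a) gel"
  where "theory_cou T j = tau_vfun J T \<rhd> arity_cou j"

lemma tau_FO: "j \<in> J \<Longrightarrow> FO (tau_vfun J T) j = j"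
  by (simp add: tau_vfun_def)

lemma theory_cou:
  assumes T: "is_theory V J T" and j: "j \<in> J"
  shows "is_gel T (theory_cou T j)" "gdom (theory_cou T j) = j" "gsrc (theory_cou T j) = j" "gtgt (theory_cou T j) = \<one>" "is_cot T (theory_cou T j)"
proof -
  note F = theory_facts[OF T] and K = arity_cou[OF j]
  show "is_gel T (theory_cou T j)" "gdom (theory_cou T j) = j" "gsrc (theory_cou T j) = j" "gtgt (theory_cou T j) = \<one>"
    unfolding theory_cou_def using K j by (simp_all add: gmap_simps[OF F(3)] tau_FO)
  show "is_cot T (theory_cou T j)"
    unfolding theory_cou_def by (rule preserves_cot[OF F(4) K(6)]) (simp add: K j)
qed

lemma theory_cou_unit:
  assumes T: "is_theory V J T"
  shows "theory_cou T \<one> = gid T \<one>"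
  using gmap_gid[OF theory_facts(3)[OF T], of \<one>] by (simp add: theory_cou_def arity_cou_unit tau_FO)

end

section \<open>Wedges and the hom-objects of the category of algebras\<close>

locale commutants = arity_system V J for V :: "('o, 'a) smc_category" (structure) and J +
  fixes C :: "('o, 'a, 'c) cvcat"
  assumes adm: "admissible V J C"
begin

abbreviation E where "E T \<equiv> alg_vcat V J C T"
abbreviation alg where "alg T \<equiv> is_algebra V J C T"

lemma cotensored_C: "cotensored C" and C_vcat [simp]: "vcategory V C"
  using adm by (simp_all add: admissible_def cotensored_def)

context
  fixes T :: "('o, 'a) jtheory"
  assumes T: "is_theory V J T"
begin

lemma T_simps [simp]: "VObj T = J" "vcategory V T"
  using theory_facts[OF T] by auto


lemma algebra_props:
  assumes "alg T A"
  shows "vfunctor V T C A" "\<lbrakk>is_cot T \<kappa>; gdom \<kappa> \<in> J\<rbrakk> \<Longrightarrow> is_cot C (A \<rhd> \<kappa>)" "j \<in> J \<Longrightarrow> FO A j \<in> VObj C"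
proof -
  show F: "vfunctor V T C A" using assms by (simp add: is_algebra_def)
  show "\<lbrakk>is_cot T \<kappa>; gdom \<kappa> \<in> J\<rbrakk> \<Longrightarrow> is_cot C (A \<rhd> \<kappa>)"
    by (rule preserves_cot[where C = T]) (use assms in \<open>simp_all add: is_algebra_def\<close>)
  show "j \<in> J \<Longrightarrow> FO A j \<in> VObj C" using vfunctor_typing(1)[OF F] by simp
qed

text \<open>This is \<open>is_wedge\<close> with naturality required at all elements of
  \<open>T\<close> and not only at the generic ones, and with components that remember their source
  and target.\<close>

definition wedge :: "('o, 'c, 'a) vfun \<Rightarrow> ('o, 'c, 'a) vfun \<Rightarrow> 'o \<Rightarrow> ('o \<Rightarrow> ('c, 'a) gel) \<Rightarrow> bool"
  where "wedge A B x l \<longleftrightarrow> x \<in> Obj V \<and>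
    (\<forall>j\<in>J. is_gel C (l j) \<and> gsrc (l j) = FO A j \<and> gtgt (l j) = FO B j \<and> gdom (l j) = x) \<and>
    (\<forall>t. is_gel T t \<longrightarrow> l (gtgt t) \<odot>[C] (A \<rhd> t) = (B \<rhd> t) \<odot>[C] l (gsrc t) \<lhd> Sym V x (gdom t))"

lemma T_gel: "is_gel T t \<Longrightarrow> gsrc t \<in> J" "is_gel T t \<Longrightarrow> gtgt t \<in> J"
  using gel_simps(1,2)[of T t] by simp_all

text \<open>Passage from generic elements to all elements: both sides of the naturality equation are
  stable under reindexing.\<close>

lemma wedge_iff:
  assumes A: "alg T A" and B: "alg T B" and l: "\<And>j. j \<in> J \<Longrightarrow> l j = Gel (FO A j) (FO B j) (m j)"
  shows "wedge A B x l \<longleftrightarrow> is_wedge V C T A B x m"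
proof -
  note a = algebra_props(1)[OF A] and b = algebra_props(1)[OF B]
  let ?t = "\<lambda>j k. Gel j k (Ident V (VHom T j k))"
  have t: "is_gel T (?t j k)" if "j \<in> J" "k \<in> J" for j k using that by (simp add: is_gel_Gel)
  have ty: "(\<forall>j\<in>J. is_gel C (l j) \<and> gsrc (l j) = FO A j \<and> gtgt (l j) = FO B j \<and> gdom (l j) = x) \<longleftrightarrow>
     (\<forall>j\<in>J. m j \<in> Hom V x (VHom C (FO A j) (FO B j)))"
    using l algebra_props(3)[OF A] algebra_props(3)[OF B] by (auto simp: is_gel_Gel Hom_def)
  show ?thesis
  proof (cases "x \<in> Obj V \<and> (\<forall>j\<in>J. m j \<in> Hom V x (VHom C (FO A j) (FO B j)))")
    case True
    then have x: "x \<in> Obj V" and m: "\<And>j. j \<in> J \<Longrightarrow> m j \<in> Arr V" "\<And>j. j \<in> J \<Longrightarrow> Dom V (m j) = x"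
        "\<And>j. j \<in> J \<Longrightarrow> Cod V (m j) = VHom C (FO A j) (FO B j)" by (auto simp: Hom_def)
    have lg: "is_gel C (l j)" "gsrc (l j) = FO A j" "gtgt (l j) = FO B j" "gdom (l j) = x" if "j \<in> J" for j
      using True that ty by auto
    let ?N = "\<lambda>t. l (gtgt t) \<odot>[C] (A \<rhd> t) = (B \<rhd> t) \<odot>[C] l (gsrc t) \<lhd> Sym V x (gdom t)"
    have e: "?N (?t j k) \<longleftrightarrow> VComp C (FO A j) (FO A k) (FO B k) \<cdot> (m k \<boxtimes> FH A j k) =
      VComp C (FO A j) (FO B j) (FO B k) \<cdot> (FH B j k \<boxtimes> m j) \<cdot> Sym V x (VHom T j k)"
      if o: "j \<in> J" "k \<in> J" for j k
      using o x m l algebra_props(3)[OF A] algebra_props(3)[OF B]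
      by (simp add: gmap_def gcomp_def reindex_def vfunctor_typing[OF a] vfunctor_typing[OF b])
    have "?N t" if t': "is_gel T t" and n: "?N (?t (gsrc t) (gtgt t))" for t
    proof -
      let ?j = "gsrc t" and ?k = "gtgt t"
      let ?h = "?t ?j ?k"
      have o: "?j \<in> J" "?k \<in> J" using T_gel t' by auto
      have h: "is_gel T ?h" "?h \<lhd> garr t = t" "gdom ?h = VHom T ?j ?k" using t[OF o] gel_generic[OF t'] o by auto
      have u: "garr t \<in> Arr V" "Cod V (garr t) = gdom ?h" "Dom V (garr t) = gdom t" using t' h by (simp_all add: gdom_def)
      have "l ?k \<odot>[C] (A \<rhd> (?h \<lhd> garr t)) = l ?k \<odot>[C] (A \<rhd> ?h) \<lhd> Ident V x \<boxtimes> garr t"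
        using h(1) u lg o x by (simp add: gmap_simps[OF a])
      also have "\<dots> = (B \<rhd> ?h) \<odot>[C] l ?j \<lhd> Sym V x (VHom T ?j ?k) \<cdot> (Ident V x \<boxtimes> garr t)"
        using n h(1) u lg o x by (simp add: gmap_simps[OF b] del: gcomp_reindex_left)
      also have "\<dots> = (B \<rhd> (?h \<lhd> garr t)) \<odot>[C] l ?j \<lhd> Sym V x (gdom t)"
        using h(1) u lg o x gel_simps(4)[OF t'] by (simp add: gmap_simps[OF b] sym_nat)
      finally show ?thesis unfolding h(2) .
    qed
    then have "(\<forall>t. is_gel T t \<longrightarrow> ?N t) \<longleftrightarrow> (\<forall>j\<in>J. \<forall>k\<in>J. ?N (?t j k))" using t T_gel by blast
    then show ?thesis unfolding wedge_def is_wedge_def T_simps(1) using True ty e by simp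
  next
    case False
    then show ?thesis unfolding wedge_def is_wedge_def T_simps(1) using ty by blast
  qed
qed

lemma alg_end:
  assumes A: "alg T A" and B: "alg T B"
  shows "is_end V C T A B (alg_hom V C T A B) (alg_ev V C T A B)"
proof -
  obtain e l where "is_end V C T A B e l" using adm T A B unfolding admissible_def by blast
  then have "case (e, l) of (e, l) \<Rightarrow> is_end V C T A B e l" by simp
  then have "case chosen_end V C T A B of (e, l) \<Rightarrow> is_end V C T A B e l"
    unfolding chosen_end_def by (rule someI)
  then show ?thesis by (simp add: alg_hom_def alg_ev_def case_prod_beta)
qed

lemma E_simps [simp]: "VObj (E T) = {A. alg T A}" "VHom (E T) A B = alg_hom V C T A B" "Cot (E T) v A = pointwise_cot V C T v A"
  by (simp_all add: alg_vcat_def)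

text \<open>Evaluation at \<open>j\<close> as a V-functor from \<open>E T\<close> to
  \<open>C\<close>; on homs it is the projection of the end.\<close>

definition ev_fun :: "'o \<Rightarrow> (('o, 'c, 'a) vfun, 'c, 'a) vfun"
  where "ev_fun j = \<lparr>FO = (\<lambda>A\<in>{A. alg T A}. FO A j), FH = (\<lambda>A\<in>{A. alg T A}. \<lambda>B\<in>{A. alg T A}. alg_ev V C T A B j)\<rparr>"

lemma ev_fun_FO [simp]: "alg T A \<Longrightarrow> FO (ev_fun j) A = FO A j"
  by (simp add: ev_fun_def)

lemma alg_ev_typing:
  assumes A: "alg T A" and B: "alg T B" 
  shows "alg_hom V C T A B \<in> Obj V" "j \<in> J \<Longrightarrow> alg_ev V C T A B j \<in> Arr V"
    "j \<in> J \<Longrightarrow> Dom V (alg_ev V C T A B j) = alg_hom V C T A B"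
    "j \<in> J \<Longrightarrow> Cod V (alg_ev V C T A B j) = VHom C (FO A j) (FO B j)"
  using alg_end[OF A B] by (auto simp: is_end_def is_wedge_def Hom_def)

text \<open>A wedge composed with an arrow is again a wedge, so the uniqueness part of the end
  applies to \<open>h\<close> and \<open>h'\<close>: the projections are jointly monic.\<close>

lemma alg_hom_ext:
  assumes A: "alg T A" and B: "alg T B" and h: "h \<in> Arr V" "h' \<in> Arr V" "Cod V h = alg_hom V C T A B"
    "Cod V h' = alg_hom V C T A B" "Dom V h = Dom V h'"
    and e: "\<And>j. j \<in> J \<Longrightarrow> alg_ev V C T A B j \<cdot> h = alg_ev V C T A B j \<cdot> h'"
  shows "h = h'"
proof -
  let ?m = "\<lambda>j. alg_ev V C T A B j \<cdot> h"
  note t = alg_ev_typing[OF A B]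
  let ?l = "\<lambda>j. Gel (FO A j) (FO B j) (alg_ev V C T A B j)"
  have w: "wedge A B (alg_hom V C T A B) ?l"
    using alg_end[OF A B] wedge_iff[OF A B, of ?l "alg_ev V C T A B"] by (simp add: is_end_def)
  note a = algebra_props(1)[OF A] and b = algebra_props(1)[OF B]
  have "wedge A B (Dom V h) (\<lambda>j. ?l j \<lhd> h)"
    unfolding wedge_def
  proof (intro conjI allI impI ballI)
    fix j assume j: "j \<in> J"
    show "is_gel C (?l j \<lhd> h)" "gsrc (?l j \<lhd> h) = FO A j" "gtgt (?l j \<lhd> h) = FO B j" "gdom (?l j \<lhd> h) = Dom V h"
      using t j h algebra_props(3)[OF A] algebra_props(3)[OF B] by (simp_all add: is_gel_Gel)
  next
    fix s assume s: "is_gel T s"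
    have o: "gsrc s \<in> J" "gtgt s \<in> J" using T_gel s by auto
    have lg: "is_gel C (?l j)" if "j \<in> J" for j using that t algebra_props(3)[OF A] algebra_props(3)[OF B] by (simp add: is_gel_Gel)
    have "(?l (gtgt s) \<lhd> h) \<odot>[C] (A \<rhd> s) = ?l (gtgt s) \<odot>[C] (A \<rhd> s) \<lhd> h \<boxtimes> Ident V (gdom s)"
      using lg o s h t by (simp add: gmap_simps[OF a])
    also have "?l (gtgt s) \<odot>[C] (A \<rhd> s) = (B \<rhd> s) \<odot>[C] ?l (gsrc s) \<lhd> Sym V (alg_hom V C T A B) (gdom s)"
      using w s unfolding wedge_def by blast
    also have "\<dots> \<lhd> h \<boxtimes> Ident V (gdom s) = (B \<rhd> s) \<odot>[C] (?l (gsrc s) \<lhd> h) \<lhd> Sym V (Dom V h) (gdom s)"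
      using lg o s h t by (simp add: gmap_simps[OF b] sym_nat)
    finally show "(?l (gtgt s) \<lhd> h) \<odot>[C] (A \<rhd> s) = (B \<rhd> s) \<odot>[C] (?l (gsrc s) \<lhd> h) \<lhd> Sym V (Dom V h) (gdom s)" .
  qed (use h in simp)
  then have "is_wedge V C T A B (Dom V h) ?m"
    using wedge_iff[OF A B, of "\<lambda>j. ?l j \<lhd> h" ?m] by (simp add: reindex_def)
  then have "\<exists>!k. k \<in> Hom V (Dom V h) (alg_hom V C T A B) \<and> (\<forall>j\<in>VObj T. alg_ev V C T A B j \<cdot> k = ?m j)"
    using alg_end[OF A B] unfolding is_end_def by blast
  moreover have "h \<in> Hom V (Dom V h) (alg_hom V C T A B)" "h' \<in> Hom V (Dom V h) (alg_hom V C T A B)"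
    using h by (simp_all add: Hom_def)
  moreover have "\<forall>j\<in>VObj T. alg_ev V C T A B j \<cdot> h' = ?m j" using e by simp
  ultimately show ?thesis by blast
qed

lemma into_alg_hom:
  assumes A: "alg T A" and B: "alg T B" and w: "wedge A B x l" and m: "\<And>j. j \<in> J \<Longrightarrow> m j = garr (l j)"
  defines "h \<equiv> into_alg_hom V C T A B x m"
  shows "h \<in> Arr V" "Dom V h = x" "Cod V h = alg_hom V C T A B"
    "j \<in> J \<Longrightarrow> alg_ev V C T A B j \<cdot> h = m j"
    "j \<in> J \<Longrightarrow> ev_fun j \<rhd> Gel A B h = l j" "is_gel (E T) (Gel A B h)"
proof -
  have lm: "l j = Gel (FO A j) (FO B j) (m j)" if "j \<in> J" for j
    using that m w by (simp add: wedge_def gel.expand)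
  have "is_wedge V C T A B x m" using wedge_iff[OF A B lm] w by simp
  then have "\<exists>!k. k \<in> Hom V x (alg_hom V C T A B) \<and> (\<forall>j\<in>VObj T. alg_ev V C T A B j \<cdot> k = m j)"
    using alg_end[OF A B] unfolding is_end_def by blast
  from theI'[OF this] show h: "h \<in> Arr V" "Dom V h = x" "Cod V h = alg_hom V C T A B"
    and e: "j \<in> J \<Longrightarrow> alg_ev V C T A B j \<cdot> h = m j" for j
    unfolding h_def into_alg_hom_def by (auto simp: Hom_def)
  show "j \<in> J \<Longrightarrow> ev_fun j \<rhd> Gel A B h = l j"
    using e A B lm by (simp add: gmap_def ev_fun_def)
  show "is_gel (E T) (Gel A B h)" using h A B by (simp add: is_gel_Gel)
qed

lemma wedge_comp:
  assumes A: "alg T A" and B: "alg T B" and D: "alg T D" and l: "wedge A B x l" and m: "wedge B D y m"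
  shows "wedge A D (y \<otimes> x) (\<lambda>j. m j \<odot>[C] l j)"
  unfolding wedge_def
proof (intro conjI ballI allI impI)
  note a = algebra_props(1)[OF A] and b = algebra_props(1)[OF B] and d = algebra_props(1)[OF D]
  have xy [simp]: "x \<in> Obj V" "y \<in> Obj V" using l m by (simp_all add: wedge_def)
  then show "y \<otimes> x \<in> Obj V" by simp
  have lg: "is_gel C (l j)" "gsrc (l j) = FO A j" "gtgt (l j) = FO B j" "gdom (l j) = x" 
    and mg: "is_gel C (m j)" "gsrc (m j) = FO B j" "gtgt (m j) = FO D j" "gdom (m j) = y" if "j \<in> J" for j
    using l m that by (auto simp: wedge_def)
  show "is_gel C (m j \<odot>[C] l j)" "gsrc (m j \<odot>[C] l j) = FO A j" "gtgt (m j \<odot>[C] l j) = FO D j" "gdom (m j \<odot>[C] l j) = y \<otimes> x"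
    if "j \<in> J" for j using lg mg that by simp_all
  fix t assume t: "is_gel T t"
  let ?j = "gsrc t" and ?k = "gtgt t" and ?t = "gdom t"
  have o: "?j \<in> J" "?k \<in> J" using T_gel t by auto
  have td: "?t \<in> Obj V" using t by simp
  have ln: "l ?k \<odot>[C] (A \<rhd> t) = (B \<rhd> t) \<odot>[C] l ?j \<lhd> Sym V x ?t" 
    and mn: "m ?k \<odot>[C] (B \<rhd> t) = (D \<rhd> t) \<odot>[C] m ?j \<lhd> Sym V y ?t" using l m t by (auto simp: wedge_def)
  have tA: "is_gel C (A \<rhd> t)" "gdom (A \<rhd> t) = ?t" "is_gel C (B \<rhd> t)" "gdom (B \<rhd> t) = ?t"
     "is_gel C (D \<rhd> t)" "gdom (D \<rhd> t) = ?t"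
    using gmap_typing[OF a t] gmap_typing[OF b t] gmap_typing[OF d t] by auto
  note lgm = lg[OF o(1)] lg[OF o(2)] mg[OF o(1)] mg[OF o(2)]
  \<comment> \<open>Naturality of \<open>l\<close> and of \<open>m\<close> contribute one symmetry
    each; \<open>hexagon_right\<close> combines them into the exchange of
    \<open>y \<otimes> x\<close> with the domain of \<open>t\<close>.\<close>
  have "(m ?k \<odot>[C] l ?k) \<odot>[C] (A \<rhd> t) = m ?k \<odot>[C] (l ?k \<odot>[C] (A \<rhd> t)) \<lhd> Assoc V y x ?t"
    using lgm tA td by (simp add: gcomp_assoc)
  also have "\<dots> = m ?k \<odot>[C] ((B \<rhd> t) \<odot>[C] l ?j) \<lhd> (Ident V y \<boxtimes> Sym V x ?t) \<cdot> Assoc V y x ?t"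
    unfolding ln using lgm tA td by simp
  also have "m ?k \<odot>[C] ((B \<rhd> t) \<odot>[C] l ?j) = (m ?k \<odot>[C] (B \<rhd> t)) \<odot>[C] l ?j \<lhd> inverse_arrow V (Assoc V y ?t x)"
    using lgm tA td by (simp add: gcomp_assoc)
  also have "\<dots> = (D \<rhd> t) \<odot>[C] (m ?j \<odot>[C] l ?j) \<lhd> Assoc V ?t y x \<cdot> (Sym V y ?t \<boxtimes> Ident V x) \<cdot> inverse_arrow V (Assoc V y ?t x)"
    unfolding mn using lgm tA td by (simp add: gcomp_assoc)
  also have "\<dots> \<lhd> (Ident V y \<boxtimes> Sym V x ?t) \<cdot> Assoc V y x ?t = (D \<rhd> t) \<odot>[C] (m ?j \<odot>[C] l ?j) \<lhd> Sym V (y \<otimes> x) ?t"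
    using lgm tA td by (simp add: hexagon_right[of y x ?t])
  finally show "(m ?k \<odot>[C] l ?k) \<odot>[C] (A \<rhd> t) = (D \<rhd> t) \<odot>[C] (m ?j \<odot>[C] l ?j) \<lhd> Sym V (y \<otimes> x) ?t" .
qed

lemma wedge_gid:
  assumes A: "alg T A"
  shows "wedge A A \<one> (\<lambda>j. gid C (FO A j))"
  unfolding wedge_def
proof (intro conjI ballI allI impI)
  note a = algebra_props(1)[OF A]
  fix t assume t: "is_gel T t"
  have o: "gsrc t \<in> J" "gtgt t \<in> J" using T_gel t by auto
  show "gid C (FO A (gtgt t)) \<odot>[C] (A \<rhd> t) = (A \<rhd> t) \<odot>[C] gid C (FO A (gsrc t)) \<lhd> Sym V \<one> (gdom t)"
    using gmap_typing[OF a t] t by (simp add: runit_sym)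
qed (use algebra_props(3)[OF A] in simp_all)

end

end

section \<open>The V-category of algebras and its pointwise cotensors\<close>

context commutants
begin

context
  fixes T :: "('o, 'a) jtheory"
  assumes T: "is_theory V J T"
begin


lemmas [simp] = T_simps[OF T] E_simps[OF T] ev_fun_FO[OF T]
lemmas algebraD = algebra_props[OF T]

lemma E_gel:
  assumes "is_gel (E T) f"
  shows "alg T (gsrc f)" "alg T (gtgt f)" "garr f \<in> Arr V" "Dom V (garr f) = gdom f" "gdom f \<in> Obj V"
    "Cod V (garr f) = alg_hom V C T (gsrc f) (gtgt f)"
  using gel_simps[OF assms] by (simp_all add: gdom_def)

lemma ev_app: "\<lbrakk>alg T (gsrc f); alg T (gtgt f)\<rbrakk> \<Longrightarrow>
  ev_fun T j \<rhd> f = Gel (FO (gsrc f) j) (FO (gtgt f) j) (alg_ev V C T (gsrc f) (gtgt f) j \<cdot> garr f)"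
  by (simp add: gmap_def ev_fun_def[OF T])

lemma ev_gel:
  assumes f: "is_gel (E T) f" and j: "j \<in> J"
  shows "is_gel C (ev_fun T j \<rhd> f)" "gdom (ev_fun T j \<rhd> f) = gdom f" "garr (ev_fun T j \<rhd> f) \<in> Arr V"
  using E_gel[OF f] alg_ev_typing[OF T E_gel(1,2)[OF f]] algebraD(3) j
  by (simp_all add: ev_app is_gel_Gel)

lemma ev_ext:
  assumes "is_gel (E T) f" "is_gel (E T) g" "gsrc f = gsrc g" "gtgt f = gtgt g" "gdom f = gdom g"
    "\<And>j. j \<in> J \<Longrightarrow> ev_fun T j \<rhd> f = ev_fun T j \<rhd> g"
  shows "f = g"
proof (rule gel_eqI)
  note F = E_gel[OF assms(1)] and G = E_gel[OF assms(2)]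
  show "garr f = garr g"
  proof (rule alg_hom_ext[OF T F(1,2)])
    show "alg_ev V C T (gsrc f) (gtgt f) j \<cdot> garr f = alg_ev V C T (gsrc f) (gtgt f) j \<cdot> garr g" if "j \<in> J" for j
      using assms(6)[OF that] F G assms(3,4) by (simp add: ev_app)
  qed (use F G assms(3-5) in simp_all)
qed (use assms in simp_all)

text \<open>An element of a hom-object of \<open>E T\<close> amounts to a wedge over its domain.
  This is one direction of the correspondence, and \<open>ev_lift\<close> is the other.\<close>

lemma ev_wedge:
  assumes f: "is_gel (E T) f"
  shows "wedge T (gsrc f) (gtgt f) (gdom f) (\<lambda>j. ev_fun T j \<rhd> f)"
proof -
  let ?A = "gsrc f" and ?B = "gtgt f"
  note F = E_gel[OF f]
  note t = alg_ev_typing[OF T F(1,2)]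
  let ?l = "\<lambda>j. Gel (FO ?A j) (FO ?B j) (alg_ev V C T ?A ?B j)"
  have w: "wedge T ?A ?B (alg_hom V C T ?A ?B) ?l"
    using alg_end[OF T F(1,2)] wedge_iff[OF T F(1,2), of ?l "alg_ev V C T ?A ?B"] by (simp add: is_end_def)
  have lg: "is_gel C (?l j)" if "j \<in> J" for j using that t algebraD(3)[OF F(1)] algebraD(3)[OF F(2)] by (simp add: is_gel_Gel)
  have e: "ev_fun T j \<rhd> f = ?l j \<lhd> garr f" for j using F by (simp add: ev_app reindex_def)
  show ?thesis
    unfolding wedge_def[OF T]
  proof (intro conjI allI impI ballI)
    fix j assume j: "j \<in> J"
    show "is_gel C (ev_fun T j \<rhd> f)" "gsrc (ev_fun T j \<rhd> f) = FO ?A j" "gtgt (ev_fun T j \<rhd> f) = FO ?B j" "gdom (ev_fun T j \<rhd> f) = gdom f"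
      using ev_gel[OF f j] F by simp_all
  next
    fix s assume s: "is_gel T s"
    have o: "gsrc s \<in> J" "gtgt s \<in> J" using T_gel[OF T s] by auto
    note a = gmap_simps[OF algebraD(1)[OF F(1)]] and b = gmap_simps[OF algebraD(1)[OF F(2)]]
    have "(?l (gtgt s) \<lhd> garr f) \<odot>[C] (?A \<rhd> s) = ?l (gtgt s) \<odot>[C] (?A \<rhd> s) \<lhd> garr f \<boxtimes> Ident V (gdom s)"
      using lg o s F t by (simp add: a)
    also have "?l (gtgt s) \<odot>[C] (?A \<rhd> s) = (?B \<rhd> s) \<odot>[C] ?l (gsrc s) \<lhd> Sym V (alg_hom V C T ?A ?B) (gdom s)"
      using w s unfolding wedge_def[OF T] by blast
    also have "\<dots> \<lhd> garr f \<boxtimes> Ident V (gdom s) = (?B \<rhd> s) \<odot>[C] (?l (gsrc s) \<lhd> garr f) \<lhd> Sym V (gdom f) (gdom s)"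
      using lg o s F t by (simp add: b sym_nat)
    finally show "(ev_fun T (gtgt s) \<rhd> f) \<odot>[C] (?A \<rhd> s) = (?B \<rhd> s) \<odot>[C] (ev_fun T (gsrc s) \<rhd> f) \<lhd> Sym V (gdom f) (gdom s)"
      unfolding e .
  qed (use F in simp)
qed

lemma ev_natural:
  assumes f: "is_gel (E T) f" and t: "is_gel T t"
  shows "(ev_fun T (gtgt t) \<rhd> f) \<odot>[C] (gsrc f \<rhd> t) = (gtgt f \<rhd> t) \<odot>[C] (ev_fun T (gsrc t) \<rhd> f) \<lhd> Sym V (gdom f) (gdom t)"
  using ev_wedge[OF f] t unfolding wedge_def[OF T] by blast

lemma ev_lift:
  assumes A: "alg T A" and B: "alg T B" and w: "wedge T A B x l"
  obtains f where "is_gel (E T) f" "gsrc f = A" "gtgt f = B" "gdom f = x" "\<And>j. j \<in> J \<Longrightarrow> ev_fun T j \<rhd> f = l j"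
proof -
  note L = into_alg_hom[OF T A B w, of "\<lambda>j. garr (l j)", OF refl]
  show thesis by (rule that[OF L(6)]) (use L(2,5) in simp_all)
qed

lemma evcomp:
  assumes A: "alg T A" and B: "alg T B" and D: "alg T D" 
  defines "m \<equiv> VComp (E T) A B D"
  shows "m \<in> Arr V" "Dom V m = alg_hom V C T B D \<otimes> alg_hom V C T A B" "Cod V m = alg_hom V C T A D"
    "j \<in> J \<Longrightarrow> alg_ev V C T A D j \<cdot> m = VComp C (FO A j) (FO B j) (FO D j) \<cdot> (alg_ev V C T B D j \<boxtimes> alg_ev V C T A B j)"
proof -
  let ?g = "\<lambda>A B. Gel A B (Ident V (alg_hom V C T A B))"
  have g: "is_gel (E T) (?g A B)" "is_gel (E T) (?g B D)"
    using A B D alg_ev_typing(1)[OF T] by (simp_all add: is_gel_Gel)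
  have "wedge T A D (alg_hom V C T B D \<otimes> alg_hom V C T A B) (\<lambda>j. (ev_fun T j \<rhd> ?g B D) \<odot>[C] (ev_fun T j \<rhd> ?g A B))"
    using wedge_comp[OF T A B D] ev_wedge[OF g(1)] ev_wedge[OF g(2)] alg_ev_typing(1)[OF T] A B D by simp
  note L = into_alg_hom[OF T A D this, of "\<lambda>j. VComp C (FO A j) (FO B j) (FO D j) \<cdot> (alg_ev V C T B D j \<boxtimes> alg_ev V C T A B j)"]
  have e: "VComp C (FO A j) (FO B j) (FO D j) \<cdot> (alg_ev V C T B D j \<boxtimes> alg_ev V C T A B j) = garr ((ev_fun T j \<rhd> ?g B D) \<odot>[C] (ev_fun T j \<rhd> ?g A B))" if "j \<in> J" for j
    using A B D that alg_ev_typing[OF T A B] alg_ev_typing[OF T B D] by (simp add: gcomp_def ev_app)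
  show "m \<in> Arr V" "Dom V m = alg_hom V C T B D \<otimes> alg_hom V C T A B" "Cod V m = alg_hom V C T A D"
    "j \<in> J \<Longrightarrow> alg_ev V C T A D j \<cdot> m = VComp C (FO A j) (FO B j) (FO D j) \<cdot> (alg_ev V C T B D j \<boxtimes> alg_ev V C T A B j)"
    using L(1-4)[OF e] by (simp_all add: m_def alg_vcat_def)
qed

lemma evid:
  assumes A: "alg T A"
  shows "VId (E T) A \<in> Arr V" "Dom V (VId (E T) A) = \<one>" "Cod V (VId (E T) A) = alg_hom V C T A A"
    "j \<in> J \<Longrightarrow> alg_ev V C T A A j \<cdot> VId (E T) A = VId C (FO A j)"
  using into_alg_hom(1-4)[OF T A A wedge_gid[OF T A], of "\<lambda>j. VId C (FO A j)"]
  by (simp_all add: alg_vcat_def gid_garr)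

text \<open>By \<open>ec\<close> and \<open>ei\<close> composition and identities are pointwise, and
  by \<open>ext\<close> equations may be checked after all evaluations; so the axioms are inherited
  from \<open>C\<close>.\<close>

lemma E_vcategory: "vcategory V (E T)"
proof -
  let ?e = "\<lambda>A B j. Gel (FO A j) (FO B j) (alg_ev V C T A B j)"
  let ?H = "alg_hom V C T"
  note t = alg_ev_typing[OF T]
  have eg: "is_gel C (?e A B j)" if "alg T A" "alg T B" "j \<in> J" for A B j
    using that t algebraD(3) by (simp add: is_gel_Gel)
  have ec: "?e A D j \<lhd> VComp (E T) A B D = ?e B D j \<odot>[C] ?e A B j" if "alg T A" "alg T B" "alg T D" "j \<in> J" for A B D j
    using evcomp(4)[OF that] by (simp add: gcomp_def reindex_def)
  have ei: "?e A A j \<lhd> VId (E T) A = gid C (FO A j)" if "alg T A" "j \<in> J" for A j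
    using evid(4)[OF that] by (simp add: gid_def reindex_def)
  have ext: "h = h'" if "alg T A" "alg T B" "h \<in> Arr V" "h' \<in> Arr V" "Cod V h = ?H A B" "Cod V h' = ?H A B" "Dom V h = Dom V h'"
    "\<And>j. j \<in> J \<Longrightarrow> ?e A B j \<lhd> h = ?e A B j \<lhd> h'" for A B h h'
  proof (rule alg_hom_ext[OF T that(1-7)])
    fix j assume "j \<in> J"
    from that(8)[OF this] show "alg_ev V C T A B j \<cdot> h = alg_ev V C T A B j \<cdot> h'" by (simp add: reindex_def)
  qed
  have assc: "VComp (E T) P Q S \<cdot> (VComp (E T) Q R S \<boxtimes> Ident V (?H P Q)) =
      VComp (E T) P R S \<cdot> (Ident V (?H R S) \<boxtimes> VComp (E T) P Q R) \<cdot> Assoc V (?H R S) (?H Q R) (?H P Q)"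
    (is "?l = ?r") if a: "alg T P" "alg T Q" "alg T R" "alg T S" for P Q R S
  proof (rule ext[OF a(1,4)])
    fix j assume j: "j \<in> J"
    note g = eg[OF a(1,2) j] eg[OF a(1,3) j] eg[OF a(1,4) j] eg[OF a(2,3) j] eg[OF a(2,4) j] eg[OF a(3,4) j]
    note tt = t[OF a(1,2)] t[OF a(1,3)] t[OF a(1,4)] t[OF a(2,3)] t[OF a(2,4)] t[OF a(3,4)]
    note cc = evcomp(1-3)[OF a(1,2,4)] evcomp(1-3)[OF a(2,3,4)] evcomp(1-3)[OF a(1,3,4)] evcomp(1-3)[OF a(1,2,3)]
    have "?e P S j \<lhd> ?l = (?e P S j \<lhd> VComp (E T) P Q S) \<lhd> VComp (E T) Q R S \<boxtimes> Ident V (?H P Q)"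
      using g tt cc j by simp
    also have "\<dots> = (?e Q S j \<lhd> VComp (E T) Q R S) \<odot>[C] ?e P Q j"
      unfolding ec[OF a(1,2,4) j] using g tt cc j by simp
    also have "\<dots> = ?e R S j \<odot>[C] (?e Q R j \<odot>[C] ?e P Q j) \<lhd> Assoc V (?H R S) (?H Q R) (?H P Q)"
      unfolding ec[OF a(2,3,4) j] using g tt cc j by (simp add: gcomp_assoc)
    also have "\<dots> = ?e R S j \<odot>[C] (?e P R j \<lhd> VComp (E T) P Q R) \<lhd> Assoc V (?H R S) (?H Q R) (?H P Q)"
      unfolding ec[OF a(1,2,3) j] ..
    also have "\<dots> = (?e R S j \<odot>[C] ?e P R j) \<lhd> (Ident V (?H R S) \<boxtimes> VComp (E T) P Q R) \<cdot> Assoc V (?H R S) (?H Q R) (?H P Q)"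
      using g tt cc j by simp
    also have "\<dots> = ?e P S j \<lhd> ?r"
      unfolding ec[OF a(1,3,4) j, symmetric] using g tt cc j by simp
    finally show "?e P S j \<lhd> ?l = ?e P S j \<lhd> ?r" .
  qed (use evcomp(1-3) t a in simp_all)
  have lid: "VComp (E T) P Q Q \<cdot> (VId (E T) Q \<boxtimes> Ident V (?H P Q)) = LUnit V (?H P Q)" (is "?l = ?r")
    and rid: "VComp (E T) P P Q \<cdot> (Ident V (?H P Q) \<boxtimes> VId (E T) P) = RUnit V (?H P Q)" (is "?l' = ?r'") if a: "alg T P" "alg T Q" for P Q
  proof -
    note cc = evcomp(1-3)[OF a(1,2,2)] evcomp(1-3)[OF a(1,1,2)] evid(1-3)[OF a(1)] evid(1-3)[OF a(2)]
    note tt = t[OF a(1,2)] t[OF a(1,1)] t[OF a(2,2)]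
    show "?l = ?r"
    proof (rule ext[OF a])
      fix j assume j: "j \<in> J"
      note g = eg[OF a(1,2) j] eg[OF a(1,1) j] eg[OF a(2,2) j]
      have "?e P Q j \<lhd> ?l = (?e P Q j \<lhd> VComp (E T) P Q Q) \<lhd> VId (E T) Q \<boxtimes> Ident V (?H P Q)"
        using g tt cc j by simp
      also have "\<dots> = (?e Q Q j \<lhd> VId (E T) Q) \<odot>[C] ?e P Q j"
        unfolding ec[OF a(1,2,2) j] using g tt cc j by simp
      also have "\<dots> = ?e P Q j \<lhd> ?r" unfolding ei[OF a(2) j] using g tt cc j by simp
      finally show "?e P Q j \<lhd> ?l = ?e P Q j \<lhd> ?r" .
    qed (use cc tt in simp_all)
    show "?l' = ?r'"
    proof (rule ext[OF a])
      fix j assume j: "j \<in> J"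
      note g = eg[OF a(1,2) j] eg[OF a(1,1) j] eg[OF a(2,2) j]
      have "?e P Q j \<lhd> ?l' = (?e P Q j \<lhd> VComp (E T) P P Q) \<lhd> Ident V (?H P Q) \<boxtimes> VId (E T) P"
        using g tt cc j by simp
      also have "\<dots> = ?e P Q j \<odot>[C] (?e P P j \<lhd> VId (E T) P)"
        unfolding ec[OF a(1,1,2) j] using g tt cc j by simp
      also have "\<dots> = ?e P Q j \<lhd> ?r'" unfolding ei[OF a(1) j] using g tt cc j by simp
      finally show "?e P Q j \<lhd> ?l' = ?e P Q j \<lhd> ?r'" .
    qed (use cc tt in simp_all)
  qed
  show ?thesis
    unfolding vcategory_def
    by (simp add: Hom_def assc lid rid evcomp(1-3) evid(1-3) alg_ev_typing(1)[OF T])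
qed

lemmas [simp] = E_vcategory

lemma ev_functor:
  assumes j: "j \<in> J"
  shows "vfunctor V (E T) C (ev_fun T j)"
proof (rule vfunctorI)
  note t = alg_ev_typing[OF T]
  show "FO (ev_fun T j) \<in> VObj (E T) \<rightarrow>\<^sub>E VObj C" "FH (ev_fun T j) \<in> VObj (E T) \<rightarrow>\<^sub>E VObj (E T) \<rightarrow>\<^sub>E Arr V"
    using j t algebraD(3) by (auto simp: ev_fun_def[OF T])
  show "Dom V (FH (ev_fun T j) a b) = VHom (E T) a b" "Cod V (FH (ev_fun T j) a b) = VHom C (FO (ev_fun T j) a) (FO (ev_fun T j) b)"
    if "a \<in> VObj (E T)" "b \<in> VObj (E T)" for a b
    using that j t by (simp_all add: ev_fun_def[OF T])
  show "ev_fun T j \<rhd> gid (E T) a = gid C (FO (ev_fun T j) a)" if "a \<in> VObj (E T)" for a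
    using that evid(4)[of a j] j by (simp add: ev_app gid_def)
  show "ev_fun T j \<rhd> (g \<odot>[(E T)] f) = (ev_fun T j \<rhd> g) \<odot>[C] (ev_fun T j \<rhd> f)"
    if a: "is_gel (E T) f" "is_gel (E T) g" "gsrc g = gtgt f" for f g
  proof -
    note F = E_gel[OF a(1)] and G = E_gel[OF a(2)]
    have al: "alg T (gsrc f)" "alg T (gtgt f)" "alg T (gtgt g)" using F G by auto
    note c = evcomp[OF al]
    have "alg_ev V C T (gsrc f) (gtgt g) j \<cdot> VComp (E T) (gsrc f) (gtgt f) (gtgt g) \<cdot> (garr g \<boxtimes> garr f) =
       (alg_ev V C T (gsrc f) (gtgt g) j \<cdot> VComp (E T) (gsrc f) (gtgt f) (gtgt g)) \<cdot> (garr g \<boxtimes> garr f)"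
      using c(1-3) t[OF al(1,3)] F G a(3) j by simp
    also have "\<dots> = VComp C (FO (gsrc f) j) (FO (gtgt f) j) (FO (gtgt g) j) \<cdot>
        ((alg_ev V C T (gtgt f) (gtgt g) j \<cdot> garr g) \<boxtimes> (alg_ev V C T (gsrc f) (gtgt f) j \<cdot> garr f))"
      unfolding c(4)[OF j] using t[OF al(1,2)] t[OF al(2,3)] F G a(3) j algebraD(3)[OF al(1) j] algebraD(3)[OF al(2) j] algebraD(3)[OF al(3) j]
      by (simp add: interchange_simps)
    finally show ?thesis using al a(3) by (simp add: ev_app gcomp_def)
  qed
qed simp_all

text \<open>A morphism of algebras is determined by its component at the unit, since algebras preserve
  the cotensors \<open>j \<rightarrow> T(j, I)\<close>.\<close>

lemma ev_unit_mono:
  assumes f: "is_gel (E T) f" "is_gel (E T) g" "gsrc f = gsrc g" "gtgt f = gtgt g" "gdom f = gdom g"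
    and e: "ev_fun T \<one> \<rhd> f = ev_fun T \<one> \<rhd> g"
  shows "f = g"
proof (rule ev_ext[OF f])
  fix j assume j: "j \<in> J"
  note K = theory_cou[OF T j]
  note F = E_gel[OF f(1)] and G = E_gel[OF f(2)]
  let ?k = "gtgt f \<rhd> theory_cou T j"
  have k: "is_cot C ?k" by (rule algebraD(2)[OF F(2) K(5)]) (simp add: K j)
  show "ev_fun T j \<rhd> f = ev_fun T j \<rhd> g"
  proof (rule cot_cancel[OF C_vcat _ k])
    have "?k \<odot>[C] (ev_fun T j \<rhd> f) \<lhd> Sym V (gdom f) j = ?k \<odot>[C] (ev_fun T j \<rhd> g) \<lhd> Sym V (gdom f) j"
      using ev_natural[OF f(1) K(1)] ev_natural[OF f(2) K(1)] K(2-4) e f(3-5) by simp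
    then show "?k \<odot>[C] (ev_fun T j \<rhd> f) = ?k \<odot>[C] (ev_fun T j \<rhd> g)"
      by (rule reindex_cancel[OF C_vcat]) 
        (use ev_gel[OF f(1) j] ev_gel[OF f(2) j] is_cot_gel[OF k] F G f(3-5) K(2-4) gmap_simps(2)[OF algebraD(1)[OF F(2)] K(1)] j in simp_all)
  qed (use ev_gel[OF f(1) j] ev_gel[OF f(2) j] F G f(3-5) K(2-4) in simp_all)
qed

lemmas dC = cotensored_cotf[OF cotensored_C] and dCf = cotensored_cotf_functor[OF cotensored_C] and dCc = cotensored_cou[OF cotensored_C]

lemma pointwise_algebra_eq:
  assumes A: "alg T A" and v: "v \<in> J"
  shows "pointwise_cot V C T v A = vfun_comp V J (cotensor_fun V C v) A"
  using algebraD(3)[OF A] by (auto simp: pointwise_cot_def vfun_comp_def cotensor_fun_def fun_eq_iff)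

text \<open>The composite of [v, -] with an algebra is an algebra because [v, -] preserves
  cotensors.\<close>

lemma pointwise_algebra:
  assumes A: "alg T A" and v: "v \<in> J"
  defines "P \<equiv> pointwise_cot V C T v A"
  shows "alg T P" "is_gel T t \<Longrightarrow> P \<rhd> t = cotensor_fun V C v \<rhd> A \<rhd> t" "j \<in> J \<Longrightarrow> FO P j = Cot C v (FO A j)"
proof -
  note a = algebraD(1)[OF A]
  have P: "P = vfun_comp V J (cotensor_fun V C v) A" unfolding P_def by (rule pointwise_algebra_eq[OF A v])
  note c = vfunctor_comp[OF a dCf[OF v] T_simps(1)[OF T]]
  show e: "P \<rhd> t = cotensor_fun V C v \<rhd> A \<rhd> t" if "is_gel T t" for t unfolding P using c(2)[OF that] .
  have F: "vfunctor V T C P" unfolding P by (rule c(1))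
  have "preserves_cotensors V J T C P"
  proof (rule preserves_cotI[OF F])
    fix \<kappa> assume k: "is_cot T \<kappa>" "gdom \<kappa> \<in> J"
    have "is_cot C (cotensor_fun V C v \<rhd> A \<rhd> \<kappa>)" by (rule cotensored_cotf_preserves[OF cotensored_C v algebraD(2)[OF A k]])
    then show "is_cot C (P \<rhd> \<kappa>)" using e[OF is_cot_gel[OF k(1)]] by simp
  qed
  then show "alg T P" using F by (simp add: is_algebra_def)
  show "j \<in> J \<Longrightarrow> FO P j = Cot C v (FO A j)" by (simp add: P_def pointwise_cot_def)
qed

lemma cou_wedge:
  assumes A: "alg T A" and v: "v \<in> J"
  shows "wedge T (pointwise_cot V C T v A) A v (\<lambda>j. cou C v (FO A j))"
  unfolding wedge_def[OF T]
proof (intro conjI ballI allI impI)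
  note P = pointwise_algebra[OF A v]
  fix j assume j: "j \<in> J"
  show "is_gel C (cou C v (FO A j))" "gsrc (cou C v (FO A j)) = FO (pointwise_cot V C T v A) j"
    "gtgt (cou C v (FO A j)) = FO A j" "gdom (cou C v (FO A j)) = v"
    using P(3)[OF j] dCc[OF v] algebraD(3)[OF A j] by simp_all
next
  fix t assume t: "is_gel T t"
  have At: "is_gel C (A \<rhd> t)" "gdom (A \<rhd> t) = gdom t" using gmap_simps(1,2)[OF algebraD(1)[OF A] t] by auto
  show "cou C v (FO A (gtgt t)) \<odot>[C] (pointwise_cot V C T v A \<rhd> t) =
     (A \<rhd> t) \<odot>[C] cou C v (FO A (gsrc t)) \<lhd> Sym V v (gdom t)"
    using dC(3)[OF v At(1)] At(2) pointwise_algebra(2)[OF A v t] by simp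
qed (use v in simp)

lemma E_cou:
  assumes A: "alg T A" and v: "v \<in> J"
  shows "is_gel (E T) (cou (E T) v A)" "gdom (cou (E T) v A) = v" "j \<in> J \<Longrightarrow> ev_fun T j \<rhd> cou (E T) v A = cou C v (FO A j)"
proof -
  note L = into_alg_hom[OF T pointwise_algebra(1)[OF A v] A cou_wedge[OF A v], of "\<lambda>j. Cou C v (FO A j)"]
  have e: "cou (E T) v A = Gel (pointwise_cot V C T v A) A
      (into_alg_hom V C T (pointwise_cot V C T v A) A v (\<lambda>j. Cou C v (FO A j)))"
    by (simp add: cou_def alg_vcat_def)
  show "is_gel (E T) (cou (E T) v A)" "gdom (cou (E T) v A) = v" "j \<in> J \<Longrightarrow> ev_fun T j \<rhd> cou (E T) v A = cou C v (FO A j)"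
    unfolding e using L(2,5,6) by (simp_all add: cou_def)
qed

text \<open>The factorizations through the counits of \<open>C\<close> exist for each j, and they
  assemble into a wedge because their naturality can be tested after the counits.\<close>

lemma E_cot:
  assumes A: "alg T A" and v: "v \<in> J"
  shows "is_cot (E T) (cou (E T) v A)"
proof (rule is_cotI[OF E_vcategory])
  note P = pointwise_algebra[OF A v] and K = E_cou[OF A v]
  let ?P = "pointwise_cot V C T v A"
  have vo: "v \<in> Obj V" using v by simp
  have kc: "is_cot C (cou C v (FO A j))" "is_gel C (cou C v (FO A j))" "gdom (cou C v (FO A j)) = v" if "j \<in> J" for j
    using dCc[OF v] algebraD(3)[OF A that] by auto
  show "is_gel (E T) (cou (E T) v A)" by (rule K)
  show "\<exists>h. is_gel (E T) h \<and> gsrc h = gsrc f \<and> gtgt h = gsrc (cou (E T) v A) \<and> gdom h = x \<and> cou (E T) v A \<odot>[(E T)] h = f"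
    if f: "is_gel (E T) f" "gtgt f = gtgt (cou (E T) v A)" "x \<in> Obj V" "gdom f = gdom (cou (E T) v A) \<otimes> x" for f x
  proof -
    let ?D = "gsrc f"
    have D: "alg T ?D" and ft: "gtgt f = A" "gdom f = v \<otimes> x" using E_gel[OF f(1)] f K by simp_all
    have "\<exists>h. is_gel C h \<and> gsrc h = FO ?D j \<and> gtgt h = Cot C v (FO A j) \<and> gdom h = x \<and> cou C v (FO A j) \<odot>[C] h = ev_fun T j \<rhd> f"
      if j: "j \<in> J" for j
      using cot_ex[OF C_vcat kc(1)[OF j] f(3) ev_gel(1)[OF f(1) j]] ev_gel[OF f(1) j] kc[OF j] ft D A by (simp, metis)
    then obtain l where l: "\<And>j. j \<in> J \<Longrightarrow> is_gel C (l j)" "\<And>j. j \<in> J \<Longrightarrow> gsrc (l j) = FO ?D j"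
      "\<And>j. j \<in> J \<Longrightarrow> gtgt (l j) = Cot C v (FO A j)" "\<And>j. j \<in> J \<Longrightarrow> gdom (l j) = x"
      "\<And>j. j \<in> J \<Longrightarrow> cou C v (FO A j) \<odot>[C] l j = ev_fun T j \<rhd> f" by metis
    have "wedge T ?D ?P x l"
      unfolding wedge_def[OF T]
    proof (intro conjI ballI allI impI f(3))
      fix j assume j: "j \<in> J"
      show "is_gel C (l j)" "gsrc (l j) = FO ?D j" "gtgt (l j) = FO ?P j" "gdom (l j) = x"
        using l(1-4)[OF j] P(3)[OF j] by simp_all
    next
      fix t assume t: "is_gel T t"
      let ?j = "gsrc t" and ?k = "gtgt t" and ?t = "gdom t"
      have o: "?j \<in> J" "?k \<in> J" and td: "?t \<in> Obj V" using T_gel[OF T t] t by auto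
      note lj = l(1-4)[OF o(1)] and lk = l(1-4)[OF o(2)]
      have Dt: "is_gel C (?D \<rhd> t)" "gdom (?D \<rhd> t) = ?t" using gmap_simps(1,2)[OF algebraD(1)[OF D] t] by auto
      have At: "is_gel C (A \<rhd> t)" "gdom (A \<rhd> t) = ?t" using gmap_simps(1,2)[OF algebraD(1)[OF A] t] by auto
      have Pt: "is_gel C (?P \<rhd> t)" "gdom (?P \<rhd> t) = ?t" using gmap_simps(1,2)[OF algebraD(1)[OF P(1)] t] by auto
      have cP: "cou C v (FO A ?k) \<odot>[C] (?P \<rhd> t) = (A \<rhd> t) \<odot>[C] cou C v (FO A ?j) \<lhd> Sym V v ?t"
        using cou_wedge[OF A v] t unfolding wedge_def[OF T] by blast
      note ty = lj lk Dt At Pt kc(2,3)[OF o(1)] kc(2,3)[OF o(2)] P(3)[OF o(1)] P(3)[OF o(2)] td vo f(3)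
      \<comment> \<open>After the counit, naturality of \<open>l\<close> becomes naturality of
        \<open>f\<close> at \<open>t\<close> together with naturality of the counit;
        \<open>hexagon_right\<close> matches the symmetries.\<close>
      have "cou C v (FO A ?k) \<odot>[C] (l ?k \<odot>[C] (?D \<rhd> t)) \<lhd> Assoc V v x ?t = (cou C v (FO A ?k) \<odot>[C] l ?k) \<odot>[C] (?D \<rhd> t)"
        using ty by (simp add: gcomp_assoc)
      also have "\<dots> = (A \<rhd> t) \<odot>[C] (ev_fun T ?j \<rhd> f) \<lhd> Sym V (v \<otimes> x) ?t"
        unfolding l(5)[OF o(2)] using ev_natural[OF f(1) t] ft by simp
      also have "\<dots> = (A \<rhd> t) \<odot>[C] (cou C v (FO A ?j) \<odot>[C] l ?j) \<lhd> Sym V (v \<otimes> x) ?t"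
        unfolding l(5)[OF o(1)] ..
      also have "\<dots> = ((A \<rhd> t) \<odot>[C] cou C v (FO A ?j)) \<odot>[C] l ?j \<lhd> inverse_arrow V (Assoc V ?t v x) \<cdot> Sym V (v \<otimes> x) ?t"
        using ty by (simp add: gcomp_assoc)
      also have "\<dots> = ((A \<rhd> t) \<odot>[C] cou C v (FO A ?j) \<lhd> Sym V v ?t) \<odot>[C] l ?j \<lhd>
          inverse_arrow V (Assoc V v ?t x) \<cdot> (Ident V v \<boxtimes> Sym V x ?t) \<cdot> Assoc V v x ?t"
        using ty by (simp add: hexagon_right[of v x ?t] interchange_simps interchange'[of "Sym V v ?t" "Sym V ?t v"])
      also have "\<dots> = (cou C v (FO A ?k) \<odot>[C] (?P \<rhd> t)) \<odot>[C] l ?j \<lhd>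
          inverse_arrow V (Assoc V v ?t x) \<cdot> (Ident V v \<boxtimes> Sym V x ?t) \<cdot> Assoc V v x ?t"
        unfolding cP ..
      also have "\<dots> = cou C v (FO A ?k) \<odot>[C] ((?P \<rhd> t) \<odot>[C] l ?j \<lhd> Sym V x ?t) \<lhd> Assoc V v x ?t"
        using ty by (simp add: gcomp_assoc)
      finally have "cou C v (FO A ?k) \<odot>[C] (l ?k \<odot>[C] (?D \<rhd> t)) \<lhd> Assoc V v x ?t =
        cou C v (FO A ?k) \<odot>[C] ((?P \<rhd> t) \<odot>[C] l ?j \<lhd> Sym V x ?t) \<lhd> Assoc V v x ?t" .
      then have "cou C v (FO A ?k) \<odot>[C] (l ?k \<odot>[C] (?D \<rhd> t)) = cou C v (FO A ?k) \<odot>[C] ((?P \<rhd> t) \<odot>[C] l ?j \<lhd> Sym V x ?t)"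
        by (rule reindex_cancel[OF C_vcat]) (use ty in simp_all)
      then show "l ?k \<odot>[C] (?D \<rhd> t) = (?P \<rhd> t) \<odot>[C] l ?j \<lhd> Sym V x ?t"
        by (rule cot_cancel[OF C_vcat _ kc(1)[OF o(2)]]) (use ty in simp_all)
    qed
    then obtain h where h: "is_gel (E T) h" "gsrc h = ?D" "gtgt h = ?P" "gdom h = x" "\<And>j. j \<in> J \<Longrightarrow> ev_fun T j \<rhd> h = l j"
      using ev_lift[OF D P(1)] by metis
    have "cou (E T) v A \<odot>[(E T)] h = f"
    proof (rule ev_ext)
      show "ev_fun T j \<rhd> (cou (E T) v A \<odot>[(E T)] h) = ev_fun T j \<rhd> f" if j: "j \<in> J" for j
        using gmap_gcomp[OF ev_functor[OF j] h(1) K(1)] h(3,5) l(5) K(3) j by simp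
    qed (use h K f ft in simp_all)
    then show ?thesis using h by auto
  qed
  show "h = h'" if h: "is_gel (E T) h" "is_gel (E T) h'" "gsrc h = gsrc h'" "gtgt h = gsrc (cou (E T) v A)"
    "gtgt h' = gsrc (cou (E T) v A)" "gdom h = gdom h'" "cou (E T) v A \<odot>[(E T)] h = cou (E T) v A \<odot>[(E T)] h'" for h h'
  proof (rule ev_ext[OF h(1,2,3) _ h(6)])
    show "gtgt h = gtgt h'" using h(4,5) by simp
    fix j assume j: "j \<in> J"
    have hh: "gtgt h = ?P" "gtgt h' = ?P" using h(4,5) by simp_all
    have "cou C v (FO A j) \<odot>[C] (ev_fun T j \<rhd> h) = cou C v (FO A j) \<odot>[C] (ev_fun T j \<rhd> h')"
      using gmap_gcomp[OF ev_functor[OF j] h(1) K(1)] gmap_gcomp[OF ev_functor[OF j] h(2) K(1)] hh h(7) K(3)[OF j] by simp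
    then show "ev_fun T j \<rhd> h = ev_fun T j \<rhd> h'"
      by (rule cot_cancel[OF C_vcat _ kc(1)[OF j]])
        (use hh ev_gel[OF h(1) j] ev_gel[OF h(2) j] P h(6) j in simp_all)
  qed
qed

text \<open>The equality is strict by \<open>cotensor_fun_unit\<close>, as required by
  \<open>designated_cotensors\<close>, which asks for \<open>Cot C \<one> c = c\<close> and not just
  for an isomorphism.\<close>

lemma pointwise_algebra_unit:
  assumes A: "alg T A"
  shows "pointwise_cot V C T \<one> A = A"
proof (rule vfun_eqI)
  note P = pointwise_algebra[OF A J_simps(2)]
  show "vfunctor V T C (pointwise_cot V C T \<one> A)" by (rule algebraD(1)[OF P(1)])
  show "vfunctor V T C A" by (rule algebraD(1)[OF A])
  show "FO (pointwise_cot V C T \<one> A) j = FO A j" if "j \<in> VObj T" for j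
    using that P(3) algebraD(3)[OF A] cotensored_unit(1)[OF cotensored_C] by simp
  show "garr (pointwise_cot V C T \<one> A \<rhd> t) = garr (A \<rhd> t)" if t: "is_gel T t" for t
    using P(2)[OF t] cotensor_fun_unit[OF cotensored_C gmap_simps(1)[OF algebraD(1)[OF A] t]] by simp
qed

lemma cotensored_E: "cotensored (E T)"
  unfolding cotensored_def designated_cotensors_def
proof (intro conjI ballI E_vcategory)
  show "is_cotensor V (E T) v A (Cot (E T) v A) (Cou (E T) v A)" if "v \<in> J" "A \<in> VObj (E T)" for v A
    using E_cot[of A v] E_cou(2)[of A v] that by (simp add: is_cotensor_iff cou_def)
  fix A assume "A \<in> VObj (E T)"
  then have A: "alg T A" by simp
  show 1: "Cot (E T) \<one> A = A" using pointwise_algebra_unit[OF A] by simp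
  have "cou (E T) \<one> A = gid (E T) A"
  proof (rule ev_ext)
    show "ev_fun T j \<rhd> cou (E T) \<one> A = ev_fun T j \<rhd> gid (E T) A" if j: "j \<in> J" for j
      using E_cou(3)[OF A J_simps(2) j] gmap_gid[OF ev_functor[OF j], of A] A cotensored_unit(2)[OF cotensored_C algebraD(3)[OF A j]] by simp
  qed (use E_cou[OF A J_simps(2)] A 1 in simp_all)
  then show "Cou (E T) \<one> A = VId (E T) A" by (simp add: cou_def gid_def)
qed

end

end

section \<open>Commutants and strong morphisms\<close>

context arity_system
begin

text \<open>The cotensor of \<open>c\<close> by \<open>j\<close> in \<open>J\<^sup>o\<^sup>p\<close> is \<open>j \<otimes> c\<close>.\<close>

definition cot_rep :: "'o \<Rightarrow> 'o \<Rightarrow> ('o, 'a) gel"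
  where "cot_rep j c = unhat j c (j \<otimes> c) (Ident V (j \<otimes> c))"

lemma cot_rep:
  assumes "j \<in> J" "c \<in> J"
  shows "is_gel Jop (cot_rep j c)" "gdom (cot_rep j c) = j" "gtgt (cot_rep j c) = c"
    "is_iso V (hat (cot_rep j c))" "is_cot Jop (cot_rep j c)"
proof -
  note u = unhat[of "Ident V (j \<otimes> c)" j c "j \<otimes> c"]
  show 1: "is_gel Jop (cot_rep j c)" "gdom (cot_rep j c) = j" "gtgt (cot_rep j c) = c" and
    2: "is_iso V (hat (cot_rep j c))"
    unfolding cot_rep_def using u assms by simp_all
  show "is_cot Jop (cot_rep j c)" by (rule Jop_cotI[OF 1(1) 2])
qed

lemma theory_morphism:
  assumes "is_theory_morphism V J T U M"
  shows "is_theory V J T" "is_theory V J U" "vfunctor V T U M" "j \<in> J \<Longrightarrow> FO M j = j"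
    "is_gel Jop f \<Longrightarrow> M \<rhd> tau_vfun J T \<rhd> f = tau_vfun J U \<rhd> f"
proof -
  show T: "is_theory V J T" and U: "is_theory V J U" and M: "vfunctor V T U M"
    using assms by (simp_all add: is_theory_morphism_def)
  have e: "vfun_comp V J M (tau_vfun J T) = tau_vfun J U" using assms by (simp add: is_theory_morphism_def)
  show "FO M j = j" if "j \<in> J"
    using arg_cong[OF e, of "\<lambda>F. FO F j"] that by (simp add: vfun_comp_def tau_vfun_def)
  show "M \<rhd> tau_vfun J T \<rhd> f = tau_vfun J U \<rhd> f" if "is_gel Jop f"
    using vfunctor_comp(2)[OF theory_facts(3)[OF T] M _ that, of J] e by simp
qed

lemma theory_morphismI:
  assumes T: "is_theory V J T" and U: "is_theory V J U" and M: "vfunctor V T U M"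
    and o: "\<And>j. j \<in> J \<Longrightarrow> FO M j = j"
    and t: "\<And>f. is_gel Jop f \<Longrightarrow> M \<rhd> tau_vfun J T \<rhd> f = tau_vfun J U \<rhd> f"
  shows "is_theory_morphism V J T U M"
proof -
  note c = vfunctor_comp[OF theory_facts(3)[OF T] M, of J]
  have "vfun_comp V J M (tau_vfun J T) = tau_vfun J U"
  proof (rule vfun_eqI[of Jop U _ U])
    show "vfunctor V Jop U (vfun_comp V J M (tau_vfun J T))" by (rule c) simp
    show "vfunctor V Jop U (tau_vfun J U)" by (rule theory_facts(3)[OF U])
    show "FO (vfun_comp V J M (tau_vfun J T)) a = FO (tau_vfun J U) a" if "a \<in> VObj Jop" for a
      using that o by (simp add: vfun_comp_def tau_vfun_def)
    show "garr (vfun_comp V J M (tau_vfun J T) \<rhd> f) = garr (tau_vfun J U \<rhd> f)" if "is_gel Jop f" for f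
      using c(2)[OF _ that] t[OF that] by simp
  qed
  then show ?thesis using T U M by (simp add: is_theory_morphism_def)
qed

end

section \<open>The commutant as an algebra\<close>

context commutants
begin

abbreviation Algs where "Algs \<equiv> Alg\<^sub>s V J C"
abbreviation perpT where "perpT T A \<equiv> cotensor_theory V J (E T) A"
abbreviation perpA where "perpA T A \<equiv> snd (commutant V J C (T, A))"

lemma commutant_simps [simp]: "fst (commutant V J C (T, A)) = perpT T A"
  by (simp add: commutant_def)

context
  fixes T :: "('o, 'a) jtheory" and A :: "('o, 'c, 'a) vfun"
  assumes T: "is_theory V J T" and A: "alg T A"
begin

lemma A_obj: "A \<in> VObj (E T)"
  using A by (simp add: E_simps[OF T])

lemmas dE = cotensored_E[OF T]

lemma A_one: "FO A \<one> \<in> VObj C"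
  by (rule algebra_props(3)[OF T A]) simp

lemma perpT_theory: "is_theory V J (perpT T A)"
  by (rule cotensor_theory_is_theory[OF dE A_obj])

lemmas incl_fun = incl_functor[OF dE A_obj]

lemma incl_FO: "j \<in> J \<Longrightarrow> FO (incl V J (E T) A) j = pointwise_cot V C T j A"
  by (simp add: incl_def E_simps[OF T])

text \<open>Exhibits the commutant as evaluation at \<one> after a full inclusion, so that
  functoriality and faithfulness come from the two factors.\<close>

lemma perpA_eq: "perpA T A = vfun_comp V J (ev_fun T \<one>) (incl V J (E T) A)"
proof (rule vfun.equality)
  have p: "alg T (pointwise_cot V C T j A)" if "j \<in> J" for j by (rule pointwise_algebra(1)[OF T A that])
  show "FO (perpA T A) = FO (vfun_comp V J (ev_fun T \<one>) (incl V J (E T) A))"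
    using p pointwise_algebra(3)[OF T A] by (auto simp: fun_eq_iff commutant_def vfun_comp_def incl_FO ev_fun_FO[OF T] carrier_def)
  have e: "alg_ev V C T (pointwise_cot V C T j A) (pointwise_cot V C T k A) \<one> =
      FH (ev_fun T \<one>) (pointwise_cot V C T j A) (pointwise_cot V C T k A) \<cdot> FH (incl V J (E T) A) j k" if "j \<in> J" "k \<in> J" for j k
    using p[OF that(1)] p[OF that(2)] that alg_ev_typing[OF T p[OF that(1)] p[OF that(2)]]
    by (simp add: ev_fun_def[OF T] incl_def E_simps[OF T])
  show "FH (perpA T A) = FH (vfun_comp V J (ev_fun T \<one>) (incl V J (E T) A))"
    by (rule ext)+ (auto simp: commutant_def vfun_comp_def incl_FO e)
qed simp

lemma perpA_functor: "vfunctor V (perpT T A) C (perpA T A)"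
  and perpA_app: "is_gel (perpT T A) f \<Longrightarrow> perpA T A \<rhd> f = ev_fun T \<one> \<rhd> incl V J (E T) A \<rhd> f"
  unfolding perpA_eq
  using vfunctor_comp[OF incl_fun ev_functor[OF T J_simps(2)] cotensor_theory_simps(1)[OF dE A_obj]] by auto

lemma perpA_FO: "j \<in> J \<Longrightarrow> FO (perpA T A) j = Cot C j (FO A \<one>)"
  by (simp add: commutant_def carrier_def)

text \<open>Evaluation at \<one> sends the counits of [j, A] to the designated counits of [j, |A|],
  and the counits determine [-, A] and [-, |A|].\<close>

lemma ev_tauf:
  assumes f: "is_gel Jop f"
  shows "ev_fun T \<one> \<rhd> tau_fun V J (E T) A \<rhd> f = tau_fun V J C (FO A \<one>) \<rhd> f"
proof (rule tau_fun_eqI[OF cotensored_C A_one, of "gtgt f"])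
  have o: "gsrc f \<in> J" "gtgt f \<in> J" using Jop_gel f by auto
  note F = tau_fun_gel[OF dE A_obj f] and G = tau_fun_gel[OF cotensored_C A_one f]
  note c = E_cou[OF T A o(1)] E_cou[OF T A o(2)]
  have s: "gsrc (cou (E T) (gtgt f) A) = gtgt (tau_fun V J (E T) A \<rhd> f)" using o tau_fun_FO[OF dE A_obj] by simp
  note ef = gmap_typing[OF ev_functor[OF T J_simps(2)]]
    gmap_reindex[OF ev_functor[OF T J_simps(2)]] gmap_gcomp[OF ev_functor[OF T J_simps(2)]]
  have "cou C (gtgt f) (FO A \<one>) \<odot>[C] (ev_fun T \<one> \<rhd> tau_fun V J (E T) A \<rhd> f) =
    ev_fun T \<one> \<rhd> (cou (E T) (gtgt f) A \<odot>[E T] (tau_fun V J (E T) A \<rhd> f))"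
    using ef(5)[OF F(1) c(4) s] c(6)[OF J_simps(2)] by simp
  also have "\<dots> = cou C (gsrc f) (FO A \<one>) \<lhd> hat f \<cdot> Sym V (gtgt f) (gdom f)"
    unfolding F(3) using c(1,2) c(3)[OF J_simps(2)] ef(4)[OF c(1)] f o by simp
  finally show "cou C (gtgt f) (FO A \<one>) \<odot>[C] (ev_fun T \<one> \<rhd> tau_fun V J (E T) A \<rhd> f) =
    cou C (gtgt f) (FO A \<one>) \<odot>[C] (tau_fun V J C (FO A \<one>) \<rhd> f)" unfolding G(3) .
  show "gtgt f \<in> J" by fact
  show "is_gel C (ev_fun T \<one> \<rhd> tau_fun V J (E T) A \<rhd> f)" "is_gel C (tau_fun V J C (FO A \<one>) \<rhd> f)"
    "gdom (ev_fun T \<one> \<rhd> tau_fun V J (E T) A \<rhd> f) = gdom (tau_fun V J C (FO A \<one>) \<rhd> f)"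
    using ef(1,2)[OF F(1)] F G by simp_all
  have "alg T (pointwise_cot V C T (gtgt f) A)" by (rule pointwise_algebra(1)[OF T A o(2)])
  then show "gtgt (ev_fun T \<one> \<rhd> tau_fun V J (E T) A \<rhd> f) = Cot C (gtgt f) (FO A \<one>)"
    using tau_fun_FO[OF dE A_obj o(2)] pointwise_algebra(3)[OF T A o(2), of \<one>] by (simp add: E_simps[OF T] ev_fun_FO[OF T])
  show "gtgt (tau_fun V J C (FO A \<one>) \<rhd> f) = Cot C (gtgt f) (FO A \<one>)"
    using tau_fun_FO[OF cotensored_C A_one o(2)] by simp
qed

lemma perpA_tau:
  assumes f: "is_gel Jop f"
  shows "perpA T A \<rhd> tau_vfun J (perpT T A) \<rhd> f = tau_fun V J C (FO A \<one>) \<rhd> f"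
  using incl_tau(1,2)[OF dE A_obj f] perpA_app ev_tauf[OF f] by simp

text \<open>By \<open>cot_transport\<close> one cotensor for each object and arity is enough. The
  one from \<open>cot_rep\<close> is convenient: \<open>perpA_tau\<close> identifies its image with
  that under [-, |A|], which \<open>tau_fun_cot\<close> shows to be a cotensor.\<close>

lemma perpA_alg: "alg (perpT T A) (perpA T A)"
proof -
  have "preserves_cotensors V J (perpT T A) C (perpA T A)"
  proof (rule preserves_cotI[OF perpA_functor])
    fix \<kappa> assume k: "is_cot (perpT T A) \<kappa>" and d: "gdom \<kappa> \<in> J"
    have c: "gtgt \<kappa> \<in> J" using incl_gel(5)[OF dE A_obj is_cot_gel[OF k]] .
    note r = cot_rep[OF d c]
    let ?k = "tau_vfun J (perpT T A) \<rhd> cot_rep (gdom \<kappa>) (gtgt \<kappa>)"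
    note t = incl_tau[OF dE A_obj r(1)]
    have k0: "is_cot (perpT T A) ?k"
      by (rule preserves_cot[OF theory_facts(4)[OF perpT_theory] r(5)]) (simp add: r d)
    have "is_cot C (perpA T A \<rhd> ?k)"
      unfolding perpA_tau[OF r(1)] by (rule tau_fun_cot[OF cotensored_C A_one r(1,4)])
    then show "is_cot C (perpA T A \<rhd> \<kappa>)"
      by (rule cot_transport[OF perpA_functor k0 k, rotated 2]) (use t r in simp_all)
  qed
  then show ?thesis using perpA_functor by (simp add: is_algebra_def)
qed

text \<open>\<open>incl\<close> is injective on parallel elements and evaluation at \<one> is monic
  by \<open>ev_unit_mono\<close>. Equations in a commutant theory can therefore be verified in
  \<open>C\<close>.\<close>

lemma perpA_mono:
  assumes f: "is_gel (perpT T A) f" "is_gel (perpT T A) g" "gsrc f = gsrc g" "gtgt f = gtgt g" "gdom f = gdom g"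
    and e: "perpA T A \<rhd> f = perpA T A \<rhd> g"
  shows "f = g"
proof (rule incl_inj[OF dE A_obj _ f(1-4)])
  note F = incl_gel[OF dE A_obj f(1)] and G = incl_gel[OF dE A_obj f(2)]
  show "incl V J (E T) A \<rhd> f = incl V J (E T) A \<rhd> g"
    by (rule ev_unit_mono[OF T F(2) G(2)]) (use F(3) G(3) f(3-5) e perpA_app[OF f(1)] perpA_app[OF f(2)] in simp_all)
qed

end

section \<open>Strong morphisms in terms of generalized elements\<close>

definition obj :: "('o, 'a, 'c) algebra \<Rightarrow> bool"
  where "obj X \<longleftrightarrow> is_theory V J (fst X) \<and> alg (fst X) (snd X)"

lemma obj_commutant: "obj X \<Longrightarrow> obj (commutant V J C X)"
  using perpT_theory[of "fst X" "snd X"] perpA_alg[of "fst X" "snd X"] 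
  by (cases X) (simp add: obj_def)

lemma carrier_commutant: "obj X \<Longrightarrow> carrier V (commutant V J C X) = carrier V X"
  using perpA_FO[of "fst X" "snd X" \<one>] A_one[of "fst X" "snd X"] cotensored_unit(1)[OF cotensored_C]
  by (cases X) (simp add: carrier_def obj_def)

text \<open>Invertibility is asked of each component separately; that the inverses are natural again
  is recovered in \<open>arr_iff\<close>. Since a theory morphism is the identity on objects,
  \<open>FO (snd Y) j\<close> is the value at \<open>j\<close> of the algebra of \<open>Y\<close>
  restricted along \<open>M\<close>.\<close>

definition strong :: "('o, 'a, 'c) algebra \<Rightarrow> ('o, 'a, 'c) algebra \<Rightarrow> ('o, 'o, 'a) vfun \<Rightarrow> ('o \<Rightarrow> ('c, 'a) gel) \<Rightarrow> bool"
  where "strong X Y M a \<longleftrightarrow> obj X \<and> obj Y \<and> is_theory_morphism V J (fst X) (fst Y) M \<and>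
    (\<forall>j\<in>J. gsrc (a j) = FO (snd X) j \<and> gtgt (a j) = FO (snd Y) j \<and> (\<exists>b. ginverse C (a j) b)) \<and>
    (\<forall>t. is_gel (fst X) t \<longrightarrow> a (gtgt t) \<star>[C] (snd X \<rhd> t) = (snd Y \<rhd> M \<rhd> t) \<star>[C] a (gsrc t))"

definition acomp :: "('o, 'a, 'c) strong_morphism \<Rightarrow> 'o \<Rightarrow> ('c, 'a) gel"
  where "acomp h j = Gel (FO (snd (Src h)) j) (FO (snd (Tgt h)) j) (AIso h j)"

text \<open>A naturality square with its two invertible sides reversed; it makes componentwise
  inverses natural.\<close>

lemma inverse_natural:
  assumes i: "ginverse C a a'" "ginverse C b b'" and f: "is_gel C f" "gsrc f = gsrc a" "gtgt f = gsrc b"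
    and g: "is_gel C g" "gsrc g = gtgt a" "gtgt g = gtgt b" and n: "b \<star>[C] f = g \<star>[C] a"
  shows "b' \<star>[C] g = f \<star>[C] a'"
proof -
  have t: "is_gel C a" "is_gel C a'" "is_gel C b" "is_gel C b'" "gdom a = \<one>" "gdom a' = \<one>" "gdom b = \<one>" "gdom b' = \<one>"
    "gsrc a' = gtgt a" "gtgt a' = gsrc a" "gsrc b' = gtgt b" "gtgt b' = gsrc b"
    using i by (simp_all add: ginverse_def)
  have "b' \<star>[C] g = b' \<star>[C] ((g \<star>[C] a) \<star>[C] a')"
    using ginverse_cancel(4)[OF C_vcat i(1) g(1,2)] by simp
  also have "\<dots> = b' \<star>[C] ((b \<star>[C] f) \<star>[C] a')" by (simp only: n)
  also have "\<dots> = (b' \<star>[C] (b \<star>[C] f)) \<star>[C] a'"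
    using t f by (simp add: star_assoc)
  also have "\<dots> = f \<star>[C] a'" using ginverse_cancel(1)[OF C_vcat i(2) f(1,3)] by simp
  finally show ?thesis .
qed

text \<open>From here on arrows of \<open>Algs\<close> are handled through \<open>acomp\<close> and
  \<open>strong\<close>; the natural inverse demanded by \<open>vnatural_iso\<close> is traded for
  objectwise inverses.\<close>

lemma arr_iff: "h \<in> Arr Algs \<longleftrightarrow> AIso h \<in> extensional J \<and> strong (Src h) (Tgt h) (TMor h) (acomp h)"
proof -
  let ?T = "fst (Src h)" and ?A = "snd (Src h)" and ?U = "fst (Tgt h)" and ?B = "snd (Tgt h)" and ?M = "TMor h" and ?\<alpha> = "AIso h"
  let ?BM = "vfun_comp V J ?B ?M"
  have "h \<in> Arr Algs \<longleftrightarrow> obj (Src h) \<and> obj (Tgt h) \<and> is_theory_morphism V J ?T ?U ?M \<and> vnatural_iso V ?T C ?A ?BM ?\<alpha>"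
    by (auto simp: Alg\<^sub>s_def obj_def is_theory_morphism_def)
  also have "\<dots> \<longleftrightarrow> ?\<alpha> \<in> extensional J \<and> strong (Src h) (Tgt h) ?M (acomp h)"
  proof (cases "obj (Src h) \<and> obj (Tgt h) \<and> is_theory_morphism V J ?T ?U ?M")
    case True
    then have T: "is_theory V J ?T" "is_theory V J ?U" and al: "alg ?T ?A" "alg ?U ?B" and M: "is_theory_morphism V J ?T ?U ?M"
      by (auto simp: obj_def)
    note m = theory_morphism[OF M] and a = algebra_props[OF T(1) al(1)] and b = algebra_props[OF T(2) al(2)]
    note TJ = T_simps(1)[OF T(1)]
    note bm = vfunctor_comp[OF m(3) b(1) TJ]
    have FB: "FO ?BM j = FO ?B j" if "j \<in> J" for j using that m(4) by (simp add: vfun_comp_def)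
    have g1: "Gel (FO ?A j) (FO ?BM j) (?\<alpha> j) = acomp h j" if "j \<in> J" for j using FB[OF that] by (simp add: acomp_def)
    have nat: "vnatural V ?T C ?A ?BM ?\<alpha> \<longleftrightarrow> ?\<alpha> \<in> extensional J \<and> (\<forall>j\<in>J. is_gel C (acomp h j) \<and> gdom (acomp h j) = \<one>) \<and>
      (\<forall>t. is_gel ?T t \<longrightarrow> acomp h (gtgt t) \<star>[C] (?A \<rhd> t) = (?B \<rhd> ?M \<rhd> t) \<star>[C] acomp h (gsrc t))"
      unfolding vnatural_iff TJ using a(1) bm g1 T_gel[OF T(1)] by (auto simp: acomp_def)
    show ?thesis
    proof
      assume L: "obj (Src h) \<and> obj (Tgt h) \<and> is_theory_morphism V J ?T ?U ?M \<and> vnatural_iso V ?T C ?A ?BM ?\<alpha>"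
      then obtain \<beta> where n: "vnatural V ?T C ?A ?BM ?\<alpha>" 
        and v: "\<forall>j\<in>J. vinverse0 V C (FO ?A j) (FO ?BM j) (?\<alpha> j) (\<beta> j)"
        unfolding vnatural_iso_def TJ by blast
      have "\<exists>b. ginverse C (acomp h j) b" if "j \<in> J" for j
      proof -
        have "vinverse0 V C (FO ?A j) (FO ?B j) (?\<alpha> j) (\<beta> j)" using v that FB[OF that] by auto
        then have "ginverse C (acomp h j) (Gel (FO ?B j) (FO ?A j) (\<beta> j))"
          using ginverse_iff_vinverse0[OF C_vcat a(3)[OF that] b(3)[OF that]] by (simp add: acomp_def)
        then show ?thesis by blast
      qed
      then show "?\<alpha> \<in> extensional J \<and> strong (Src h) (Tgt h) ?M (acomp h)"
        using True n unfolding nat by (simp add: strong_def acomp_def)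
    next
      assume R: "?\<alpha> \<in> extensional J \<and> strong (Src h) (Tgt h) ?M (acomp h)"
      then have "\<forall>j\<in>J. \<exists>b. ginverse C (acomp h j) b" by (simp add: strong_def)
      then obtain b' where bi: "\<And>j. j \<in> J \<Longrightarrow> ginverse C (acomp h j) (b' j)" by metis
      have n: "vnatural V ?T C ?A ?BM ?\<alpha>" unfolding nat using R bi by (auto simp: strong_def ginverse_def)
      \<comment> \<open>Objectwise chosen inverses, restricted to \<open>J\<close> to be
        extensional; their naturality is \<open>inverse_natural\<close>.\<close>
      let ?\<beta> = "\<lambda>j\<in>J. garr (b' j)"
      have be: "Gel (FO ?BM j) (FO ?A j) (?\<beta> j) = b' j" if "j \<in> J" for j
        using bi[OF that] that FB[OF that] by (simp add: ginverse_def acomp_def gel.expand)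
      have bt: "is_gel C (b' j)" "gdom (b' j) = \<one>" if "j \<in> J" for j using bi[OF that] by (auto simp: ginverse_def)
      have "vnatural V ?T C ?BM ?A ?\<beta>"
        unfolding vnatural_iff TJ
      proof (intro conjI ballI allI impI bm(1) a(1))
        show "is_gel C (Gel (FO ?BM j) (FO ?A j) (?\<beta> j))" "Dom V (?\<beta> j) = \<one>" if "j \<in> J" for j
          using be[OF that] bt[OF that] that by (simp_all add: gdom_def)
        fix t assume t: "is_gel ?T t"
        have o: "gsrc t \<in> J" "gtgt t \<in> J" using T_gel[OF T(1) t] by auto
        have tt: "is_gel C (?A \<rhd> t)" "is_gel C (?BM \<rhd> t)" using gmap_typing[OF a(1) t] gmap_typing[OF bm(1) t] by auto
        have "b' (gtgt t) \<star>[C] (?BM \<rhd> t) = (?A \<rhd> t) \<star>[C] b' (gsrc t)"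
          by (rule inverse_natural[OF bi[OF o(1)] bi[OF o(2)] tt(1) _ _ tt(2)])
            (use R t o FB m(4) bm(2)[OF t] in \<open>auto simp: acomp_def strong_def\<close>)
        then show "Gel (FO ?BM (gtgt t)) (FO ?A (gtgt t)) (?\<beta> (gtgt t)) \<star>[C] (?BM \<rhd> t) =
          (?A \<rhd> t) \<star>[C] Gel (FO ?BM (gsrc t)) (FO ?A (gsrc t)) (?\<beta> (gsrc t))"
          unfolding be[OF o(1)] be[OF o(2)] .
      qed simp
      moreover have "vinverse0 V C (FO ?A j) (FO ?BM j) (?\<alpha> j) (?\<beta> j)" if j: "j \<in> J" for j
      proof -
        have "ginverse C (acomp h j) (Gel (FO ?BM j) (FO ?A j) (?\<beta> j))" unfolding be[OF j] by (rule bi[OF j])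
        then show ?thesis
          using FB[OF j] ginverse_iff_vinverse0[OF C_vcat a(3)[OF j] b(3)[OF j]] by (simp add: acomp_def)
      qed
      ultimately show "obj (Src h) \<and> obj (Tgt h) \<and> is_theory_morphism V J ?T ?U ?M \<and> vnatural_iso V ?T C ?A ?BM ?\<alpha>"
        using True n unfolding vnatural_iso_def TJ by blast
    qed
  next
    case False
    then show ?thesis by (auto simp: strong_def)
  qed
  finally show ?thesis .
qed

lemma arr_eqI:
  assumes "h \<in> Arr Algs" "h' \<in> Arr Algs" "Src h = Src h'" "Tgt h = Tgt h'" "TMor h = TMor h'"
    "\<And>j. j \<in> J \<Longrightarrow> acomp h j = acomp h' j"
  shows "h = h'"
proof (rule strong_morphism.equality)
  have "AIso h \<in> extensional J" "AIso h' \<in> extensional J" using assms by (auto simp: arr_iff)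
  then show "AIso h = AIso h'" using assms(6) by (auto intro!: extensionalityI[of _ J] simp: acomp_def)
qed (use assms in simp_all)

definition mk_strong :: "('o, 'a, 'c) algebra \<Rightarrow> ('o, 'a, 'c) algebra \<Rightarrow> ('o, 'o, 'a) vfun \<Rightarrow> ('o \<Rightarrow> ('c, 'a) gel) \<Rightarrow> ('o, 'a, 'c) strong_morphism"
  where "mk_strong X Y M a = \<lparr>Src = X, Tgt = Y, TMor = M, AIso = (\<lambda>j\<in>J. garr (a j))\<rparr>"

lemma mk_strong_simps [simp]: "Src (mk_strong X Y M a) = X" "Tgt (mk_strong X Y M a) = Y" "TMor (mk_strong X Y M a) = M"
  by (simp_all add: mk_strong_def)

lemma mk_strong:
  assumes s: "strong X Y M a"
  shows "mk_strong X Y M a \<in> Hom Algs X Y" "j \<in> J \<Longrightarrow> acomp (mk_strong X Y M a) j = a j"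
proof -
  show e: "acomp (mk_strong X Y M a) j = a j" if "j \<in> J" for j
    using s that by (simp add: acomp_def mk_strong_def strong_def gel.expand)
  have T: "is_theory V J (fst X)" using s by (simp add: strong_def obj_def)
  have "strong X Y M (acomp (mk_strong X Y M a))"
    using s e T_gel[OF T] unfolding strong_def by simp
  then show "mk_strong X Y M a \<in> Hom Algs X Y"
    by (simp add: Hom_def arr_iff) (simp add: Alg\<^sub>s_def mk_strong_def)
qed

lemma Alg_simps [simp]: "Dom Algs = Src" "Cod Algs = Tgt" "Obj Algs = {X. obj X}"
  by (auto simp: Alg\<^sub>s_def obj_def)

lemma underlying_acomp: "underlying V h = garr (acomp h \<one>)"
  by (simp add: underlying_def acomp_def)

lemma arr_into_commutant_unique:
  assumes h: "h \<in> Hom Algs X (commutant V J C Y)" "h' \<in> Hom Algs X (commutant V J C Y)"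
    and Y: "obj Y" and u: "underlying V h = underlying V h'"
  shows "h = h'"
proof -
  obtain T A where YT: "Y = (T, A)" by (cases Y)
  have T: "is_theory V J T" and A: "alg T A" using Y by (auto simp: YT obj_def)
  let ?U = "perpT T A" and ?P = "perpA T A"
  note U = perpT_theory[OF T A] and P = perpA_alg[OF T A]
  let ?S = "fst X" and ?B = "snd X" and ?M = "TMor h" and ?M' = "TMor h'"
  have h0: "h \<in> Arr Algs" "h' \<in> Arr Algs" "Src h = X" "Src h' = X"
    "Tgt h = commutant V J C Y" "Tgt h' = commutant V J C Y"
    using h by (simp_all add: Hom_def)
  have s: "strong X (commutant V J C Y) ?M (acomp h)" "strong X (commutant V J C Y) ?M' (acomp h')"
    using h0 by (simp_all add: arr_iff)
  have S: "is_theory V J ?S" and B: "alg ?S ?B" using s by (auto simp: strong_def obj_def)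
  have M: "is_theory_morphism V J ?S ?U ?M" "is_theory_morphism V J ?S ?U ?M'"
    using s by (auto simp: strong_def YT)
  note m = theory_morphism[OF M(1)] and m' = theory_morphism[OF M(2)]
  have gs: "gsrc (acomp h j) = FO ?B j" "gtgt (acomp h j) = FO ?P j" "gsrc (acomp h' j) = FO ?B j" "gtgt (acomp h' j) = FO ?P j"
    for j using h0 by (simp_all add: acomp_def YT)
  have gi: "is_gel C (acomp h j)" "gdom (acomp h j) = \<one>" "is_gel C (acomp h' j)" "gdom (acomp h' j) = \<one>" if "j \<in> J" for j
    using s that by (auto simp: strong_def ginverse_def)
  have n: "acomp h (gtgt t) \<star>[C] (?B \<rhd> t) = (?P \<rhd> ?M \<rhd> t) \<star>[C] acomp h (gsrc t)"
    "acomp h' (gtgt t) \<star>[C] (?B \<rhd> t) = (?P \<rhd> ?M' \<rhd> t) \<star>[C] acomp h' (gsrc t)" if "is_gel ?S t" for t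
    using s that by (auto simp: strong_def YT)
  have o: "acomp h \<one> = acomp h' \<one>" using u gs[of \<one>] by (intro gel_eqI) (simp_all add: underlying_acomp)
  have ac: "acomp h j = acomp h' j" if j: "j \<in> J" for j
  proof -
    note K = theory_cou[OF S j]
    let ?k = "?P \<rhd> theory_cou ?U j"
    have k: "is_cot C ?k" by (rule algebra_props(2)[OF U P theory_cou(5)[OF U j]]) (simp add: theory_cou[OF U j] j)
    have kk: "?M \<rhd> theory_cou ?S j = theory_cou ?U j" "?M' \<rhd> theory_cou ?S j = theory_cou ?U j"
      unfolding theory_cou_def using m(5) m'(5) arity_cou(1)[OF j] by auto
    \<comment> \<open>By naturality at the structure arrow, each side is the component at \<one>
      after the action of that arrow on \<open>?B\<close>, and the components at \<one>
      agree.\<close>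
    have "?k \<star>[C] acomp h j = ?k \<star>[C] acomp h' j"
      using n[OF K(1)] K(3,4) kk o by simp
    then show ?thesis
      by (rule cot_star_cancel[OF C_vcat _ k]) (use gi[OF j] gs[of j] theory_cou(3)[OF U j] in simp_all)
  qed
  \<comment> \<open>With equal invertible components, naturality forces \<open>?M\<close> and
    \<open>?M'\<close> to agree after the commutant algebra, which is faithful by
    \<open>perpA_mono\<close>.\<close>
  have "?M = ?M'"
  proof (rule vfun_eqI[OF m(3) m'(3)])
    show "FO ?M a = FO ?M' a" if "a \<in> VObj ?S" for a using that m(4) m'(4) T_simps(1)[OF S] by simp
    show "garr (?M \<rhd> f) = garr (?M' \<rhd> f)" if f: "is_gel ?S f" for f
    proof -
      have of: "gsrc f \<in> J" "gtgt f \<in> J" using T_gel[OF S f] by auto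
      note F = gmap_typing[OF m(3) f] and F' = gmap_typing[OF m'(3) f]
      note PF = gmap_typing[OF perpA_functor[OF T A] F(1)] and PF' = gmap_typing[OF perpA_functor[OF T A] F'(1)]
      have "(?P \<rhd> ?M \<rhd> f) \<star>[C] acomp h (gsrc f) = (?P \<rhd> ?M' \<rhd> f) \<star>[C] acomp h (gsrc f)"
        using n[OF f] ac[OF of(1)] ac[OF of(2)] by simp
      moreover obtain b where b: "ginverse C (acomp h (gsrc f)) b" using s(1) of by (auto simp: strong_def)
      moreover have "gsrc (?P \<rhd> ?M \<rhd> f) = gtgt (acomp h (gsrc f))" "gsrc (?P \<rhd> ?M' \<rhd> f) = gtgt (acomp h (gsrc f))"
        using gs m(4) m'(4) of by simp_all
      ultimately have "?P \<rhd> ?M \<rhd> f = ?P \<rhd> ?M' \<rhd> f"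
        using ginverse_cancel(4)[OF C_vcat b PF(1)] ginverse_cancel(4)[OF C_vcat b PF'(1)] by metis
      then have "?M \<rhd> f = ?M' \<rhd> f"
        by (rule perpA_mono[OF T A F(1) F'(1), rotated 3]) (use F F' m(4) m'(4) of in simp_all)
      then show ?thesis by simp
    qed
  qed
  then show ?thesis using h0 ac by (intro arr_eqI) simp_all
qed

end

section \<open>The category of strong morphisms, and conjugation of wedges\<close>

context commutants
begin

lemma strong_comp:
  assumes f: "strong X Y M a" and g: "strong Y Z N b"
  shows "strong X Z (vfun_comp V J N M) (\<lambda>j. b j \<star>[C] a j)"
proof -
  have M: "is_theory_morphism V J (fst X) (fst Y) M" and N: "is_theory_morphism V J (fst Y) (fst Z) N"
    using f g by (simp_all add: strong_def)
  note m = theory_morphism[OF M] and n = theory_morphism[OF N]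
  have alX: "alg (fst X) (snd X)" and alY: "alg (fst Y) (snd Y)" and alZ: "alg (fst Z) (snd Z)" using f g by (simp_all add: strong_def obj_def)
  note nm = vfunctor_comp[OF m(3) n(3) T_simps(1)[OF m(1)]]
  have at: "is_gel C (a j)" "gdom (a j) = \<one>" "gsrc (a j) = FO (snd X) j" "gtgt (a j) = FO (snd Y) j"
    and bt: "is_gel C (b j)" "gdom (b j) = \<one>" "gsrc (b j) = FO (snd Y) j" "gtgt (b j) = FO (snd Z) j" if "j \<in> J" for j
    using f g that by (auto simp: strong_def ginverse_def)
  have FN: "FO (vfun_comp V J N M) j = j" if "j \<in> J" for j using that m(4) n(4) by (simp add: vfun_comp_def)
  have "is_theory_morphism V J (fst X) (fst Z) (vfun_comp V J N M)"
  proof (rule theory_morphismI[OF m(1) n(2) nm(1) FN])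
    show "vfun_comp V J N M \<rhd> tau_vfun J (fst X) \<rhd> t = tau_vfun J (fst Z) \<rhd> t" if t: "is_gel Jop t" for t
      using nm(2)[OF gmap_typing(1)[OF theory_facts(3)[OF m(1)] t]] m(5)[OF t] n(5)[OF t] by simp
  qed
  moreover have "\<exists>c. ginverse C (b j \<star>[C] a j) c" if j: "j \<in> J" for j
  proof -
    obtain a' where a': "ginverse C (a j) a'" using f j unfolding strong_def by blast
    obtain b' where b': "ginverse C (b j) b'" using g j unfolding strong_def by blast
    from ginverse_star[OF C_vcat a' b'] show ?thesis using at bt j by auto
  qed
  moreover have "(b (gtgt t) \<star>[C] a (gtgt t)) \<star>[C] (snd X \<rhd> t) = (snd Z \<rhd> vfun_comp V J N M \<rhd> t) \<star>[C] (b (gsrc t) \<star>[C] a (gsrc t))"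
    if t: "is_gel (fst X) t" for t
  proof -
    have o: "gsrc t \<in> J" "gtgt t \<in> J" using T_gel[OF m(1) t] by auto
    have Mt: "is_gel (fst Y) (M \<rhd> t)" "is_gel (fst Z) (N \<rhd> M \<rhd> t)" using gmap_typing(1)[OF m(3) t] gmap_typing(1)[OF n(3)] by auto
    have tt: "is_gel C (snd X \<rhd> t)" "is_gel C (snd Y \<rhd> M \<rhd> t)" "is_gel C (snd Z \<rhd> N \<rhd> M \<rhd> t)"
      using gmap_typing(1)[OF algebra_props(1)[OF m(1) alX] t] gmap_typing(1)[OF algebra_props(1)[OF n(1) alY] Mt(1)] gmap_typing(1)[OF algebra_props(1)[OF n(2) alZ] Mt(2)] by auto
    note ty = tt at[OF o(1)] at[OF o(2)] bt[OF o(1)] bt[OF o(2)] o m(4) n(4)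
    have na: "a (gtgt t) \<star>[C] (snd X \<rhd> t) = (snd Y \<rhd> M \<rhd> t) \<star>[C] a (gsrc t)" using f t by (simp add: strong_def)
    have "b (gtgt (M \<rhd> t)) \<star>[C] (snd Y \<rhd> M \<rhd> t) = (snd Z \<rhd> N \<rhd> M \<rhd> t) \<star>[C] b (gsrc (M \<rhd> t))" using g Mt(1) unfolding strong_def by blast
    then have nb: "b (gtgt t) \<star>[C] (snd Y \<rhd> M \<rhd> t) = (snd Z \<rhd> N \<rhd> M \<rhd> t) \<star>[C] b (gsrc t)" using o m(4) by simp
    have "(b (gtgt t) \<star>[C] a (gtgt t)) \<star>[C] (snd X \<rhd> t) = b (gtgt t) \<star>[C] (a (gtgt t) \<star>[C] (snd X \<rhd> t))"
      using ty by (simp add: star_assoc)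
    also have "\<dots> = (b (gtgt t) \<star>[C] (snd Y \<rhd> M \<rhd> t)) \<star>[C] a (gsrc t)"
      unfolding na using ty by (simp add: star_assoc)
    also have "\<dots> = (snd Z \<rhd> N \<rhd> M \<rhd> t) \<star>[C] (b (gsrc t) \<star>[C] a (gsrc t))"
      unfolding nb using ty by (simp add: star_assoc)
    finally show ?thesis using nm(2)[OF t] by simp
  qed
  ultimately show ?thesis using f g at bt by (simp add: strong_def)
qed

lemma strong_ident:
  assumes X: "obj X"
  shows "strong X X (vfun_id V (fst X)) (\<lambda>j. gid C (FO (snd X) j))"
proof -
  have T: "is_theory V J (fst X)" and A: "alg (fst X) (snd X)" using X by (simp_all add: obj_def)
  note i = vfunctor_id[OF T_simps(2)[OF T]] and a = algebra_props[OF T A]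
  have "is_theory_morphism V J (fst X) (fst X) (vfun_id V (fst X))"
    by (rule theory_morphismI[OF T T i(1)])
      (use i(2) gmap_typing(1)[OF theory_facts(3)[OF T]] T_simps(1)[OF T] in \<open>simp_all add: vfun_id_def\<close>)
  moreover have "ginverse C (gid C (FO (snd X) j)) (gid C (FO (snd X) j))" if "j \<in> J" for j
    using a(3)[OF that] by simp
  ultimately show ?thesis using X i(2) gmap_typing(1)[OF a(1)] by (auto simp: strong_def)
qed

lemma Ident_eq: "Ident Algs X = mk_strong X X (vfun_id V (fst X)) (\<lambda>j. gid C (FO (snd X) j))"
  by (simp add: Alg\<^sub>s_def mk_strong_def gid_garr cong: restrict_cong)

lemma arr_strong: "h \<in> Hom Algs X Y \<Longrightarrow> strong X Y (TMor h) (acomp h)"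
  by (auto simp: Hom_def arr_iff)

lemma acomp_typing:
  assumes "h \<in> Hom Algs X Y" "j \<in> J"
  shows "is_gel C (acomp h j)" "gdom (acomp h j) = \<one>" "gsrc (acomp h j) = FO (snd X) j" "gtgt (acomp h j) = FO (snd Y) j"
  using arr_strong[OF assms(1)] assms(2) by (auto simp: strong_def ginverse_def)

lemma Comp_eq:
  assumes h: "h \<in> Hom Algs X Y" and k: "k \<in> Hom Algs Y Z"
  shows "Comp Algs k h = mk_strong X Z (vfun_comp V J (TMor k) (TMor h)) (\<lambda>j. acomp k j \<star>[C] acomp h j)"
proof -
  have s: "Src h = X" "Tgt h = Y" "Src k = Y" "Tgt k = Z" using h k by (simp_all add: Hom_def)
  have M: "is_theory_morphism V J (fst X) (fst Y) (TMor h)" "is_theory_morphism V J (fst Y) (fst Z) (TMor k)"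
    using arr_strong[OF h] arr_strong[OF k] by (simp_all add: strong_def)
  have "vcomp0 V C (FO (snd X) j) (FO (snd Y) (FO (TMor h) j)) (FO (snd Z) (FO (TMor k) (FO (TMor h) j)))
        (AIso k (FO (TMor h) j)) (AIso h j) = garr (acomp k j \<star>[C] acomp h j)" if j: "j \<in> J" for j
    using garr_star[OF C_vcat acomp_typing(1)[OF h j] acomp_typing(1)[OF k j]] acomp_typing[OF h j] acomp_typing[OF k j]
      theory_morphism(4)[OF M(1) j] theory_morphism(4)[OF M(2) j]
    by (simp add: acomp_def)
  then show ?thesis using s by (simp add: Alg\<^sub>s_def mk_strong_def cong: restrict_cong)
qed

lemma Comp_hom:
  assumes h: "h \<in> Hom Algs X Y" and k: "k \<in> Hom Algs Y Z"
  shows "Comp Algs k h \<in> Hom Algs X Z"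
    "TMor (Comp Algs k h) = vfun_comp V J (TMor k) (TMor h)"
    "j \<in> J \<Longrightarrow> acomp (Comp Algs k h) j = acomp k j \<star>[C] acomp h j"
  using mk_strong[OF strong_comp[OF arr_strong[OF h] arr_strong[OF k]]] by (simp_all add: Comp_eq[OF h k])

lemma Ident_hom:
  assumes "obj X"
  shows "Ident Algs X \<in> Hom Algs X X"
    "TMor (Ident Algs X) = vfun_id V (fst X)"
    "j \<in> J \<Longrightarrow> acomp (Ident Algs X) j = gid C (FO (snd X) j)"
  using mk_strong[OF strong_ident[OF assms]] by (simp_all add: Ident_eq)

lemma hom_eqI:
  assumes h: "h \<in> Hom Algs X Y" "h' \<in> Hom Algs X Y"
    and m: "\<And>t. is_gel (fst X) t \<Longrightarrow> TMor h \<rhd> t = TMor h' \<rhd> t"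
    and a: "\<And>j. j \<in> J \<Longrightarrow> acomp h j = acomp h' j"
  shows "h = h'"
proof (rule arr_eqI)
  have M: "is_theory_morphism V J (fst X) (fst Y) (TMor h)" "is_theory_morphism V J (fst X) (fst Y) (TMor h')"
    using arr_strong[OF h(1)] arr_strong[OF h(2)] by (simp_all add: strong_def)
  note m1 = theory_morphism[OF M(1)] and m2 = theory_morphism[OF M(2)]
  show "TMor h = TMor h'"
    by (rule vfun_eqI[OF m1(3) m2(3)]) (use m m1(4) m2(4) T_simps(1)[OF m1(1)] in simp_all)
qed (use h a in \<open>simp_all add: Hom_def\<close>)

lemma Alg_category: "category Algs"
proof
  fix X Y Z W :: "('o, 'a, 'c) algebra" and f g h
  show "f \<in> Arr Algs \<Longrightarrow> Dom Algs f \<in> Obj Algs"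
    "f \<in> Arr Algs \<Longrightarrow> Cod Algs f \<in> Obj Algs"
    by (simp_all add: arr_iff strong_def)
  show "X \<in> Obj Algs \<Longrightarrow> Ident Algs X \<in> Hom Algs X X"
    by (simp add: Ident_hom)
  show "\<lbrakk>f \<in> Hom Algs X Y; g \<in> Hom Algs Y Z\<rbrakk> \<Longrightarrow> Comp Algs g f \<in> Hom Algs X Z"
    by (rule Comp_hom(1))
  have M: "vfunctor V (fst X) (fst Y) (TMor f)" "VObj (fst X) = J" "obj X" "obj Y"
    if "f \<in> Hom Algs X Y" for X Y f
    using theory_morphism(1,3)[of "fst X" "fst Y" "TMor f"] arr_strong[OF that] T_simps(1)[of "fst X"]
    by (simp_all add: strong_def)
  show "Comp Algs f (Ident Algs X) = f" if f: "f \<in> Hom Algs X Y"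
  proof -
    note m = M[OF f]
    have T: "is_theory V J (fst X)" using m(3) by (simp add: obj_def)
    note i = Ident_hom[OF m(3)]
    note c = Comp_hom[OF i(1) f]
    show ?thesis
    proof (rule hom_eqI[OF c(1) f])
      show "TMor (Comp Algs f (Ident Algs X)) \<rhd> t = TMor f \<rhd> t" if "is_gel (fst X) t" for t
        unfolding c(2) i(2) using vfunctor_comp(2)[OF vfunctor_id(1)[OF T_simps(2)[OF T]] m(1) T_simps(1)[OF T] that] vfunctor_id(2)[OF T_simps(2)[OF T] that] by simp
    qed (use c(3) i(3) acomp_typing[OF f] in simp)
  qed
  show "Comp Algs (Ident Algs Y) f = f" if f: "f \<in> Hom Algs X Y"
  proof -
    note m = M[OF f]
    have T: "is_theory V J (fst X)" "is_theory V J (fst Y)" using m(3,4) by (simp_all add: obj_def)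
    note i = Ident_hom[OF m(4)]
    note c = Comp_hom[OF f i(1)]
    show ?thesis
    proof (rule hom_eqI[OF c(1) f])
      show "TMor (Comp Algs (Ident Algs Y) f) \<rhd> t = TMor f \<rhd> t" if "is_gel (fst X) t" for t
        unfolding c(2) i(2) using vfunctor_comp(2)[OF m(1) vfunctor_id(1)[OF T_simps(2)[OF T(2)]] T_simps(1)[OF T(1)] that] vfunctor_id(2)[OF T_simps(2)[OF T(2)] gmap_typing(1)[OF m(1) that]] by simp
    qed (use c(3) i(3) acomp_typing[OF f] in simp)
  qed
  show "Comp Algs (Comp Algs h g) f = Comp Algs h (Comp Algs g f)"
    if f: "f \<in> Hom Algs X Y" and g: "g \<in> Hom Algs Y Z" and h: "h \<in> Hom Algs Z W"
  proof -
    note mf = M[OF f] and mg = M[OF g] and mh = M[OF h]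
    note gf = Comp_hom[OF f g] and hg = Comp_hom[OF g h]
    note l = Comp_hom[OF f hg(1)] and r = Comp_hom[OF gf(1) h]
    note gfc = vfunctor_comp[OF mf(1) mg(1) mf(2)] and hgc = vfunctor_comp[OF mg(1) mh(1) mg(2)]
    show ?thesis
    proof (rule hom_eqI[OF l(1) r(1)])
      fix t assume t: "is_gel (fst X) t"
      show "TMor (Comp Algs (Comp Algs h g) f) \<rhd> t = TMor (Comp Algs h (Comp Algs g f)) \<rhd> t"
        unfolding l(2) r(2) gf(2) hg(2)
        using vfunctor_comp(2)[OF mf(1) hgc(1) mf(2) t] vfunctor_comp(2)[OF gfc(1) mh(1) mf(2) t]
          hgc(2)[OF gmap_typing(1)[OF mf(1) t]] gfc(2)[OF t] by simp
    next
      fix j assume j: "j \<in> J"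
      show "acomp (Comp Algs (Comp Algs h g) f) j = acomp (Comp Algs h (Comp Algs g f)) j"
        using l(3)[OF j] r(3)[OF j] gf(3)[OF j] hg(3)[OF j] acomp_typing[OF f j] acomp_typing[OF g j] acomp_typing[OF h j]
        by (simp add: star_assoc)
    qed
  qed
qed

text \<open>Conjugates compose because the inner \<open>a\<close> and its inverse \<open>b'\<close>
  cancel. This gives the functoriality of the theory morphisms defined by conjugation below.\<close>

lemma conj_gcomp:
  assumes i: "ginverse C a b'" and t: "is_gel C b" "is_gel C g" "is_gel C f" "is_gel C a'"
    "gdom b = \<one>" "gdom a' = \<one>" "gsrc b = gtgt g" "gsrc g = gtgt a" "gsrc f = gtgt a'" "gtgt f = gtgt a"
  shows "(b \<star>[C] (g \<star>[C] a)) \<odot>[C] (b' \<star>[C] (f \<star>[C] a')) = b \<star>[C] ((g \<odot>[C] f) \<star>[C] a')"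
proof -
  have s: "is_gel C a" "is_gel C b'" "gdom a = \<one>" "gdom b' = \<one>" "gsrc b' = gtgt a" "gtgt b' = gsrc a"
    using i by (simp_all add: ginverse_def)
  have "(b \<star>[C] (g \<star>[C] a)) \<odot>[C] (b' \<star>[C] (f \<star>[C] a')) = b \<star>[C] ((g \<star>[C] a) \<odot>[C] (b' \<star>[C] (f \<star>[C] a')))"
    using s t by (simp add: star_gcomp)
  also have "\<dots> = b \<star>[C] (g \<odot>[C] (a \<star>[C] (b' \<star>[C] (f \<star>[C] a'))))"
    using s t by (simp add: star_gcomp_middle)
  also have "a \<star>[C] (b' \<star>[C] (f \<star>[C] a')) = f \<star>[C] a'"
    by (rule ginverse_cancel(2)[OF C_vcat i]) (use s t in simp_all)
  finally show ?thesis using s t by (simp add: gcomp_star)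
qed

text \<open>Wedges may be composed with V-natural transformations on both sides. For f^\<bottom>
  these are the isomorphisms between [l, A] and the restriction of [l, B]; for the unit they are
  [l, A j] \<cong> [j, [l, A I]], natural in l.\<close>

lemma conj_wedge:
  assumes T: "is_theory V J T"
    and F: "vfunctor V T C P" "vfunctor V T C P'" "vfunctor V T C Q" "vfunctor V T C Q'"
    and a: "\<And>j. j \<in> J \<Longrightarrow> is_gel C (a j) \<and> gdom (a j) = \<one> \<and> gsrc (a j) = FO P j \<and> gtgt (a j) = FO P' j"
    and b: "\<And>j. j \<in> J \<Longrightarrow> is_gel C (b j) \<and> gdom (b j) = \<one> \<and> gsrc (b j) = FO Q' j \<and> gtgt (b j) = FO Q j"
    and na: "\<And>t. is_gel T t \<Longrightarrow> a (gtgt t) \<star>[C] (P \<rhd> t) = (P' \<rhd> t) \<star>[C] a (gsrc t)"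
    and nb: "\<And>t. is_gel T t \<Longrightarrow> b (gtgt t) \<star>[C] (Q' \<rhd> t) = (Q \<rhd> t) \<star>[C] b (gsrc t)"
    and w: "wedge T P' Q' x l"
  shows "wedge T P Q x (\<lambda>j. b j \<star>[C] (l j \<star>[C] a j))"
proof -
  have x: "x \<in> Obj V" using w by (simp add: wedge_def[OF T])
  have l: "is_gel C (l j)" "gsrc (l j) = FO P' j" "gtgt (l j) = FO Q' j" "gdom (l j) = x" if "j \<in> J" for j
    using w that by (auto simp: wedge_def[OF T])
  have nl: "l (gtgt t) \<odot>[C] (P' \<rhd> t) = (Q' \<rhd> t) \<odot>[C] l (gsrc t) \<lhd> Sym V x (gdom t)" if "is_gel T t" for t
    using w that by (auto simp: wedge_def[OF T])
  show ?thesis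
    unfolding wedge_def[OF T]
  proof (intro conjI ballI allI impI x)
    fix j assume j: "j \<in> J"
    show "is_gel C (b j \<star>[C] (l j \<star>[C] a j))" "gsrc (b j \<star>[C] (l j \<star>[C] a j)) = FO P j"
      "gtgt (b j \<star>[C] (l j \<star>[C] a j)) = FO Q j" "gdom (b j \<star>[C] (l j \<star>[C] a j)) = x"
      using a[OF j] b[OF j] l[OF j] by simp_all
  next
    fix t assume t: "is_gel T t"
    let ?j = "gsrc t" and ?k = "gtgt t"
    have o: "?j \<in> J" "?k \<in> J" and td: "gdom t \<in> Obj V" using T_gel[OF T t] t by auto
    note g = gmap_typing(1,2)[OF F(1) t] gmap_typing(1,2)[OF F(2) t] gmap_typing(1,2)[OF F(3) t] gmap_typing(1,2)[OF F(4) t]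
    note ty = g a[OF o(1)] a[OF o(2)] b[OF o(1)] b[OF o(2)] l[OF o(1)] l[OF o(2)] x td
    have "(b ?k \<star>[C] (l ?k \<star>[C] a ?k)) \<odot>[C] (P \<rhd> t) = b ?k \<star>[C] (l ?k \<odot>[C] (a ?k \<star>[C] (P \<rhd> t)))"
      using ty by (simp add: star_gcomp star_gcomp_middle)
    also have "\<dots> = b ?k \<star>[C] ((l ?k \<odot>[C] (P' \<rhd> t)) \<star>[C] a ?j)"
      unfolding na[OF t] using ty by (simp add: gcomp_star)
    also have "\<dots> = (b ?k \<star>[C] ((Q' \<rhd> t) \<odot>[C] (l ?j \<star>[C] a ?j))) \<lhd> Sym V x (gdom t)"
      unfolding nl[OF t] using ty by (simp add: gcomp_star star_reindex_left star_reindex_right)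
    also have "b ?k \<star>[C] ((Q' \<rhd> t) \<odot>[C] (l ?j \<star>[C] a ?j)) = (b ?k \<star>[C] (Q' \<rhd> t)) \<odot>[C] (l ?j \<star>[C] a ?j)"
      using ty by (simp add: star_gcomp)
    also have "\<dots> = (Q \<rhd> t) \<odot>[C] (b ?j \<star>[C] (l ?j \<star>[C] a ?j))"
      unfolding nb[OF t] using ty by (simp add: star_gcomp_middle)
    finally show "(b ?k \<star>[C] (l ?k \<star>[C] a ?k)) \<odot>[C] (P \<rhd> t) =
      (Q \<rhd> t) \<odot>[C] (b ?j \<star>[C] (l ?j \<star>[C] a ?j)) \<lhd> Sym V x (gdom t)" .
  qed
qed

text \<open>Since \<open>perpA\<close> is monic on hom-objects, an assignment of wedges that is functorial at the unit
  component is a morphism of theories into the commutant.\<close>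

lemma into_commutant:
  assumes T: "is_theory V J T" and A: "alg T A" and S: "is_theory V J S"
    and w: "\<And>s. is_gel S s \<Longrightarrow> wedge T (pointwise_cot V C T (gsrc s) A) (pointwise_cot V C T (gtgt s) A) (gdom s) (W s)"
    and re: "\<And>s u j. \<lbrakk>is_gel S s; u \<in> Arr V; Cod V u = gdom s; j \<in> J\<rbrakk> \<Longrightarrow> W (s \<lhd> u) j = W s j \<lhd> u"
    and id: "\<And>a. a \<in> J \<Longrightarrow> W (gid S a) \<one> = gid C (Cot C a (FO A \<one>))"
    and co: "\<And>f g. \<lbrakk>is_gel S f; is_gel S g; gsrc g = gtgt f\<rbrakk> \<Longrightarrow> W (g \<odot>[S] f) \<one> = W g \<one> \<odot>[C] W f \<one>"
    and ta: "\<And>f. is_gel Jop f \<Longrightarrow> W (tau_vfun J S \<rhd> f) \<one> = tau_fun V J C (FO A \<one>) \<rhd> f"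
  obtains N where "is_theory_morphism V J S (perpT T A) N" "\<And>s. is_gel S s \<Longrightarrow> perpA T A \<rhd> N \<rhd> s = W s \<one>"
proof -
  let ?U = "perpT T A" and ?P = "perpA T A"
  note U = perpT_theory[OF T A]
  note ao = A_obj[OF T A]
  let ?g = "\<lambda>a b. Gel a b (Ident V (VHom S a b))"
  have g: "is_gel S (?g a b)" "gdom (?g a b) = VHom S a b" if "a \<in> J" "b \<in> J" for a b
    using that T_simps[OF S] by (simp_all add: is_gel_Gel)
  let ?K = "\<lambda>a b k. is_gel (E T) k \<and> gsrc k = pointwise_cot V C T a A \<and> gtgt k = pointwise_cot V C T b A \<and>
      gdom k = VHom S a b \<and> (\<forall>j\<in>J. ev_fun T j \<rhd> k = W (?g a b) j)"
  \<comment> \<open>The wedge at the generic element of S(a, b) lifts to an arrow of hom-objects;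
    the reindexing hypothesis \<open>re\<close> then yields \<open>W s \<one>\<close> for every
    element \<open>s\<close>.\<close>
  define K where "K a b = (SOME k. ?K a b k)" for a b
  have ex: "\<exists>k. ?K a b k" if o: "a \<in> J" "b \<in> J" for a b
  proof -
    obtain k where "is_gel (E T) k" "gsrc k = pointwise_cot V C T a A" "gtgt k = pointwise_cot V C T b A"
      "gdom k = VHom S a b" "\<And>j. j \<in> J \<Longrightarrow> ev_fun T j \<rhd> k = W (?g a b) j"
      using ev_lift[OF T pointwise_algebra(1)[OF T A o(1)] pointwise_algebra(1)[OF T A o(2)], of "VHom S a b" "W (?g a b)"] w[OF g(1)[OF o]] g(2)[OF o] by auto
    then show ?thesis by blast
  qed
  have K: "?K a b (K a b)" if "a \<in> J" "b \<in> J" for a b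
    unfolding K_def by (rule someI_ex[OF ex[OF that]])
  define N where "N = \<lparr>FO = (\<lambda>j\<in>J. j), FH = (\<lambda>a\<in>J. \<lambda>b\<in>J. garr (K a b))\<rparr>"
  have NO: "FO N j = j" if "j \<in> J" for j using that by (simp add: N_def)
  have Kt: "is_gel ?U (Gel a b (garr (K a b)))" "incl V J (E T) A \<rhd> Gel a b (garr (K a b)) = K a b" "Dom V (garr (K a b)) = VHom S a b"
    if o: "a \<in> J" "b \<in> J" for a b
    using incl_full[OF cotensored_E[OF T] ao _ _ _ o, where f = "K a b"] K[OF o] E_simps(3)[OF T] by simp_all
  have Ns: "is_gel ?U (N \<rhd> s)" "gdom (N \<rhd> s) = gdom s" "?P \<rhd> N \<rhd> s = W s \<one>" if s: "is_gel S s" for s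
  proof -
    have o: "gsrc s \<in> J" "gtgt s \<in> J" using T_gel[OF S s] by auto
    let ?k = "Gel (gsrc s) (gtgt s) (garr (K (gsrc s) (gtgt s)))"
    note k = Kt[OF o]
    have e: "N \<rhd> s = ?k \<lhd> garr s" using o by (simp add: gmap_def N_def reindex_def)
    have d: "garr s \<in> Arr V" "Dom V (garr s) = gdom s" "Cod V (garr s) = gdom ?k" "garr ?k \<in> Arr V"
      using s gel_simps(3,5)[OF s] k gel_simps(3)[OF k(1)] by (simp_all add: gdom_def)
    show N: "is_gel ?U (N \<rhd> s)" "gdom (N \<rhd> s) = gdom s" unfolding e using k(1) d by simp_all
    note ef = ev_functor[OF T J_simps(2)]
    have "?P \<rhd> N \<rhd> s = (?P \<rhd> ?k) \<lhd> garr s"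
      unfolding e by (rule gmap_reindex[OF perpA_functor[OF T A] k(1) d(1,3)])
    also have "?P \<rhd> ?k = W (?g (gsrc s) (gtgt s)) \<one>"
      using perpA_app[OF T A k(1)] k(2) K[OF o] by simp
    also have "\<dots> \<lhd> garr s = W (?g (gsrc s) (gtgt s) \<lhd> garr s) \<one>"
      by (rule re[OF g(1)[OF o] d(1) _ J_simps(2), symmetric]) (use d(3) k(3) g(2)[OF o] in simp)
    also have "?g (gsrc s) (gtgt s) \<lhd> garr s = s" using gel_generic[OF s] by simp
    finally show "?P \<rhd> N \<rhd> s = W s \<one>" .
  qed
  have "vfunctor V S ?U N"
  proof (rule vfunctorI[OF T_simps(2)[OF S] T_simps(2)[OF U]])
    show "FO N \<in> VObj S \<rightarrow>\<^sub>E VObj ?U" using T_simps(1)[OF S] T_simps(1)[OF U] by (simp add: N_def)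
    show "FH N \<in> VObj S \<rightarrow>\<^sub>E VObj S \<rightarrow>\<^sub>E Arr V"
      using T_simps(1)[OF S] Kt(1) by (auto simp: N_def is_gel_Gel)
    show "Dom V (FH N a b) = VHom S a b" "Cod V (FH N a b) = VHom ?U (FO N a) (FO N b)" if "a \<in> VObj S" "b \<in> VObj S" for a b
      using Kt(1,3)[of a b] that T_simps(1)[OF S] by (simp_all add: N_def is_gel_Gel)
    show "N \<rhd> gid S a = gid ?U (FO N a)" if "a \<in> VObj S" for a
    proof (rule perpA_mono[OF T A])
      have a: "a \<in> J" using that T_simps(1)[OF S] by simp
      have ga: "is_gel S (gid S a)" using a T_simps[OF S] by simp
      have gu: "is_gel ?U (gid ?U a)" "gdom (gid ?U a) = \<one>" using a T_simps[OF U] by simp_all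
      show "is_gel ?U (N \<rhd> gid S a)" "is_gel ?U (gid ?U (FO N a))" "gsrc (N \<rhd> gid S a) = gsrc (gid ?U (FO N a))"
        "gtgt (N \<rhd> gid S a) = gtgt (gid ?U (FO N a))" "gdom (N \<rhd> gid S a) = gdom (gid ?U (FO N a))"
        using Ns[OF ga] gu NO[OF a] T_simps[OF S] a by simp_all
      show "?P \<rhd> N \<rhd> gid S a = ?P \<rhd> gid ?U (FO N a)"
        unfolding Ns(3)[OF ga] id[OF a] NO[OF a]
        using gmap_gid[OF perpA_functor[OF T A], of a] a T_simps(1)[OF U] perpA_FO[OF T A a] by simp
    qed
    show "N \<rhd> (h \<odot>[S] f) = (N \<rhd> h) \<odot>[?U] (N \<rhd> f)" if f: "is_gel S f" "is_gel S h" "gsrc h = gtgt f" for f h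
    proof (rule perpA_mono[OF T A])
      have hf: "is_gel S (h \<odot>[S] f)" "gdom (h \<odot>[S] f) = gdom h \<otimes> gdom f" using f T_simps(2)[OF S] by simp_all
      note F = Ns[OF f(1)] and H = Ns[OF f(2)] and HF = Ns[OF hf(1)]
      have c: "gsrc (N \<rhd> h) = gtgt (N \<rhd> f)" using f(3) by simp
      show "is_gel ?U (N \<rhd> (h \<odot>[S] f))" by (rule HF)
      show "is_gel ?U ((N \<rhd> h) \<odot>[?U] (N \<rhd> f))" "gdom (N \<rhd> (h \<odot>[S] f)) = gdom ((N \<rhd> h) \<odot>[?U] (N \<rhd> f))"
        using F H HF c hf(2) T_simps(2)[OF U] by simp_all
      show "?P \<rhd> N \<rhd> (h \<odot>[S] f) = ?P \<rhd> ((N \<rhd> h) \<odot>[?U] (N \<rhd> f))"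
        using HF(3) F(3) H(3) co[OF f] gmap_gcomp[OF perpA_functor[OF T A] F(1) H(1) c] by simp
    qed simp_all
  qed
  then have "is_theory_morphism V J S ?U N"
  proof (rule theory_morphismI[OF S U _ NO])
    show "N \<rhd> tau_vfun J S \<rhd> f = tau_vfun J ?U \<rhd> f" if f: "is_gel Jop f" for f
    proof (rule perpA_mono[OF T A])
      have o: "gsrc f \<in> J" "gtgt f \<in> J" using Jop_gel f by auto
      note s = gmap_typing(1,2)[OF theory_facts(3)[OF S] f] and u = gmap_typing(1,2)[OF theory_facts(3)[OF U] f]
      show "is_gel ?U (N \<rhd> tau_vfun J S \<rhd> f)" "is_gel ?U (tau_vfun J ?U \<rhd> f)"
        "gdom (N \<rhd> tau_vfun J S \<rhd> f) = gdom (tau_vfun J ?U \<rhd> f)" using Ns[OF s(1)] s(2) u by simp_all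
      show "?P \<rhd> N \<rhd> tau_vfun J S \<rhd> f = ?P \<rhd> tau_vfun J ?U \<rhd> f"
        using Ns(3)[OF s(1)] ta[OF f] perpA_tau[OF T A f] by simp
      show "gsrc (N \<rhd> tau_vfun J S \<rhd> f) = gsrc (tau_vfun J ?U \<rhd> f)" "gtgt (N \<rhd> tau_vfun J S \<rhd> f) = gtgt (tau_vfun J ?U \<rhd> f)"
        using o NO by (simp_all add: tau_FO)
    qed
  qed
  then show thesis using that Ns(3) by blast
qed

end

section \<open>Commutants of strong morphisms\<close>

context commutants
begin

lemma wedge_pull:
  assumes M: "is_theory_morphism V J T U M" and P: "vfunctor V U C P" and Q: "vfunctor V U C Q" and w: "wedge U P Q x l"
  shows "wedge T (vfun_comp V J P M) (vfun_comp V J Q M) x l"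
proof -
  note m = theory_morphism[OF M]
  note TJ = T_simps(1)[OF m(1)]
  note w' = w[unfolded wedge_def[OF m(2)]]
  show ?thesis
    unfolding wedge_def[OF m(1)]
  proof (intro conjI ballI allI impI)
    show "x \<in> Obj V" using w' by blast
    fix j assume j: "j \<in> J"
    show "is_gel C (l j)" "gsrc (l j) = FO (vfun_comp V J P M) j" "gtgt (l j) = FO (vfun_comp V J Q M) j" "gdom (l j) = x"
      using w' j m(4) by (auto simp: vfun_comp_def)
  next
    fix t assume t: "is_gel T t"
    have o: "gsrc t \<in> J" "gtgt t \<in> J" using T_gel[OF m(1) t] by auto
    note Mt = gmap_typing(1,2)[OF m(3) t]
    have "l (gtgt (M \<rhd> t)) \<odot>[C] (P \<rhd> M \<rhd> t) = (Q \<rhd> M \<rhd> t) \<odot>[C] l (gsrc (M \<rhd> t)) \<lhd> Sym V x (gdom (M \<rhd> t))"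
      using w' Mt(1) by blast
    then show "l (gtgt t) \<odot>[C] (vfun_comp V J P M \<rhd> t) = (vfun_comp V J Q M \<rhd> t) \<odot>[C] l (gsrc t) \<lhd> Sym V x (gdom t)"
      using Mt(2) m(4) o vfunctor_comp(2)[OF m(3) P TJ t] vfunctor_comp(2)[OF m(3) Q TJ t] by simp
  qed
qed

text \<open>An element of the commutant of \<open>Y\<close> is a wedge between cotensors of the
  algebra of \<open>Y\<close>. Restricted along \<open>TMor f\<close> and conjugated with the
  cotensored components of \<open>f\<close>, it becomes a wedge between cotensors of the algebra of
  \<open>X\<close>, hence an element of the commutant of \<open>X\<close>.\<close>

lemma commutant_arrow_ex:
  assumes f: "f \<in> Hom Algs X Y"
  obtains g where "g \<in> Hom Algs (commutant V J C Y) (commutant V J C X)"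
    "ginverse C (acomp f \<one>) (acomp g \<one>)"
proof -
  obtain T A where XT: "X = (T, A)" by (cases X)
  obtain U B where YU: "Y = (U, B)" by (cases Y)
  note s = arr_strong[OF f]
  let ?M = "TMor f" and ?\<phi> = "acomp f"
  have T: "is_theory V J T" and A: "alg T A" and U: "is_theory V J U" and B: "alg U B"
    and M: "is_theory_morphism V J T U ?M" and oX: "obj X" and oY: "obj Y"
    using s by (auto simp: strong_def obj_def XT YU)
  note m = theory_morphism[OF M]
  have "\<forall>j\<in>J. \<exists>b. ginverse C (?\<phi> j) b" using s by (simp add: strong_def)
  then obtain \<psi> where i: "\<And>j. j \<in> J \<Longrightarrow> ginverse C (?\<phi> j) (\<psi> j)" by metis
  have ph: "is_gel C (?\<phi> j)" "gdom (?\<phi> j) = \<one>" "gsrc (?\<phi> j) = FO A j" "gtgt (?\<phi> j) = FO B j" 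
    and ps: "is_gel C (\<psi> j)" "gdom (\<psi> j) = \<one>" "gsrc (\<psi> j) = FO B j" "gtgt (\<psi> j) = FO A j" if "j \<in> J" for j
    using acomp_typing[OF f that] i[OF that] by (auto simp: XT YU ginverse_def)
  have nf: "?\<phi> (gtgt t) \<star>[C] (A \<rhd> t) = (B \<rhd> ?M \<rhd> t) \<star>[C] ?\<phi> (gsrc t)" if "is_gel T t" for t
    using s that by (simp add: strong_def XT YU)
  note a = algebra_props[OF T A] and b = algebra_props[OF U B]
  note Fc = cotensored_cotf_functor[OF cotensored_C]
  \<comment> \<open>Cotensored by \<open>l\<close>, the components of \<open>f\<close> and their
    inverses are isomorphisms between [l, A] and the restriction of [l, B] along
    \<open>?M\<close>.\<close>
  define \<Phi> where "\<Phi> l j = cotensor_fun V C l \<rhd> ?\<phi> j" for l j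
  define \<Psi> where "\<Psi> l j = cotensor_fun V C l \<rhd> \<psi> j" for l j
  have I: "ginverse C (\<Phi> l j) (\<Psi> l j)" if "l \<in> J" "j \<in> J" for l j
    unfolding \<Phi>_def \<Psi>_def by (rule gmap_ginverse[OF Fc[OF that(1)] i[OF that(2)]])
  have Ft: "is_gel C (\<Phi> l j)" "gdom (\<Phi> l j) = \<one>" "gsrc (\<Phi> l j) = Cot C l (FO A j)" "gtgt (\<Phi> l j) = Cot C l (FO B j)"
    "is_gel C (\<Psi> l j)" "gdom (\<Psi> l j) = \<one>" "gsrc (\<Psi> l j) = Cot C l (FO B j)" "gtgt (\<Psi> l j) = Cot C l (FO A j)"
    if o: "l \<in> J" "j \<in> J" for l j
    using I[OF o] ph[OF o(2)] ps[OF o(2)] a(3)[OF o(2)] b(3)[OF o(2)] by (auto simp: ginverse_def \<Phi>_def \<Psi>_def cotensor_fun_def)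
  let ?S = "perpT U B" and ?P = "perpA U B"
  note S = perpT_theory[OF U B] and Bo = A_obj[OF U B]
  let ?I = "incl V J (E U) B"
  \<comment> \<open>The components of the wedge that \<open>s\<close> represents.\<close>
  define G where "G s j = ev_fun U j \<rhd> ?I \<rhd> s" for s j
  have Gt: "is_gel C (G s j)" "gdom (G s j) = gdom s" "gsrc (G s j) = Cot C (gsrc s) (FO B j)"
    "gtgt (G s j) = Cot C (gtgt s) (FO B j)" "gsrc s \<in> J" "gtgt s \<in> J" if s: "is_gel ?S s" and j: "j \<in> J" for s j
  proof -
    note c = incl_gel[OF cotensored_E[OF U] Bo s]
    show "is_gel C (G s j)" "gdom (G s j) = gdom s" "gsrc s \<in> J" "gtgt s \<in> J"
      using gmap_typing[OF ev_functor[OF U j] c(2)] c by (simp_all add: G_def)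
    show "gsrc (G s j) = Cot C (gsrc s) (FO B j)" "gtgt (G s j) = Cot C (gtgt s) (FO B j)"
      unfolding G_def using c(4,5) pointwise_algebra(1,3)[OF U B] j by (simp_all add: incl_FO[OF U B] ev_fun_FO[OF U])
  qed
  have G1: "G s \<one> = ?P \<rhd> s" if "is_gel ?S s" for s
    using perpA_app[OF U B that] by (simp add: G_def)
  define W where "W s j = \<Psi> (gtgt s) j \<star>[C] (G s j \<star>[C] \<Phi> (gsrc s) j)" for s j
  obtain N where N: "is_theory_morphism V J ?S (perpT T A) N" "\<And>s. is_gel ?S s \<Longrightarrow> perpA T A \<rhd> N \<rhd> s = W s \<one>"
  proof (rule into_commutant[OF T A S, of W])
    fix s assume s: "is_gel ?S s"
    let ?l = "gsrc s" and ?m = "gtgt s"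
    note c = incl_gel[OF cotensored_E[OF U] Bo s]
    note lm = c(4,5)
    note pA = pointwise_algebra[OF T A lm(1)] pointwise_algebra[OF T A lm(2)] and pB = pointwise_algebra[OF U B lm(1)] pointwise_algebra[OF U B lm(2)]
    let ?P' = "vfun_comp V J (pointwise_cot V C U ?l B) ?M" and ?Q' = "vfun_comp V J (pointwise_cot V C U ?m B) ?M"
    note vP = algebra_props(1)[OF U pB(1)] and vQ = algebra_props(1)[OF U pB(4)]
    note cP = vfunctor_comp[OF m(3) vP T_simps(1)[OF T]] and cQ = vfunctor_comp[OF m(3) vQ T_simps(1)[OF T]]
    have Gs: "G s = (\<lambda>j. ev_fun U j \<rhd> ?I \<rhd> s)" by (simp add: G_def fun_eq_iff)
    have w1: "wedge T ?P' ?Q' (gdom s) (G s)"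
      using wedge_pull[OF M vP vQ] ev_wedge[OF U c(2)] c(3) lm by (simp add: incl_FO[OF U B] Gs)
    have FP: "FO ?P' j = Cot C ?l (FO B j)" "FO ?Q' j = Cot C ?m (FO B j)" if "j \<in> J" for j
      using that m(4) pB(3,6)[of j] by (simp_all add: vfun_comp_def)
    show "wedge T (pointwise_cot V C T ?l A) (pointwise_cot V C T ?m A) (gdom s) (W s)"
      unfolding W_def
    proof (rule conj_wedge[OF T algebra_props(1)[OF T pA(1)] cP(1) algebra_props(1)[OF T pA(4)] cQ(1) _ _ _ _ w1])
      show "is_gel C (\<Phi> ?l j) \<and> gdom (\<Phi> ?l j) = \<one> \<and> gsrc (\<Phi> ?l j) = FO (pointwise_cot V C T ?l A) j \<and> gtgt (\<Phi> ?l j) = FO ?P' j"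
        "is_gel C (\<Psi> ?m j) \<and> gdom (\<Psi> ?m j) = \<one> \<and> gsrc (\<Psi> ?m j) = FO ?Q' j \<and> gtgt (\<Psi> ?m j) = FO (pointwise_cot V C T ?m A) j"
        if j: "j \<in> J" for j
        using Ft[OF lm(1) j] Ft[OF lm(2) j] FP[OF j] pA(3,6)[of j] j by simp_all
      fix t assume t: "is_gel T t"
      have o: "gsrc t \<in> J" "gtgt t \<in> J" using T_gel[OF T t] by auto
      note Mt = gmap_typing[OF m(3) t]
      note At = gmap_typing[OF a(1) t] and BMt = gmap_typing[OF b(1) Mt(1)]
      have n: "\<Phi> l (gtgt t) \<star>[C] (cotensor_fun V C l \<rhd> A \<rhd> t) = (cotensor_fun V C l \<rhd> B \<rhd> ?M \<rhd> t) \<star>[C] \<Phi> l (gsrc t)" if l: "l \<in> J" for l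
        using arg_cong[OF nf[OF t], of "\<lambda>x. cotensor_fun V C l \<rhd> x"] At BMt ph[OF o(1)] ph[OF o(2)] o m(4)
        by (simp add: \<Phi>_def gmap_star[OF Fc[OF l]])
      show "\<Phi> ?l (gtgt t) \<star>[C] (pointwise_cot V C T ?l A \<rhd> t) = (?P' \<rhd> t) \<star>[C] \<Phi> ?l (gsrc t)"
        unfolding pA(2)[OF t] cP(2)[OF t] pB(2)[OF Mt(1)] by (rule n[OF lm(1)])
      show "\<Psi> ?m (gtgt t) \<star>[C] (?Q' \<rhd> t) = (pointwise_cot V C T ?m A \<rhd> t) \<star>[C] \<Psi> ?m (gsrc t)"
        unfolding pA(5)[OF t] cQ(2)[OF t] pB(5)[OF Mt(1)]
        by (rule inverse_natural[OF I[OF lm(2) o(1)] I[OF lm(2) o(2)] _ _ _ _ _ _ n[OF lm(2)]])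
          (use gmap_typing[OF Fc[OF lm(2)] At(1)] gmap_typing[OF Fc[OF lm(2)] BMt(1)] Ft[OF lm(2) o(1)] Ft[OF lm(2) o(2)] o m(4) a(3) b(3)
            in \<open>simp_all add: cotensor_fun_def\<close>)
    qed
    note Is = incl_functor[OF cotensored_E[OF U] Bo]
    fix u j assume u: "u \<in> Arr V" "Cod V u = gdom s" and j: "j \<in> J"
    have "G (s \<lhd> u) j = G s j \<lhd> u"
      using gmap_reindex[OF Is s u] gmap_reindex[OF ev_functor[OF U j] c(2), of u] u c(3) by (simp add: G_def)
    then show "W (s \<lhd> u) j = W s j \<lhd> u"
      using Gt[OF s j] Ft[OF lm(1) j] Ft[OF lm(2) j] u by (simp add: W_def star_reindex_left star_reindex_right)
  next
    fix l assume l: "l \<in> J"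
    have gl: "is_gel ?S (gid ?S l)" using l T_simps[OF S] by simp
    have "G (gid ?S l) \<one> = gid C (Cot C l (FO B \<one>))"
      unfolding G1[OF gl] using gmap_gid[OF perpA_functor[OF U B], of l] perpA_FO[OF U B l] l T_simps(1)[OF S] by simp
    then show "W (gid ?S l) \<one> = gid C (Cot C l (FO A \<one>))"
      using Ft[OF l J_simps(2)] I[OF l J_simps(2)] by (simp add: W_def ginverse_def)
  next
    fix g h assume gh: "is_gel ?S g" "is_gel ?S h" "gsrc h = gtgt g"
    have c: "is_gel ?S (h \<odot>[?S] g)" using gh T_simps(2)[OF S] by simp
    note Gg = Gt[OF gh(1) J_simps(2)] and Gh = Gt[OF gh(2) J_simps(2)]
    have e: "G (h \<odot>[?S] g) \<one> = G h \<one> \<odot>[C] G g \<one>"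
      using gmap_gcomp[OF perpA_functor[OF U B] gh] G1[OF c] G1[OF gh(1)] G1[OF gh(2)] by simp
    have "W h \<one> \<odot>[C] W g \<one> = \<Psi> (gtgt h) \<one> \<star>[C] ((G h \<one> \<odot>[C] G g \<one>) \<star>[C] \<Phi> (gsrc g) \<one>)"
      unfolding W_def gh(3)
      by (rule conj_gcomp[OF I[OF Gg(6) J_simps(2)]])
        (use Gg Gh gh(3) Ft[OF Gg(5) J_simps(2)] Ft[OF Gg(6) J_simps(2)] Ft[OF Gh(6) J_simps(2)] in simp_all)
    then show "W (h \<odot>[?S] g) \<one> = W h \<one> \<odot>[C] W g \<one>" using e by (simp add: W_def)
  next
    fix k assume k: "is_gel Jop k"
    let ?l = "gsrc k" and ?m = "gtgt k"
    have lm: "?l \<in> J" "?m \<in> J" using Jop_gel k by auto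
    let ?a = "FO A \<one>" and ?b = "FO B \<one>"
    have ab: "?a \<in> VObj C" "?b \<in> VObj C" using a(3) b(3) by auto
    let ?t = "tau_fun V J C ?b \<rhd> k" and ?h = "hat k \<cdot> Sym V ?m (gdom k)"
    note tB = tau_fun_gel[OF cotensored_C ab(2) k] and tA = tau_fun_gel[OF cotensored_C ab(1) k]
    note ks = incl_tau[OF cotensored_E[OF U] Bo k]
    have e: "W (tau_vfun J ?S \<rhd> k) \<one> = \<Psi> ?m \<one> \<star>[C] (?t \<star>[C] \<Phi> ?l \<one>)"
      unfolding W_def G1[OF ks(2)] perpA_tau[OF U B k] using ks(4,5) by simp
    have tg: "gsrc ?t = Cot C ?l ?b" "gtgt ?t = Cot C ?m ?b" using lm tau_fun_FO[OF cotensored_C ab(2)] by simp_all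
    note F1 = Ft[OF lm(1) J_simps(2)] Ft[OF lm(2) J_simps(2)]
    note cc = cotensored_cou[OF cotensored_C lm(1) ab(1)] cotensored_cou[OF cotensored_C lm(1) ab(2)] cotensored_cou[OF cotensored_C lm(2) ab(1)] cotensored_cou[OF cotensored_C lm(2) ab(2)]
    have hh: "?h \<in> Arr V" "Cod V ?h = ?l" using k lm by simp_all
    note p1 = ph[OF J_simps(2)] ps[OF J_simps(2)]
    \<comment> \<open>Naturality of the counits carries \<open>\<Psi>\<close> and
      \<open>\<Phi>\<close> to \<open>\<psi>\<close> and \<open>?\<phi>\<close> at \<one>, which
      cancel in the chain below. So conjugation respects the structure arrows.\<close>
    have c1: "cou C ?m ?a \<star>[C] \<Psi> ?m \<one> = \<psi> \<one> \<star>[C] cou C ?m ?b"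
      using cotensored_cotf(4)[OF cotensored_C lm(2) p1(5,6)] p1 by (simp add: \<Psi>_def)
    have c2: "cou C ?l ?b \<star>[C] \<Phi> ?l \<one> = ?\<phi> \<one> \<star>[C] cou C ?l ?a"
      using cotensored_cotf(4)[OF cotensored_C lm(1) p1(1,2)] p1 by (simp add: \<Phi>_def)
    have "cou C ?m ?a \<odot>[C] (\<Psi> ?m \<one> \<star>[C] (?t \<star>[C] \<Phi> ?l \<one>)) = (cou C ?m ?a \<star>[C] \<Psi> ?m \<one>) \<odot>[C] (?t \<star>[C] \<Phi> ?l \<one>)"
      using F1 cc tB(1,2) tg by (simp add: star_gcomp_middle)
    also have "\<dots> = \<psi> \<one> \<star>[C] ((cou C ?m ?b \<odot>[C] ?t) \<star>[C] \<Phi> ?l \<one>)"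
      unfolding c1 using F1 cc tB(1,2) tg p1 by (simp add: star_gcomp gcomp_star)
    also have "\<dots> = \<psi> \<one> \<star>[C] (cou C ?l ?b \<star>[C] \<Phi> ?l \<one>) \<lhd> ?h"
      unfolding tB(3) using F1 cc p1 hh by (simp add: star_reindex_left star_reindex_right del: assoc)
    also have "\<psi> \<one> \<star>[C] (cou C ?l ?b \<star>[C] \<Phi> ?l \<one>) = cou C ?l ?a"
      unfolding c2 by (rule ginverse_cancel(1)[OF C_vcat i[OF J_simps(2)]]) (use cc p1 in simp_all)
    finally have "cou C ?m ?a \<odot>[C] (\<Psi> ?m \<one> \<star>[C] (?t \<star>[C] \<Phi> ?l \<one>)) = cou C ?m ?a \<odot>[C] (tau_fun V J C ?a \<rhd> k)"
      unfolding tA(3) .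
    then have "\<Psi> ?m \<one> \<star>[C] (?t \<star>[C] \<Phi> ?l \<one>) = tau_fun V J C ?a \<rhd> k"
      by (rule tau_fun_eqI[OF cotensored_C ab(1)]) (use F1 tB tA tg lm tau_fun_FO[OF cotensored_C ab(1)] in simp_all)
    then show "W (tau_vfun J ?S \<rhd> k) \<one> = tau_fun V J C ?a \<rhd> k" unfolding e .
  qed (use that in blast)
  have "strong (commutant V J C Y) (commutant V J C X) N (\<lambda>l. \<Psi> l \<one>)"
    unfolding strong_def
  proof (intro conjI ballI allI impI obj_commutant oX oY)
    show "is_theory_morphism V J (fst (commutant V J C Y)) (fst (commutant V J C X)) N"
      using N(1) by (simp add: XT YU)
    fix l assume l: "l \<in> J"
    show "gsrc (\<Psi> l \<one>) = FO (snd (commutant V J C Y)) l" "gtgt (\<Psi> l \<one>) = FO (snd (commutant V J C X)) l"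
      using Ft[OF l J_simps(2)] perpA_FO[OF U B l] perpA_FO[OF T A l] by (simp_all add: XT YU)
    show "\<exists>b. ginverse C (\<Psi> l \<one>) b" using ginverse_sym[OF I[OF l J_simps(2)]] by blast
  next
    fix t assume "is_gel (fst (commutant V J C Y)) t"
    then have t: "is_gel ?S t" by (simp add: YU)
    note g = Gt[OF t J_simps(2)]
    note F1 = Ft[OF g(5) J_simps(2)] Ft[OF g(6) J_simps(2)]
    have "W t \<one> \<star>[C] \<Psi> (gsrc t) \<one> = \<Psi> (gtgt t) \<one> \<star>[C] ((G t \<one> \<star>[C] \<Phi> (gsrc t) \<one>) \<star>[C] \<Psi> (gsrc t) \<one>)"
      unfolding W_def using g F1 by (simp add: star_assoc)
    also have "(G t \<one> \<star>[C] \<Phi> (gsrc t) \<one>) \<star>[C] \<Psi> (gsrc t) \<one> = G t \<one>"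
      by (rule ginverse_cancel(4)[OF C_vcat I[OF g(5) J_simps(2)] g(1)]) (use g F1 in simp)
    finally show "\<Psi> (gtgt t) \<one> \<star>[C] (snd (commutant V J C Y) \<rhd> t) = (snd (commutant V J C X) \<rhd> N \<rhd> t) \<star>[C] \<Psi> (gsrc t) \<one>"
      using N(2)[OF t] G1[OF t] by (simp add: XT YU)
  qed
  note r = mk_strong[OF this]
  \<comment> \<open>[\<one>, -] is the identity on elements, so the component at \<one> is exactly
    the inverse of that of \<open>f\<close>.\<close>
  have "\<Psi> \<one> \<one> = \<psi> \<one>" unfolding \<Psi>_def by (rule cotensor_fun_unit[OF cotensored_C ps(1)[OF J_simps(2)]])
  then have "ginverse C (acomp f \<one>) (acomp (mk_strong (commutant V J C Y) (commutant V J C X) N (\<lambda>l. \<Psi> l \<one>)) \<one>)"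
    using i[OF J_simps(2)] r(2)[OF J_simps(2)] by simp
  with r(1) show thesis by (rule that)
qed

end

section \<open>The unit\<close>

context commutants
begin

text \<open>The isomorphism \<open>\<theta> l j : [l, A j] \<cong> [j, [l, A I]]\<close> exists because \<open>[l, A -]\<close> is again an algebra, so
  that both sides are cotensors of \<open>[l, A I]\<close> by \<open>j\<close>.\<close>

lemma com_unit_ex:
  assumes X: "obj X"
  obtains u where "u \<in> Hom Algs X (commutant V J C (commutant V J C X))"
    "acomp u \<one> = gid C (carrier V X)"
proof -
  obtain T A where XT: "X = (T, A)" by (cases X)
  have T: "is_theory V J T" and A: "alg T A" using X by (simp_all add: obj_def XT)
  let ?S = "perpT T A" and ?P = "perpA T A"
  let ?Y = "commutant V J C (commutant V J C X)"
  note S = perpT_theory[OF T A] and P = perpA_alg[OF T A]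
  have cX: "commutant V J C X = (?S, ?P)" using commutant_simps[of T A] by (simp add: XT prod_eq_iff)
  note a = algebra_props[OF T A]
  note Fc = cotensored_cotf_functor[OF cotensored_C]
  note Ao = A_obj[OF T A]
  let ?I = "incl V J (E T) A"
  have P1: "FO ?P \<one> = FO A \<one>" using perpA_FO[OF T A J_simps(2)] cotensored_unit(1)[OF cotensored_C A_one[OF T A]] by simp
  have Pl: "FO ?P l = Cot C l (FO A \<one>)" "FO ?P l \<in> VObj C" if "l \<in> J" for l
    using perpA_FO[OF T A that] algebra_props(3)[OF S P that] by auto
  \<comment> \<open>Comparison of two cotensors of \<open>FO ?P l\<close> by \<open>j\<close>: the
    designated one, and the image under [l, A -] of the structure arrow j \<rightarrow> T(j,
    \<one>). The counit equations are kept as the means to compute with \<open>\<theta>\<close> and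
    \<open>\<theta>'\<close>.\<close>
  let ?Q = "\<lambda>l j \<theta> \<theta>'. ginverse C \<theta> \<theta>' \<and> gsrc \<theta> = Cot C l (FO A j) \<and> gtgt \<theta> = Cot C j (FO ?P l) \<and>
      cou C j (FO ?P l) \<star>[C] \<theta> = cotensor_fun V C l \<rhd> A \<rhd> theory_cou T j \<and> (cotensor_fun V C l \<rhd> A \<rhd> theory_cou T j) \<star>[C] \<theta>' = cou C j (FO ?P l)"
  have ex: "\<exists>\<theta> \<theta>'. ?Q l j \<theta> \<theta>'"
    if o: "l \<in> J" "j \<in> J" for l j
  proof -
    note K = theory_cou[OF T o(2)]
    note c = cotensored_cou[OF cotensored_C o(2) Pl(2)[OF o(1)]]
    let ?k = "cotensor_fun V C l \<rhd> A \<rhd> theory_cou T j"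
    have k: "is_cot C ?k" by (rule cotensored_cotf_preserves[OF cotensored_C o(1) a(2)[OF K(5)]]) (simp add: K o)
    note At = gmap_typing[OF a(1) K(1)]
    note kt = gmap_typing(1,2)[OF Fc[OF o(1)] At(1)]
    have s: "gsrc ?k = Cot C l (FO A j)" "gtgt ?k = FO ?P l" "gdom ?k = j"
      using kt At K Pl[OF o(1)] a(3)[OF o(2)] a(3)[OF J_simps(2)] by (simp_all add: cotensor_fun_def)
    show ?thesis
      by (rule cot_comparison[OF C_vcat c(1) k]) (use s c in auto)
  qed
  define \<theta> where "\<theta> l j = (SOME a. \<exists>b. ?Q l j a b)" for l j
  have ex': "\<exists>b. ?Q l j (\<theta> l j) b" if "l \<in> J" "j \<in> J" for l j
    unfolding \<theta>_def by (rule someI_ex[OF ex[OF that]])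
  define \<theta>' where "\<theta>' l j = (SOME b. ?Q l j (\<theta> l j) b)" for l j
  have Q: "?Q l j (\<theta> l j) (\<theta>' l j)" if "l \<in> J" "j \<in> J" for l j
    unfolding \<theta>'_def by (rule someI_ex[OF ex'[OF that]])
  have I: "ginverse C (\<theta> l j) (\<theta>' l j)"
    and t0: "gsrc (\<theta> l j) = Cot C l (FO A j) \<and> gtgt (\<theta> l j) = Cot C j (FO ?P l)"
    and tc: "cou C j (FO ?P l) \<star>[C] \<theta> l j = cotensor_fun V C l \<rhd> A \<rhd> theory_cou T j"
    and tc': "(cotensor_fun V C l \<rhd> A \<rhd> theory_cou T j) \<star>[C] \<theta>' l j = cou C j (FO ?P l)"
    if "l \<in> J" "j \<in> J" for l j
    using Q[OF that] by blast+
  have th: "is_gel C (\<theta> l j)" "gdom (\<theta> l j) = \<one>" "gsrc (\<theta> l j) = Cot C l (FO A j)" "gtgt (\<theta> l j) = Cot C j (FO ?P l)"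
    "is_gel C (\<theta>' l j)" "gdom (\<theta>' l j) = \<one>" "gsrc (\<theta>' l j) = Cot C j (FO ?P l)" "gtgt (\<theta>' l j) = Cot C l (FO A j)"
    if "l \<in> J" "j \<in> J" for l j
    using I[OF that] t0[OF that] by (auto simp: ginverse_def)
  \<comment> \<open>\<open>H\<close> is the action of \<open>T\<close> on [l, A -], and
    \<open>R\<close> below is the action of the commutant theory on [-, A j].\<close>
  define H where "H l t = cotensor_fun V C l \<rhd> A \<rhd> t" for l t
  have Ht: "is_gel C (H l t)" "gdom (H l t) = gdom t" "gsrc (H l t) = Cot C l (FO A (gsrc t))" "gtgt (H l t) = Cot C l (FO A (gtgt t))"
    "gsrc t \<in> J" "gtgt t \<in> J" if l: "l \<in> J" and t: "is_gel T t" for l t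
  proof -
    note At = gmap_typing[OF a(1) t]
    show o: "gsrc t \<in> J" "gtgt t \<in> J" using T_gel[OF T t] by auto
    show "is_gel C (H l t)" "gdom (H l t) = gdom t" "gsrc (H l t) = Cot C l (FO A (gsrc t))" "gtgt (H l t) = Cot C l (FO A (gtgt t))"
      using gmap_typing[OF Fc[OF l] At(1)] At a(3)[OF o(1)] a(3)[OF o(2)] by (simp_all add: H_def cotensor_fun_def)
  qed
  have H1: "H \<one> t = A \<rhd> t" if t: "is_gel T t" for t
    unfolding H_def by (rule cotensor_fun_unit[OF cotensored_C gmap_typing(1)[OF a(1) t]])
  define R where "R j s = ev_fun T j \<rhd> ?I \<rhd> s" for j s
  have Rt: "is_gel C (R j s)" "gdom (R j s) = gdom s" "gsrc (R j s) = Cot C (gsrc s) (FO A j)"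
    "gtgt (R j s) = Cot C (gtgt s) (FO A j)" "gsrc s \<in> J" "gtgt s \<in> J" if s: "is_gel ?S s" and j: "j \<in> J" for s j
  proof -
    note c = incl_gel[OF cotensored_E[OF T] Ao s]
    show "is_gel C (R j s)" "gdom (R j s) = gdom s" "gsrc s \<in> J" "gtgt s \<in> J"
      using gmap_typing[OF ev_functor[OF T j] c(2)] c by (simp_all add: R_def)
    show "gsrc (R j s) = Cot C (gsrc s) (FO A j)" "gtgt (R j s) = Cot C (gtgt s) (FO A j)"
      unfolding R_def using c(4,5) pointwise_algebra(1,3)[OF T A] j by (simp_all add: incl_FO[OF T A] ev_fun_FO[OF T])
  qed
  have R1: "R \<one> s = ?P \<rhd> s" if "is_gel ?S s" for s
    using perpA_app[OF T A that] by (simp add: R_def)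
  \<comment> \<open>Naturality over \<open>T\<close> of the wedge represented by \<open>s\<close>.
    The square is symmetric in the two theories: read with \<open>t\<close> fixed, it says that
    \<open>H l t\<close> is natural in \<open>l\<close> along the commutant theory, which is
    \<open>w1\<close> below.\<close>
  have HR: "R (gtgt t) s \<odot>[C] H (gsrc s) t = H (gtgt s) t \<odot>[C] R (gsrc t) s \<lhd> Sym V (gdom s) (gdom t)"
    if s: "is_gel ?S s" and t: "is_gel T t" for s t
  proof -
    note c = incl_gel[OF cotensored_E[OF T] Ao s]
    show ?thesis
      using ev_natural[OF T c(2) t] c(3) pointwise_algebra(2)[OF T A c(4) t] pointwise_algebra(2)[OF T A c(5) t] c(4,5)
      by (simp add: R_def H_def incl_FO[OF T A])
  qed
  \<comment> \<open>Naturality of \<open>\<theta> l j\<close> in \<open>l\<close>. Tested after the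
    counit of the cotensor by \<open>j\<close>, it is \<open>HR\<close> at the structure arrow j
    \<rightarrow> T(j, \<one>).\<close>
  have RF: "\<theta> (gtgt s) j \<star>[C] R j s = (cotensor_fun V C j \<rhd> ?P \<rhd> s) \<star>[C] \<theta> (gsrc s) j"
    if s: "is_gel ?S s" and j: "j \<in> J" for s j
  proof -
    let ?l = "gsrc s" and ?m = "gtgt s"
    note r = Rt[OF s j] and r1 = Rt[OF s J_simps(2)]
    note l = th[OF r(5) j] and m = th[OF r(6) j]
    note K = theory_cou[OF T j]
    note hl = Ht[OF r(5) K(1)] and hm = Ht[OF r(6) K(1)]
    note cl = cotensored_cou[OF cotensored_C j Pl(2)[OF r(5)]] and cm = cotensored_cou[OF cotensored_C j Pl(2)[OF r(6)]]
    note ps = gmap_typing[OF algebra_props(1)[OF S P] s]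
    note F = cotensored_cotf[OF cotensored_C j ps(1)]
    have sd: "gdom s \<in> Obj V" "j \<in> Obj V" using s j by simp_all
    have r1': "gsrc (R \<one> s) = FO ?P ?l" using r1(3) Pl(1)[OF r(5)] by simp
    have FF: "gsrc (cotensor_fun V C j \<rhd> ?P \<rhd> s) = Cot C j (FO ?P ?l)" "gtgt (cotensor_fun V C j \<rhd> ?P \<rhd> s) = Cot C j (FO ?P ?m)"
      using Pl(2)[OF r(5)] Pl(2)[OF r(6)] by (simp_all add: cotensor_fun_def)
    have n: "R \<one> s \<odot>[C] H ?l (theory_cou T j) = H ?m (theory_cou T j) \<odot>[C] R j s \<lhd> Sym V (gdom s) j"
      using HR[OF s K(1)] K by simp
    have "cou C j (FO ?P ?m) \<odot>[C] (\<theta> ?m j \<star>[C] R j s) = (cou C j (FO ?P ?m) \<star>[C] \<theta> ?m j) \<odot>[C] R j s"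
      using r m cm by (simp add: star_gcomp_middle)
    also have "\<dots> = H ?m (theory_cou T j) \<odot>[C] R j s \<lhd> Sym V (gdom s) j \<lhd> Sym V j (gdom s)"
      unfolding tc[OF r(6) j] using r hm K sd by (simp add: H_def)
    also have "\<dots> = ((R \<one> s \<odot>[C] cou C j (FO ?P ?l)) \<star>[C] \<theta> ?l j) \<lhd> Sym V j (gdom s)"
      unfolding n[symmetric] using r1(1,2) r1' l cl by (simp add: gcomp_star tc[OF r(5) j] H_def)
    also have "\<dots> = (cou C j (FO ?P ?m) \<odot>[C] (cotensor_fun V C j \<rhd> ?P \<rhd> s)) \<star>[C] \<theta> ?l j"
      using F(3) R1[OF s] r1 l cl Pl[OF r(5)] ps sd by (simp add: star_reindex_left)
    also have "\<dots> = cou C j (FO ?P ?m) \<odot>[C] ((cotensor_fun V C j \<rhd> ?P \<rhd> s) \<star>[C] \<theta> ?l j)"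
      using F(1,2) l cm FF by (simp add: gcomp_star)
    finally show ?thesis
      by (rule cot_cancel[OF C_vcat _ cm(1)]) (use r l m F(1,2) FF ps in simp_all)
  qed
  \<comment> \<open>\<open>H l t\<close> transported along \<open>\<theta>\<close>: an arrow
    [l, A j] \<rightarrow> [l, A k] becomes [j, [l, A I]] \<rightarrow> [k, [l, A I]], and
    \<open>l\<close> is now the variable of the wedge.\<close>
  define W where "W t l = \<theta> l (gtgt t) \<star>[C] (H l t \<star>[C] \<theta>' l (gsrc t))" for t l
  obtain N where N: "is_theory_morphism V J T (perpT ?S ?P) N" "\<And>t. is_gel T t \<Longrightarrow> perpA ?S ?P \<rhd> N \<rhd> t = W t \<one>"
  proof (rule into_commutant[OF S P T, of W])
    fix t assume t: "is_gel T t"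
    let ?j = "gsrc t" and ?k = "gtgt t"
    have o: "?j \<in> J" "?k \<in> J" using T_gel[OF T t] by auto
    have td: "gdom t \<in> Obj V" using t by simp
    note pj = pointwise_algebra[OF S P o(1)] and pk = pointwise_algebra[OF S P o(2)]
    let ?R = "\<lambda>j. vfun_comp V J (ev_fun T j) ?I"
    note Iv = incl_functor[OF cotensored_E[OF T] Ao] and SJ = cotensor_theory_simps(1)[OF cotensored_E[OF T] Ao]
    note cj = vfunctor_comp[OF Iv ev_functor[OF T o(1)] SJ] and ck = vfunctor_comp[OF Iv ev_functor[OF T o(2)] SJ]
    have Rf: "FO (?R j) l = Cot C l (FO A j)" if "l \<in> J" "j \<in> J" for l j
      using pointwise_algebra(1,3)[OF T A that(1)] that by (simp add: vfun_comp_def incl_FO[OF T A] ev_fun_FO[OF T])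
    have w1: "wedge ?S (?R ?j) (?R ?k) (gdom t) (\<lambda>l. H l t)"
      unfolding wedge_def[OF S]
    proof (intro conjI ballI allI impI td)
      show "is_gel C (H l t)" "gsrc (H l t) = FO (?R ?j) l" "gtgt (H l t) = FO (?R ?k) l" "gdom (H l t) = gdom t" if "l \<in> J" for l
        using Ht[OF that t] Rf[OF that] o by simp_all
      fix s assume s: "is_gel ?S s"
      note rj = Rt[OF s o(1)] and rk = Rt[OF s o(2)]
      have sd: "gdom s \<in> Obj V" using s by simp
      show "H (gtgt s) t \<odot>[C] (?R ?j \<rhd> s) = (?R ?k \<rhd> s) \<odot>[C] H (gsrc s) t \<lhd> Sym V (gdom t) (gdom s)"
        unfolding cj(2)[OF s] ck(2)[OF s] R_def[symmetric] HR[OF s t]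
        using rj rk Ht[OF rj(5) t] Ht[OF rj(6) t] sd td by simp
    qed
    show "wedge ?S (pointwise_cot V C ?S ?j ?P) (pointwise_cot V C ?S ?k ?P) (gdom t) (W t)"
      unfolding W_def
    proof (rule conj_wedge[OF S algebra_props(1)[OF S pj(1)] cj(1) algebra_props(1)[OF S pk(1)] ck(1) _ _ _ _ w1])
      show "is_gel C (\<theta>' l ?j) \<and> gdom (\<theta>' l ?j) = \<one> \<and> gsrc (\<theta>' l ?j) = FO (pointwise_cot V C ?S ?j ?P) l \<and> gtgt (\<theta>' l ?j) = FO (?R ?j) l"
        "is_gel C (\<theta> l ?k) \<and> gdom (\<theta> l ?k) = \<one> \<and> gsrc (\<theta> l ?k) = FO (?R ?k) l \<and> gtgt (\<theta> l ?k) = FO (pointwise_cot V C ?S ?k ?P) l"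
        if "l \<in> J" for l
        using th[OF that o(1)] th[OF that o(2)] Rf[OF that] o pj(3)[OF that] pk(3)[OF that] by simp_all
      fix s assume s: "is_gel ?S s"
      note rj = Rt[OF s o(1)]
      note ps = gmap_typing[OF algebra_props(1)[OF S P] s]
      show "\<theta>' (gtgt s) ?j \<star>[C] (pointwise_cot V C ?S ?j ?P \<rhd> s) = (?R ?j \<rhd> s) \<star>[C] \<theta>' (gsrc s) ?j"
        unfolding pj(2)[OF s] cj(2)[OF s] R_def[symmetric]
        by (rule inverse_natural[OF I[OF rj(5) o(1)] I[OF rj(6) o(1)] _ _ _ _ _ _ RF[OF s o(1)]])
          (use rj th[OF rj(5) o(1)] th[OF rj(6) o(1)] cotensored_cotf(1)[OF cotensored_C o(1) ps(1)] Pl(2)[OF rj(5)] Pl(2)[OF rj(6)] in \<open>simp_all add: cotensor_fun_def\<close>)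
      show "\<theta> (gtgt s) ?k \<star>[C] (?R ?k \<rhd> s) = (pointwise_cot V C ?S ?k ?P \<rhd> s) \<star>[C] \<theta> (gsrc s) ?k"
        unfolding pk(2)[OF s] ck(2)[OF s] R_def[symmetric] by (rule RF[OF s o(2)])
    qed
    fix u l assume u: "u \<in> Arr V" "Cod V u = gdom t" and l: "l \<in> J"
    note At = gmap_typing[OF a(1) t]
    have "H l (t \<lhd> u) = H l t \<lhd> u"
      using gmap_reindex[OF a(1) t u] gmap_reindex[OF Fc[OF l] At(1), of u] u At(2) by (simp add: H_def)
    then show "W (t \<lhd> u) l = W t l \<lhd> u"
      using Ht[OF l t] th[OF l o(1)] th[OF l o(2)] u by (simp add: W_def star_reindex_left star_reindex_right)
  next
    fix j assume j: "j \<in> J"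
    have gj: "is_gel T (gid T j)" using j T_simps[OF T] by simp
    have "H \<one> (gid T j) = gid C (FO A j)"
      unfolding H1[OF gj] using gmap_gid[OF a(1), of j] j T_simps(1)[OF T] by simp
    moreover have "Cot C \<one> (FO A j) = FO A j" by (rule cotensored_unit(1)[OF cotensored_C a(3)[OF j]])
    ultimately show "W (gid T j) \<one> = gid C (Cot C j (FO ?P \<one>))"
      using th[OF J_simps(2) j] I[OF J_simps(2) j] by (simp add: W_def ginverse_def)
  next
    fix g h assume gh: "is_gel T g" "is_gel T h" "gsrc h = gtgt g"
    have c: "is_gel T (h \<odot>[T] g)" using gh T_simps(2)[OF T] by simp
    note Hg = Ht[OF J_simps(2) gh(1)] and Hh = Ht[OF J_simps(2) gh(2)]
    have e: "H \<one> (h \<odot>[T] g) = H \<one> h \<odot>[C] H \<one> g"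
      using gmap_gcomp[OF a(1) gh] H1[OF c] H1[OF gh(1)] H1[OF gh(2)] by simp
    have "W h \<one> \<odot>[C] W g \<one> = \<theta> \<one> (gtgt h) \<star>[C] ((H \<one> h \<odot>[C] H \<one> g) \<star>[C] \<theta>' \<one> (gsrc g))"
      unfolding W_def gh(3)
      by (rule conj_gcomp[OF ginverse_sym[OF I[OF J_simps(2) Hg(6)]]])
        (use Hg Hh gh(3) th[OF J_simps(2) Hg(5)] th[OF J_simps(2) Hg(6)] th[OF J_simps(2) Hh(6)] in simp_all)
    then show "W (h \<odot>[T] g) \<one> = W h \<one> \<odot>[C] W g \<one>" using e by (simp add: W_def)
  next
    fix k assume k: "is_gel Jop k"
    let ?l = "gsrc k" and ?m = "gtgt k" and ?c = "FO ?P \<one>"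
    have lm: "?l \<in> J" "?m \<in> J" using Jop_gel k by auto
    have cc: "?c \<in> VObj C" by (rule Pl(2)[OF J_simps(2)])
    note t = theory_facts(3)[OF T]
    let ?k = "tau_vfun J T \<rhd> k" and ?h = "hat k \<cdot> Sym V ?m (gdom k)"
    note kt = gmap_typing[OF t k]
    have ks: "gsrc ?k = ?l" "gtgt ?k = ?m" using lm by (simp_all add: tau_FO)
    note Hk = Ht[OF J_simps(2) kt(1)]
    note Kl = theory_cou[OF T lm(1)] and Km = theory_cou[OF T lm(2)]
    note hl = Ht[OF J_simps(2) Kl(1)] and hm = Ht[OF J_simps(2) Km(1)]
    note tl = th[OF J_simps(2) lm(1)] and tm = th[OF J_simps(2) lm(2)]
    note al = arity_cou[OF lm(1)] and am = arity_cou[OF lm(2)]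
    have hh: "?h \<in> Arr V" "Cod V ?h = ?l" "Dom V ?h = ?m \<otimes> gdom k" using k lm by simp_all
    note cl = cotensored_cou[OF cotensored_C lm(1) cc] and cm = cotensored_cou[OF cotensored_C lm(2) cc]
    \<comment> \<open>The image of \<open>arity_cou_gcomp\<close> under the structure functor;
      below, \<open>tc\<close> and \<open>tc'\<close> convert the structure arrows of
      \<open>T\<close> in it to the counits of \<open>C\<close>.\<close>
    have "theory_cou T ?m \<odot>[T] ?k = theory_cou T ?l \<lhd> ?h"
      using gmap_gcomp[OF t k am(1)] am(4) arity_cou_gcomp[OF k] gmap_reindex[OF t al(1) hh(1)] hh(2) al(2) by (simp add: theory_cou_def)
    then have tk: "H \<one> (theory_cou T ?m) \<odot>[C] H \<one> ?k = H \<one> (theory_cou T ?l) \<lhd> ?h"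
      using gmap_gcomp[OF a(1) kt(1) Km(1)] gmap_reindex[OF a(1) Kl(1) hh(1)] hh(2) Km(3) Kl(2) ks
      by (simp add: H1[OF kt(1)] H1[OF Km(1)] H1[OF Kl(1)])
    have "cou C ?m ?c \<odot>[C] W ?k \<one> = (cou C ?m ?c \<star>[C] \<theta> \<one> ?m) \<odot>[C] (H \<one> ?k \<star>[C] \<theta>' \<one> ?l)"
      using cm tm tl Hk ks by (simp add: W_def star_gcomp_middle)
    also have "\<dots> = (H \<one> (theory_cou T ?m) \<odot>[C] H \<one> ?k) \<star>[C] \<theta>' \<one> ?l"
      unfolding tc[OF J_simps(2) lm(2)] H_def[symmetric] using tl Hk hm ks Km by (simp add: gcomp_star)
    also have "\<dots> = (H \<one> (theory_cou T ?l) \<star>[C] \<theta>' \<one> ?l) \<lhd> ?h"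
      unfolding tk using tl hl Kl hh by (simp add: star_reindex_left del: assoc)
    also have "\<dots> = cou C ?l ?c \<lhd> ?h" using tc'[OF J_simps(2) lm(1)] by (simp add: H_def)
    also have "\<dots> = cou C ?m ?c \<odot>[C] (tau_fun V J C ?c \<rhd> k)" using tau_fun_gel(3)[OF cotensored_C cc k] by simp
    finally show "W ?k \<one> = tau_fun V J C ?c \<rhd> k"
      by (rule tau_fun_eqI[OF cotensored_C cc]) (use tau_fun_gel[OF cotensored_C cc k] tl tm Hk ks kt lm tau_fun_FO[OF cotensored_C cc] in \<open>simp_all add: W_def\<close>)
  qed (use that in blast)
  have one: "Cot C \<one> (FO A j) = FO A j" if "j \<in> J" for j by (rule cotensored_unit(1)[OF cotensored_C a(3)[OF that]])
  have Ye: "?Y = commutant V J C (?S, ?P)" unfolding cX ..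
  have Y: "fst ?Y = perpT ?S ?P" "snd ?Y = perpA ?S ?P" unfolding Ye by (rule commutant_simps, rule refl)
  have Xe: "fst X = T" "snd X = A" by (simp_all add: XT)
  have "strong X ?Y N (\<theta> \<one>)"
    unfolding strong_def
  proof (intro conjI ballI allI impI obj_commutant X)
    show "is_theory_morphism V J (fst X) (fst ?Y) N" using N(1) by (simp only: Xe Y)
    fix j assume j: "j \<in> J"
    show "gsrc (\<theta> \<one> j) = FO (snd X) j" "gtgt (\<theta> \<one> j) = FO (snd ?Y) j"
      using th[OF J_simps(2) j] one[OF j] perpA_FO[OF S P j] unfolding Xe Y by simp_all
    show "\<exists>b. ginverse C (\<theta> \<one> j) b" using I[OF J_simps(2) j] by blast
  next
    fix t assume "is_gel (fst X) t"
    then have t: "is_gel T t" by (simp only: Xe)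
    note Hh = Ht[OF J_simps(2) t]
    note tj = th[OF J_simps(2) Hh(5)] and tk = th[OF J_simps(2) Hh(6)]
    have "W t \<one> \<star>[C] \<theta> \<one> (gsrc t) = \<theta> \<one> (gtgt t) \<star>[C] ((H \<one> t \<star>[C] \<theta>' \<one> (gsrc t)) \<star>[C] \<theta> \<one> (gsrc t))"
      unfolding W_def using Hh tj tk by (simp add: star_assoc)
    also have "(H \<one> t \<star>[C] \<theta>' \<one> (gsrc t)) \<star>[C] \<theta> \<one> (gsrc t) = H \<one> t"
      by (rule ginverse_cancel(3)[OF C_vcat I[OF J_simps(2) Hh(5)] Hh(1)]) (use Hh tj in simp)
    finally show "\<theta> \<one> (gtgt t) \<star>[C] (snd X \<rhd> t) = (snd ?Y \<rhd> N \<rhd> t) \<star>[C] \<theta> \<one> (gsrc t)"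
      unfolding Xe Y N(2)[OF t] H1[OF t] by simp
  qed
  note r = mk_strong[OF this]
  \<comment> \<open>At l = j = \<one> the designated counit and the structure arrow are identities,
    so the defining equation of \<open>\<theta>\<close> makes it the identity of the
    carrier.\<close>
  have "cou C \<one> (FO ?P \<one>) \<star>[C] \<theta> \<one> \<one> = A \<rhd> theory_cou T \<one>"
    using tc[OF J_simps(2) J_simps(2)] H1[OF theory_cou(1)[OF T J_simps(2)]] by (simp add: H_def)
  also have "\<dots> = gid C (FO A \<one>)" using theory_cou_unit[OF T] gmap_gid[OF a(1), of \<one>] T_simps(1)[OF T] by simp
  also have "cou C \<one> (FO ?P \<one>) \<star>[C] \<theta> \<one> \<one> = \<theta> \<one> \<one>"
    using cotensored_unit[OF cotensored_C Pl(2)[OF J_simps(2)]] th[OF J_simps(2) J_simps(2)] by simp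
  finally have "acomp (mk_strong X ?Y N (\<theta> \<one>)) \<one> = gid C (carrier V X)"
    using r(2)[OF J_simps(2)] by (simp add: carrier_def XT)
  with r(1) show thesis by (rule that)
qed

end

section \<open>Idempotency\<close>

lemma category_dual:
  assumes "category D"
  shows "category (dual D)"
proof -
  interpret category D by fact
  show ?thesis
    by unfold_locales (auto simp: dual_def Hom_def)
qed

text \<open>\<open>F\<close> is contravariant, so it serves as both adjoints and \<open>u\<close> as
  both unit and counit, and \<open>T1\<close> is both triangle identities. Together with
  \<open>T2\<close> it makes \<open>u\<close> at F x inverse to F (u x), which is idempotency. The
  abstract form serves \<open>Alg\<^sub>s\<close> and each \<open>Alg_on\<close> alike.\<close>

lemma idempotent_self_adjunction:
  fixes D :: "('o, 'a) category" and F :: "('o, 'a, 'o, 'a) func" and u :: "'o \<Rightarrow> 'a"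
  assumes D: "category D"
    and O: "\<And>x. x \<in> Obj D \<Longrightarrow> OMap F x \<in> Obj D"
    and A: "\<And>f. f \<in> Arr D \<Longrightarrow> AMap F f \<in> Hom D (OMap F (Cod D f)) (OMap F (Dom D f))"
    and U: "\<And>x. x \<in> Obj D \<Longrightarrow> u x \<in> Hom D x (OMap F (OMap F x))"
    and F1: "\<And>x. x \<in> Obj D \<Longrightarrow> AMap F (Ident D x) = Ident D (OMap F x)"
    and F2: "\<And>f g. \<lbrakk>f \<in> Arr D; g \<in> Arr D; Dom D g = Cod D f\<rbrakk> \<Longrightarrow>
      AMap F (Comp D g f) = Comp D (AMap F f) (AMap F g)"
    and N: "\<And>f. f \<in> Arr D \<Longrightarrow> Comp D (AMap F (AMap F f)) (u (Dom D f)) = Comp D (u (Cod D f)) f"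
    and T1: "\<And>x. x \<in> Obj D \<Longrightarrow> Comp D (AMap F (u x)) (u (OMap F x)) = Ident D (OMap F x)"
    and T2: "\<And>x. x \<in> Obj D \<Longrightarrow> Comp D (u (OMap F x)) (AMap F (u x)) = Ident D (OMap F (OMap F (OMap F x)))"
  shows "is_idempotent_adjunction D (dual D) F (dual_func F) u u \<and>
    is_idempotent_monad D (comp_func (dual_func F) F) u (adjunction_mult F (dual_func F) u)"
proof -
  interpret category D by (rule D)
  have At [simp]: "AMap F f \<in> Arr D" "Dom D (AMap F f) = OMap F (Cod D f)" "Cod D (AMap F f) = OMap F (Dom D f)"
    if "f \<in> Arr D" for f using A[OF that] by (auto simp: Hom_def)
  have Ut [simp]: "u x \<in> Arr D" "Dom D (u x) = x" "Cod D (u x) = OMap F (OMap F x)" if "x \<in> Obj D" for x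
    using U[OF that] by (auto simp: Hom_def)
  note [simp] = O F1 F2 N T1 T2
  have dd: "category (dual D)" by (rule category_dual[OF D])
  have F: "is_functor D (dual D) F" using D dd by (auto simp: is_functor_def dual_def Hom_def)
  have G: "is_functor (dual D) D (dual_func F)" using D dd by (auto simp: is_functor_def dual_def dual_func_def Hom_def)
  have I: "is_functor D D id_func" "is_functor (dual D) (dual D) id_func"
    using D dd by (auto simp: is_functor_def dual_def id_func_def Hom_def)
  have GF: "is_functor D D (comp_func (dual_func F) F)"
    using D by (auto simp: is_functor_def comp_func_def dual_func_def Hom_def)
  have FG: "is_functor (dual D) (dual D) (comp_func F (dual_func F))"
    using dd by (auto simp: is_functor_def comp_func_def dual_func_def Hom_def dual_def)
  have n1: "is_nat_trans D D id_func (comp_func (dual_func F) F) u"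
    unfolding is_nat_trans_def using I(1) GF by (auto simp: comp_func_def dual_func_def Hom_def id_func_def)
  have n2: "is_nat_trans (dual D) (dual D) (comp_func F (dual_func F)) id_func u"
    unfolding is_nat_trans_def using I(2) FG by (auto simp: comp_func_def dual_func_def Hom_def id_func_def dual_def)
  have i: "is_iso (dual D) (AMap F (u x))" if "x \<in> Obj D" for x
    unfolding is_iso_def inverse_arrows_def
    by (rule exI[of _ "u (OMap F x)"]) (use that in \<open>auto simp: dual_def Hom_def\<close>)
  have adj: "is_idempotent_adjunction D (dual D) F (dual_func F) u u"
    unfolding is_idempotent_adjunction_def is_adjunction_def
    using F G n1 n2 i by (auto simp: dual_def dual_func_def)
  let ?T = "comp_func (dual_func F) F" and ?\<mu> = "adjunction_mult F (dual_func F) u"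
  have TT: "is_functor D D (comp_func ?T ?T)"
    using D by (auto simp: is_functor_def comp_func_def dual_func_def Hom_def)
  have mu: "?\<mu> = (\<lambda>x. AMap F (u (OMap F x)))" by (simp add: adjunction_mult_def dual_func_def)
  have com: "Comp D (AMap F f) (AMap F g) = AMap F (Comp D g f)" if "f \<in> Arr D" "g \<in> Arr D" "Dom D g = Cod D f" for f g
    using that by simp
  have n3: "is_nat_trans D D (comp_func ?T ?T) ?T ?\<mu>"
    unfolding is_nat_trans_def
  proof (intro conjI ballI TT GF)
    show "?\<mu> x \<in> Hom D (OMap (comp_func ?T ?T) x) (OMap ?T x)" if "x \<in> Obj D" for x
      using that unfolding mu by (simp add: comp_func_def dual_func_def Hom_def)
    fix f assume f: "f \<in> Arr D"
    \<comment> \<open>Naturality of the multiplication is naturality of \<open>u\<close> at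
      \<open>AMap F f\<close>, with \<open>F\<close> applied.\<close>
    have "Comp D (AMap F (u (OMap F (Cod D f)))) (AMap F (AMap F (AMap F (AMap F f)))) =
        AMap F (Comp D (AMap F (AMap F (AMap F f))) (u (OMap F (Cod D f))))"
      using f by (intro com) simp_all
    also have "\<dots> = AMap F (Comp D (u (OMap F (Dom D f))) (AMap F f))"
      using f N[of "AMap F f"] by (simp del: F2 N)
    also have "\<dots> = Comp D (AMap F (AMap F f)) (AMap F (u (OMap F (Dom D f))))"
      using f by (intro F2) simp_all
    finally show "Comp D (AMap ?T f) (?\<mu> (Dom D f)) = Comp D (?\<mu> (Cod D f)) (AMap (comp_func ?T ?T) f)"
      unfolding mu by (simp add: comp_func_def dual_func_def)
  qed
  have "is_monad D ?T u ?\<mu>"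
    unfolding is_monad_def
  proof (intro conjI ballI n1 n3)
    fix x assume x: "x \<in> Obj D"
    let ?c = "OMap F x"
    \<comment> \<open>Associativity is naturality of \<open>u\<close> at \<open>u ?c\<close> with
      \<open>F\<close> applied; the first unit law is \<open>T1\<close> with \<open>F\<close>
      applied.\<close>
    have "Comp D (AMap F (u ?c)) (AMap F (AMap F (AMap F (u ?c)))) = AMap F (Comp D (AMap F (AMap F (u ?c))) (u ?c))"
      using x by (intro com) simp_all
    also have "\<dots> = AMap F (Comp D (u (OMap F (OMap F ?c))) (u ?c))"
      using x N[of "u ?c"] by (simp del: F2 N)
    also have "\<dots> = Comp D (AMap F (u ?c)) (AMap F (u (OMap F (OMap F ?c))))"
      using x by (intro F2) simp_all
    finally show "Comp D (?\<mu> x) (AMap ?T (?\<mu> x)) = Comp D (?\<mu> x) (?\<mu> (OMap ?T x))"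
      unfolding mu by (simp add: comp_func_def dual_func_def)
    have "Comp D (AMap F (u ?c)) (AMap F (AMap F (u x))) = AMap F (Comp D (AMap F (u x)) (u ?c))"
      using x by (intro com) simp_all
    also have "\<dots> = Ident D (OMap F ?c)" using x by (simp del: F2)
    finally show "Comp D (?\<mu> x) (AMap ?T (u x)) = Ident D (OMap ?T x)"
      unfolding mu by (simp add: comp_func_def dual_func_def)
    show "Comp D (?\<mu> x) (u (OMap ?T x)) = Ident D (OMap ?T x)"
      using x T1[of ?c] unfolding mu by (simp add: comp_func_def dual_func_def)
  qed
  \<comment> \<open>The inverse is \<open>u\<close> at F (F x), by \<open>T1\<close> and
    \<open>T2\<close> at F x.\<close>
  moreover have "is_iso D (?\<mu> x)" if x: "x \<in> Obj D" for x
    unfolding is_iso_def inverse_arrows_def mu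
    by (rule exI[of _ "u (OMap F (OMap F x))"]) (use x in \<open>auto simp: Hom_def\<close>)
  ultimately show ?thesis using adj by (simp add: is_idempotent_monad_def)
qed

section \<open>Functoriality of the commutant, and the unit as an isomorphism on commutants\<close>

context commutants
begin

lemma carrier_eq: "FO (snd X) \<one> = carrier V X"
  by (simp add: carrier_def)

text \<open>Existence comes from \<open>commutant_arrow_ex\<close> and uniqueness from
  \<open>arr_into_commutant_unique\<close>, so the definite description denotes. Invertibility is
  rephrased for generalized elements, where inverses are unique.\<close>

lemma commutant_arrow:
  assumes f: "f \<in> Hom Algs X Y"
  shows "commutant_arrow V J C f \<in> Hom Algs (commutant V J C Y) (commutant V J C X)"
    "ginverse C (acomp f \<one>) (acomp (commutant_arrow V J C f) \<one>)"
proof -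
  have XY: "obj X" "obj Y" and s: "Src f = X" "Tgt f = Y" using arr_strong[OF f] f by (auto simp: strong_def Hom_def)
  have co: "carrier V X \<in> VObj C" "carrier V Y \<in> VObj C"
    using gel_simps(1,2)[OF acomp_typing(1)[OF f J_simps(2)]] acomp_typing(3,4)[OF f J_simps(2)] by (simp_all add: carrier_eq)
  have af: "acomp f \<one> = Gel (carrier V X) (carrier V Y) (underlying V f)"
    using s by (simp add: acomp_def carrier_eq underlying_def)
  have ag: "acomp g \<one> = Gel (carrier V Y) (carrier V X) (underlying V g)"
    if "g \<in> Hom Algs (commutant V J C Y) (commutant V J C X)" for g
    using that carrier_commutant[OF XY(1)] carrier_commutant[OF XY(2)] by (simp add: Hom_def acomp_def carrier_eq underlying_def)
  let ?Q = "\<lambda>g. g \<in> Hom Algs (commutant V J C Y) (commutant V J C X) \<and>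
      vinverse0 V C (carrier V X) (carrier V Y) (underlying V f) (underlying V g)"
  have iff: "vinverse0 V C (carrier V X) (carrier V Y) (underlying V f) (underlying V g) \<longleftrightarrow> ginverse C (acomp f \<one>) (acomp g \<one>)"
    if "g \<in> Hom Algs (commutant V J C Y) (commutant V J C X)" for g
    unfolding af ag[OF that] using ginverse_iff_vinverse0[OF C_vcat co] by simp
  obtain g where g: "g \<in> Hom Algs (commutant V J C Y) (commutant V J C X)" "ginverse C (acomp f \<one>) (acomp g \<one>)"
    by (rule commutant_arrow_ex[OF f])
  have "?Q (THE g. ?Q g)"
  proof (rule theI[of ?Q g])
    show "?Q g" using g iff by blast
    show "h = g" if "?Q h" for h
    proof (rule arr_into_commutant_unique[OF _ g(1) XY(1)])
      show h: "h \<in> Hom Algs (commutant V J C Y) (commutant V J C X)" using that by blast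
      have "acomp h \<one> = acomp g \<one>"
        by (rule ginverse_unique[OF C_vcat _ g(2)]) (use that iff[OF h] in blast)
      then show "underlying V h = underlying V g" by (simp add: underlying_acomp)
    qed
  qed
  then have "?Q (commutant_arrow V J C f)" unfolding commutant_arrow_def s .
  then show "commutant_arrow V J C f \<in> Hom Algs (commutant V J C Y) (commutant V J C X)"
    "ginverse C (acomp f \<one>) (acomp (commutant_arrow V J C f) \<one>)" using iff by blast+
qed

text \<open>Between algebras with the same carrier, membership in \<open>Alg_on\<close> only
  prescribes the underlying isomorphism, which determines an arrow into a commutant; so the
  description denotes the arrow of \<open>com_unit_ex\<close>.\<close>

lemma com_unit:
  assumes X: "obj X"
  shows "com_unit V J C X \<in> Hom Algs X (commutant V J C (commutant V J C X))"
    "acomp (com_unit V J C X) \<one> = gid C (carrier V X)"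
proof -
  let ?Y = "commutant V J C (commutant V J C X)"
  note oc = obj_commutant[OF X]
  have cY: "carrier V ?Y = carrier V X" using carrier_commutant[OF X] carrier_commutant[OF oc] by simp
  have iff: "u \<in> Hom (Alg_on V J C (carrier V X)) X ?Y \<longleftrightarrow> u \<in> Hom Algs X ?Y \<and> underlying V u = VId C (carrier V X)" for u
    using cY by (auto simp: Alg_on_def Hom_def)
  obtain u where u: "u \<in> Hom Algs X ?Y" "acomp u \<one> = gid C (carrier V X)"
    by (rule com_unit_ex[OF X])
  have un: "underlying V u = VId C (carrier V X)" using u(2) by (simp add: underlying_acomp gid_garr)
  have "com_unit V J C X = u"
    unfolding com_unit_def
  proof (rule the_equality)
    show "u \<in> Hom (Alg_on V J C (carrier V X)) X ?Y" using u un iff by blast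
    show "v = u" if "v \<in> Hom (Alg_on V J C (carrier V X)) X ?Y" for v
      by (rule arr_into_commutant_unique[OF _ u(1) oc]) (use that iff un in simp_all)
  qed
  with u show "com_unit V J C X \<in> Hom Algs X ?Y" "acomp (com_unit V J C X) \<one> = gid C (carrier V X)" by simp_all
qed

text \<open>The functor, naturality and triangle equations below all compare arrows into a
  commutant, so they reduce to equations between invertible arrows of \<open>C\<close> on
  carriers.\<close>

lemma into_commutant_eqI:
  assumes "h \<in> Hom Algs X (commutant V J C Y)" "h' \<in> Hom Algs X (commutant V J C Y)"
    and "obj Y" and "acomp h \<one> = acomp h' \<one>"
  shows "h = h'"
  by (rule arr_into_commutant_unique[OF assms(1-3)]) (simp add: underlying_acomp assms(4))

lemma commutant_arrow_ident:
  assumes X: "obj X"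
  shows "commutant_arrow V J C (Ident Algs X) = Ident Algs (commutant V J C X)"
proof -
  note i = Ident_hom[OF X] and interchange_simps = Ident_hom[OF obj_commutant[OF X]]
  note c = commutant_arrow[OF i(1)]
  have co: "FO (snd X) \<one> \<in> VObj C" using gel_simps(1)[OF acomp_typing(1)[OF i(1) J_simps(2)]] i(3)[OF J_simps(2)] by simp
  show ?thesis
  proof (rule into_commutant_eqI[OF c(1) interchange_simps(1) X])
    show "acomp (commutant_arrow V J C (Ident Algs X)) \<one> = acomp (Ident Algs (commutant V J C X)) \<one>"
      unfolding interchange_simps(3)[OF J_simps(2)] carrier_eq carrier_commutant[OF X]
      by (rule ginverse_unique[OF C_vcat c(2)[unfolded i(3)[OF J_simps(2)]]])
        (use co in \<open>simp add: carrier_eq\<close>)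
  qed
qed

lemma commutant_arrow_comp:
  assumes f: "f \<in> Hom Algs X Y" and g: "g \<in> Hom Algs Y Z"
  shows "commutant_arrow V J C (Comp Algs g f) =
    Comp Algs (commutant_arrow V J C f) (commutant_arrow V J C g)"
proof -
  have X: "obj X" using arr_strong[OF f] by (simp add: strong_def)
  note c = commutant_arrow[OF Comp_hom(1)[OF f g]] and cf = commutant_arrow[OF f] and cg = commutant_arrow[OF g]
  show ?thesis
  proof (rule into_commutant_eqI[OF c(1) Comp_hom(1)[OF cg(1) cf(1)] X])
    show "acomp (commutant_arrow V J C (Comp Algs g f)) \<one> =
        acomp (Comp Algs (commutant_arrow V J C f) (commutant_arrow V J C g)) \<one>"
      unfolding Comp_hom(3)[OF cg(1) cf(1) J_simps(2)]
      by (rule ginverse_unique[OF C_vcat c(2)[unfolded Comp_hom(3)[OF f g J_simps(2)]]])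
        (rule ginverse_star[OF C_vcat cf(2) cg(2)], use acomp_typing[OF f J_simps(2)] acomp_typing[OF g J_simps(2)] in simp)
  qed
qed

lemma com_unit_natural:
  assumes f: "f \<in> Hom Algs X Y"
  shows "Comp Algs (commutant_arrow V J C (commutant_arrow V J C f)) (com_unit V J C X) =
    Comp Algs (com_unit V J C Y) f"
proof -
  have X: "obj X" and Y: "obj Y" using arr_strong[OF f] by (simp_all add: strong_def)
  note cf = commutant_arrow[OF f]
  note ccf = commutant_arrow[OF cf(1)]
  note uX = com_unit[OF X] and uY = com_unit[OF Y]
  note af = acomp_typing[OF f J_simps(2)]
  \<comment> \<open>Passing to commutants inverts the underlying isomorphism, so doing it twice
    restores it.\<close>
  have e: "acomp (commutant_arrow V J C (commutant_arrow V J C f)) \<one> = acomp f \<one>"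
    by (rule ginverse_unique[OF C_vcat ccf(2) ginverse_sym[OF cf(2)]])
  show ?thesis
    by (rule into_commutant_eqI[OF Comp_hom(1)[OF uX(1) ccf(1)] Comp_hom(1)[OF f uY(1)] obj_commutant[OF Y]])
      (use af in \<open>simp add: Comp_hom(3)[OF uX(1) ccf(1) J_simps(2)] Comp_hom(3)[OF f uY(1) J_simps(2)] e uX(2) uY(2) carrier_eq\<close>)
qed

lemma com_unit_iso:
  assumes X: "obj X"
  shows "Comp Algs (commutant_arrow V J C (com_unit V J C X)) (com_unit V J C (commutant V J C X)) =
      Ident Algs (commutant V J C X)"
    "Comp Algs (com_unit V J C (commutant V J C X)) (commutant_arrow V J C (com_unit V J C X)) =
      Ident Algs (commutant V J C (commutant V J C (commutant V J C X)))"
proof -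
  note X1 = obj_commutant[OF X]
  note X2 = obj_commutant[OF X1]
  note X3 = obj_commutant[OF X2]
  note c = carrier_commutant[OF X] carrier_commutant[OF X1] carrier_commutant[OF X2]
  note u = com_unit[OF X] and uc = com_unit[OF X1]
  note cu = commutant_arrow[OF u(1)]
  have co: "carrier V X \<in> VObj C"
    using gel_simps(1)[OF acomp_typing(1)[OF u(1) J_simps(2)]] acomp_typing(3)[OF u(1) J_simps(2)] by (simp add: carrier_eq)
  \<comment> \<open>The underlying isomorphism is the inverse of an identity.\<close>
  have a: "acomp (commutant_arrow V J C (com_unit V J C X)) \<one> = gid C (carrier V X)"
    by (rule ginverse_unique[OF C_vcat cu(2)[unfolded u(2)] ginverse_gid[OF C_vcat co]])
  show "Comp Algs (commutant_arrow V J C (com_unit V J C X)) (com_unit V J C (commutant V J C X)) =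
      Ident Algs (commutant V J C X)"
    by (rule into_commutant_eqI[OF Comp_hom(1)[OF uc(1) cu(1)] Ident_hom(1)[OF X1] X])
      (use co in \<open>simp add: Comp_hom(3)[OF uc(1) cu(1) J_simps(2)] Ident_hom(3)[OF X1 J_simps(2)] a uc(2) c carrier_eq\<close>)
  show "Comp Algs (com_unit V J C (commutant V J C X)) (commutant_arrow V J C (com_unit V J C X)) =
      Ident Algs (commutant V J C (commutant V J C (commutant V J C X)))"
    by (rule into_commutant_eqI[OF Comp_hom(1)[OF cu(1) uc(1)] Ident_hom(1)[OF X3] X2])
      (use co in \<open>simp add: Comp_hom(3)[OF cu(1) uc(1) J_simps(2)] Ident_hom(3)[OF X3 J_simps(2)] a uc(2) c carrier_eq\<close>)
qed

lemma Com_simps [simp]: "OMap (Com V J C) = commutant V J C" "AMap (Com V J C) = commutant_arrow V J C"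
  by (simp_all add: Com_def)

lemma arr_hom: "f \<in> Arr Algs \<Longrightarrow> f \<in> Hom Algs (Src f) (Tgt f)"
  by (simp add: Hom_def)

lemma Alg_idempotent:
  "is_idempotent_adjunction Algs (dual Algs) (Com V J C) (dual_func (Com V J C))
      (com_unit V J C) (com_unit V J C) \<and>
    is_idempotent_monad Algs (comp_func (dual_func (Com V J C)) (Com V J C)) (com_unit V J C)
      (adjunction_mult (Com V J C) (dual_func (Com V J C)) (com_unit V J C))"
proof (rule idempotent_self_adjunction[OF Alg_category], simp_all only: Com_simps Alg_simps mem_Collect_eq)
  show "obj x \<Longrightarrow> obj (commutant V J C x)" for x by (rule obj_commutant)
  show "commutant_arrow V J C f \<in> Hom Algs (commutant V J C (Tgt f)) (commutant V J C (Src f))"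
    if "f \<in> Arr Algs" for f by (rule commutant_arrow(1)[OF arr_hom[OF that]])
  show "commutant_arrow V J C (Comp Algs g f) = Comp Algs (commutant_arrow V J C f) (commutant_arrow V J C g)"
    if "f \<in> Arr Algs" "g \<in> Arr Algs" "Src g = Tgt f" for f g
    using commutant_arrow_comp[OF arr_hom[OF that(1)]] arr_hom[OF that(2)] that(3) by simp
  show "Comp Algs (commutant_arrow V J C (commutant_arrow V J C f)) (com_unit V J C (Src f)) =
      Comp Algs (com_unit V J C (Tgt f)) f" if "f \<in> Arr Algs" for f
    by (rule com_unit_natural[OF arr_hom[OF that]])
qed (simp_all add: com_unit(1) commutant_arrow_ident com_unit_iso)

section \<open>Restriction to algebras on a fixed carrier\<close>

lemma Alg_on_simps [simp]:
  "Obj (Alg_on V J C c) = {X. obj X \<and> carrier V X = c}"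
  "Arr (Alg_on V J C c) = {h \<in> Arr Algs. carrier V (Src h) = c \<and> carrier V (Tgt h) = c \<and> underlying V h = VId C c}"
  "Dom (Alg_on V J C c) = Src" "Cod (Alg_on V J C c) = Tgt"
  "Ident (Alg_on V J C c) = Ident Algs" "Comp (Alg_on V J C c) = Comp Algs"
  using Alg_simps by (auto simp: Alg_on_def)

lemma Alg_on_Hom:
  "h \<in> Hom (Alg_on V J C c) X Y \<longleftrightarrow> h \<in> Hom Algs X Y \<and> carrier V X = c \<and> carrier V Y = c \<and> acomp h \<one> = gid C c"
proof -
  have "acomp h \<one> = gid C c \<longleftrightarrow> underlying V h = VId C c" if "h \<in> Hom Algs X Y" "carrier V X = c" "carrier V Y = c"
    using that by (auto simp: Hom_def acomp_def gid_def underlying_def carrier_eq)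
  then show ?thesis by (auto simp: Hom_def)
qed

lemma Alg_on_category:
  assumes c: "c \<in> VObj C"
  shows "category (Alg_on V J C c)"
proof -
  interpret category "Algs" by (rule Alg_category)
  show ?thesis
  proof
    fix X Y Z W :: "('o, 'a, 'c) algebra" and f g h
    show "f \<in> Arr (Alg_on V J C c) \<Longrightarrow> Dom (Alg_on V J C c) f \<in> Obj (Alg_on V J C c)"
      "f \<in> Arr (Alg_on V J C c) \<Longrightarrow> Cod (Alg_on V J C c) f \<in> Obj (Alg_on V J C c)"
      using dom_obj cod_obj by auto
    show "Ident (Alg_on V J C c) X \<in> Hom (Alg_on V J C c) X X" if "X \<in> Obj (Alg_on V J C c)"
      using that Ident_hom[of X] by (simp add: Alg_on_Hom carrier_eq)
    show "Comp (Alg_on V J C c) g f \<in> Hom (Alg_on V J C c) X Z"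
      if "f \<in> Hom (Alg_on V J C c) X Y" "g \<in> Hom (Alg_on V J C c) Y Z"
      using that Comp_hom[of f X Y g Z] c by (simp add: Alg_on_Hom)
    show "Comp (Alg_on V J C c) f (Ident (Alg_on V J C c) X) = f" "Comp (Alg_on V J C c) (Ident (Alg_on V J C c) Y) f = f"
      if "f \<in> Hom (Alg_on V J C c) X Y"
      using that comp_ident_right[of f X Y] comp_ident_left[of f X Y] by (simp_all add: Alg_on_Hom)
    show "Comp (Alg_on V J C c) (Comp (Alg_on V J C c) h g) f = Comp (Alg_on V J C c) h (Comp (Alg_on V J C c) g f)"
      if "f \<in> Hom (Alg_on V J C c) X Y" "g \<in> Hom (Alg_on V J C c) Y Z" "h \<in> Hom (Alg_on V J C c) Z W"
      using that comp_assoc[of f X Y g Z h W] by (simp add: Alg_on_Hom)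
  qed
qed

text \<open>Inverses of identities are identities, so the commutant functor and the unit restrict to
  algebras with carrier c; the required equations are instances of those in the larger
  category.\<close>

lemma Alg_on_idempotent:
  assumes c: "c \<in> VObj C"
  shows "is_idempotent_adjunction (Alg_on V J C c) (dual (Alg_on V J C c)) (Com V J C) (dual_func (Com V J C))
      (com_unit V J C) (com_unit V J C) \<and>
    is_idempotent_monad (Alg_on V J C c) (comp_func (dual_func (Com V J C)) (Com V J C)) (com_unit V J C)
      (adjunction_mult (Com V J C) (dual_func (Com V J C)) (com_unit V J C))"
proof (rule idempotent_self_adjunction[OF Alg_on_category[OF c]], unfold Com_simps)
  have arr: "f \<in> Hom (Alg_on V J C c) (Src f) (Tgt f)" if "f \<in> Arr (Alg_on V J C c)" for f using that by (simp add: Hom_def)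
  show "x \<in> Obj (Alg_on V J C c) \<Longrightarrow> commutant V J C x \<in> Obj (Alg_on V J C c)" for x
    by (simp add: obj_commutant carrier_commutant)
  show "commutant_arrow V J C f \<in> Hom (Alg_on V J C c) (commutant V J C (Cod (Alg_on V J C c) f)) (commutant V J C (Dom (Alg_on V J C c) f))"
    if "f \<in> Arr (Alg_on V J C c)" for f
  proof -
    note f = arr[OF that, unfolded Alg_on_Hom]
    note cf = commutant_arrow[OF conjunct1[OF f]]
    have o: "obj (Src f)" "obj (Tgt f)" using arr_strong[OF conjunct1[OF f]] by (simp_all add: strong_def)
    have "acomp (commutant_arrow V J C f) \<one> = gid C c"
      by (rule ginverse_unique[OF C_vcat cf(2)]) (use f c in simp)
    then show ?thesis using cf(1) f carrier_commutant[OF o(1)] carrier_commutant[OF o(2)] by (simp add: Alg_on_Hom)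
  qed
  show "com_unit V J C x \<in> Hom (Alg_on V J C c) x (commutant V J C (commutant V J C x))"
    if "x \<in> Obj (Alg_on V J C c)" for x
    using that com_unit[of x] by (simp add: Alg_on_Hom obj_commutant carrier_commutant)
  show "commutant_arrow V J C (Comp (Alg_on V J C c) g f) = Comp (Alg_on V J C c) (commutant_arrow V J C f) (commutant_arrow V J C g)"
    if "f \<in> Arr (Alg_on V J C c)" "g \<in> Arr (Alg_on V J C c)" "Dom (Alg_on V J C c) g = Cod (Alg_on V J C c) f" for f g
    using commutant_arrow_comp[of f "Src f" "Tgt f" g "Tgt g"] that by (simp add: Hom_def)
  show "Comp (Alg_on V J C c) (commutant_arrow V J C (commutant_arrow V J C f)) (com_unit V J C (Dom (Alg_on V J C c) f)) =
      Comp (Alg_on V J C c) (com_unit V J C (Cod (Alg_on V J C c) f)) f" if "f \<in> Arr (Alg_on V J C c)" for f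
    using com_unit_natural[of f "Src f" "Tgt f"] that by (simp add: Hom_def)
qed (simp_all add: commutant_arrow_ident com_unit_iso)

end

text \<open>Covers the case in which there are no theories and hence no algebras.\<close>

lemma empty_idempotent:
  fixes D :: "('o, 'a) category"
  assumes "Obj D = {}" "Arr D = {}"
  shows "is_idempotent_adjunction D (dual D) F (dual_func F) u u \<and>
    is_idempotent_monad D (comp_func (dual_func F) F) u (adjunction_mult F (dual_func F) u)"
proof (rule idempotent_self_adjunction)
  show "category D" by unfold_locales (use assms in \<open>auto simp: Hom_def\<close>)
qed (use assms in auto)

theorem proposition10p1:
  fixes V :: "('o, 'a) smc_category"
    and J :: "'o set"
    and C :: "('o, 'a, 'c) cvcat"
  assumes "symmetric_monoidal_closed_category V"
    and "has_pullbacks V"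
    and "system_of_arities V J"
    and "admissible V J C"
  shows "is_idempotent_adjunction (Alg\<^sub>s V J C) (dual (Alg\<^sub>s V J C))
      (Com V J C) (dual_func (Com V J C)) (com_unit V J C) (com_counit V J C) \<and>
    (\<forall>c\<in>VObj C. is_idempotent_adjunction (Alg_on V J C c) (dual (Alg_on V J C c))
      (Com V J C) (dual_func (Com V J C)) (com_unit V J C) (com_counit V J C)) \<and>
    is_idempotent_monad (Alg\<^sub>s V J C)
      (comp_func (dual_func (Com V J C)) (Com V J C)) (com_unit V J C)
      (adjunction_mult (Com V J C) (dual_func (Com V J C)) (com_counit V J C)) \<and>
    (\<forall>c\<in>VObj C. is_idempotent_monad (Alg_on V J C c)
      (comp_func (dual_func (Com V J C)) (Com V J C)) (com_unit V J C)
      (adjunction_mult (Com V J C) (dual_func (Com V J C)) (com_counit V J C)))"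
proof (cases "vcategory V (arity_op V J)")
  case True
  interpret commutants V J C
    using assms True by (simp add: commutants_def commutants_axioms_def arity_system_def arity_system_axioms_def)
  show ?thesis
    unfolding com_counit_def using Alg_idempotent Alg_on_idempotent by blast
next
  \<comment> \<open>A theory includes a V-functor out of \<open>arity_op V J\<close>; if that is not
    a V-category, there are no theories and all the categories of algebras are empty.\<close>
  case False
  then have "\<not> is_theory V J T" for T by (simp add: is_theory_def vfunctor_def)
  then have e: "Obj (Alg\<^sub>s V J C) = {}" "Arr (Alg\<^sub>s V J C) = {}"
    by (auto simp: Alg\<^sub>s_def is_theory_morphism_def)
  then have "Obj (Alg_on V J C c) = {}" "Arr (Alg_on V J C c) = {}" for c
    by (auto simp: Alg_on_def)
  with e show ?thesis
    unfolding com_counit_def using empty_idempotent by blast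
qed

end
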